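(* Let $k\in\mathbb{Z}\setminus\{0\}$ and let $W(s)=\frac12 s^2-R(s)$, where $R:\mathbb{R}^+=[0,\infty)\to\mathbb{R}$ is continuously differentiable and satisfies: (i) $R(0)=R'(0)=0$; (ii) there exist $c>0$ and $p>2$ such that $|R(s)|\le c\,s^p$ for all $s\ge 0$; (iii) with the same $p$, $sR'(s)\ge pR(s)>0$ for all $s>0$. Then there exists a non-trivial (i.e. $u_0\not\equiv 0$) solution $(u_0,\mathbf{A}_0)$, in the sense of distributions on $\mathbb{R}^2$, of the system $$-\Delta u+|k\nabla\theta-\mathbf{A}|^2u+W'(u)=0,$$ $$\nabla\times(\nabla\times\mathbf{A})=(k\nabla\theta-\mathbf{A})u^2,$$ such that - $u_0:\mathbb{R}^2\to\mathbb{R}$ is positive, radial, and $\int_{\mathbb{R}^2}|\nabla u_0|^2\,dx+\int_{\mathbb{R}^2}\left(1+\frac1{r^2}\right)u_0^2\,dx<+\infty$, where $r^2=x_1^2+x_2^2$; - $\mathbf{A}_0$ is divergence free and $\int_{\mathbb{R}^2}|\nabla\mathbf{A}_0|^2\,dx<+\infty$.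
   Context: The problem is posed on $\mathbb{R}^2$, $x=(x_1,x_2)$, $r=|x|$. Vector fields are regarded as three-vectors with null third component and depending only on $(x_1,x_2)$, so that $\nabla\times\mathbf{A}$ makes sense; $|\nabla\mathbf{A}|^2=\sum_{i,j}(\partial_iA_j)^2$. The angular function is $\theta(x)=\mathrm{Im}\log(x_1+ix_2)$ on $\mathbb{R}^2\setminus\{0\}$, whose gradient is the $C^\infty$ field on $\mathbb{R}^2\setminus\{0\}$ given by $\nabla\theta=(-x_2/r^2,\,x_1/r^2,\,0)$, with $|\nabla\theta|=1/r$. "In the sense of distributions" means that the equations hold when tested against all functions $v\in C_c^\infty(\mathbb{R}^2)$ (first equation) and all $\mathbf{V}\in (C_c^\infty(\mathbb{R}^2))^3$ (second equation), i.e. $$\int\left(\nabla u\cdot\nabla v+|k\nabla\theta-\mathbf{A}|^2uv+W'(u)v\right)dx=0,\qquad \int\left((\nabla\times\mathbf{A})\cdot(\nabla\times\mathbf{V})-(k\nabla\theta-\mathbf{A})\cdot\mathbf{V}\,u^2\right)dx=0.$$ *)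

theory Defs
  imports "HOL-Analysis.Analysis"
begin

definition partial :: "2 \<Rightarrow> (real^2 \<Rightarrow> real) \<Rightarrow> real^2 \<Rightarrow> real" where
  "partial i f x = frechet_derivative f (at x) (axis i 1)"

definition grad :: "(real^2 \<Rightarrow> real) \<Rightarrow> real^2 \<Rightarrow> real^2" where
  "grad f x = (\<chi> i. partial i f x)"

primrec C_k :: "nat \<Rightarrow> (real^2 \<Rightarrow> real) \<Rightarrow> bool" where
  "C_k 0 f \<longleftrightarrow> continuous_on UNIV f"
| "C_k (Suc n) f \<longleftrightarrow> (\<forall>x. f differentiable (at x)) \<and> (\<forall>i. C_k n (partial i f))"

definition test_function :: "(real^2 \<Rightarrow> real) \<Rightarrow> bool" where
  "test_function v \<longleftrightarrow> (\<forall>n. C_k n v) \<and> compact (closure {x. v x \<noteq> 0})"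

definition test_field :: "(real^2 \<Rightarrow> real^3) \<Rightarrow> bool" where
  "test_field V \<longleftrightarrow> (\<forall>j. test_function (\<lambda>x. V x $ j))"

definition locally_integrable :: "(real^2 \<Rightarrow> real) \<Rightarrow> bool" where
  "locally_integrable f \<longleftrightarrow> (\<forall>K. compact K \<longrightarrow> set_integrable lborel K f)"

definition weak_partial :: "2 \<Rightarrow> (real^2 \<Rightarrow> real) \<Rightarrow> (real^2 \<Rightarrow> real) \<Rightarrow> bool" where
  "weak_partial i f g \<longleftrightarrow> locally_integrable f \<and> locally_integrable g \<and>
     (\<forall>v. test_function v \<longrightarrow>
        (LINT x|lborel. f x * partial i v x) = - (LINT x|lborel. g x * v x))"

definition weak_gradient :: "(real^2 \<Rightarrow> real) \<Rightarrow> (real^2 \<Rightarrow> real^2) \<Rightarrow> bool" where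
  "weak_gradient u Du \<longleftrightarrow> (\<forall>i. weak_partial i u (\<lambda>x. Du x $ i))"

text \<open>
  Vector fields are three-vectors depending on two variables only. Their Jacobians are stored
  row by component: entry \<open>J $ j $ i\<close> is the derivative of component \<open>j\<close> in direction \<open>i\<close>.
\<close>

definition jacobian :: "(real^2 \<Rightarrow> real^3) \<Rightarrow> real^2 \<Rightarrow> real^2^3" where
  "jacobian V x = (\<chi> j i. partial i (\<lambda>y. V y $ j) x)"

definition weak_jacobian :: "(real^2 \<Rightarrow> real^3) \<Rightarrow> (real^2 \<Rightarrow> real^2^3) \<Rightarrow> bool" where
  "weak_jacobian A DA \<longleftrightarrow> (\<forall>j i. weak_partial i (\<lambda>x. A x $ j) (\<lambda>x. DA x $ j $ i))"

text \<open>Curl and divergence in terms of the Jacobian, with all derivatives in the third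
  variable equal to zero.\<close>

definition curl_of :: "real^2^3 \<Rightarrow> real^3" where
  "curl_of J = vector [J $ 3 $ 2, - (J $ 3 $ 1), J $ 2 $ 1 - J $ 1 $ 2]"

definition div_of :: "real^2^3 \<Rightarrow> real" where
  "div_of J = J $ 1 $ 1 + J $ 2 $ 2"

text \<open>
  The gradient of the angular function \<open>\<theta> = Im log (x\<^sub>1 + i x\<^sub>2)\<close>. It is a smooth field on the
  whole punctured plane although \<open>\<theta>\<close> itself is multivalued there; the (irrelevant) value at
  the origin is \<open>0\<close> by the convention for division.
\<close>

definition grad_theta :: "real^2 \<Rightarrow> real^3" where
  "grad_theta x = vector [- (x $ 2) / (norm x)\<^sup>2, x $ 1 / (norm x)\<^sup>2, 0]"

text \<open>
  Solutions \<open>(u, A)\<close>, with weak derivatives \<open>Du\<close> and \<open>DA\<close>, of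
  \<open>- \<Delta> u + |k \<nabla>\<theta> - A|\<^sup>2 u + W'(u) = 0\<close> and \<open>\<nabla> \<times> (\<nabla> \<times> A) = (k \<nabla>\<theta> - A) u\<^sup>2\<close>
  in the sense of distributions on the whole plane. Test functions need not vanish near the
  origin, and \<open>has_bochner_integral\<close> makes the integrability of the integrands part of the claim.
\<close>

definition distributional_solution ::
  "int \<Rightarrow> (real \<Rightarrow> real) \<Rightarrow> (real^2 \<Rightarrow> real) \<Rightarrow> (real^2 \<Rightarrow> real^2) \<Rightarrow>
   (real^2 \<Rightarrow> real^3) \<Rightarrow> (real^2 \<Rightarrow> real^2^3) \<Rightarrow> bool" where
  "distributional_solution k W' u Du A DA \<longleftrightarrow>
     weak_gradient u Du \<and> weak_jacobian A DA \<and>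
     (\<forall>v. test_function v \<longrightarrow>
        has_bochner_integral lborel
          (\<lambda>x. inner (Du x) (grad v x)
               + (norm (of_int k *\<^sub>R grad_theta x - A x))\<^sup>2 * u x * v x
               + W' (u x) * v x) 0) \<and>
     (\<forall>V. test_field V \<longrightarrow>
        has_bochner_integral lborel
          (\<lambda>x. inner (curl_of (DA x)) (curl_of (jacobian V x))
               - inner (of_int k *\<^sub>R grad_theta x - A x) (V x) * (u x)\<^sup>2) 0)"

end

theory Submission
  imports Defs "HOL-Complex_Analysis.Great_Picard"
begin

text \<open>
  Put \<open>\<kappa> = \<bar>k\<bar>\<close>, \<open>\<sigma> = sgn k\<close> and \<open>t = ln r\<close>. The radial ansatz \<open>u\<^sub>0(x) = u(t)\<close>,
  \<open>A\<^sub>0 = \<sigma> (\<kappa> - a(t)) \<nabla>\<theta>\<close> turns the system into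
  \<open>u'' = a\<^sup>2 u + e\<^sup>2\<^sup>t (u - R'(u))\<close>, \<open>a' = e\<^sup>2\<^sup>t b\<close>, \<open>b' = a u\<^sup>2\<close> on the real line. On \<open>[-L, L]\<close> with
  \<open>u(-L) = u(L) = 0\<close>, \<open>a(-L) = \<kappa>\<close>, \<open>b(L) = 0\<close> this is the Euler--Lagrange system of a functional of
  mountain pass type, and one fixed path bounds the energy of its critical points independently
  of \<open>L\<close>. The energy controls \<open>u\<close>, \<open>a\<close> and \<open>b\<close> with exponential weights, while at an interior
  maximum the equation bounds \<open>u\<close> from below at a bounded position. Hence the solutions on
  \<open>[-L, L]\<close> converge locally uniformly, along a subsequence, to a nontrivial solution on the line.
  Back in the plane all relevant fluxes are \<open>o(1/r)\<close> at the origin, so that the equations, which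
  hold classically away from the origin, hold in the sense of distributions everywhere.
\<close>

section \<open>A mountain pass theorem without completeness\<close>

text \<open>Since \<open>R'\<close> is merely continuous, the functional is C^1 but its gradient
  need not be locally Lipschitz, so a gradient flow is not at hand. Finite Euler steps along the
  gradient itself replace it; their descent only needs uniform continuity of the gradient on bounded
  sets. Growth is assumed for \<open>R\<close> and not for \<open>R'\<close>. At a maximum M of u
  the equation alone gives R'(M) \<ge> M, which does not exclude small M. The lower bound for M
  comes instead from an energy identity integrated up to the right end, in which the sign of a b,
  that is the monotonicity of a^2, controls the gauge terms. The system is not invariant under
  translations in t, and the two ends are controlled by different terms: at +infinity the weight
  e^(2t) forces decay, while at -infinity this weight degenerates and a^2 u with a close to \<kappa>
  takes over. The latter also yields the integrability of u / r^2 near the origin. Finite energy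
  gives only that of u^2 / r^2, which is too weak for test functions that do not vanish at the
  origin.\<close>

text \<open>
  Every point of the initial path is moved by discrete steepest descent. The parameters whose
  orbit gets trapped near the origin at a low level and those whose orbit reaches a negative level
  form disjoint open sets; a parameter in neither has an orbit along which \<open>J\<close> stays
  nonnegative, and along which \<open>g\<close> must therefore become small.
\<close>

lemma dynamical_mountain_pass:
  fixes J :: "'a::real_inner \<Rightarrow> real" and g :: "'a \<Rightarrow> 'a" and N :: "'a \<Rightarrow> real" and e :: 'a
  assumes contJ: "continuous_on UNIV J" and contg: "continuous_on UNIV g"
    and lip: "\<And>x y. \<bar>N x - N y\<bar> \<le> norm (x - y)"
    and descent: "\<And>K \<delta>. 0 < \<delta> \<Longrightarrow> \<exists>\<tau>0>0. \<forall>x. norm x \<le> K \<longrightarrow> \<delta> \<le> norm (g x) \<longrightarrow>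
       (\<forall>\<tau>. 0 \<le> \<tau> \<and> \<tau> \<le> \<tau>0 \<longrightarrow> J (x - \<tau> *\<^sub>R g x) \<le> J x - \<tau> / 2 * (norm (g x))\<^sup>2)"
    and gbdd: "\<And>K. \<exists>G. \<forall>x. norm x \<le> K \<longrightarrow> norm (g x) \<le> G"
    and coercive: "\<exists>M. \<forall>x. J x \<le> \<beta> \<longrightarrow> norm (g x) \<le> 1 \<longrightarrow> norm x \<le> M"
    and \<rho>: "0 < \<rho>" and inner_nonneg: "\<And>x. N x < \<rho> \<Longrightarrow> 0 \<le> J x"
    and \<alpha>: "0 < \<alpha>" and shell: "\<And>x. \<rho> / 2 \<le> N x \<Longrightarrow> N x < \<rho> \<Longrightarrow> \<alpha> \<le> J x"
    and T: "0 \<le> T" and N0: "N 0 = 0" and J0: "J 0 = 0"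
    and path: "\<And>s. 0 \<le> s \<Longrightarrow> s \<le> T \<Longrightarrow> J (s *\<^sub>R e) \<le> \<beta>" and endpoint: "J (T *\<^sub>R e) < 0"
  shows "\<exists>K. \<forall>\<delta>>0. \<exists>x. norm x \<le> K \<and> norm (g x) < \<delta> \<and> 0 \<le> J x \<and> J x \<le> \<beta> \<and> (\<rho> \<le> N x \<or> \<alpha> \<le> J x)"
proof -
  obtain M where M: "\<And>x. J x \<le> \<beta> \<Longrightarrow> norm (g x) \<le> 1 \<Longrightarrow> norm x \<le> M" using coercive by blast
  have \<beta>0: "0 \<le> \<beta>" using path[of 0] T J0 by simp
  \<comment> \<open>Along each orbit norm + 2 J stays below \<open>K\<close>: beyond norm
    \<open>M\<close> the gradient has norm at least 1, so a step is at most twice as long as the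
    drop of \<open>J\<close>; from inside, a step of length at most 1 leads to norm at most
    \<open>M + 1\<close>, at a level at most \<beta>.\<close>
  define K where "K = max (M + 1) (T * norm e) + 2 * \<beta>"
  obtain G where G: "\<And>x. norm x \<le> K + 1 \<Longrightarrow> norm (g x) \<le> G" using gbdd by blast
  have "\<exists>x. norm x \<le> K \<and> norm (g x) < \<delta> \<and> 0 \<le> J x \<and> J x \<le> \<beta> \<and> (\<rho> \<le> N x \<or> \<alpha> \<le> J x)"
    if \<delta>0: "0 < \<delta>" for \<delta>
  proof (rule ccontr)
    assume neg: "\<not> ?thesis"
    define d where "d = min \<delta> 1"
    have d: "0 < d" "d \<le> 1" "d \<le> \<delta>" using \<delta>0 by (auto simp: d_def)
    obtain \<tau>0 where \<tau>0: "0 < \<tau>0" and desc: "\<And>x \<tau>. norm x \<le> K + 1 \<Longrightarrow> d / 2 \<le> norm (g x) \<Longrightarrow> 0 \<le> \<tau> \<Longrightarrow> \<tau> \<le> \<tau>0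
       \<Longrightarrow> J (x - \<tau> *\<^sub>R g x) \<le> J x - \<tau> / 2 * (norm (g x))\<^sup>2"
      using descent[of "d/2" "K+1"] d by auto
    \<comment> \<open>Steps of length at most \<rho> / 2 cannot leap over the shell; length at most
      1 serves the bound \<open>K\<close>.\<close>
    define s1 where "s1 = min 1 (\<rho>/2)"
    have s1: "0 < s1" "s1 \<le> 1" "s1 \<le> \<rho>/2" using \<rho> by (auto simp: s1_def)
    define \<tau> where "\<tau> = min \<tau>0 (s1 / (\<bar>G\<bar> + 1))"
    have \<tau>: "0 < \<tau>" "\<tau> \<le> \<tau>0" using \<tau>0 s1 by (auto simp: \<tau>_def)
    have \<tau>G: "\<tau> * norm (g x) \<le> s1" if "norm x \<le> K + 1" for x
    proof -
      have "\<tau> * norm (g x) \<le> s1 / (\<bar>G\<bar> + 1) * (\<bar>G\<bar> + 1)"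
        using G[OF that] s1 by (intro mult_mono) (auto simp: \<tau>_def)
      then show ?thesis by simp
    qed
    \<comment> \<open>The cutoff makes the step a continuous map of the whole space: full steps for
      norm at most \<open>K\<close> and gradient at least \<open>d\<close>, no step beyond
      \<open>K + 1\<close> or below \<open>d / 2\<close>. Thus one \<open>\<tau>0\<close> serves
      wherever the map moves a point.\<close>
    define \<theta> where "\<theta> x = max 0 (min 1 (K + 1 - norm x)) * max 0 (min 1 (2 * norm (g x) / d - 1))" for x
    have \<theta>01: "0 \<le> \<theta> x" "\<theta> x \<le> 1" for x
      unfolding \<theta>_def by (auto intro!: mult_le_one)
    have \<theta>nz: "norm x \<le> K + 1 \<and> d / 2 \<le> norm (g x)" if "\<theta> x \<noteq> 0" for x
      using that d unfolding \<theta>_def by (auto simp: max_def min_def field_simps split: if_splits)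
    have \<theta>1: "\<theta> x = 1" if "norm x \<le> K" "d \<le> norm (g x)" for x
      using that d unfolding \<theta>_def by (auto simp: max_def min_def field_simps split: if_splits)
    define \<Phi> where "\<Phi> x = x - (\<tau> * \<theta> x) *\<^sub>R g x" for x
    have cont\<Phi>: "continuous_on UNIV \<Phi>"
      unfolding \<Phi>_def \<theta>_def using contg d by (intro continuous_intros) auto
    have dec: "J (\<Phi> x) \<le> J x - \<tau> * \<theta> x / 2 * (norm (g x))\<^sup>2" for x
    proof (cases "\<theta> x = 0")
      case False
      have "\<tau> * \<theta> x \<le> \<tau> * 1" using \<theta>01[of x] \<tau> by (intro mult_left_mono) auto
      then have "\<tau> * \<theta> x \<le> \<tau>0" using \<tau> by linarith
      then show ?thesis unfolding \<Phi>_def using \<theta>nz[OF False] \<tau> \<theta>01[of x] by (intro desc) auto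
    qed (simp add: \<Phi>_def)
    have dec': "J (\<Phi> x) \<le> J x" for x
      using dec[of x] \<tau> \<theta>01[of x] by (smt (verit) divide_nonneg_nonneg mult_nonneg_nonneg zero_le_power2)
    have step: "norm (\<Phi> x - x) \<le> s1" for x
    proof (cases "\<theta> x = 0")
      case False
      have "norm (\<Phi> x - x) = \<theta> x * (\<tau> * norm (g x))" using \<tau> \<theta>01[of x] by (simp add: \<Phi>_def abs_mult)
      also have "\<dots> \<le> 1 * s1" using \<tau>G[of x] \<theta>nz[OF False] \<theta>01[of x] \<tau> s1 by (intro mult_mono) auto
      finally show ?thesis by simp
    qed (use s1 in \<open>simp add: \<Phi>_def\<close>)
    define X where "X n x = (\<Phi> ^^ n) x" for n x
    have X0: "X 0 x = x" and XS: "X (Suc n) x = \<Phi> (X n x)" for n x by (auto simp: X_def)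
    have contX: "continuous_on UNIV (X n)" for n
    proof (induction n)
      case 0 then show ?case by (simp add: X_def)
    next
      case (Suc n)
      have "X (Suc n) = \<Phi> \<circ> X n" by (auto simp: XS)
      then show ?case using Suc cont\<Phi> by (metis continuous_on_compose continuous_on_subset subset_UNIV)
    qed
    have contN: "continuous_on UNIV N"
      unfolding continuous_on_iff dist_norm real_norm_def by (metis lip le_less_trans)
    have Jmono: "J (X (n + m) x) \<le> J (X n x)" for n m x
      by (induction m) (auto simp: XS intro: order_trans[OF dec'])
    have contseg: "continuous_on {0..T} (\<lambda>s. X n (s *\<^sub>R e))" for n
      by (rule continuous_on_compose2[OF contX]) (auto intro!: continuous_intros)
    define A where "A = (\<Union>n. {s \<in> {0..T}. N (X n (s *\<^sub>R e)) < \<rho> \<and> J (X n (s *\<^sub>R e)) < \<alpha>})"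
    define B where "B = (\<Union>n. {s \<in> {0..T}. J (X n (s *\<^sub>R e)) < 0})"
    have contNs: "continuous_on {0..T} (\<lambda>s. N (X n (s *\<^sub>R e)))" for n
      by (rule continuous_on_compose2[OF contN contseg]) auto
    have contJs: "continuous_on {0..T} (\<lambda>s. J (X n (s *\<^sub>R e)))" for n
      by (rule continuous_on_compose2[OF contJ contseg]) auto
    have opA: "openin (top_of_set {0..T}) A"
    proof -
      have "openin (top_of_set {0..T}) {s \<in> {0..T}. N (X n (s *\<^sub>R e)) < \<rho> \<and> J (X n (s *\<^sub>R e)) < \<alpha>}" for n
      proof -
        have "openin (top_of_set {0..T}) ({0..T} \<inter> (\<lambda>s. N (X n (s *\<^sub>R e))) -` {..<\<rho>} \<inter> ({0..T} \<inter> (\<lambda>s. J (X n (s *\<^sub>R e))) -` {..<\<alpha>}))"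
          by (intro openin_Int continuous_openin_preimage_gen contNs contJs) auto
        moreover have "{0..T} \<inter> (\<lambda>s. N (X n (s *\<^sub>R e))) -` {..<\<rho>} \<inter> ({0..T} \<inter> (\<lambda>s. J (X n (s *\<^sub>R e))) -` {..<\<alpha>}) = {s \<in> {0..T}. N (X n (s *\<^sub>R e)) < \<rho> \<and> J (X n (s *\<^sub>R e)) < \<alpha>}"
          by auto
        ultimately show ?thesis by simp
      qed
      then show ?thesis unfolding A_def by (intro openin_Union) auto
    qed
    have opB: "openin (top_of_set {0..T}) B"
    proof -
      have "openin (top_of_set {0..T}) {s \<in> {0..T}. J (X n (s *\<^sub>R e)) < 0}" for n
      proof -
        have "openin (top_of_set {0..T}) ({0..T} \<inter> (\<lambda>s. J (X n (s *\<^sub>R e))) -` {..<0})"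
          by (intro continuous_openin_preimage_gen contJs) auto
        moreover have "{0..T} \<inter> (\<lambda>s. J (X n (s *\<^sub>R e))) -` {..<0} = {s \<in> {0..T}. J (X n (s *\<^sub>R e)) < 0}"
          by auto
        ultimately show ?thesis by simp
      qed
      then show ?thesis unfolding B_def by (intro openin_Union) auto
    qed
    \<comment> \<open>Below level \<alpha> the shell cannot be met, so N < \<rho> improves to N <
      \<rho> / 2, and the next step stays inside.\<close>
    have trap: "N (X (n + m) x) < \<rho> \<and> J (X (n + m) x) < \<alpha>" if "N (X n x) < \<rho>" "J (X n x) < \<alpha>" for n m x
    proof (induction m)
      case (Suc m)
      let ?y = "X (n + m) x"
      have "N ?y < \<rho> / 2" using shell[of ?y] Suc by fastforce
      moreover have "N (\<Phi> ?y) \<le> N ?y + s1" using lip[of "\<Phi> ?y" ?y] step[of ?y] by linarith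
      ultimately show ?case using dec'[of ?y] s1 Suc by (auto simp: XS)
    qed (use that in auto)
    have "A \<inter> B = {}"
    proof -
      have False if "N (X n x) < \<rho>" "J (X n x) < \<alpha>" "J (X m x) < 0" for n m x
      proof -
        have "0 \<le> J (X (n + m) x)" using trap[OF that(1,2), of m] inner_nonneg by blast
        also have "\<dots> \<le> J (X m x)" using Jmono[of m n x] by (simp add: add.commute)
        finally show False using that by simp
      qed
      then show ?thesis unfolding A_def B_def by blast
    qed
    moreover have "0 \<in> A" unfolding A_def using T \<rho> \<alpha> by (auto intro!: exI[of _ 0] simp: X0 N0 J0)
    moreover have "T \<in> B" unfolding B_def using T endpoint by (auto intro!: exI[of _ 0] simp: X0)
    moreover have "connected {0..T}" by (rule connected_Icc)
    moreover have "A \<subseteq> {0..T}" "B \<subseteq> {0..T}" unfolding A_def B_def by auto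
    ultimately have "\<not> {0..T} \<subseteq> A \<union> B"
      using opA opB unfolding connected_openin by blast
    then obtain s where s: "0 \<le> s" "s \<le> T" "s \<notin> A" "s \<notin> B"
      by (metis UnI1 UnI2 atLeastAtMost_iff subsetI)
    define x where "x n = X n (s *\<^sub>R e)" for n
    have xS: "x (Suc n) = \<Phi> (x n)" for n by (simp add: x_def XS)
    have Jx0: "0 \<le> J (x n)" for n using s(1,2,4) unfolding B_def x_def by (auto simp: not_less)
    have alt: "\<rho> \<le> N (x n) \<or> \<alpha> \<le> J (x n)" for n using s(1,2,3) unfolding A_def x_def by (auto simp: not_less)
    have Jx\<beta>: "J (x n) \<le> \<beta>" for n
      using Jmono[of 0 n "s *\<^sub>R e"] path[of s] s by (simp add: x_def X0)
    have xb: "norm (x n) + 2 * J (x n) \<le> K" for n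
    proof (induction n)
      case 0
      have "norm (x 0) \<le> T * norm e" using s by (auto simp: x_def X0 intro: mult_right_mono)
      then show ?case using Jx\<beta>[of 0] unfolding K_def by linarith
    next
      case (Suc n)
      show ?case
      proof (cases "norm (x n) \<le> M")
        case True
        have "norm (x (Suc n)) \<le> norm (x n) + norm (\<Phi> (x n) - x n)" unfolding xS by norm
        then have "norm (x (Suc n)) \<le> M + 1" using step[of "x n"] s1 True by linarith
        then show ?thesis using Jx\<beta>[of "Suc n"] unfolding K_def by linarith
      next
        case False
        then have g1: "1 \<le> norm (g (x n))" using M[OF Jx\<beta>[of n]] by force
        have "norm (x (Suc n)) \<le> norm (x n) + norm (\<Phi> (x n) - x n)" unfolding xS by norm
        moreover have "norm (\<Phi> (x n) - x n) = \<tau> * \<theta> (x n) * norm (g (x n))"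
          using \<tau> \<theta>01[of "x n"] by (simp add: \<Phi>_def abs_mult)
        moreover have "\<tau> * \<theta> (x n) * norm (g (x n)) \<le> \<tau> * \<theta> (x n) * (norm (g (x n)))\<^sup>2"
          using g1 \<tau> \<theta>01[of "x n"] by (intro mult_left_mono self_le_power) auto
        ultimately show ?thesis using dec[of "x n"] Suc unfolding xS by auto
      qed
    qed
    have big: "d \<le> norm (g (x n))" for n
    proof (rule ccontr)
      assume "\<not> ?thesis"
      then have "norm (g (x n)) < \<delta>" using d by simp
      moreover have "norm (x n) \<le> K" using xb[of n] Jx0[of n] by linarith
      ultimately show False using neg Jx0[of n] Jx\<beta>[of n] alt[of n] by blast
    qed
    \<comment> \<open>Full steps with gradient at least \<open>d\<close> lower \<open>J\<close> by a
      fixed amount each, against its nonnegativity along this orbit.\<close>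
    have "J (x n) \<le> \<beta> - n * (\<tau> / 2 * d\<^sup>2)" for n
    proof (induction n)
      case (Suc n)
      have "\<theta> (x n) = 1" using \<theta>1 big[of n] xb[of n] Jx0[of n] by simp
      then have "J (x (Suc n)) \<le> J (x n) - \<tau> / 2 * (norm (g (x n)))\<^sup>2" using dec[of "x n"] by (simp add: xS)
      moreover have "\<tau> / 2 * d\<^sup>2 \<le> \<tau> / 2 * (norm (g (x n)))\<^sup>2"
        using big[of n] d \<tau> by (intro mult_left_mono power_mono) auto
      moreover have "real (Suc n) * (\<tau> / 2 * d\<^sup>2) = real n * (\<tau> / 2 * d\<^sup>2) + \<tau> / 2 * d\<^sup>2"
        by (simp add: algebra_simps)
      ultimately show ?case using Suc by linarith
    qed (use Jx\<beta> in simp)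
    moreover obtain n :: nat where "\<beta> < n * (\<tau> / 2 * d\<^sup>2)"
      using reals_Archimedean3[of "\<tau> / 2 * d\<^sup>2" ] \<tau> d by auto
    ultimately show False using Jx0[of n] by (smt (verit))
  qed
  then show ?thesis by blast
qed

section \<open>The variational problem on the unit interval\<close>

text \<open>
  Continuous functions with the \<open>L\<^sup>2\<close> inner product. The space is not complete; compactness of
  the integral operators below makes up for that.
\<close>

typedef cfun = "{f :: real \<Rightarrow> real. continuous_on {0..1} f \<and> (\<forall>x. x \<notin> {0..1} \<longrightarrow> f x = 0)}"
  morphisms fn Abs_cfun
  by (rule exI[of _ "\<lambda>_. 0"]) auto

definition mkc :: "(real \<Rightarrow> real) \<Rightarrow> cfun" where
  "mkc f = Abs_cfun (\<lambda>x. if x \<in> {0..1} then f x else 0)"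

lemma fn_mkc: "continuous_on {0..1} f \<Longrightarrow> fn (mkc f) = (\<lambda>x. if x \<in> {0..1} then f x else 0)"
proof -
  assume "continuous_on {0..1} f"
  then have "continuous_on {0..1} (\<lambda>x. if x \<in> {0..1} then f x else 0)"
    by (rule continuous_on_eq) simp
  then show ?thesis unfolding mkc_def by (intro Abs_cfun_inverse) simp
qed

lemma fn_mkc_in [simp]: "continuous_on {0..1} f \<Longrightarrow> 0 \<le> x \<Longrightarrow> x \<le> 1 \<Longrightarrow> fn (mkc f) x = f x"
  by (simp add: fn_mkc)

lemma fn_outside: "x \<notin> {0..1} \<Longrightarrow> fn f x = 0" using fn[of f] by auto

lemma cont_fn [continuous_intros]: "continuous_on {0..1} (fn f)" using fn[of f] by auto

lemma cfun_eqI: "(\<And>x. 0 \<le> x \<Longrightarrow> x \<le> 1 \<Longrightarrow> fn f x = fn g x) \<Longrightarrow> f = g"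
proof -
  assume *: "\<And>x. 0 \<le> x \<Longrightarrow> x \<le> 1 \<Longrightarrow> fn f x = fn g x"
  have "fn f x = fn g x" for x
    by (cases "x \<in> {0..1}") (use * in \<open>auto simp: fn_outside\<close>)
  then have "fn f = fn g" by (rule ext)
  then show "f = g" by (simp add: fn_inject)
qed

lemma int_fn: "continuous_on {0..1} f \<Longrightarrow> f integrable_on {0..1::real}" for f :: "real \<Rightarrow> real"
  by (rule integrable_continuous_real)

instantiation cfun :: real_inner
begin

definition "0 = mkc (\<lambda>_. 0)"
definition "f + g = mkc (\<lambda>x. fn f x + fn g x)"
definition "- f = mkc (\<lambda>x. - fn f x)" for f :: cfun
definition "f - g = mkc (\<lambda>x. fn f x - fn g x)"
definition "r *\<^sub>R f = mkc (\<lambda>x. r * fn f x)"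
definition "inner f g = integral {0..1} (\<lambda>x. fn f x * fn g x)"
definition "norm f = sqrt (inner f f)" for f :: cfun
definition "sgn f = inverse (norm f) *\<^sub>R f" for f :: cfun
definition "dist f g = norm (f - g)" for f :: cfun
definition "(uniformity :: (cfun \<times> cfun) filter) = (INF e\<in>{0 <..}. principal {(x, y). dist x y < e})"
definition "open U \<longleftrightarrow> (\<forall>x\<in>U. \<forall>\<^sub>F (x', y) in uniformity. x' = x \<longrightarrow> y \<in> U)" for U :: "cfun set"

lemma fn_simps_aux: 
  "fn 0 x = 0"
  "fn (f + g) x = fn f x + fn g x"
  "fn (- f) x = - fn f x"
  "fn (f - g) x = fn f x - fn g x"
  "fn (r *\<^sub>R f) x = r * fn f x"
  unfolding zero_cfun_def plus_cfun_def uminus_cfun_def minus_cfun_def scaleR_cfun_def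
  by (subst fn_mkc, intro continuous_intros, simp add: fn_outside)+

instance
proof
  fix f g h :: cfun and r s :: real
  show "f + g + h = f + (g + h)" "f + g = g + f" "0 + f = f" "- f + f = 0" "f - g = f + - g"
    "r *\<^sub>R (f + g) = r *\<^sub>R f + r *\<^sub>R g" "(r + s) *\<^sub>R f = r *\<^sub>R f + s *\<^sub>R f"
    "r *\<^sub>R s *\<^sub>R f = (r * s) *\<^sub>R f" "1 *\<^sub>R f = f"
    by (simp_all add: cfun_eqI fn_simps_aux algebra_simps)
  show "inner f g = inner g f" by (simp add: inner_cfun_def mult.commute)
  show "inner (f + g) h = inner f h + inner g h"
    unfolding inner_cfun_def fn_simps_aux
    by (subst integral_add[symmetric]) (auto intro!: int_fn continuous_intros simp: algebra_simps)
  show "inner (r *\<^sub>R f) g = r * inner f g"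
    unfolding inner_cfun_def fn_simps_aux by (simp add: mult.assoc)
  show "0 \<le> inner f f" unfolding inner_cfun_def
    by (rule integral_nonneg) (auto intro!: int_fn continuous_intros)
  show "inner f f = 0 \<longleftrightarrow> f = 0"
  proof
    assume *: "inner f f = 0"
    have "((\<lambda>x. fn f x * fn f x) has_integral 0) (cbox 0 1)"
      using * int_fn[of "\<lambda>x. fn f x * fn f x"] unfolding inner_cfun_def
      by (auto simp: has_integral_iff intro!: continuous_intros)
    then have "fn f x * fn f x = 0" if "x \<in> {0..1}" for x
      using that has_integral_0_cbox_imp_0[of 0 1 "\<lambda>x. fn f x * fn f x" x]
      by (auto intro!: continuous_intros)
    then show "f = 0" by (intro cfun_eqI) (auto simp: fn_simps_aux)
  qed (simp add: inner_cfun_def fn_simps_aux)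
qed (simp_all add: norm_cfun_def sgn_cfun_def dist_cfun_def uniformity_cfun_def open_cfun_def)

end

lemmas fn_simps [simp] = fn_simps_aux

lemma norm_cfun_sq: "(norm f)\<^sup>2 = integral {0..1} (\<lambda>x. (fn f x)\<^sup>2)" for f :: cfun
  using power2_norm_eq_inner[of f] by (simp add: inner_cfun_def power2_eq_square)

lemma inner_cfun_mkc:
  assumes "continuous_on {0..1} g"
  shows "inner (mkc g) f = integral {0..1} (\<lambda>x. g x * fn f x)"
  unfolding inner_cfun_def by (rule integral_cong) (use assms in auto)

lemma norm_cfun_le:
  assumes "\<And>x. 0 \<le> x \<Longrightarrow> x \<le> 1 \<Longrightarrow> \<bar>fn f x\<bar> \<le> B" "0 \<le> B" shows "norm f \<le> B"
proof -
  have "(norm f)\<^sup>2 \<le> integral {0..1} (\<lambda>x::real. B\<^sup>2)"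
    unfolding norm_cfun_sq using assms
    by (intro integral_le int_fn continuous_intros) (auto simp: abs_le_square_iff[symmetric])
  then have "(norm f)\<^sup>2 \<le> B\<^sup>2" by simp
  then show ?thesis using assms(2) by (rule power2_le_imp_le)
qed

text \<open>Cauchy--Schwarz on a subinterval, with the part of \<open>f\<close> outside discarded.\<close>

lemma integral_mult_cfun_le:
  assumes c: "continuous_on {0..1} \<eta>" and ab: "0 \<le> x" "x \<le> y" "y \<le> 1"
  shows "\<bar>integral {x..y} (\<lambda>s. \<eta> s * fn f s)\<bar> \<le> sqrt (integral {x..y} (\<lambda>s. (\<eta> s)\<^sup>2)) * norm f"
proof -
  have sub: "{x..y} \<subseteq> {0..1}" using ab by auto
  have c1: "continuous_on {x..y} \<eta>" and c2: "continuous_on {x..y} (fn f)"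
    using c cont_fn continuous_on_subset[OF _ sub] by blast+
  let ?A = "integral {x..y} (\<lambda>s. (\<eta> s)\<^sup>2)" and ?B = "integral {x..y} (\<lambda>s. (fn f s)\<^sup>2)"
    and ?C = "integral {x..y} (\<lambda>s. \<eta> s * fn f s)"
  have "?B \<le> integral {0..1} (\<lambda>s. (fn f s)\<^sup>2)"
    by (rule integral_subset_le[OF sub]) (auto intro!: integrable_continuous_real continuous_intros c2)
  then have B: "?B \<le> (norm f)\<^sup>2" by (simp add: norm_cfun_sq)
  have A0: "0 \<le> ?A" and B0: "0 \<le> ?B"
    by (auto intro!: integral_nonneg integrable_continuous_real continuous_intros c1 c2)
  \<comment> \<open>A quadratic in \<open>l\<close> that is nonnegative everywhere has nonpositive
    discriminant; if its leading coefficient vanishes, the linear one must vanish as well.\<close>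
  have quad: "0 \<le> ?A * l\<^sup>2 + 2 * ?C * l + ?B" for l
  proof -
    have "0 \<le> integral {x..y} (\<lambda>s. (l * \<eta> s + fn f s)\<^sup>2)"
      by (auto intro!: integral_nonneg integrable_continuous_real continuous_intros c1 c2)
    also have "\<dots> = integral {x..y} (\<lambda>s. l\<^sup>2 * (\<eta> s)\<^sup>2 + (2 * l * (\<eta> s * fn f s) + (fn f s)\<^sup>2))"
      by (rule integral_cong) (simp add: power2_eq_square algebra_simps)
    also have "\<dots> = l\<^sup>2 * ?A + (2 * l * ?C + ?B)"
      by (subst integral_add, (auto intro!: integrable_continuous_real continuous_intros c1 c2)[2])+ simp
    finally show ?thesis by (simp add: algebra_simps)
  qed
  have "?C\<^sup>2 \<le> ?A * ?B"
  proof (cases "?A = 0")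
    case True
    have "?C = 0"
    proof (rule ccontr)
      assume "?C \<noteq> 0"
      then show False using quad[of "- (?B + 1) / (2 * ?C)"] True by (simp add: field_simps)
    qed
    then show ?thesis using True by simp
  next
    case False
    then have "0 < ?A" using A0 by simp
    then show ?thesis using quad[of "- ?C / ?A"] by (simp add: field_simps power2_eq_square)
  qed
  also have "\<dots> \<le> ?A * (norm f)\<^sup>2" using B A0 by (intro mult_left_mono) auto
  finally have "sqrt (?C\<^sup>2) \<le> sqrt (?A * (norm f)\<^sup>2)" by (rule real_sqrt_le_mono)
  then show ?thesis by (simp add: real_sqrt_mult)
qed

section \<open>Primitives from the two endpoints and integration by parts\<close>

definition prim :: "(real \<Rightarrow> real) \<Rightarrow> real \<Rightarrow> real" where
  "prim f x = integral {0..x} f"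

definition tail :: "(real \<Rightarrow> real) \<Rightarrow> real \<Rightarrow> real" where
  "tail f x = integral {x..1} f"

lemma prim_deriv: "continuous_on {0..1} f \<Longrightarrow> 0 \<le> x \<Longrightarrow> x \<le> 1 \<Longrightarrow>
    (prim f has_real_derivative f x) (at x within {0..1})"
  unfolding prim_def by (rule integral_has_real_derivative) auto

lemma cont_prim [continuous_intros]: "continuous_on {0..1} f \<Longrightarrow> continuous_on {0..1} (prim f)"
  unfolding prim_def by (intro indefinite_integral_continuous_1 integrable_continuous_real)

lemma tail_prim: "continuous_on {0..1} f \<Longrightarrow> 0 \<le> x \<Longrightarrow> x \<le> 1 \<Longrightarrow> tail f x = prim f 1 - prim f x"
  unfolding prim_def tail_def
  using Henstock_Kurzweil_Integration.integral_combine[of 0 x 1 f] by (simp add: int_fn)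

lemma cont_tail [continuous_intros]: "continuous_on {0..1} f \<Longrightarrow> continuous_on {0..1} (tail f)"
  unfolding tail_def by (intro indefinite_integral_continuous_1' integrable_continuous_real)

lemma tail_deriv:
  assumes "continuous_on {0..1} f" "0 \<le> x" "x \<le> 1"
  shows "(tail f has_real_derivative - f x) (at x within {0..1})"
proof -
  have "((\<lambda>x. prim f 1 - prim f x) has_real_derivative - f x) (at x within {0..1})"
    using prim_deriv[OF assms] by (auto intro!: derivative_eq_intros)
  then show ?thesis
    by (rule has_field_derivative_transform_within[where d = 1]) (use assms in \<open>auto simp: tail_prim\<close>)
qed

lemma prim_0 [simp]: "prim f 0 = 0" by (simp add: prim_def)
lemma tail_1 [simp]: "tail f 1 = 0" by (simp add: tail_def)

text \<open>The boundary terms vanish because \<open>prim f\<close> is 0 at 0 and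
  \<open>tail g\<close> is 0 at 1. Hence \<open>tail\<close> is the L^2-adjoint of
  \<open>prim\<close>, the source of the adjoints that make up the gradient.\<close>

lemma integral_parts_prim_tail:
  assumes f: "continuous_on {0..1} f" and g: "continuous_on {0..1} g"
  shows "integral {0..1} (\<lambda>x. g x * prim f x) = integral {0..1} (\<lambda>x. tail g x * f x)"
proof -
  have "((\<lambda>x. tail g x * f x - g x * prim f x) has_integral (tail g 1 * prim f 1 - tail g 0 * prim f 0)) {0..1}"
  proof (rule fundamental_theorem_of_calculus)
    fix x :: real assume "x \<in> {0..1}"
    then have "((\<lambda>x. tail g x * prim f x) has_real_derivative tail g x * f x - g x * prim f x) (at x within {0..1})"
      using tail_deriv[OF g, of x] prim_deriv[OF f, of x]
      by (auto intro!: derivative_eq_intros)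
    then show "((\<lambda>x. tail g x * prim f x) has_vector_derivative tail g x * f x - g x * prim f x) (at x within {0..1})"
      by (simp add: has_real_derivative_iff_has_vector_derivative)
  qed simp
  then have "integral {0..1} (\<lambda>x. tail g x * f x - g x * prim f x) = 0"
    by (simp add: integral_unique)
  then show ?thesis
    by (subst (asm) integral_diff) (auto intro!: int_fn continuous_intros f g)
qed

lemma abs_prim_le:
  assumes "continuous_on {0..1} f" "\<And>s. 0 \<le> s \<Longrightarrow> s \<le> 1 \<Longrightarrow> \<bar>f s\<bar> \<le> B" "0 \<le> x" "x \<le> 1"
  shows "\<bar>prim f x\<bar> \<le> B"
proof -
  have "0 \<le> B" using assms(2)[of 0] by simp
  have "norm (integral {0..x} f) \<le> B * (x - 0)"
    by (rule integral_bound) (use assms in \<open>auto intro: continuous_on_subset\<close>)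
  also have "\<dots> \<le> B" using \<open>0 \<le> B\<close> assms by (simp add: mult_left_le)
  finally show ?thesis by (simp add: prim_def)
qed

lemma abs_tail_le:
  assumes "continuous_on {0..1} f" "\<And>s. 0 \<le> s \<Longrightarrow> s \<le> 1 \<Longrightarrow> \<bar>f s\<bar> \<le> B" "0 \<le> x" "x \<le> 1"
  shows "\<bar>tail f x\<bar> \<le> B"
proof -
  have "0 \<le> B" using assms(2)[of 0] by simp
  have "norm (integral {x..1} f) \<le> B * (1 - x)"
    by (rule integral_bound) (use assms in \<open>auto intro: continuous_on_subset\<close>)
  also have "\<dots> \<le> B" using \<open>0 \<le> B\<close> assms by (simp add: mult_left_le)
  finally show ?thesis by (simp add: tail_def)
qed

lemma prim_lin: "continuous_on {0..1} f \<Longrightarrow> continuous_on {0..1} g \<Longrightarrow> x \<in> {0..1} \<Longrightarrow>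
   prim (\<lambda>s. f s - r * g s) x = prim f x - r * prim g x"
  unfolding prim_def
  by (subst integral_diff) (auto intro!: integrable_continuous_real continuous_intros intro: continuous_on_subset)

lemma tail_diff: "continuous_on {0..1} f \<Longrightarrow> continuous_on {0..1} g \<Longrightarrow> x \<in> {0..1} \<Longrightarrow>
   tail (\<lambda>s. f s - g s) x = tail f x - tail g x"
  unfolding tail_def
  by (subst integral_diff) (auto intro!: integrable_continuous_real continuous_intros intro: continuous_on_subset)

text \<open>The interval [-L, L] moved to the unit interval by t = -L + 2Ls: q is (2L)^2, m(s) is
  (2L)^2 e^(2t) and \<eta>(s) is e^t, the factors 2L coming from the derivatives. The unknown behind
  a is w with a' = \<eta> w, which turns the weighted energy of a' into the plain norm of w. The
  nonlinearity is already extended to negative arguments, hence the absolute value in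
  \<open>R_le\<close>.\<close>

locale truncated =
  fixes q \<kappa> c p :: real and m \<eta> R R' :: "real \<Rightarrow> real"
  assumes q: "0 < q" and cm: "continuous_on {0..1} m" and m: "\<And>s. 0 \<le> s \<Longrightarrow> s \<le> 1 \<Longrightarrow> 0 < m s"
    and c\<eta>: "continuous_on {0..1} \<eta>"
    and R_deriv: "\<And>s. (R has_real_derivative R' s) (at s)" and R'_cont: "continuous_on UNIV R'"
    and R0: "R 0 = 0" and R'0: "R' 0 = 0" and R_le: "\<And>s. R s \<le> c * \<bar>s\<bar> powr p" and R_ge: "\<And>s. 0 \<le> R s"
    and AR: "\<And>s. p * R s \<le> s * R' s" and c: "0 < c" and p: "2 < p"
begin

definition "E = (SOME B. 0 \<le> B \<and> (\<forall>s\<in>{0..1}. \<bar>\<eta> s\<bar> \<le> B))"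

lemma E: "0 \<le> E" "0 \<le> s \<Longrightarrow> s \<le> 1 \<Longrightarrow> \<bar>\<eta> s\<bar> \<le> E"
proof -
  have "bounded (\<eta> ` {0..1})" using c\<eta> compact_continuous_image compact_imp_bounded by blast
  then obtain B where "\<forall>s\<in>{0..1}. \<bar>\<eta> s\<bar> \<le> B" unfolding bounded_iff by auto
  then have "0 \<le> max B 0 \<and> (\<forall>s\<in>{0..1}. \<bar>\<eta> s\<bar> \<le> max B 0)" by fastforce
  then have "0 \<le> E \<and> (\<forall>s\<in>{0..1}. \<bar>\<eta> s\<bar> \<le> E)" unfolding E_def by (rule someI)
  then show "0 \<le> E" "0 \<le> s \<Longrightarrow> s \<le> 1 \<Longrightarrow> \<bar>\<eta> s\<bar> \<le> E" by auto
qed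

text \<open>
  Writing the unknowns as \<open>U v\<close> and \<open>Aw w\<close> builds in the boundary conditions. \<open>\<Theta>\<close> is the
  potential part of the Lagrangian with partial derivatives \<open>\<Theta>u\<close> and \<open>\<Theta>a\<close>; \<open>V1\<close> and \<open>V2\<close> are the
  \<open>L\<^sup>2\<close>-adjoints of \<open>U\<close> and \<open>Aw - \<kappa>\<close>, which makes \<open>g\<close> the gradient of \<open>J\<close>.
\<close>

definition "U v s = prim (fn v) s - s * prim (fn v) 1"
definition "Aw w s = \<kappa> + prim (\<lambda>x. \<eta> x * fn w x) s"
definition "\<Theta> s u a = q * a\<^sup>2 * u\<^sup>2 / 2 + m s * u\<^sup>2 / 2 - m s * R u"
definition "\<Theta>u s u a = q * a\<^sup>2 * u + m s * u - m s * R' u"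
definition "\<Theta>a (s :: real) u a = q * a * u\<^sup>2"
definition "V1 h s = tail h s - prim (tail h) 1"
definition "V2 h s = \<eta> s * tail h s"
definition "NN u a = (mkc (V1 (\<lambda>s. \<Theta>u s (u s) (a s))), mkc (V2 (\<lambda>s. \<Theta>a s (u s) (a s))))"
definition "J x = (norm x)\<^sup>2 / 2 + integral {0..1} (\<lambda>s. \<Theta> s (U (fst x) s) (Aw (snd x) s))"
definition "g x = x + NN (U (fst x)) (Aw (snd x))"

lemma R_cont: "continuous_on A R"
  using R_deriv by (meson DERIV_isCont continuous_at_imp_continuous_on)

lemma cont_U [continuous_intros]: "continuous_on {0..1} (U v)"
  unfolding U_def by (intro continuous_intros)

lemma cont_Aw [continuous_intros]: "continuous_on {0..1} (Aw w)"
  unfolding Aw_def by (intro continuous_intros c\<eta>)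

lemma cont_\<Theta>: 
  assumes "continuous_on {0..1} u" "continuous_on {0..1} a"
  shows "continuous_on {0..1} (\<lambda>s. \<Theta> s (u s) (a s))" "continuous_on {0..1} (\<lambda>s. \<Theta>u s (u s) (a s))"
    "continuous_on {0..1} (\<lambda>s. \<Theta>a s (u s) (a s))"
  unfolding \<Theta>_def \<Theta>u_def \<Theta>a_def
  by (intro continuous_intros cm assms continuous_on_compose2[OF R_cont[of UNIV]]
     continuous_on_compose2[OF R'_cont]; simp)+

lemma cont_V: "continuous_on {0..1} h \<Longrightarrow> continuous_on {0..1} (V1 h)"
  "continuous_on {0..1} h \<Longrightarrow> continuous_on {0..1} (V2 h)"
  unfolding V1_def V2_def by (intro continuous_intros c\<eta>; simp)+

text \<open>\<open>U\<close> corrects the primitive by a linear function so as to vanish at both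
  ends. In the adjoint this correction becomes the subtraction of a constant: the integral of s
  h(s), which is the mean of \<open>tail h\<close>.\<close>

lemma inner_V1:
  assumes h: "continuous_on {0..1} h"
  shows "inner (mkc (V1 h)) d = integral {0..1} (\<lambda>s. h s * U d s)"
proof -
  have 1: "integral {0..1} (\<lambda>s. h s * prim (fn d) s) = integral {0..1} (\<lambda>s. tail h s * fn d s)"
    by (rule integral_parts_prim_tail) (auto intro: cont_fn h)
  have "integral {0..1} (\<lambda>s. h s * s) = integral {0..1} (\<lambda>s. h s * prim (\<lambda>_. 1) s)"
    by (rule integral_cong) (simp add: prim_def)
  also have "\<dots> = prim (tail h) 1"
    by (subst integral_parts_prim_tail) (auto intro: h simp: prim_def)
  finally have 2: "integral {0..1} (\<lambda>s. h s * s) = prim (tail h) 1" .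
  have "integral {0..1} (\<lambda>s. h s * U d s) = integral {0..1} (\<lambda>s. h s * prim (fn d) s - prim (fn d) 1 * (h s * s))"
    by (rule integral_cong) (simp add: U_def algebra_simps)
  also have "\<dots> = integral {0..1} (\<lambda>s. tail h s * fn d s) - prim (fn d) 1 * prim (tail h) 1"
    by (subst integral_diff) (auto intro!: int_fn continuous_intros h simp: 1 2)
  also have "\<dots> = integral {0..1} (\<lambda>s. tail h s * fn d s - prim (tail h) 1 * fn d s)"
    by (subst integral_diff) (auto intro!: int_fn continuous_intros h simp: prim_def)
  also have "\<dots> = integral {0..1} (\<lambda>s. V1 h s * fn d s)"
    by (rule integral_cong) (simp add: V1_def algebra_simps)
  finally show ?thesis using inner_cfun_mkc[OF cont_V(1)[OF h]] by simp
qed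

lemma inner_V2:
  assumes h: "continuous_on {0..1} h"
  shows "inner (mkc (V2 h)) d = integral {0..1} (\<lambda>s. h s * (Aw d s - \<kappa>))"
proof -
  have "integral {0..1} (\<lambda>s. h s * (Aw d s - \<kappa>)) = integral {0..1} (\<lambda>s. tail h s * (\<eta> s * fn d s))"
    unfolding Aw_def by (simp, rule integral_parts_prim_tail) (auto intro!: continuous_intros h c\<eta>)
  then show ?thesis
    by (subst inner_cfun_mkc[OF cont_V(2)[OF h]]) (simp add: V2_def mult_ac)
qed

lemma prim_diff_cfun:
  assumes "continuous_on {0..1} h" "0 \<le> x" "x \<le> y" "y \<le> 1"
  shows "prim h y - prim h x = integral {x..y} h"
proof -
  have "h integrable_on {0..y}"
    using assms by (intro integrable_continuous_real continuous_on_subset[OF assms(1)]) auto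
  then show ?thesis unfolding prim_def
    using Henstock_Kurzweil_Integration.integral_combine[of 0 x y h] assms by simp
qed

text \<open>Cauchy--Schwarz on [x, y] turns an L^2 bound on \<open>v\<close> into a Hoelder modulus
  of exponent 1/2 for its weighted primitives. The compactness on the unit interval rests on this
  equicontinuity.\<close>

lemma prim_cfun_holder:
  assumes h: "continuous_on {0..1} h" and hB: "\<And>s. 0 \<le> s \<Longrightarrow> s \<le> 1 \<Longrightarrow> \<bar>h s\<bar> \<le> B" and xy: "0 \<le> x" "x \<le> 1" "0 \<le> y" "y \<le> 1"
  shows "\<bar>prim (\<lambda>s. h s * fn v s) y - prim (\<lambda>s. h s * fn v s) x\<bar> \<le> B * sqrt \<bar>y - x\<bar> * norm v"
proof -
  have B0: "0 \<le> B" using hB[of 0] by simp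
  have *: "\<bar>prim (\<lambda>s. h s * fn v s) y - prim (\<lambda>s. h s * fn v s) x\<bar> \<le> B * sqrt (y - x) * norm v"
    if "0 \<le> x" "x \<le> y" "y \<le> 1" for x y
  proof -
    have "prim (\<lambda>s. h s * fn v s) y - prim (\<lambda>s. h s * fn v s) x = integral {x..y} (\<lambda>s. h s * fn v s)"
      by (rule prim_diff_cfun) (use that in \<open>auto intro!: continuous_intros h\<close>)
    also have "\<bar>\<dots>\<bar> \<le> sqrt (integral {x..y} (\<lambda>s. (h s)\<^sup>2)) * norm v"
      by (rule integral_mult_cfun_le[OF h that])
    also have "\<dots> \<le> sqrt (B\<^sup>2 * (y - x)) * norm v"
    proof (intro mult_right_mono real_sqrt_le_mono)
      have "integral {x..y} (\<lambda>s. (h s)\<^sup>2) \<le> integral {x..y} (\<lambda>s. B\<^sup>2)"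
        using that hB B0
        by (intro integral_le integrable_continuous_real continuous_intros continuous_on_subset[OF h])
           (auto intro!: abs_le_square_iff[THEN iffD1])
      then show "integral {x..y} (\<lambda>s. (h s)\<^sup>2) \<le> B\<^sup>2 * (y - x)" using that by (simp add: mult.commute)
    qed auto
    finally show ?thesis using B0 by (simp add: real_sqrt_mult)
  qed
  show ?thesis
    using *[of x y] *[of y x] xy by (cases "x \<le> y") (auto simp: abs_minus_commute)
qed

text \<open>One half of the factor 2 is for the primitive, the other for the linear correction,
  where |y - x| is at most its square root on the unit interval.\<close>

lemma U_holder:
  assumes "0 \<le> x" "x \<le> 1" "0 \<le> y" "y \<le> 1"
  shows "\<bar>U v y - U v x\<bar> \<le> 2 * sqrt \<bar>y - x\<bar> * norm v"
proof -
  have 1: "\<bar>prim (fn v) y - prim (fn v) x\<bar> \<le> sqrt \<bar>y - x\<bar> * norm v"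
    using prim_cfun_holder[of "\<lambda>_. 1" 1 x y v] assms by simp
  have 2: "\<bar>prim (fn v) 1\<bar> \<le> norm v"
    using prim_cfun_holder[of "\<lambda>_. 1" 1 0 1 v] by simp
  have 3: "\<bar>y - x\<bar> \<le> sqrt \<bar>y - x\<bar>"
  proof (rule real_le_rsqrt)
    have "\<bar>y - x\<bar> * \<bar>y - x\<bar> \<le> \<bar>y - x\<bar> * 1" using assms by (intro mult_left_mono) auto
    then show "\<bar>y - x\<bar>\<^sup>2 \<le> \<bar>y - x\<bar>" by (simp add: power2_eq_square)
  qed
  have "\<bar>(y - x) * prim (fn v) 1\<bar> \<le> sqrt \<bar>y - x\<bar> * norm v"
    unfolding abs_mult using 2 3 by (intro mult_mono) auto
  moreover have "U v y - U v x = (prim (fn v) y - prim (fn v) x) - (y - x) * prim (fn v) 1"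
    by (simp add: U_def algebra_simps)
  ultimately show ?thesis using 1 by linarith
qed

lemma U_01 [simp]: "U v 0 = 0" "U v 1 = 0" by (simp_all add: U_def)

lemma U_le: "0 \<le> x \<Longrightarrow> x \<le> 1 \<Longrightarrow> \<bar>U v x\<bar> \<le> 2 * norm v"
proof -
  assume x: "0 \<le> x" "x \<le> 1"
  have "\<bar>U v x\<bar> \<le> 2 * sqrt \<bar>x\<bar> * norm v" using U_holder[of 0 x v] x by simp
  also have "\<dots> \<le> 2 * 1 * norm v" using x by (intro mult_right_mono mult_left_mono) auto
  finally show ?thesis by simp
qed

lemma Aw_holder:
  assumes "0 \<le> x" "x \<le> 1" "0 \<le> y" "y \<le> 1"
  shows "\<bar>Aw v y - Aw v x\<bar> \<le> E * sqrt \<bar>y - x\<bar> * norm v"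
  using prim_cfun_holder[OF c\<eta> E(2), of x y v] assms by (simp add: Aw_def)

lemma Aw_0 [simp]: "Aw v 0 = \<kappa>" by (simp add: Aw_def)

lemma Aw_le: "0 \<le> x \<Longrightarrow> x \<le> 1 \<Longrightarrow> \<bar>Aw v x - \<kappa>\<bar> \<le> E * norm v"
proof -
  assume x: "0 \<le> x" "x \<le> 1"
  have "\<bar>Aw v x - \<kappa>\<bar> \<le> E * sqrt \<bar>x\<bar> * norm v" using Aw_holder[of 0 x v] x by simp
  also have "\<dots> \<le> E * 1 * norm v" using x E by (intro mult_right_mono mult_left_mono) auto
  finally show ?thesis by simp
qed

lemma U_lin: "x \<in> {0..1} \<Longrightarrow> U (v - r *\<^sub>R d) x = U v x - r * U d x"
proof -
  assume x: "x \<in> {0..1}"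
  have *: "prim (fn (v - r *\<^sub>R d)) y = prim (fn v) y - r * prim (fn d) y" if "y \<in> {0..1}" for y
  proof -
    have "fn (v - r *\<^sub>R d) = (\<lambda>s. fn v s - r * fn d s)" by auto
    then show ?thesis using prim_lin[of "fn v" "fn d" y r] that by (simp add: cont_fn)
  qed
  have 1: "prim (fn (v - r *\<^sub>R d)) 1 = prim (fn v) 1 - r * prim (fn d) 1" using * by simp
  show ?thesis unfolding U_def *[OF x] 1 by (simp add: algebra_simps)
qed

text \<open>\<open>Aw\<close> is affine, with linear part \<open>Aw d - \<kappa>\<close>. The form v
  - r d is that of a descent step.\<close>

lemma Aw_lin: "x \<in> {0..1} \<Longrightarrow> Aw (v - r *\<^sub>R d) x = Aw v x - r * (Aw d x - \<kappa>)"
proof -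
  assume x: "x \<in> {0..1}"
  have "prim (\<lambda>s. \<eta> s * fn v s - r * (\<eta> s * fn d s)) x = prim (\<lambda>s. \<eta> s * fn v s) x - r * prim (\<lambda>s. \<eta> s * fn d s) x"
    using x by (intro prim_lin continuous_intros c\<eta>)
  then show ?thesis unfolding Aw_def by (simp add: algebra_simps)
qed

lemma U_diff_le: "0 \<le> x \<Longrightarrow> x \<le> 1 \<Longrightarrow> \<bar>U v x - U w x\<bar> \<le> 2 * norm (v - w)"
  using U_lin[of x v 1 w] U_le[of x "v - w"] by simp

lemma Aw_diff_le: "0 \<le> x \<Longrightarrow> x \<le> 1 \<Longrightarrow> \<bar>Aw v x - Aw w x\<bar> \<le> E * norm (v - w)"
  using Aw_lin[of x v 1 w] Aw_le[of x "v - w"] by simp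

end

section \<open>Uniform continuity of the potential and of the gradient\<close>

lemma uniform_continuity_triple:
  fixes F :: "real \<Rightarrow> real \<Rightarrow> real \<Rightarrow> real"
  assumes "continuous_on ({0..1} \<times> {-B..B} \<times> {-B..B}) (\<lambda>x. F (fst x) (fst (snd x)) (snd (snd x)))" "0 < \<epsilon>"
  obtains d where "0 < d" "\<And>s u a u' a'. 0 \<le> s \<Longrightarrow> s \<le> 1 \<Longrightarrow> \<bar>u\<bar> \<le> B \<Longrightarrow> \<bar>a\<bar> \<le> B \<Longrightarrow> \<bar>u'\<bar> \<le> B \<Longrightarrow> \<bar>a'\<bar> \<le> B
     \<Longrightarrow> \<bar>u - u'\<bar> < d \<Longrightarrow> \<bar>a - a'\<bar> < d \<Longrightarrow> \<bar>F s u a - F s u' a'\<bar> < \<epsilon>"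
proof -
  have "uniformly_continuous_on ({0..1} \<times> {-B..B} \<times> {-B..B}) (\<lambda>x. F (fst x) (fst (snd x)) (snd (snd x)))"
    by (intro compact_uniformly_continuous assms compact_Times compact_Icc)
  then obtain d where d: "0 < d" and *: "\<And>x y. x \<in> {0..1} \<times> {-B..B} \<times> {-B..B} \<Longrightarrow> y \<in> {0..1} \<times> {-B..B} \<times> {-B..B} \<Longrightarrow>
      dist y x < d \<Longrightarrow> dist (F (fst y) (fst (snd y)) (snd (snd y))) (F (fst x) (fst (snd x)) (snd (snd x))) < \<epsilon>"
    using assms(2) unfolding uniformly_continuous_on_def by metis
  show thesis
  proof (rule that[of "d/2"])
    fix s u a u' a' :: real
    assume s: "0 \<le> s" "s \<le> 1" and b: "\<bar>u\<bar> \<le> B" "\<bar>a\<bar> \<le> B" "\<bar>u'\<bar> \<le> B" "\<bar>a'\<bar> \<le> B"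
      and l: "\<bar>u - u'\<bar> < d / 2" "\<bar>a - a'\<bar> < d / 2"
    have "dist (s, u, a) (s, u', a') = norm (u - u', a - a')"
      by (simp add: dist_prod_def norm_prod_def dist_real_def)
    also have "\<dots> \<le> norm (u - u') + norm (a - a')" by (rule norm_Pair_le)
    finally have "dist (s, u, a) (s, u', a') < d" using l by simp
    then show "\<bar>F s u a - F s u' a'\<bar> < \<epsilon>"
      using *[of "(s, u', a')" "(s, u, a)"] s b by (simp add: dist_real_def abs_le_iff)
  qed (use d in simp)
qed

context truncated begin

lemma cont3:
  "continuous_on ({0..1} \<times> A) (\<lambda>x. \<Theta> (fst x) (fst (snd x)) (snd (snd x)))"
  "continuous_on ({0..1} \<times> A) (\<lambda>x. \<Theta>u (fst x) (fst (snd x)) (snd (snd x)))"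
  "continuous_on ({0..1} \<times> A) (\<lambda>x. \<Theta>a (fst x) (fst (snd x)) (snd (snd x)))"
  unfolding \<Theta>_def \<Theta>u_def \<Theta>a_def
  by (intro continuous_intros continuous_on_compose2[OF cm] continuous_on_compose2[OF R_cont[of UNIV]]
     continuous_on_compose2[OF R'_cont]; auto)+

text \<open>With \<open>R'\<close> only continuous, a common modulus of continuity on a box stands
  in for Lipschitz bounds on \<Theta> and its partial derivatives.\<close>

lemma uniform_close:
  assumes "0 < \<epsilon>"
  obtains d where "0 < d" "\<And>s u a u' a'. 0 \<le> s \<Longrightarrow> s \<le> 1 \<Longrightarrow> \<bar>u\<bar> \<le> B \<Longrightarrow> \<bar>a\<bar> \<le> B \<Longrightarrow> \<bar>u'\<bar> \<le> B \<Longrightarrow> \<bar>a'\<bar> \<le> B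
     \<Longrightarrow> \<bar>u - u'\<bar> < d \<Longrightarrow> \<bar>a - a'\<bar> < d \<Longrightarrow> \<bar>\<Theta> s u a - \<Theta> s u' a'\<bar> < \<epsilon> \<and>
       \<bar>\<Theta>u s u a - \<Theta>u s u' a'\<bar> < \<epsilon> \<and> \<bar>\<Theta>a s u a - \<Theta>a s u' a'\<bar> < \<epsilon>"
proof -
  obtain d1 where d1: "0 < d1" "\<And>s u a u' a'. 0 \<le> s \<Longrightarrow> s \<le> 1 \<Longrightarrow> \<bar>u\<bar> \<le> B \<Longrightarrow> \<bar>a\<bar> \<le> B \<Longrightarrow> \<bar>u'\<bar> \<le> B \<Longrightarrow> \<bar>a'\<bar> \<le> B
     \<Longrightarrow> \<bar>u - u'\<bar> < d1 \<Longrightarrow> \<bar>a - a'\<bar> < d1 \<Longrightarrow> \<bar>\<Theta> s u a - \<Theta> s u' a'\<bar> < \<epsilon>"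
    by (rule uniform_continuity_triple[where F = \<Theta> and B = B, OF cont3(1) assms], erule that)
  obtain d2 where d2: "0 < d2" "\<And>s u a u' a'. 0 \<le> s \<Longrightarrow> s \<le> 1 \<Longrightarrow> \<bar>u\<bar> \<le> B \<Longrightarrow> \<bar>a\<bar> \<le> B \<Longrightarrow> \<bar>u'\<bar> \<le> B \<Longrightarrow> \<bar>a'\<bar> \<le> B
     \<Longrightarrow> \<bar>u - u'\<bar> < d2 \<Longrightarrow> \<bar>a - a'\<bar> < d2 \<Longrightarrow> \<bar>\<Theta>u s u a - \<Theta>u s u' a'\<bar> < \<epsilon>"
    by (rule uniform_continuity_triple[where F = \<Theta>u and B = B, OF cont3(2) assms], erule that)
  obtain d3 where d3: "0 < d3" "\<And>s u a u' a'. 0 \<le> s \<Longrightarrow> s \<le> 1 \<Longrightarrow> \<bar>u\<bar> \<le> B \<Longrightarrow> \<bar>a\<bar> \<le> B \<Longrightarrow> \<bar>u'\<bar> \<le> B \<Longrightarrow> \<bar>a'\<bar> \<le> B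
     \<Longrightarrow> \<bar>u - u'\<bar> < d3 \<Longrightarrow> \<bar>a - a'\<bar> < d3 \<Longrightarrow> \<bar>\<Theta>a s u a - \<Theta>a s u' a'\<bar> < \<epsilon>"
    by (rule uniform_continuity_triple[where F = \<Theta>a and B = B, OF cont3(3) assms], erule that)
  show thesis
  proof (rule that[of "min d1 (min d2 d3)"])
    show "0 < min d1 (min d2 d3)" using d1(1) d2(1) d3(1) by simp
    fix s u a u' a' :: real
    assume h: "0 \<le> s" "s \<le> 1" "\<bar>u\<bar> \<le> B" "\<bar>a\<bar> \<le> B" "\<bar>u'\<bar> \<le> B" "\<bar>a'\<bar> \<le> B"
      and l: "\<bar>u - u'\<bar> < min d1 (min d2 d3)" "\<bar>a - a'\<bar> < min d1 (min d2 d3)"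
    have "\<bar>u - u'\<bar> < d1" "\<bar>a - a'\<bar> < d1" "\<bar>u - u'\<bar> < d2" "\<bar>a - a'\<bar> < d2" "\<bar>u - u'\<bar> < d3" "\<bar>a - a'\<bar> < d3"
      using l by auto
    then show "\<bar>\<Theta> s u a - \<Theta> s u' a'\<bar> < \<epsilon> \<and> \<bar>\<Theta>u s u a - \<Theta>u s u' a'\<bar> < \<epsilon> \<and> \<bar>\<Theta>a s u a - \<Theta>a s u' a'\<bar> < \<epsilon>"
      by (intro conjI d1(2) d2(2) d3(2) h)
  qed
qed

lemma uniform_bound:
  obtains C where "0 \<le> C" "\<And>s u a. 0 \<le> s \<Longrightarrow> s \<le> 1 \<Longrightarrow> \<bar>u\<bar> \<le> B \<Longrightarrow> \<bar>a\<bar> \<le> B \<Longrightarrow> \<bar>\<Theta>u s u a\<bar> \<le> C"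
    "\<And>s u a. 0 \<le> s \<Longrightarrow> s \<le> 1 \<Longrightarrow> \<bar>u\<bar> \<le> B \<Longrightarrow> \<bar>a\<bar> \<le> B \<Longrightarrow> \<bar>\<Theta>a s u a\<bar> \<le> C"
proof -
  let ?S = "{0..1::real} \<times> {-B..B} \<times> {-B..B}"
  have "compact ?S" by (intro compact_Times compact_Icc)
  then have "bounded ((\<lambda>x. \<Theta>u (fst x) (fst (snd x)) (snd (snd x))) ` ?S)"
     "bounded ((\<lambda>x. \<Theta>a (fst x) (fst (snd x)) (snd (snd x))) ` ?S)"
    by (auto intro!: compact_imp_bounded compact_continuous_image cont3)
  then obtain C1 C2 where
      C: "\<forall>y \<in> (\<lambda>x. \<Theta>u (fst x) (fst (snd x)) (snd (snd x))) ` ?S. norm y \<le> C1"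
      "\<forall>y \<in> (\<lambda>x. \<Theta>a (fst x) (fst (snd x)) (snd (snd x))) ` ?S. norm y \<le> C2"
    unfolding bounded_iff by (elim exE) (rule that)
  have b: "\<bar>\<Theta>u s u a\<bar> \<le> max 0 (max C1 C2)" "\<bar>\<Theta>a s u a\<bar> \<le> max 0 (max C1 C2)"
    if "0 \<le> s" "s \<le> 1" "\<bar>u\<bar> \<le> B" "\<bar>a\<bar> \<le> B" for s u a
  proof -
    have "(s, u, a) \<in> ?S" using that by (auto simp: abs_le_iff)
    then have "\<bar>\<Theta>u s u a\<bar> \<le> C1" "\<bar>\<Theta>a s u a\<bar> \<le> C2"
      using C(1)[rule_format, OF imageI, of "(s, u, a)"] C(2)[rule_format, OF imageI, of "(s, u, a)"] by simp_all
    then show "\<bar>\<Theta>u s u a\<bar> \<le> max 0 (max C1 C2)" "\<bar>\<Theta>a s u a\<bar> \<le> max 0 (max C1 C2)" by linarith+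
  qed
  show thesis by (rule that[of "max 0 (max C1 C2)"], simp, erule (3) b(1), erule (3) b(2))
qed

text \<open>\<open>V1\<close> costs \<epsilon> for the tail and \<epsilon> for its mean,
  \<open>V2\<close> costs \<epsilon> times the bound \<open>E\<close> of \<eta>; hence 2 + E. The
  arguments are arbitrary continuous functions rather than values of \<open>U\<close> and
  \<open>Aw\<close>, because uniform limits of such values are inserted later.\<close>

lemma NN_close:
  assumes u: "continuous_on {0..1} u" "continuous_on {0..1} a" "continuous_on {0..1} u'" "continuous_on {0..1} a'"
    and d: "\<And>s. 0 \<le> s \<Longrightarrow> s \<le> 1 \<Longrightarrow> \<bar>\<Theta>u s (u s) (a s) - \<Theta>u s (u' s) (a' s)\<bar> \<le> \<epsilon>"
     "\<And>s. 0 \<le> s \<Longrightarrow> s \<le> 1 \<Longrightarrow> \<bar>\<Theta>a s (u s) (a s) - \<Theta>a s (u' s) (a' s)\<bar> \<le> \<epsilon>"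
  shows "norm (NN u a - NN u' a') \<le> (2 + E) * \<epsilon>"
proof -
  have e0: "0 \<le> \<epsilon>" using d(1)[of 0] by simp
  let ?h = "\<lambda>s. \<Theta>u s (u s) (a s)" and ?h' = "\<lambda>s. \<Theta>u s (u' s) (a' s)"
  let ?k = "\<lambda>s. \<Theta>a s (u s) (a s)" and ?k' = "\<lambda>s. \<Theta>a s (u' s) (a' s)"
  note c = cont_\<Theta>(2)[OF u(1,2)] cont_\<Theta>(2)[OF u(3,4)] cont_\<Theta>(3)[OF u(1,2)] cont_\<Theta>(3)[OF u(3,4)]
  have 1: "norm (mkc (V1 ?h) - mkc (V1 ?h')) \<le> 2 * \<epsilon>"
  proof (rule norm_cfun_le)
    fix x :: real assume x: "0 \<le> x" "x \<le> 1"
    have t: "\<bar>tail ?h y - tail ?h' y\<bar> \<le> \<epsilon>" if "0 \<le> y" "y \<le> 1" for y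
      using abs_tail_le[OF continuous_on_diff[OF c(1,2)] d(1) that] tail_diff[OF c(1,2), of y] that by simp
    have "\<bar>prim (\<lambda>s. tail ?h s - tail ?h' s) 1\<bar> \<le> \<epsilon>"
      by (rule abs_prim_le) (auto intro!: continuous_intros c t)
    moreover have "prim (\<lambda>s. tail ?h s - tail ?h' s) 1 = prim (tail ?h) 1 - prim (tail ?h') 1"
      using prim_lin[of "tail ?h" "tail ?h'" 1 1] cont_tail[OF c(1)] cont_tail[OF c(2)] by simp
    ultimately show "\<bar>fn (mkc (V1 ?h) - mkc (V1 ?h')) x\<bar> \<le> 2 * \<epsilon>"
      using t[OF x] x by (simp add: cont_V c V1_def[of _ x])
  qed (use e0 in simp)
  have 2: "norm (mkc (V2 ?k) - mkc (V2 ?k')) \<le> E * \<epsilon>"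
  proof (rule norm_cfun_le)
    fix x :: real assume x: "0 \<le> x" "x \<le> 1"
    have "\<bar>tail ?k x - tail ?k' x\<bar> \<le> \<epsilon>"
      using abs_tail_le[OF continuous_on_diff[OF c(3,4)] d(2) x] tail_diff[OF c(3,4), of x] x by simp
    then have "\<bar>\<eta> x * (tail ?k x - tail ?k' x)\<bar> \<le> E * \<epsilon>"
      unfolding abs_mult using E(1) E(2)[OF x] by (intro mult_mono) auto
    then show "\<bar>fn (mkc (V2 ?k) - mkc (V2 ?k')) x\<bar> \<le> E * \<epsilon>"
      using x by (simp add: cont_V c V2_def[of _ x] algebra_simps)
  qed (use e0 E in simp)
  have "norm (NN u a - NN u' a') \<le> norm (mkc (V1 ?h) - mkc (V1 ?h')) + norm (mkc (V2 ?k) - mkc (V2 ?k'))"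
    unfolding NN_def by (simp add: norm_Pair_le)
  then show ?thesis using 1 2 by (simp add: algebra_simps)
qed

text \<open>Both partial derivatives of \<Theta> vanish at u = 0, whatever a is. This gives a
  reference point for bounds on \<open>NN\<close> and shows that a critical point with u = 0 is the
  origin.\<close>

lemma NN_0: "NN (\<lambda>_. 0) a = 0"
proof -
  have "V1 (\<lambda>s. \<Theta>u s 0 (a s)) = (\<lambda>_. 0)" "V2 (\<lambda>s. \<Theta>a s 0 (a s)) = (\<lambda>_. 0)"
    by (simp_all add: fun_eq_iff V1_def V2_def \<Theta>u_def \<Theta>a_def R'0 tail_def prim_def tail_def[abs_def])
  then show ?thesis by (simp add: NN_def zero_cfun_def zero_prod_def)
qed

lemma norm_fst_snd: "norm (fst x) \<le> norm x" "norm (snd x) \<le> norm x" for x :: "cfun \<times> cfun"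
  using norm_fst_le[of "fst x" "snd x"] norm_snd_le[of "snd x" "fst x"] by simp_all

lemma U_Aw_bound:
  "\<exists>B. \<forall>x::cfun \<times> cfun. norm x \<le> K \<longrightarrow> (\<forall>s. 0 \<le> s \<longrightarrow> s \<le> 1 \<longrightarrow> \<bar>U (fst x) s\<bar> \<le> B \<and> \<bar>Aw (snd x) s\<bar> \<le> B)"
proof (intro exI[of _ "2 * K + (\<bar>\<kappa>\<bar> + E * K)"] allI impI)
  fix x :: "cfun \<times> cfun" and s :: real assume x: "norm x \<le> K" and s: "0 \<le> s" "s \<le> 1"
  have K: "0 \<le> K" using x norm_ge_zero order_trans by blast
  have "\<bar>U (fst x) s\<bar> \<le> 2 * K" using U_le[OF s, of "fst x"] norm_fst_snd(1)[of x] x by linarith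
  moreover have "E * norm (snd x) \<le> E * K" using norm_fst_snd(2)[of x] x E by (intro mult_left_mono) auto
  then have "\<bar>Aw (snd x) s\<bar> \<le> \<bar>\<kappa>\<bar> + E * K" using Aw_le[OF s, of "snd x"] by linarith
  moreover have "0 \<le> E * K" using E K by simp
  ultimately show "\<bar>U (fst x) s\<bar> \<le> 2 * K + (\<bar>\<kappa>\<bar> + E * K) \<and> \<bar>Aw (snd x) s\<bar> \<le> 2 * K + (\<bar>\<kappa>\<bar> + E * K)"
    using K by auto
qed

lemma g_bounded: "\<exists>G. \<forall>x. norm x \<le> K \<longrightarrow> norm (g x) \<le> G"
proof -
  obtain B where B: "\<And>x s. norm (x::cfun \<times> cfun) \<le> K \<Longrightarrow> 0 \<le> s \<Longrightarrow> s \<le> 1 \<Longrightarrow> \<bar>U (fst x) s\<bar> \<le> B \<and> \<bar>Aw (snd x) s\<bar> \<le> B"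
    using U_Aw_bound by blast
  obtain C where C: "\<And>s u a. 0 \<le> s \<Longrightarrow> s \<le> 1 \<Longrightarrow> \<bar>u\<bar> \<le> B \<Longrightarrow> \<bar>a\<bar> \<le> B \<Longrightarrow> \<bar>\<Theta>u s u a\<bar> \<le> C \<and> \<bar>\<Theta>a s u a\<bar> \<le> C"
    using uniform_bound[of B] by (metis (no_types, lifting))
  have "norm (g x) \<le> K + (2 + E) * C" if "norm x \<le> K" for x
  proof -
    have "norm (NN (U (fst x)) (Aw (snd x)) - NN (\<lambda>_. 0) (\<lambda>_. 0)) \<le> (2 + E) * C"
      using B[OF that] C by (intro NN_close) (auto intro!: continuous_intros simp: \<Theta>u_def[of _ 0] \<Theta>a_def[of _ 0] R'0)
    then show ?thesis unfolding g_def NN_0 using that norm_triangle_ineq[of x "NN (U (fst x)) (Aw (snd x))"] by simp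
  qed
  then show ?thesis by blast
qed

lemma uniform_continuity:
  assumes "0 < \<epsilon>"
  obtains d where "0 < d" "\<And>x y. norm x \<le> K \<Longrightarrow> norm y \<le> K \<Longrightarrow> norm (x - y) < d \<Longrightarrow>
    norm (NN (U (fst x)) (Aw (snd x)) - NN (U (fst y)) (Aw (snd y))) \<le> \<epsilon>"
    "\<And>x y. norm x \<le> K \<Longrightarrow> norm y \<le> K \<Longrightarrow> norm (x - y) < d \<Longrightarrow>
    \<bar>integral {0..1} (\<lambda>s. \<Theta> s (U (fst x) s) (Aw (snd x) s)) - integral {0..1} (\<lambda>s. \<Theta> s (U (fst y) s) (Aw (snd y) s))\<bar> \<le> \<epsilon>"
proof -
  obtain B where B: "\<And>x s. norm (x::cfun \<times> cfun) \<le> K \<Longrightarrow> 0 \<le> s \<Longrightarrow> s \<le> 1 \<Longrightarrow> \<bar>U (fst x) s\<bar> \<le> B \<and> \<bar>Aw (snd x) s\<bar> \<le> B"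
    using U_Aw_bound by blast
  define \<epsilon>' where "\<epsilon>' = \<epsilon> / (2 + E)"
  have e': "0 < \<epsilon>'" "\<epsilon>' \<le> \<epsilon>" "(2 + E) * \<epsilon>' = \<epsilon>" using assms E(1) by (auto simp: \<epsilon>'_def field_simps)
  obtain d where d: "0 < d" and close: "\<And>s u a u' a'. 0 \<le> s \<Longrightarrow> s \<le> 1 \<Longrightarrow> \<bar>u\<bar> \<le> B \<Longrightarrow> \<bar>a\<bar> \<le> B \<Longrightarrow> \<bar>u'\<bar> \<le> B \<Longrightarrow> \<bar>a'\<bar> \<le> B
     \<Longrightarrow> \<bar>u - u'\<bar> < d \<Longrightarrow> \<bar>a - a'\<bar> < d \<Longrightarrow> \<bar>\<Theta> s u a - \<Theta> s u' a'\<bar> < \<epsilon>' \<and>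
       \<bar>\<Theta>u s u a - \<Theta>u s u' a'\<bar> < \<epsilon>' \<and> \<bar>\<Theta>a s u a - \<Theta>a s u' a'\<bar> < \<epsilon>'"
    by (rule uniform_close[where B = B, OF e'(1)], erule that)
  show thesis
  proof (rule that[of "d / (2 + E)"])
    show "0 < d / (2 + E)" using d E by simp
    fix x y :: "cfun \<times> cfun" assume x: "norm x \<le> K" "norm y \<le> K" and xy: "norm (x - y) < d / (2 + E)"
    have dd: "(2 + E) * norm (x - y) < d" using xy E(1) by (simp add: field_simps)
    have dU: "\<bar>U (fst x) s - U (fst y) s\<bar> < d" if "0 \<le> s" "s \<le> 1" for s
    proof -
      have "\<bar>U (fst x) s - U (fst y) s\<bar> \<le> 2 * norm (x - y)"
        using U_diff_le[OF that, of "fst x" "fst y"] norm_fst_snd(1)[of "x - y"] by simp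
      also have "\<dots> \<le> (2 + E) * norm (x - y)" using E by (intro mult_right_mono) auto
      finally show ?thesis using dd by simp
    qed
    have dA: "\<bar>Aw (snd x) s - Aw (snd y) s\<bar> < d" if "0 \<le> s" "s \<le> 1" for s
    proof -
      have "\<bar>Aw (snd x) s - Aw (snd y) s\<bar> \<le> E * norm (snd x - snd y)" by (rule Aw_diff_le[OF that])
      also have "\<dots> \<le> (2 + E) * norm (x - y)"
        using norm_fst_snd(2)[of "x - y"] E by (intro mult_mono) auto
      finally show ?thesis using dd by simp
    qed
    note cl = close[OF _ _ B[OF x(1), THEN conjunct1] B[OF x(1), THEN conjunct2] B[OF x(2), THEN conjunct1] B[OF x(2), THEN conjunct2] dU dA]
    have "norm (NN (U (fst x)) (Aw (snd x)) - NN (U (fst y)) (Aw (snd y))) \<le> (2 + E) * \<epsilon>'"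
      by (rule NN_close) (auto intro!: continuous_intros less_imp_le simp: cl)
    then show "norm (NN (U (fst x)) (Aw (snd x)) - NN (U (fst y)) (Aw (snd y))) \<le> \<epsilon>" using e' by simp
    have "prim (\<lambda>s. \<Theta> s (U (fst x) s) (Aw (snd x) s) - 1 * \<Theta> s (U (fst y) s) (Aw (snd y) s)) 1
       = prim (\<lambda>s. \<Theta> s (U (fst x) s) (Aw (snd x) s)) 1 - 1 * prim (\<lambda>s. \<Theta> s (U (fst y) s) (Aw (snd y) s)) 1"
      by (rule prim_lin) (auto intro!: cont_\<Theta> continuous_intros)
    moreover have "\<bar>prim (\<lambda>s. \<Theta> s (U (fst x) s) (Aw (snd x) s) - 1 * \<Theta> s (U (fst y) s) (Aw (snd y) s)) 1\<bar> \<le> \<epsilon>"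
      by (rule abs_prim_le) (use cl e' in \<open>auto intro!: cont_\<Theta> continuous_intros less_imp_le intro: less_le_trans\<close>)
    ultimately show "\<bar>integral {0..1} (\<lambda>s. \<Theta> s (U (fst x) s) (Aw (snd x) s)) - integral {0..1} (\<lambda>s. \<Theta> s (U (fst y) s) (Aw (snd y) s))\<bar> \<le> \<epsilon>"
      by (simp add: prim_def)
  qed
qed

lemma cont_g: "continuous_on UNIV g" and cont_J: "continuous_on UNIV J"
proof -
  have loc: "\<exists>d>0. \<forall>y. dist y x < d \<longrightarrow>
    dist (NN (U (fst y)) (Aw (snd y))) (NN (U (fst x)) (Aw (snd x))) < \<epsilon> \<and>
    dist (integral {0..1} (\<lambda>s. \<Theta> s (U (fst y) s) (Aw (snd y) s))) (integral {0..1} (\<lambda>s. \<Theta> s (U (fst x) s) (Aw (snd x) s))) < \<epsilon>"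
    if "0 < \<epsilon>" for \<epsilon> x
  proof -
    have e2: "0 < \<epsilon> / 2" using that by simp
    obtain d where d: "0 < d" "\<And>z y. norm z \<le> norm x + 1 \<Longrightarrow> norm y \<le> norm x + 1 \<Longrightarrow> norm (z - y) < d \<Longrightarrow>
      norm (NN (U (fst z)) (Aw (snd z)) - NN (U (fst y)) (Aw (snd y))) \<le> \<epsilon>/2"
     "\<And>z y. norm z \<le> norm x + 1 \<Longrightarrow> norm y \<le> norm x + 1 \<Longrightarrow> norm (z - y) < d \<Longrightarrow>
      \<bar>integral {0..1} (\<lambda>s. \<Theta> s (U (fst z) s) (Aw (snd z) s)) - integral {0..1} (\<lambda>s. \<Theta> s (U (fst y) s) (Aw (snd y) s))\<bar> \<le> \<epsilon>/2"
      by (rule uniform_continuity[OF e2, of "norm x + 1"], erule that)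
    show ?thesis
    proof (intro exI[of _ "min d 1"] conjI allI impI)
      fix y assume y: "dist y x < min d 1"
      have "norm y \<le> norm x + norm (y - x)" by norm
      then have "norm y \<le> norm x + 1" using y by (simp add: dist_norm)
      note * = d(2)[OF this, of x] d(3)[OF this, of x]
      show "dist (NN (U (fst y)) (Aw (snd y))) (NN (U (fst x)) (Aw (snd x))) < \<epsilon>"
        "dist (integral {0..1} (\<lambda>s. \<Theta> s (U (fst y) s) (Aw (snd y) s))) (integral {0..1} (\<lambda>s. \<Theta> s (U (fst x) s) (Aw (snd x) s))) < \<epsilon>"
        using * y that by (auto simp: dist_norm)
    qed (use d in simp)
  qed
  have "continuous_on UNIV (\<lambda>x. NN (U (fst x)) (Aw (snd x)))"
    unfolding continuous_on_iff using loc by (metis UNIV_I)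
  then show "continuous_on UNIV g" unfolding g_def by (intro continuous_intros)
  have "continuous_on UNIV (\<lambda>x. integral {0..1} (\<lambda>s. \<Theta> s (U (fst x) s) (Aw (snd x) s)))"
    unfolding continuous_on_iff using loc by (metis UNIV_I)
  then show "continuous_on UNIV J" unfolding J_def by (intro continuous_intros) auto
qed

lemma inner_NN:
  assumes "continuous_on {0..1} u" "continuous_on {0..1} a"
  shows "inner (NN u a) d = integral {0..1} (\<lambda>s. \<Theta>u s (u s) (a s) * U (fst d) s + \<Theta>a s (u s) (a s) * (Aw (snd d) s - \<kappa>))"
proof -
  have "inner (NN u a) d = integral {0..1} (\<lambda>s. \<Theta>u s (u s) (a s) * U (fst d) s) + integral {0..1} (\<lambda>s. \<Theta>a s (u s) (a s) * (Aw (snd d) s - \<kappa>))"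
    unfolding NN_def inner_prod_def by (simp add: inner_V1 inner_V2 cont_\<Theta> assms)
  also have "\<dots> = integral {0..1} (\<lambda>s. \<Theta>u s (u s) (a s) * U (fst d) s + \<Theta>a s (u s) (a s) * (Aw (snd d) s - \<kappa>))"
    by (subst integral_add) (auto intro!: int_fn continuous_intros cont_\<Theta> assms)
  finally show ?thesis .
qed

section \<open>First-order expansion and descent along the gradient\<close>

lemma \<Theta>_deriv:
  assumes "(X has_real_derivative X') (at r)" "(Y has_real_derivative Y') (at r)"
  shows "((\<lambda>r. \<Theta> s (X r) (Y r)) has_real_derivative \<Theta>u s (X r) (Y r) * X' + \<Theta>a s (X r) (Y r) * Y') (at r)"
  unfolding \<Theta>_def \<Theta>u_def \<Theta>a_def
  by (auto intro!: derivative_eq_intros assms DERIV_chain'[OF _ R_deriv] simp: field_simps power2_eq_square)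

lemma Aw_zero: "Aw 0 s = \<kappa>" by (simp add: Aw_def prim_def)

text \<open>Mean value theorem along the segment; replacing the partial derivatives at the
  intermediate point by those at the start costs \<epsilon>. For a C^1 potential the remainder is
  only o(\<tau>), but it is uniform on boxes.\<close>

lemma \<Theta>_line:
  assumes e: "0 < \<epsilon>"
  obtains d where "0 < d" "\<And>s u a \<phi> \<psi> \<tau>. 0 \<le> s \<Longrightarrow> s \<le> 1 \<Longrightarrow> \<bar>u\<bar> \<le> B \<Longrightarrow> \<bar>a\<bar> \<le> B \<Longrightarrow> 0 \<le> \<tau> \<Longrightarrow>
     \<tau> * \<bar>\<phi>\<bar> \<le> d \<Longrightarrow> \<tau> * \<bar>\<psi>\<bar> \<le> d \<Longrightarrow>
     \<Theta> s (u - \<tau> * \<phi>) (a - \<tau> * \<psi>) \<le> \<Theta> s u a - \<tau> * (\<Theta>u s u a * \<phi> + \<Theta>a s u a * \<psi>) + \<tau> * (\<epsilon> * (\<bar>\<phi>\<bar> + \<bar>\<psi>\<bar>))"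
proof -
  obtain d where d: "0 < d" and close: "\<And>s u a u' a'. 0 \<le> s \<Longrightarrow> s \<le> 1 \<Longrightarrow> \<bar>u\<bar> \<le> B + 1 \<Longrightarrow> \<bar>a\<bar> \<le> B + 1 \<Longrightarrow> \<bar>u'\<bar> \<le> B + 1 \<Longrightarrow> \<bar>a'\<bar> \<le> B + 1
     \<Longrightarrow> \<bar>u - u'\<bar> < d \<Longrightarrow> \<bar>a - a'\<bar> < d \<Longrightarrow> \<bar>\<Theta> s u a - \<Theta> s u' a'\<bar> < \<epsilon> \<and>
       \<bar>\<Theta>u s u a - \<Theta>u s u' a'\<bar> < \<epsilon> \<and> \<bar>\<Theta>a s u a - \<Theta>a s u' a'\<bar> < \<epsilon>"
    by (rule uniform_close[where B = "B + 1", OF e], erule that)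
  show thesis
  proof (rule that[of "min 1 (d/2)"])
    show "0 < min 1 (d/2)" using d by simp
    fix s u a \<phi> \<psi> \<tau> :: real
    assume s: "0 \<le> s" "s \<le> 1" and b: "\<bar>u\<bar> \<le> B" "\<bar>a\<bar> \<le> B" and \<tau>: "0 \<le> \<tau>" "\<tau> * \<bar>\<phi>\<bar> \<le> min 1 (d/2)" "\<tau> * \<bar>\<psi>\<bar> \<le> min 1 (d/2)"
    show "\<Theta> s (u - \<tau> * \<phi>) (a - \<tau> * \<psi>) \<le> \<Theta> s u a - \<tau> * (\<Theta>u s u a * \<phi> + \<Theta>a s u a * \<psi>) + \<tau> * (\<epsilon> * (\<bar>\<phi>\<bar> + \<bar>\<psi>\<bar>))"
    proof (cases "\<tau> = 0")
      case False
      then have \<tau>0: "0 < \<tau>" using \<tau> by simp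
      define f where "f r = \<Theta> s (u - r * \<phi>) (a - r * \<psi>)" for r
      define f' where "f' r = - (\<Theta>u s (u - r * \<phi>) (a - r * \<psi>) * \<phi> + \<Theta>a s (u - r * \<phi>) (a - r * \<psi>) * \<psi>)" for r
      have "(f has_real_derivative f' r) (at r)" for r
      proof -
        have "((\<lambda>r. \<Theta> s (u - r * \<phi>) (a - r * \<psi>)) has_real_derivative
            \<Theta>u s (u - r * \<phi>) (a - r * \<psi>) * (- \<phi>) + \<Theta>a s (u - r * \<phi>) (a - r * \<psi>) * (- \<psi>)) (at r)"
          by (rule \<Theta>_deriv) (auto intro!: derivative_eq_intros)
        then show ?thesis by (simp add: f_def[abs_def] f'_def)
      qed
      then obtain r where r: "0 < r" "r < \<tau>" and mvt: "f \<tau> - f 0 = (\<tau> - 0) * f' r"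
        using MVT2[of 0 \<tau> f f'] \<tau>0 by auto
      have rl: "\<bar>r * \<phi>\<bar> \<le> min 1 (d/2)" "\<bar>r * \<psi>\<bar> \<le> min 1 (d/2)"
      proof -
        have "\<bar>r * \<phi>\<bar> \<le> \<tau> * \<bar>\<phi>\<bar>" "\<bar>r * \<psi>\<bar> \<le> \<tau> * \<bar>\<psi>\<bar>"
          using r by (simp_all add: abs_mult mult_right_mono)
        then show "\<bar>r * \<phi>\<bar> \<le> min 1 (d/2)" "\<bar>r * \<psi>\<bar> \<le> min 1 (d/2)"
          using \<tau>(2,3) order_trans by blast+
      qed
      have cl: "\<bar>\<Theta>u s (u - r * \<phi>) (a - r * \<psi>) - \<Theta>u s u a\<bar> < \<epsilon>" "\<bar>\<Theta>a s (u - r * \<phi>) (a - r * \<psi>) - \<Theta>a s u a\<bar> < \<epsilon>"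
      proof -
        have l: "\<bar>(u - r * \<phi>) - u\<bar> < d" "\<bar>(a - r * \<psi>) - a\<bar> < d" using rl d by auto
        have "\<bar>u - r * \<phi>\<bar> \<le> B + 1" "\<bar>a - r * \<psi>\<bar> \<le> B + 1" "\<bar>u\<bar> \<le> B + 1" "\<bar>a\<bar> \<le> B + 1" using rl b by linarith+
        from close[OF s this l]
        show "\<bar>\<Theta>u s (u - r * \<phi>) (a - r * \<psi>) - \<Theta>u s u a\<bar> < \<epsilon>" "\<bar>\<Theta>a s (u - r * \<phi>) (a - r * \<psi>) - \<Theta>a s u a\<bar> < \<epsilon>"
          by blast+
      qed
      have "- (\<Theta>u s (u - r * \<phi>) (a - r * \<psi>) * \<phi>) \<le> - (\<Theta>u s u a * \<phi>) + \<epsilon> * \<bar>\<phi>\<bar>"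
      proof -
        have "\<bar>(\<Theta>u s (u - r * \<phi>) (a - r * \<psi>) - \<Theta>u s u a) * \<phi>\<bar> \<le> \<epsilon> * \<bar>\<phi>\<bar>"
          unfolding abs_mult using cl by (intro mult_right_mono) auto
        then show ?thesis unfolding left_diff_distrib by linarith
      qed
      moreover have "- (\<Theta>a s (u - r * \<phi>) (a - r * \<psi>) * \<psi>) \<le> - (\<Theta>a s u a * \<psi>) + \<epsilon> * \<bar>\<psi>\<bar>"
      proof -
        have "\<bar>(\<Theta>a s (u - r * \<phi>) (a - r * \<psi>) - \<Theta>a s u a) * \<psi>\<bar> \<le> \<epsilon> * \<bar>\<psi>\<bar>"
          unfolding abs_mult using cl by (intro mult_right_mono) auto
        then show ?thesis unfolding left_diff_distrib by linarith
      qed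
      ultimately have "f' r \<le> - (\<Theta>u s u a * \<phi> + \<Theta>a s u a * \<psi>) + \<epsilon> * (\<bar>\<phi>\<bar> + \<bar>\<psi>\<bar>)"
        unfolding f'_def distrib_left by linarith
      then have "\<tau> * f' r \<le> \<tau> * (- (\<Theta>u s u a * \<phi> + \<Theta>a s u a * \<psi>) + \<epsilon> * (\<bar>\<phi>\<bar> + \<bar>\<psi>\<bar>))"
        using \<tau> by (intro mult_left_mono)
      also have "\<dots> = - (\<tau> * (\<Theta>u s u a * \<phi> + \<Theta>a s u a * \<psi>)) + \<tau> * (\<epsilon> * (\<bar>\<phi>\<bar> + \<bar>\<psi>\<bar>))"
        by (simp only: distrib_left mult_minus_right)
      finally show ?thesis using mvt unfolding f_def by simp
    qed simp
  qed
qed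

text \<open>To first order a step gains \<tau> |g|^2. A quarter of this is lost to the quadratic
  term of the norm, because \<tau> \<le> 1/2, and another quarter to the remainder of the potential,
  because \<delta> \<le> |g|. One half remains.\<close>

lemma J_descent:
  assumes \<delta>: "0 < \<delta>"
  shows "\<exists>\<tau>0>0. \<forall>x. norm x \<le> K \<longrightarrow> \<delta> \<le> norm (g x) \<longrightarrow>
       (\<forall>\<tau>. 0 \<le> \<tau> \<and> \<tau> \<le> \<tau>0 \<longrightarrow> J (x - \<tau> *\<^sub>R g x) \<le> J x - \<tau> / 2 * (norm (g x))\<^sup>2)"
proof -
  obtain B where B: "\<And>x s. norm (x::cfun \<times> cfun) \<le> K \<Longrightarrow> 0 \<le> s \<Longrightarrow> s \<le> 1 \<Longrightarrow> \<bar>U (fst x) s\<bar> \<le> B \<and> \<bar>Aw (snd x) s\<bar> \<le> B"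
    using U_Aw_bound by blast
  obtain G where G: "\<And>x. norm x \<le> K \<Longrightarrow> norm (g x) \<le> G" using g_bounded by blast
  \<comment> \<open>The displacements of u and a together are at most (2 + E) |g|, so the remainder
    becomes \<delta> / 4 times |g|.\<close>
  define \<epsilon> where "\<epsilon> = \<delta> / (4 * (2 + E))"
  have e: "0 < \<epsilon>" "\<epsilon> * (2 + E) = \<delta> / 4" using \<delta> E(1) by (auto simp: \<epsilon>_def field_simps)
  obtain d where d: "0 < d" and line: "\<And>s u a \<phi> \<psi> \<tau>. 0 \<le> s \<Longrightarrow> s \<le> 1 \<Longrightarrow> \<bar>u\<bar> \<le> B \<Longrightarrow> \<bar>a\<bar> \<le> B \<Longrightarrow> 0 \<le> \<tau> \<Longrightarrow>
     \<tau> * \<bar>\<phi>\<bar> \<le> d \<Longrightarrow> \<tau> * \<bar>\<psi>\<bar> \<le> d \<Longrightarrow>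
     \<Theta> s (u - \<tau> * \<phi>) (a - \<tau> * \<psi>) \<le> \<Theta> s u a - \<tau> * (\<Theta>u s u a * \<phi> + \<Theta>a s u a * \<psi>) + \<tau> * (\<epsilon> * (\<bar>\<phi>\<bar> + \<bar>\<psi>\<bar>))"
    by (rule \<Theta>_line[OF e(1), of B], erule that)
  \<comment> \<open>The second bound keeps the displacement within the range \<open>d\<close> of the
    expansion.\<close>
  define \<tau>0 where "\<tau>0 = min (1/2) (d / ((2 + E) * (\<bar>G\<bar> + 1)))"
  have "0 < \<tau>0" using d E(1) unfolding \<tau>0_def by (auto intro!: divide_pos_pos mult_pos_pos)
  moreover have "J (x - \<tau> *\<^sub>R g x) \<le> J x - \<tau> / 2 * (norm (g x))\<^sup>2"
    if x: "norm x \<le> K" and gx: "\<delta> \<le> norm (g x)" and \<tau>: "0 \<le> \<tau>" "\<tau> \<le> \<tau>0" for x \<tau>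
  proof -
    let ?u = "U (fst x)" and ?a = "Aw (snd x)" and ?d = "g x"
    let ?\<phi> = "U (fst ?d)" and ?\<psi> = "\<lambda>s. Aw (snd ?d) s - \<kappa>"
    let ?D = "norm ?d"
    have \<phi>: "\<bar>?\<phi> s\<bar> \<le> 2 * ?D" "\<bar>?\<psi> s\<bar> \<le> E * ?D" if "0 \<le> s" "s \<le> 1" for s
      using U_le[OF that, of "fst ?d"] Aw_le[OF that, of "snd ?d"] norm_fst_snd[of ?d] E(1)
        mult_left_mono[of "norm (snd ?d)" ?D E] by (linarith, linarith)
    have \<tau>d: "\<tau> * ((2 + E) * ?D) \<le> d"
    proof -
      have "\<tau> * ((2 + E) * ?D) \<le> d / ((2 + E) * (\<bar>G\<bar> + 1)) * ((2 + E) * (\<bar>G\<bar> + 1))"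
        using \<tau> G[OF x] E(1) d unfolding \<tau>0_def by (intro mult_mono) (auto intro!: divide_nonneg_nonneg mult_nonneg_nonneg)
      also have "\<dots> = d" using E(1) by simp
      finally show ?thesis .
    qed
    have le: "\<tau> * \<bar>?\<phi> s\<bar> \<le> d" "\<tau> * \<bar>?\<psi> s\<bar> \<le> d" "\<bar>?\<phi> s\<bar> + \<bar>?\<psi> s\<bar> \<le> (2 + E) * ?D" if "0 \<le> s" "s \<le> 1" for s
    proof -
      have 1: "\<bar>?\<phi> s\<bar> \<le> (2 + E) * ?D" "\<bar>?\<psi> s\<bar> \<le> (2 + E) * ?D"
        using \<phi>[OF that] E(1) mult_nonneg_nonneg[OF E(1) norm_ge_zero[of ?d]] norm_ge_zero[of ?d]
        unfolding distrib_right by linarith+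
      show "\<tau> * \<bar>?\<phi> s\<bar> \<le> d" "\<tau> * \<bar>?\<psi> s\<bar> \<le> d"
        using mult_left_mono[OF 1(1) \<tau>(1)] mult_left_mono[OF 1(2) \<tau>(1)] \<tau>d by linarith+
      show "\<bar>?\<phi> s\<bar> + \<bar>?\<psi> s\<bar> \<le> (2 + E) * ?D" using \<phi>[OF that] unfolding distrib_right by linarith
    qed
    have lin: "U (fst (x - \<tau> *\<^sub>R ?d)) s = ?u s - \<tau> * ?\<phi> s" "Aw (snd (x - \<tau> *\<^sub>R ?d)) s = ?a s - \<tau> * ?\<psi> s"
      if "s \<in> {0..1}" for s
      using U_lin[OF that, of "fst x" \<tau> "fst ?d"] Aw_lin[OF that, of "snd x" \<tau> "snd ?d"] by simp_all
    have pt: "\<Theta> s (?u s - \<tau> * ?\<phi> s) (?a s - \<tau> * ?\<psi> s) \<le> \<Theta> s (?u s) (?a s)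
       - \<tau> * (\<Theta>u s (?u s) (?a s) * ?\<phi> s + \<Theta>a s (?u s) (?a s) * ?\<psi> s) + \<tau> * (\<delta> / 4 * ?D)"
      if s: "0 \<le> s" "s \<le> 1" for s
    proof -
      have "\<epsilon> * (\<bar>?\<phi> s\<bar> + \<bar>?\<psi> s\<bar>) \<le> \<epsilon> * ((2 + E) * ?D)" using le(3)[OF s] e by (intro mult_left_mono) auto
      also have "\<dots> = \<delta> / 4 * ?D" using e by (simp only: mult.assoc[symmetric])
      finally have "\<tau> * (\<epsilon> * (\<bar>?\<phi> s\<bar> + \<bar>?\<psi> s\<bar>)) \<le> \<tau> * (\<delta> / 4 * ?D)" using \<tau> by (intro mult_left_mono)
      then show ?thesis
        using line[OF s B[OF x s, THEN conjunct1] B[OF x s, THEN conjunct2] \<tau>(1) le(1)[OF s] le(2)[OF s]] by linarith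
    qed
    let ?I = "\<lambda>s. \<Theta>u s (?u s) (?a s) * ?\<phi> s + \<Theta>a s (?u s) (?a s) * ?\<psi> s"
    have c0: "continuous_on {0..1} (\<lambda>s. \<Theta> s (?u s) (?a s))" "continuous_on {0..1} ?I"
      by (intro continuous_intros cont_\<Theta>)+
    have "integral {0..1} (\<lambda>s. \<Theta> s (U (fst (x - \<tau> *\<^sub>R ?d)) s) (Aw (snd (x - \<tau> *\<^sub>R ?d)) s))
       \<le> integral {0..1} (\<lambda>s. (\<Theta> s (?u s) (?a s) - \<tau> * ?I s) + \<tau> * (\<delta> / 4 * ?D))"
    proof (rule integral_le)
      show "(\<lambda>s. \<Theta> s (U (fst (x - \<tau> *\<^sub>R ?d)) s) (Aw (snd (x - \<tau> *\<^sub>R ?d)) s)) integrable_on {0..1}"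
        by (intro int_fn cont_\<Theta> continuous_intros)
      show "(\<lambda>s. (\<Theta> s (?u s) (?a s) - \<tau> * ?I s) + \<tau> * (\<delta> / 4 * ?D)) integrable_on {0..1}"
        by (intro int_fn continuous_intros c0)
      fix s :: real assume "s \<in> {0..1}"
      then show "\<Theta> s (U (fst (x - \<tau> *\<^sub>R ?d)) s) (Aw (snd (x - \<tau> *\<^sub>R ?d)) s) \<le> (\<Theta> s (?u s) (?a s) - \<tau> * ?I s) + \<tau> * (\<delta> / 4 * ?D)"
        unfolding lin[OF \<open>s \<in> {0..1}\<close>] using pt[of s] by simp
    qed
    also have "\<dots> = integral {0..1} (\<lambda>s. \<Theta> s (?u s) (?a s)) - \<tau> * integral {0..1} ?I + \<tau> * (\<delta> / 4 * ?D)"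
    proof -
      have "integral {0..1} (\<lambda>s. (\<Theta> s (?u s) (?a s) - \<tau> * ?I s) + \<tau> * (\<delta> / 4 * ?D))
        = integral {0..1} (\<lambda>s. \<Theta> s (?u s) (?a s) - \<tau> * ?I s) + integral {0..1} (\<lambda>s::real. \<tau> * (\<delta> / 4 * ?D))"
        by (intro integral_add int_fn continuous_intros c0)
      also have "integral {0..1} (\<lambda>s. \<Theta> s (?u s) (?a s) - \<tau> * ?I s) = integral {0..1} (\<lambda>s. \<Theta> s (?u s) (?a s)) - integral {0..1} (\<lambda>s. \<tau> * ?I s)"
        by (intro integral_diff int_fn continuous_intros c0)
      finally show ?thesis by simp
    qed
    also have "integral {0..1} ?I = inner (?d - x) ?d"
      using inner_NN[of ?u ?a ?d] by (simp add: g_def cont_U cont_Aw)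
    finally have N: "integral {0..1} (\<lambda>s. \<Theta> s (U (fst (x - \<tau> *\<^sub>R ?d)) s) (Aw (snd (x - \<tau> *\<^sub>R ?d)) s))
      \<le> integral {0..1} (\<lambda>s. \<Theta> s (?u s) (?a s)) - \<tau> * (?D\<^sup>2 - inner x ?d) + \<tau> * (\<delta> / 4 * ?D)"
      by (simp only: inner_diff_left power2_norm_eq_inner)
    have sq: "(norm (x - \<tau> *\<^sub>R ?d))\<^sup>2 = (norm x)\<^sup>2 - 2 * \<tau> * inner x ?d + \<tau> * \<tau> * ?D\<^sup>2"
    proof -
      have "inner (x - \<tau> *\<^sub>R ?d) (x - \<tau> *\<^sub>R ?d) = inner x x - 2 * \<tau> * inner x ?d + \<tau> * \<tau> * inner ?d ?d"
        by (simp add: inner_diff_left inner_diff_right inner_commute[of "g x" x] algebra_simps)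
      then show ?thesis by (simp only: power2_norm_eq_inner)
    qed
    have D: "\<delta> / 4 * ?D \<le> ?D\<^sup>2 / 4" using gx \<delta> by (simp add: power2_eq_square mult_right_mono)
    define P S Q Z where "P = \<tau> * ?D\<^sup>2" and "S = \<tau> * inner x ?d" and "Q = \<tau> * \<tau> * ?D\<^sup>2" and "Z = \<tau> * (\<delta> / 4 * ?D)"
    have "\<tau> * \<tau> * ?D\<^sup>2 \<le> \<tau> * (1/2) * ?D\<^sup>2" using \<tau> unfolding \<tau>0_def by (intro mult_right_mono mult_left_mono) auto
    then have 1: "Q \<le> P / 2" by (simp add: P_def Q_def)
    have "\<tau> * (\<delta> / 4 * ?D) \<le> \<tau> * (?D\<^sup>2 / 4)" using D \<tau> by (intro mult_left_mono) auto
    then have 2: "Z \<le> P / 4" by (simp add: P_def Z_def)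
    have 3: "(norm (x - \<tau> *\<^sub>R ?d))\<^sup>2 = (norm x)\<^sup>2 - 2 * S + Q" unfolding sq by (simp add: S_def Q_def)
    have 4: "integral {0..1} (\<lambda>s. \<Theta> s (U (fst (x - \<tau> *\<^sub>R ?d)) s) (Aw (snd (x - \<tau> *\<^sub>R ?d)) s))
      \<le> integral {0..1} (\<lambda>s. \<Theta> s (?u s) (?a s)) - (P - S) + Z"
      using N by (simp add: P_def S_def Z_def right_diff_distrib)
    have 5: "\<tau> / 2 * ?D\<^sup>2 = P / 2" by (simp add: P_def)
    show ?thesis unfolding J_def 3 5 using 1 2 4 by (simp add: field_simps)
  qed
  ultimately show ?thesis by blast
qed

section \<open>Energy bounds and compactness of almost critical sequences\<close>

lemma theta_pos: "0 < 1/2 - 1/p" using p by (simp add: field_simps)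

text \<open>The functional minus 1/p times its derivative in the direction (fst x, 0). All terms
  quadratic in u, including a^2 u^2, acquire the factor 1/2 - 1/p, the norm of the second component
  keeps 1/2, and the terms with \<open>R\<close> have a sign by the superlinearity
  condition.\<close>

lemma AR_integral:
  "(1/2 - 1/p) * ((norm (fst x))\<^sup>2 + integral {0..1} (\<lambda>s. q * (Aw (snd x) s)\<^sup>2 * (U (fst x) s)\<^sup>2 + m s * (U (fst x) s)\<^sup>2))
     + (norm (snd x))\<^sup>2 / 2 \<le> J x - inner (fst (g x)) (fst x) / p"
proof -
  let ?u = "U (fst x)" and ?a = "Aw (snd x)"
  let ?Q = "\<lambda>s. q * (?a s)\<^sup>2 * (?u s)\<^sup>2 + m s * (?u s)\<^sup>2"
  have "inner (NN ?u ?a) (fst x, 0) = integral {0..1} (\<lambda>s. \<Theta>u s (?u s) (?a s) * ?u s)"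
    using inner_NN[OF cont_U cont_Aw, of "fst x" "snd x" "(fst x, 0)"] by (simp add: Aw_zero)
  then have 1: "inner (fst (g x)) (fst x) = (norm (fst x))\<^sup>2 + integral {0..1} (\<lambda>s. \<Theta>u s (?u s) (?a s) * ?u s)"
    by (simp add: g_def inner_add_left inner_prod_def power2_norm_eq_inner)
  have nx: "(norm x)\<^sup>2 = (norm (fst x))\<^sup>2 + (norm (snd x))\<^sup>2"
    by (simp add: norm_prod_def)
  have cQ: "continuous_on {0..1} ?Q" by (intro continuous_intros cm)
  have "integral {0..1} (\<lambda>s. (1/2 - 1/p) * ?Q s) \<le> integral {0..1} (\<lambda>s. \<Theta> s (?u s) (?a s) - \<Theta>u s (?u s) (?a s) * ?u s / p)"
  proof (rule integral_le)
    fix s :: real assume s: "s \<in> {0..1}"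
    have "R (?u s) \<le> ?u s * R' (?u s) / p" using AR[of "?u s"] p by (simp add: field_simps)
    then have "m s * R (?u s) \<le> m s * (?u s * R' (?u s) / p)" using m[of s] s by (intro mult_left_mono) auto
    moreover have "\<Theta> s (?u s) (?a s) - \<Theta>u s (?u s) (?a s) * ?u s / p
      = (1/2 - 1/p) * ?Q s + (m s * (?u s * R' (?u s) / p) - m s * R (?u s))"
      unfolding \<Theta>_def \<Theta>u_def using p by (simp add: field_simps power2_eq_square)
    ultimately show "(1/2 - 1/p) * ?Q s \<le> \<Theta> s (?u s) (?a s) - \<Theta>u s (?u s) (?a s) * ?u s / p" by linarith
  qed (use p in \<open>auto intro!: int_fn continuous_intros cQ cont_\<Theta>\<close>)
  also have "\<dots> = integral {0..1} (\<lambda>s. \<Theta> s (?u s) (?a s)) - integral {0..1} (\<lambda>s. \<Theta>u s (?u s) (?a s) * ?u s / p)"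
    using p by (intro integral_diff int_fn continuous_intros cont_\<Theta>) auto
  finally have 2: "(1/2 - 1/p) * integral {0..1} ?Q \<le> integral {0..1} (\<lambda>s. \<Theta> s (?u s) (?a s)) - integral {0..1} (\<lambda>s. \<Theta>u s (?u s) (?a s) * ?u s) / p"
    by simp
  show ?thesis unfolding J_def 1 nx
    using 2 by (simp add: algebra_simps add_divide_distrib)
qed

text \<open>A gradient of norm at most 1 costs only a term linear in the norm of x, against the
  quadratic lower bound with factor 1/2 - 1/p.\<close>

lemma coercive: "\<exists>M. \<forall>x. J x \<le> \<beta> \<longrightarrow> norm (g x) \<le> 1 \<longrightarrow> norm x \<le> M"
proof (intro exI allI impI)
  fix x assume J: "J x \<le> \<beta>" and gx: "norm (g x) \<le> 1"
  let ?t = "1/2 - 1/p"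
  let ?Q = "\<lambda>s. q * (Aw (snd x) s)\<^sup>2 * (U (fst x) s)\<^sup>2 + m s * (U (fst x) s)\<^sup>2"
  have t: "0 < ?t" "?t \<le> 1/2" using theta_pos p by auto
  have "\<bar>inner (fst (g x)) (fst x)\<bar> \<le> norm (fst (g x)) * norm (fst x)" by (rule Cauchy_Schwarz_ineq2)
  also have "\<dots> \<le> 1 * norm x" using norm_fst_snd[of x] norm_fst_snd[of "g x"] gx by (intro mult_mono) auto
  finally have "\<bar>inner (fst (g x)) (fst x)\<bar> \<le> norm x" by simp
  then have "\<bar>inner (fst (g x)) (fst x) / p\<bar> \<le> norm x / p" using p by (simp add: divide_right_mono)
  also have "\<dots> \<le> norm x"
    using p mult_right_mono[of 1 p "norm x"] by (simp add: divide_le_eq mult.commute)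
  finally have i: "- (inner (fst (g x)) (fst x) / p) \<le> norm x" by linarith
  have "0 \<le> integral {0..1} ?Q"
  proof (rule integral_nonneg)
    show "?Q integrable_on {0..1}" by (intro int_fn continuous_intros cm)
    fix s :: real assume "s \<in> {0..1}"
    then have "0 \<le> m s" using m[of s] by simp
    then show "0 \<le> ?Q s" using q by simp
  qed
  then have "?t * (norm (fst x))\<^sup>2 \<le> ?t * ((norm (fst x))\<^sup>2 + integral {0..1} ?Q)" using t by (intro mult_left_mono) auto
  moreover have "?t * (norm (snd x))\<^sup>2 \<le> 1/2 * (norm (snd x))\<^sup>2" using t by (intro mult_right_mono) auto
  ultimately have "?t * ((norm (fst x))\<^sup>2 + (norm (snd x))\<^sup>2) \<le> \<beta> + norm x"
    using AR_integral[of x] J i unfolding distrib_left by linarith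
  then have *: "?t * (norm x)\<^sup>2 \<le> \<bar>\<beta>\<bar> + norm x" by (simp add: norm_prod_def)
  show "norm x \<le> max 1 ((\<bar>\<beta>\<bar> + 1) / ?t)"
  proof (cases "norm x \<le> 1")
    case False
    then have "\<bar>\<beta>\<bar> * 1 \<le> \<bar>\<beta>\<bar> * norm x" by (intro mult_left_mono) auto
    then have "?t * norm x * norm x \<le> (\<bar>\<beta>\<bar> + 1) * norm x"
      using * unfolding power2_eq_square distrib_right mult.assoc by linarith
    then have "?t * norm x \<le> \<bar>\<beta>\<bar> + 1" using False by (intro mult_right_le_imp_le[of "?t * norm x" "norm x"]) auto
    then have "norm x \<le> (\<bar>\<beta>\<bar> + 1) / ?t" using t by (subst pos_le_divide_eq) (auto simp: mult.commute)
    then show ?thesis by simp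
  qed simp
qed

text \<open>The pairs (U, Aw) are equi-Hoelder, so Arzela--Ascoli gives uniform limits u and a along
  a subsequence. They need not be known to have the form U v and Aw w: from x = g x - NN the
  sequence itself converges to -NN u a, which is an element of the incomplete space.\<close>

lemma critical_limit:
  assumes K: "\<And>n. norm (X n) \<le> K" and gX: "(\<lambda>n. g (X n)) \<longlonglongrightarrow> 0"
  obtains x k where "strict_mono (k :: nat \<Rightarrow> nat)" "(\<lambda>n. X (k n)) \<longlonglongrightarrow> x" "g x = 0"
proof -
  define f where "f n s = (U (fst (X n)) s, Aw (snd (X n)) s)" for n s
  obtain B where B: "\<And>x s. norm (x::cfun \<times> cfun) \<le> K \<Longrightarrow> 0 \<le> s \<Longrightarrow> s \<le> 1 \<Longrightarrow> \<bar>U (fst x) s\<bar> \<le> B \<and> \<bar>Aw (snd x) s\<bar> \<le> B"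
    using U_Aw_bound by blast
  have K0: "0 \<le> K" using K[of 0] norm_ge_zero order_trans by blast
  have hol: "norm (f n x - f n y) \<le> (2 + E) * K * sqrt \<bar>x - y\<bar>" if "x \<in> {0..1}" "y \<in> {0..1}" for n x y
  proof -
    have nf: "norm (fst (X n)) \<le> K" "norm (snd (X n)) \<le> K" using norm_fst_snd[of "X n"] K[of n] by auto
    have "norm (f n x - f n y) \<le> \<bar>U (fst (X n)) x - U (fst (X n)) y\<bar> + \<bar>Aw (snd (X n)) x - Aw (snd (X n)) y\<bar>"
      unfolding f_def using norm_Pair_le[of "U (fst (X n)) x - U (fst (X n)) y" "Aw (snd (X n)) x - Aw (snd (X n)) y"] by simp
    also have "\<dots> \<le> 2 * sqrt \<bar>x - y\<bar> * norm (fst (X n)) + E * sqrt \<bar>x - y\<bar> * norm (snd (X n))"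
      using U_holder[of y x "fst (X n)"] Aw_holder[of y x "snd (X n)"] that by (intro add_mono) auto
    also have "\<dots> \<le> 2 * sqrt \<bar>x - y\<bar> * K + E * sqrt \<bar>x - y\<bar> * K"
      using nf E(1) by (intro add_mono mult_left_mono) auto
    finally show ?thesis by (simp add: algebra_simps)
  qed
  define C where "C = (2 + E) * K + 1"
  have C: "0 < C" "(2 + E) * K \<le> C" using E(1) K0 by (auto simp: C_def add_nonneg_pos)
  obtain h k where h: "continuous_on {0..1} h" and k: "strict_mono (k :: nat \<Rightarrow> nat)"
    and conv: "\<And>e. 0 < e \<Longrightarrow> \<exists>N. \<forall>n x. n \<ge> N \<and> x \<in> {0..1} \<longrightarrow> norm (f (k n) x - h x) < e"
  proof (rule Arzela_Ascoli[of "{0..1::real}" f "2 * B"])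
    fix n and x :: real assume x: "x \<in> {0..1}"
    have "norm (f n x) \<le> \<bar>U (fst (X n)) x\<bar> + \<bar>Aw (snd (X n)) x\<bar>" 
      unfolding f_def using norm_Pair_le[of "U (fst (X n)) x" "Aw (snd (X n)) x"] by simp
    then show "norm (f n x) \<le> 2 * B" using B[OF K[of n], of x] x by auto
  next
    fix x e :: real assume x: "x \<in> {0..1}" and e: "0 < e"
    show "\<exists>d>0. \<forall>n y. y \<in> {0..1} \<and> norm (x - y) < d \<longrightarrow> norm (f n x - f n y) < e"
    proof (intro exI[of _ "(e / C)\<^sup>2"] conjI allI impI)
      fix n y assume y: "y \<in> {0..1} \<and> norm (x - y) < (e / C)\<^sup>2"
      then have "sqrt \<bar>x - y\<bar> < e / C" using e C by (intro real_less_lsqrt) auto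
      then have "C * sqrt \<bar>x - y\<bar> < e" using C by (simp add: field_simps)
      moreover have "(2 + E) * K * sqrt \<bar>x - y\<bar> \<le> C * sqrt \<bar>x - y\<bar>" using C by (intro mult_right_mono) auto
      ultimately show "norm (f n x - f n y) < e" using hol[OF x, of y n] y by linarith
    qed (use e C in simp)
  qed auto
  define u a where "u s = fst (h s)" and "a s = snd (h s)" for s
  have cu: "continuous_on {0..1} u" "continuous_on {0..1} a" unfolding u_def a_def by (intro continuous_intros h)+
  have lims: "\<exists>N. \<forall>n s. n \<ge> N \<and> s \<in> {0..1} \<longrightarrow> \<bar>U (fst (X (k n))) s - u s\<bar> < e \<and> \<bar>Aw (snd (X (k n))) s - a s\<bar> < e" if e0: "0 < e" for e
  proof -
    obtain N where N: "\<And>n x. n \<ge> N \<Longrightarrow> x \<in> {0..1} \<Longrightarrow> norm (f (k n) x - h x) < e" using conv[OF e0] by blast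
    have "\<bar>U (fst (X (k n))) s - u s\<bar> < e \<and> \<bar>Aw (snd (X (k n))) s - a s\<bar> < e" if "n \<ge> N" "s \<in> {0..1}" for n s
    proof -
      have "f (k n) s - h s = (U (fst (X (k n))) s - u s, Aw (snd (X (k n))) s - a s)"
        by (simp add: f_def u_def a_def prod_eq_iff)
      then have "norm (U (fst (X (k n))) s - u s, Aw (snd (X (k n))) s - a s) < e" using N[OF that] by simp
      then show ?thesis
        using norm_fst_le[of "U (fst (X (k n))) s - u s" "Aw (snd (X (k n))) s - a s"]
          norm_snd_le[of "Aw (snd (X (k n))) s - a s" "U (fst (X (k n))) s - u s"] by simp
    qed
    then show ?thesis by blast
  qed
  have NNlim: "(\<lambda>n. NN (U (fst (X (k n)))) (Aw (snd (X (k n))))) \<longlonglongrightarrow> NN u a"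
  proof (rule LIMSEQ_I)
    fix r :: real assume r: "0 < r"
    define \<epsilon> where "\<epsilon> = r / (2 * (2 + E))"
    have "0 < \<epsilon>" using r E(1) by (simp add: \<epsilon>_def)
    moreover have "2 + E \<noteq> 0" using E(1) by linarith
    then have "(2 + E) * \<epsilon> = r / 2" unfolding \<epsilon>_def by (simp add: divide_simps)
    ultimately have e: "0 < \<epsilon>" "(2 + E) * \<epsilon> < r" using r by auto
    obtain d where d: "0 < d" and close: "\<And>s u a u' a'. 0 \<le> s \<Longrightarrow> s \<le> 1 \<Longrightarrow> \<bar>u\<bar> \<le> B + 1 \<Longrightarrow> \<bar>a\<bar> \<le> B + 1 \<Longrightarrow> \<bar>u'\<bar> \<le> B + 1 \<Longrightarrow> \<bar>a'\<bar> \<le> B + 1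
     \<Longrightarrow> \<bar>u - u'\<bar> < d \<Longrightarrow> \<bar>a - a'\<bar> < d \<Longrightarrow> \<bar>\<Theta> s u a - \<Theta> s u' a'\<bar> < \<epsilon> \<and>
       \<bar>\<Theta>u s u a - \<Theta>u s u' a'\<bar> < \<epsilon> \<and> \<bar>\<Theta>a s u a - \<Theta>a s u' a'\<bar> < \<epsilon>"
      by (rule uniform_close[where B = "B + 1", OF e(1)], erule that)
    have "0 < min d 1" using d by simp
    then obtain N where N: "\<And>n s. n \<ge> N \<Longrightarrow> s \<in> {0..1} \<Longrightarrow> \<bar>U (fst (X (k n))) s - u s\<bar> < min d 1 \<and> \<bar>Aw (snd (X (k n))) s - a s\<bar> < min d 1"
      using lims by meson
    have "norm (NN (U (fst (X (k n)))) (Aw (snd (X (k n)))) - NN u a) \<le> (2 + E) * \<epsilon>" if n: "n \<ge> N" for n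
    proof (rule NN_close)
      fix s :: real assume s: "0 \<le> s" "s \<le> 1"
      have b: "\<bar>U (fst (X (k n))) s\<bar> \<le> B" "\<bar>Aw (snd (X (k n))) s\<bar> \<le> B" using B[OF K s] by auto
      have c: "\<bar>U (fst (X (k n))) s - u s\<bar> < min d 1" "\<bar>Aw (snd (X (k n))) s - a s\<bar> < min d 1" using N[OF n, of s] s by auto
      have "\<bar>u s\<bar> \<le> B + 1" "\<bar>a s\<bar> \<le> B + 1" using b c by linarith+
      then have "\<bar>\<Theta>u s (U (fst (X (k n))) s) (Aw (snd (X (k n))) s) - \<Theta>u s (u s) (a s)\<bar> < \<epsilon> \<and> \<bar>\<Theta>a s (U (fst (X (k n))) s) (Aw (snd (X (k n))) s) - \<Theta>a s (u s) (a s)\<bar> < \<epsilon>"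
        using close[OF s, of "U (fst (X (k n))) s" "Aw (snd (X (k n))) s" "u s" "a s"] b c by simp
      then show "\<bar>\<Theta>u s (U (fst (X (k n))) s) (Aw (snd (X (k n))) s) - \<Theta>u s (u s) (a s)\<bar> \<le> \<epsilon>"
        "\<bar>\<Theta>a s (U (fst (X (k n))) s) (Aw (snd (X (k n))) s) - \<Theta>a s (u s) (a s)\<bar> \<le> \<epsilon>" by auto
    qed (intro cont_U cont_Aw cu)+
    then show "\<exists>no. \<forall>n\<ge>no. norm (NN (U (fst (X (k n)))) (Aw (snd (X (k n)))) - NN u a) < r"
      using e by (meson le_less_trans)
  qed
  have "(\<lambda>n. g (X (k n))) \<longlonglongrightarrow> 0" using LIMSEQ_subseq_LIMSEQ[OF gX k] by (simp add: comp_def)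
  from tendsto_diff[OF this NNlim] have Xl: "(\<lambda>n. X (k n)) \<longlonglongrightarrow> - NN u a"
    by (simp add: g_def)
  have "isCont g (- NN u a)" using cont_g continuous_on_eq_continuous_at open_UNIV by blast
  then have "(\<lambda>n. g (X (k n))) \<longlonglongrightarrow> g (- NN u a)" using Xl by (rule isCont_tendsto_compose)
  then have "g (- NN u a) = 0" using \<open>(\<lambda>n. g (X (k n))) \<longlonglongrightarrow> 0\<close> LIMSEQ_unique by blast
  then show thesis using that[OF k Xl] by blast
qed

section \<open>The ridge around u = 0 and the critical point\<close>

lemma J_zero: "J 0 = 0"
proof -
  have "fn 0 = (\<lambda>_. 0)" by auto
  then have "U 0 s = 0" for s by (simp add: U_def prim_def)
  then show ?thesis by (simp add: J_def \<Theta>_def R0)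
qed

text \<open>Only the first component has to be small: the second enters through nonnegative terms.
  The sup bound |U| \<le> 2 |v| and p > 2 make the contribution of \<open>R\<close> negligible
  against |v|^2.\<close>

lemma small_sphere:
  obtains \<rho> where "0 < \<rho>" "\<And>x. norm (fst x) < \<rho> \<Longrightarrow> (norm (fst x))\<^sup>2 / 4 \<le> J x"
proof -
  have "bounded (m ` {0..1})" using cm compact_continuous_image compact_imp_bounded by blast
  then obtain M0 where M0: "\<forall>y \<in> m ` {0..1}. norm y \<le> M0" unfolding bounded_iff by auto
  define M where "M = max 1 M0"
  have M: "1 \<le> M" "\<And>s. 0 \<le> s \<Longrightarrow> s \<le> 1 \<Longrightarrow> m s \<le> M" using M0 by (auto simp: M_def abs_le_iff le_max_iff_disj)
  define C where "C = M * (c * 2 powr p)"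
  have C: "0 < C" using M c by (simp add: C_def)
  \<comment> \<open>Chosen so that C \<rho>^(p-2) = 1/4.\<close>
  define \<rho> where "\<rho> = (1 / (4 * C)) powr (1 / (p - 2))"
  show thesis
  proof (rule that)
    show "0 < \<rho>" using C by (simp add: \<rho>_def)
    fix x :: "cfun \<times> cfun" assume x: "norm (fst x) < \<rho>"
    define n where "n = norm (fst x)"
    have n0: "0 \<le> n" by (simp add: n_def)
    have "n powr (p - 2) \<le> \<rho> powr (p - 2)" using x p by (intro powr_mono2) (auto simp: n_def)
    also have "\<dots> = 1 / (4 * C)" using C p by (simp add: \<rho>_def powr_powr)
    finally have "C * n powr (p - 2) \<le> 1 / 4" using C by (simp add: field_simps)
    then have "C * n powr (p - 2) * n\<^sup>2 \<le> 1 / 4 * n\<^sup>2" by (intro mult_right_mono) auto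
    moreover have "n powr (p - 2) * n\<^sup>2 = n powr p"
    proof (cases "n = 0")
      case False
      then have "n\<^sup>2 = n powr 2" using n0 by simp
      then show ?thesis using powr_add[of n "p - 2" 2] by simp
    qed simp
    ultimately have Cn: "C * n powr p \<le> n\<^sup>2 / 4" by (simp add: mult.assoc)
    have "- (C * n powr p) = integral {0..1::real} (\<lambda>_. - (C * n powr p))" by simp
    also have "\<dots> \<le> integral {0..1} (\<lambda>s. \<Theta> s (U (fst x) s) (Aw (snd x) s))"
    proof (intro integral_le int_fn cont_\<Theta> continuous_intros)
      fix s :: real assume s: "s \<in> {0..1}"
      have "\<bar>U (fst x) s\<bar> powr p \<le> (2 * n) powr p"
        using U_le[of s "fst x"] s p by (intro powr_mono2) (auto simp: n_def)
      then have "c * \<bar>U (fst x) s\<bar> powr p \<le> c * (2 powr p * n powr p)" using c n0 by (simp add: powr_mult)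
      then have "R (U (fst x) s) \<le> c * (2 powr p * n powr p)" using R_le order_trans by blast
      then have "m s * R (U (fst x) s) \<le> M * (c * (2 powr p * n powr p))"
        using M s R_ge c by (intro mult_mono) auto
      moreover have "0 \<le> q * (Aw (snd x) s)\<^sup>2 * (U (fst x) s)\<^sup>2" "0 \<le> m s * (U (fst x) s)\<^sup>2" using q m[of s] s by auto
      ultimately show "- (C * n powr p) \<le> \<Theta> s (U (fst x) s) (Aw (snd x) s)"
        unfolding \<Theta>_def C_def by (simp add: mult.assoc)
    qed
    finally have "(norm x)\<^sup>2 / 2 - n\<^sup>2 / 4 \<le> J x" using Cn unfolding J_def by linarith
    moreover have "n\<^sup>2 \<le> (norm x)\<^sup>2" by (simp add: n_def norm_prod_def)
    ultimately show "(norm (fst x))\<^sup>2 / 4 \<le> J x" unfolding n_def by linarith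
  qed
qed

text \<open>The mountain pass is applied with \<open>N\<close> the norm of the first component
  alone, and with \<alpha> = \<rho>^2 / 16 because the quadratic bound at |v| = \<rho> / 2 has this
  value. The Ambrosetti--Rabinowitz identity at g = 0 turns the level into the energy bound.\<close>

lemma critical_point:
  assumes T: "0 \<le> T" and path: "\<And>s. 0 \<le> s \<Longrightarrow> s \<le> T \<Longrightarrow> J (s *\<^sub>R (e, 0)) \<le> \<beta>" and endp: "J (T *\<^sub>R (e, 0)) < 0"
  obtains x where "g x = 0" "\<exists>s\<in>{0..1}. U (fst x) s \<noteq> 0"
    "(1/2 - 1/p) * ((norm (fst x))\<^sup>2 + integral {0..1} (\<lambda>s. q * (Aw (snd x) s)\<^sup>2 * (U (fst x) s)\<^sup>2 + m s * (U (fst x) s)\<^sup>2))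
     + (norm (snd x))\<^sup>2 / 2 \<le> \<beta>"
proof -
  obtain \<rho> where \<rho>: "0 < \<rho>" and sm: "\<And>x. norm (fst x) < \<rho> \<Longrightarrow> (norm (fst x))\<^sup>2 / 4 \<le> J x"
    by (rule small_sphere, erule that)
  have "\<exists>K. \<forall>\<delta>>0. \<exists>x. norm x \<le> K \<and> norm (g x) < \<delta> \<and> 0 \<le> J x \<and> J x \<le> \<beta> \<and> (\<rho> \<le> norm (fst x) \<or> \<rho>\<^sup>2 / 16 \<le> J x)"
  proof (rule dynamical_mountain_pass[where e = "(e, 0)" and T = T and J = J and g = g and N = "\<lambda>x. norm (fst x)" and \<beta> = \<beta> and \<rho> = \<rho> and \<alpha> = "\<rho>\<^sup>2 / 16"])
    show "continuous_on UNIV J" "continuous_on UNIV g" by (rule cont_J cont_g)+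
    show "\<bar>norm (fst x) - norm (fst y)\<bar> \<le> norm (x - y)" for x y :: "cfun \<times> cfun"
      using norm_triangle_ineq3[of "fst x" "fst y"] norm_fst_snd(1)[of "x - y"] by simp
    show "0 \<le> J x" if "norm (fst x) < \<rho>" for x using sm[OF that] by (rule order_trans[rotated]) simp
    show "\<rho>\<^sup>2 / 16 \<le> J x" if x: "\<rho> / 2 \<le> norm (fst x)" "norm (fst x) < \<rho>" for x
    proof -
      have "(\<rho> / 2)\<^sup>2 \<le> (norm (fst x))\<^sup>2" using x \<rho> by (intro power_mono) auto
      then show ?thesis using sm[OF x(2)] by (simp add: power_divide)
    qed
    show "0 < \<rho>\<^sup>2 / 16" using \<rho> by simp
    show "J (s *\<^sub>R (e, 0)) \<le> \<beta>" if "0 \<le> s" "s \<le> T" for s by (rule path[OF that])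
    show "\<exists>\<tau>0>0. \<forall>x. norm x \<le> K \<longrightarrow> \<delta> \<le> norm (g x) \<longrightarrow>
       (\<forall>\<tau>. 0 \<le> \<tau> \<and> \<tau> \<le> \<tau>0 \<longrightarrow> J (x - \<tau> *\<^sub>R g x) \<le> J x - \<tau> / 2 * (norm (g x))\<^sup>2)" if "0 < \<delta>" for K \<delta>
      by (rule J_descent[OF that])
    show "\<exists>G. \<forall>x. norm x \<le> K \<longrightarrow> norm (g x) \<le> G" for K by (rule g_bounded)
    show "\<exists>M. \<forall>x. J x \<le> \<beta> \<longrightarrow> norm (g x) \<le> 1 \<longrightarrow> norm x \<le> M" by (rule coercive)
    show "0 < \<rho>" "0 \<le> T" "J 0 = 0" "J (T *\<^sub>R (e, 0)) < 0" by (rule \<rho> T J_zero endp)+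
    show "norm (fst (0 :: cfun \<times> cfun)) = 0" by simp
  qed
  then obtain K where K: "\<And>\<delta>. 0 < \<delta> \<Longrightarrow> \<exists>x. norm x \<le> K \<and> norm (g x) < \<delta> \<and> 0 \<le> J x \<and> J x \<le> \<beta> \<and> (\<rho> \<le> norm (fst x) \<or> \<rho>\<^sup>2 / 16 \<le> J x)"
    by blast
  have "\<forall>n. \<exists>x. norm x \<le> K \<and> norm (g x) < inverse (real (Suc n)) \<and> 0 \<le> J x \<and> J x \<le> \<beta> \<and> (\<rho> \<le> norm (fst x) \<or> \<rho>\<^sup>2 / 16 \<le> J x)"
    by (intro allI K) simp
  then obtain X where X: "\<And>n. norm (X n) \<le> K" "\<And>n. norm (g (X n)) < inverse (real (Suc n))" "\<And>n. J (X n) \<le> \<beta>"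
      "\<And>n. \<rho> \<le> norm (fst (X n)) \<or> \<rho>\<^sup>2 / 16 \<le> J (X n)" by metis
  have "(\<lambda>n. g (X n)) \<longlonglongrightarrow> 0"
    by (rule Lim_null_comparison[OF _ LIMSEQ_inverse_real_of_nat]) (use X(2) in \<open>auto intro!: always_eventually less_imp_le\<close>)
  from critical_limit[OF X(1) this] obtain x k where k: "strict_mono (k :: nat \<Rightarrow> nat)" "(\<lambda>n. X (k n)) \<longlonglongrightarrow> x" "g x = 0"
    by blast
  have "isCont J x" using cont_J continuous_on_eq_continuous_at open_UNIV by blast
  then have Jl: "(\<lambda>n. J (X (k n))) \<longlonglongrightarrow> J x" using k(2) by (rule isCont_tendsto_compose)
  then have J\<beta>: "J x \<le> \<beta>" by (rule LIMSEQ_le_const2) (use X(3) in auto)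
  have Nl: "(\<lambda>n. norm (fst (X (k n)))) \<longlonglongrightarrow> norm (fst x)" by (intro tendsto_intros k)
  \<comment> \<open>If u vanished, the limit would be the origin, so that \<open>J\<close> and
    \<open>N\<close> would both tend to 0; but one of them stays bounded below along the
    sequence.\<close>
  have "\<exists>s\<in>{0..1}. U (fst x) s \<noteq> 0"
  proof (rule ccontr)
    assume "\<not> ?thesis"
    then have U0: "U (fst x) s = 0" if "0 \<le> s" "s \<le> 1" for s using that by auto
    have "norm (NN (U (fst x)) (Aw (snd x)) - NN (\<lambda>_. 0) (\<lambda>_. 0)) \<le> (2 + E) * 0"
      by (rule NN_close) (auto intro!: continuous_intros simp: U0 \<Theta>u_def \<Theta>a_def R'0)
    then have "NN (U (fst x)) (Aw (snd x)) = 0" by (simp add: NN_0)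
    then have "x = 0" using k(3) by (simp add: g_def)
    then have J0: "(\<lambda>n. J (X (k n))) \<longlonglongrightarrow> 0" "(\<lambda>n. norm (fst (X (k n)))) \<longlonglongrightarrow> 0"
      using Jl Nl J_zero by simp_all
    have \<rho>16: "0 < \<rho>\<^sup>2 / 16" using \<rho> by simp
    have "\<forall>\<^sub>F n in sequentially. J (X (k n)) < \<rho>\<^sup>2 / 16" "\<forall>\<^sub>F n in sequentially. norm (fst (X (k n))) < \<rho>"
      by (rule order_tendstoD(2)[OF J0(1) \<rho>16] order_tendstoD(2)[OF J0(2) \<rho>])+
    then have "\<forall>\<^sub>F n in sequentially. False"
      by eventually_elim (metis X(4) not_le)
    then show False by simp
  qed
  moreover have "(1/2 - 1/p) * ((norm (fst x))\<^sup>2 + integral {0..1} (\<lambda>s. q * (Aw (snd x) s)\<^sup>2 * (U (fst x) s)\<^sup>2 + m s * (U (fst x) s)\<^sup>2))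
     + (norm (snd x))\<^sup>2 / 2 \<le> \<beta>"
    using AR_integral[of x] k(3) J\<beta> by simp
  ultimately show thesis using that k(3) by blast
qed

section \<open>The differential equations satisfied by a critical point\<close>

lemma U_deriv:
  assumes "0 \<le> s" "s \<le> 1"
  shows "(U v has_real_derivative fn v s - prim (fn v) 1) (at s within {0..1})"
  unfolding U_def by (auto intro!: derivative_eq_intros prim_deriv assms cont_fn)

lemma Aw_deriv:
  assumes "0 \<le> s" "s \<le> 1"
  shows "(Aw w has_real_derivative \<eta> s * fn w s) (at s within {0..1})"
  unfolding Aw_def using prim_deriv[of "\<lambda>x. \<eta> x * fn w x" s] assms
  by (auto intro!: derivative_eq_intros continuous_intros c\<eta>)

text \<open>At a critical point v = -V1 and w = -V2 are integrals of continuous functions, hence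
  differentiable. The function b is minus the tail integral of \<Theta>a, so b(1) = 0 is the natural
  boundary condition at the free end of a.\<close>

lemma critical_ode:
  assumes g0: "g x = 0"
  shows "\<exists>b. b 1 = 0 \<and> (\<forall>s. 0 \<le> s \<and> s \<le> 1 \<longrightarrow> (U (fst x) has_real_derivative fn (fst x) s) (at s within {0..1}) \<and>
    (fn (fst x) has_real_derivative \<Theta>u s (U (fst x) s) (Aw (snd x) s)) (at s within {0..1}) \<and>
    (Aw (snd x) has_real_derivative (\<eta> s)\<^sup>2 * b s) (at s within {0..1}) \<and>
    (b has_real_derivative \<Theta>a s (U (fst x) s) (Aw (snd x) s)) (at s within {0..1}) \<and>
    fn (snd x) s = \<eta> s * b s)"
proof -
  let ?h = "\<lambda>s. \<Theta>u s (U (fst x) s) (Aw (snd x) s)" and ?k = "\<lambda>s. \<Theta>a s (U (fst x) s) (Aw (snd x) s)"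
  have ch: "continuous_on {0..1} ?h" "continuous_on {0..1} ?k" by (intro cont_\<Theta> cont_U cont_Aw)+
  have "fst x + mkc (V1 ?h) = 0" "snd x + mkc (V2 ?k) = 0" using g0 by (simp_all add: g_def NN_def prod_eq_iff)
  then have x: "fst x = - mkc (V1 ?h)" "snd x = - mkc (V2 ?k)" by (simp_all add: eq_neg_iff_add_eq_0)
  have fx: "fn (fst x) s = - V1 ?h s" "fn (snd x) s = - V2 ?k s" if "0 \<le> s" "s \<le> 1" for s
    using arg_cong[OF x(1), of "\<lambda>v. fn v s"] arg_cong[OF x(2), of "\<lambda>v. fn v s"] that
    by (simp_all only: fn_simps fn_mkc_in[OF cont_V(1)[OF ch(1)]] fn_mkc_in[OF cont_V(2)[OF ch(2)]])
  \<comment> \<open>\<open>V1\<close> has mean zero, so the linear correction in \<open>U\<close>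
    disappears and U' = v.\<close>
  have "prim (fn (fst x)) 1 = integral {0..1} (\<lambda>s. prim (tail ?h) 1 - tail ?h s)"
    unfolding prim_def[of _ 1] by (rule integral_cong) (simp add: fx V1_def prim_def)
  also have "\<dots> = 0" by (subst integral_diff) (auto intro!: int_fn continuous_intros ch simp: prim_def)
  finally have p0: "prim (fn (fst x)) 1 = 0" .
  define b where "b s = - tail ?k s" for s
  have d1: "(U (fst x) has_real_derivative fn (fst x) s) (at s within {0..1})" if "0 \<le> s" "s \<le> 1" for s
    using U_deriv[OF that, of "fst x"] p0 by simp
  have d2: "(fn (fst x) has_real_derivative ?h s) (at s within {0..1})" if s: "0 \<le> s" "s \<le> 1" for s
  proof -
    have "((\<lambda>s. - V1 ?h s) has_real_derivative ?h s) (at s within {0..1})"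
      unfolding V1_def using tail_deriv[OF ch(1) s] by (auto intro!: derivative_eq_intros)
    then show ?thesis
      by (rule has_field_derivative_transform_within[where d = 1]) (use s in \<open>auto simp: fx\<close>)
  qed
  have d3: "(Aw (snd x) has_real_derivative (\<eta> s)\<^sup>2 * b s) (at s within {0..1})" if s: "0 \<le> s" "s \<le> 1" for s
    using Aw_deriv[OF s, of "snd x"] by (simp add: fx(2)[OF s] V2_def b_def power2_eq_square mult.assoc)
  have d4: "(b has_real_derivative ?k s) (at s within {0..1})" if s: "0 \<le> s" "s \<le> 1" for s
    unfolding b_def using tail_deriv[OF ch(2) s] by (auto intro!: derivative_eq_intros)
  have d5: "b 1 = 0" by (simp add: b_def)
  have d6: "fn (snd x) s = \<eta> s * b s" if s: "0 \<le> s" "s \<le> 1" for s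
    using fx(2)[OF s] by (simp add: V2_def b_def)
  show ?thesis using d1 d2 d3 d4 d5 d6 by blast
qed

end

section \<open>Solutions on bounded intervals\<close>

lemma integral_affine_unit:
  assumes f: "continuous_on {-L..L} f" and L: "0 < L"
  shows "integral {0..1} (\<lambda>s. f (- L + 2 * L * s)) * (2 * L) = integral {-L..L} (f :: real \<Rightarrow> real)"
proof -
  let ?G = "\<lambda>t. integral {-L..t} f" and ?\<tau> = "\<lambda>s. - L + 2 * L * s"
  have im: "?\<tau> ` {0..1} \<subseteq> {-L..L}" using L by (auto simp: field_simps mult_left_le)
  have "((\<lambda>s. f (?\<tau> s) * (2 * L)) has_integral (?G (?\<tau> 1) - ?G (?\<tau> 0))) {0..1}"
  proof (rule fundamental_theorem_of_calculus[where f = "\<lambda>s. ?G (?\<tau> s)"])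
    fix s :: real assume s: "s \<in> {0..1}"
    have "(?G has_real_derivative f (?\<tau> s)) (at (?\<tau> s) within {-L..L})"
      by (rule integral_has_real_derivative[OF f subsetD[OF im imageI[OF s]]])
    then have "(?G has_real_derivative f (?\<tau> s)) (at (?\<tau> s) within ?\<tau> ` {0..1})"
      by (rule DERIV_subset[OF _ im])
    moreover have "(?\<tau> has_real_derivative 2 * L) (at s within {0..1})" by (auto intro!: derivative_eq_intros)
    ultimately have "(?G \<circ> ?\<tau> has_real_derivative f (?\<tau> s) * (2 * L)) (at s within {0..1})"
      by (rule DERIV_image_chain)
    then show "((\<lambda>s. ?G (?\<tau> s)) has_vector_derivative f (?\<tau> s) * (2 * L)) (at s within {0..1})"
      by (simp add: has_real_derivative_iff_has_vector_derivative comp_def)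
  qed simp
  from integral_unique[OF this] have "integral {0..1} (\<lambda>s. f (?\<tau> s) * (2 * L)) = integral {-L..L} f" by (simp del: integral_mult_left)
  then show ?thesis by simp
qed

text \<open>\<open>R\<close> is meant to be extended by 0 to negative arguments. Then
  \<open>R'\<close> vanishes there, and the minimum principle yields nonnegative solutions without
  any constraint in the variational problem.\<close>

locale nonlinearity =
  fixes c p :: real and R R' :: "real \<Rightarrow> real"
  assumes R_deriv: "\<And>s. (R has_real_derivative R' s) (at s)" and R'_cont: "continuous_on UNIV R'"
    and R0: "R 0 = 0" and R'_neg: "\<And>s. s \<le> 0 \<Longrightarrow> R' s = 0" and R_le: "\<And>s. R s \<le> c * \<bar>s\<bar> powr p" and R_ge: "\<And>s. 0 \<le> R s"
    and R_pos: "\<And>s. 0 < s \<Longrightarrow> 0 < R s"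
    and AR: "\<And>s. p * R s \<le> s * R' s" and c: "0 < c" and p: "2 < p"
begin

text \<open>The superlinearity condition says precisely that s^(-p) R(s) is nondecreasing.\<close>

lemma R_lower:
  assumes s: "1 \<le> s" shows "R 1 * s powr p \<le> R s"
proof -
  have "R 1 * 1 powr (- p) \<le> R s * s powr (- p)"
  proof (rule DERIV_nonneg_imp_nondecreasing[OF s, where f = "\<lambda>s. R s * s powr (- p)"])
    fix x :: real assume x: "1 \<le> x" "x \<le> s"
    have "((\<lambda>x. R x * x powr (- p)) has_real_derivative R' x * x powr (- p) + R x * (- p * x powr (- p - 1))) (at x)"
      using x by (auto intro!: derivative_eq_intros R_deriv)
    moreover have "x powr (- p) = x * x powr (- p - 1)" using x powr_mult_base[of x "- p - 1"] by simp
    then have "R' x * x powr (- p) + R x * (- p * x powr (- p - 1)) = (x * R' x - p * R x) * x powr (- p - 1)"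
      by (simp add: algebra_simps)
    then have "0 \<le> R' x * x powr (- p) + R x * (- p * x powr (- p - 1))" using AR[of x] by simp
    ultimately show "\<exists>y. ((\<lambda>x. R x * x powr (- p)) has_real_derivative y) (at x) \<and> 0 \<le> y" by blast
  qed
  then show ?thesis using s by (simp add: powr_minus field_simps)
qed

end

text \<open>A C^1 function supported in [-1, 1]; a continuous derivative is all that the initial
  path requires. It also serves to build the cutoff \<open>step\<close> at the origin.\<close>

definition bump :: "real \<Rightarrow> real" where "bump t = (max 0 (1 - t\<^sup>2))\<^sup>2"
definition bump' :: "real \<Rightarrow> real" where "bump' t = - 4 * t * max 0 (1 - t\<^sup>2)"

lemma bump_deriv: "(bump has_real_derivative bump' t) (at t within A)"
proof -
  have pos: "((\<lambda>x. (max 0 x)\<^sup>2) has_real_derivative 2 * max 0 x) (at x)" for x :: real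
  proof -
    consider "x < 0" | "x = 0" | "0 < x" by linarith
    then show ?thesis
    proof cases
      case 1
      have "((\<lambda>x. 0) has_real_derivative 0) (at x)" by simp
      then have "((\<lambda>x. (max 0 x)\<^sup>2) has_real_derivative 0) (at x)"
        by (rule has_field_derivative_transform_within_open[where S = "{..<0}"]) (use 1 in auto)
      then show ?thesis using 1 by simp
    next
      case 2
      have "((\<lambda>h. (max 0 (x + h))\<^sup>2 / h) \<longlongrightarrow> 0) (at 0)"
      proof (rule Lim_null_comparison[where g = "\<lambda>h. \<bar>h\<bar>"])
        show "\<forall>\<^sub>F h in at 0. norm ((max 0 (x + h))\<^sup>2 / h) \<le> \<bar>h\<bar>"
        proof (rule always_eventually, rule allI)
          fix h :: real
          have "(max 0 h)\<^sup>2 \<le> \<bar>h\<bar> * \<bar>h\<bar>" by (auto simp: power2_eq_square max_def)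
          then show "norm ((max 0 (x + h))\<^sup>2 / h) \<le> \<bar>h\<bar>"
            using 2 by (cases "h = 0") (auto simp: divide_le_eq abs_mult)
        qed
        show "((\<lambda>h::real. \<bar>h\<bar>) \<longlongrightarrow> 0) (at 0)" by (intro tendsto_eq_intros) auto
      qed
      then show ?thesis using 2 by (simp add: DERIV_def)
    next
      case 3
      have "((\<lambda>x. x\<^sup>2) has_real_derivative 2 * x) (at x)" by (auto intro!: derivative_eq_intros)
      then have "((\<lambda>x. (max 0 x)\<^sup>2) has_real_derivative 2 * x) (at x)"
        by (rule has_field_derivative_transform_within_open[where S = "{0<..}"]) (use 3 in auto)
      then show ?thesis using 3 by simp
    qed
  qed
  have "((\<lambda>t. 1 - t\<^sup>2) has_real_derivative - 2 * t) (at t within A)" by (auto intro!: derivative_eq_intros)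
  from DERIV_chain'[OF this pos] show ?thesis
    unfolding bump_def[abs_def] bump'_def by (simp add: mult_ac)
qed

lemma bump_cont: "continuous_on A bump" "continuous_on A bump'"
  unfolding bump_def[abs_def] bump'_def[abs_def] by (intro continuous_intros)+

lemma bump_outside: "1 \<le> \<bar>t\<bar> \<Longrightarrow> bump t = 0" "1 \<le> \<bar>t\<bar> \<Longrightarrow> bump' t = 0"
  using abs_le_square_iff[of 1 t] by (auto simp: bump_def bump'_def)

lemma bump_bounds: "0 \<le> bump t" "bump t \<le> 1" "\<bar>bump' t\<bar> \<le> 4"
proof -
  have m: "0 \<le> max 0 (1 - t\<^sup>2)" "max 0 (1 - t\<^sup>2) \<le> 1" by auto
  show "0 \<le> bump t" "bump t \<le> 1" using m by (auto simp: bump_def intro!: power_le_one)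
  show "\<bar>bump' t\<bar> \<le> 4"
  proof (cases "1 \<le> \<bar>t\<bar>")
    case False
    then have "\<bar>t\<bar> * \<bar>max 0 (1 - t\<^sup>2)\<bar> \<le> 1 * 1" using m by (intro mult_mono) auto
    then show ?thesis by (simp add: bump'_def abs_mult)
  qed (simp add: bump_outside)
qed

lemma bump_half: "\<bar>t\<bar> \<le> 1/2 \<Longrightarrow> 1/2 \<le> bump t"
proof -
  assume "\<bar>t\<bar> \<le> 1/2"
  then have "t\<^sup>2 \<le> (1/2)\<^sup>2" by (metis abs_ge_zero power2_abs power_mono)
  then have "(3/4)\<^sup>2 \<le> (max 0 (1 - t\<^sup>2))\<^sup>2" by (intro power_mono) (auto simp: power2_eq_square)
  then show ?thesis by (simp add: bump_def power2_eq_square)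
qed

text \<open>The radial system in first-order form with \<open>f\<close> in the role of
  \<open>R'\<close>. Derivatives are taken within the set, so that one definition covers closed
  intervals and the whole line.\<close>

definition ode_on :: "(real \<Rightarrow> real) \<Rightarrow> real set \<Rightarrow> (real \<Rightarrow> real) \<Rightarrow> (real \<Rightarrow> real) \<Rightarrow> (real \<Rightarrow> real) \<Rightarrow> (real \<Rightarrow> real) \<Rightarrow> bool" where
  "ode_on f S u du a b \<longleftrightarrow> (\<forall>t\<in>S.
     (u has_real_derivative du t) (at t within S) \<and>
     (du has_real_derivative (a t)\<^sup>2 * u t + exp (2 * t) * (u t - f (u t))) (at t within S) \<and>
     (a has_real_derivative exp (2 * t) * b t) (at t within S) \<and>
     (b has_real_derivative a t * (u t)\<^sup>2) (at t within S))"

text \<open>Up to the factor 2 pi, the four terms integrate to the planar integrals of |grad u|^2,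
  |k grad \<theta> - A|^2 u^2, u^2 and |curl A|^2. The last one is the weighted energy of a, since
  e^(2t) b = a'.\<close>

definition energy_density :: "(real \<Rightarrow> real) \<Rightarrow> (real \<Rightarrow> real) \<Rightarrow> (real \<Rightarrow> real) \<Rightarrow> (real \<Rightarrow> real) \<Rightarrow> real \<Rightarrow> real" where
  "energy_density u du a b t = (du t)\<^sup>2 + (a t)\<^sup>2 * (u t)\<^sup>2 + exp (2 * t) * (u t)\<^sup>2 + exp (2 * t) * (b t)\<^sup>2"

lemma ode_on_cont:
  assumes "ode_on f S u du a b"
  shows "continuous_on S u" "continuous_on S du" "continuous_on S a" "continuous_on S b"
  using assms unfolding ode_on_def
  by (auto simp: continuous_on_eq_continuous_within intro: DERIV_continuous)

context nonlinearity begin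

text \<open>T^p outgrows T^2. The left side will bound the quadratic part of the functional at
  amplitude \<open>T\<close>, the right side will bound the term with \<open>R\<close> from
  below.\<close>

lemma exists_large_amplitude:
  obtains T where "2 \<le> T" "2 * T\<^sup>2 * C < exp (- 1) * R 1 * (T / 2) powr p"
proof -
  have "filterlim (\<lambda>T::real. T powr (p - 2)) at_top at_top" using p by real_asymp
  moreover define D where "D = 2 * \<bar>C\<bar> * 2 powr p / (exp (- 1) * R 1) + 1"
  ultimately have "\<forall>\<^sub>F T in at_top. D \<le> T powr (p - 2)" by (simp add: filterlim_at_top)
  then have "\<forall>\<^sub>F T in at_top. D \<le> T powr (p - 2) \<and> 2 \<le> T" using eventually_ge_at_top eventually_conj by blast
  then obtain T where T: "D \<le> T powr (p - 2)" "2 \<le> T" using eventually_happens' trivial_limit_at_top_linorder by blast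
  have R1: "0 < exp (- 1) * R 1" using R_pos[of 1] by simp
  have "2 * \<bar>C\<bar> * 2 powr p / (exp (- 1) * R 1) < T powr (p - 2)" using T by (simp add: D_def)
  then have "2 * \<bar>C\<bar> * 2 powr p < T powr (p - 2) * (exp (- 1) * R 1)" using R1 by (simp add: pos_divide_less_eq)
  then have "2 * \<bar>C\<bar> * 2 powr p * T\<^sup>2 < T powr (p - 2) * (exp (- 1) * R 1) * T\<^sup>2" using T by (intro mult_strict_right_mono) auto
  moreover have "T powr (p - 2) * T\<^sup>2 = T powr p" using T powr_add[of T "p - 2" 2] by simp
  ultimately have "2 * \<bar>C\<bar> * T\<^sup>2 * 2 powr p < exp (- 1) * R 1 * T powr p" by (simp add: mult_ac)
  then have "2 * \<bar>C\<bar> * T\<^sup>2 < exp (- 1) * R 1 * (T / 2) powr p"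
    using T by (simp add: powr_divide pos_less_divide_eq)
  moreover have "2 * T\<^sup>2 * C \<le> 2 * \<bar>C\<bar> * T\<^sup>2" using mult_right_mono[of C "\<bar>C\<bar>" "2 * T\<^sup>2"] by (simp add: mult_ac)
  ultimately show thesis using that T by (meson le_less_trans)
qed

text \<open>The path consists of multiples of the bump with a constantly equal to \<kappa>. It lives
  in [-1, 1], hence its functional is 2L times a quantity free of \<open>L\<close>. The energy on
  the unit interval carries the same factor 2L, which cancels.\<close>

lemma truncated_solution:
  "\<exists>\<beta>. \<forall>L\<ge>1. \<exists>u du a b. ode_on R' {-L..L} u du a b \<and> u (- L) = 0 \<and> u L = 0 \<and> a (- L) = \<kappa> \<and> b L = 0 \<and>
     (\<exists>t\<in>{-L..L}. u t \<noteq> 0) \<and> (1/2 - 1/p) * integral {-L..L} (energy_density u du a b) \<le> \<beta>"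
proof -
  \<comment> \<open>Half of each of 16, \<kappa>^2 and e^2, from |bump'| \<le> 4, bump \<le> 1 and
    e^(2t) \<le> e^2 on [-1, 1]; the length 2 of the interval accounts for the factor in 2 T^2
    C.\<close>
  define C where "C = 8 + \<kappa>\<^sup>2 / 2 + exp 2 / 2"
  have C0: "0 \<le> C" by (simp add: C_def)
  obtain T where T: "2 \<le> T" and TC: "2 * T\<^sup>2 * C < exp (- 1) * R 1 * (T / 2) powr p"
    by (rule exists_large_amplitude, erule that)
  show ?thesis
  proof (intro exI[of _ "2 * T\<^sup>2 * C"] allI impI)
    fix L :: real assume L: "1 \<le> L"
    define \<tau> where "\<tau> s = - L + 2 * L * s" for s
    define q m \<eta> where "q = (2 * L)\<^sup>2" and "m s = (2 * L)\<^sup>2 * exp (2 * \<tau> s)" and "\<eta> s = exp (\<tau> s)" for s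
    interpret tr: truncated q \<kappa> c p m \<eta> R R'
    proof
      show "0 < q" "continuous_on {0..1} m" "continuous_on {0..1} \<eta>" "\<And>s. 0 < m s"
        unfolding q_def m_def[abs_def] \<eta>_def[abs_def] \<tau>_def using L by (auto intro!: continuous_intros)
      show "R' 0 = 0" using R'_neg by simp
    qed (rule R_deriv R'_cont R0 R_le R_ge AR c p)+
    have \<tau>_deriv: "(\<tau> has_real_derivative 2 * L) (at s within A)" for s A
      unfolding \<tau>_def[abs_def] by (auto intro!: derivative_eq_intros)
    have \<tau>_range: "\<tau> s \<in> {-L..L}" if "s \<in> {0..1}" for s
      using that L mult_left_mono[of s 1 "2 * L"] by (auto simp: \<tau>_def)
    have \<tau>cont: "continuous_on A \<tau>" for A unfolding \<tau>_def[abs_def] by (intro continuous_intros)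
    have subst: "integral {0..1} (\<lambda>s. f (\<tau> s)) * (2 * L) = integral {-L..L} f" if "continuous_on {-L..L} f" for f
      unfolding \<tau>_def using integral_affine_unit[OF that] L by simp
    define e where "e = mkc (\<lambda>s. 2 * L * bump' (\<tau> s))"
    have ce: "continuous_on {0..1} (\<lambda>s. 2 * L * bump' (\<tau> s))"
      by (intro continuous_intros continuous_on_compose2[OF bump_cont(2) \<tau>cont]) auto
    have cb: "continuous_on {0..1} (\<lambda>s. bump (\<tau> s))" "continuous_on {0..1} (\<lambda>s. bump' (\<tau> s))"
      using \<tau>cont bump_cont by (auto intro: continuous_on_compose2)
    have pe: "prim (fn e) s = bump (\<tau> s)" if s: "s \<in> {0..1}" for s
    proof -
      have hi: "((\<lambda>s. 2 * L * bump' (\<tau> s)) has_integral (bump (\<tau> s) - bump (\<tau> 0))) {0..s}"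
      proof (rule fundamental_theorem_of_calculus[where f = "\<lambda>s. bump (\<tau> s)"])
        fix x assume "x \<in> {0..s}"
        have "((\<lambda>s. bump (\<tau> s)) has_real_derivative bump' (\<tau> x) * (2 * L)) (at x within {0..s})"
          by (rule DERIV_chain'[OF \<tau>_deriv bump_deriv])
        then show "((\<lambda>s. bump (\<tau> s)) has_vector_derivative 2 * L * bump' (\<tau> x)) (at x within {0..s})"
          by (simp add: has_real_derivative_iff_has_vector_derivative mult.commute)
      qed (use s in simp)
      moreover have "bump (\<tau> 0) = 0" using L by (simp add: \<tau>_def bump_outside)
      moreover have "prim (fn e) s = integral {0..s} (\<lambda>s. 2 * L * bump' (\<tau> s))"
        unfolding prim_def e_def using s by (intro integral_cong) (simp add: ce)
      ultimately show ?thesis using integral_unique[OF hi] by linarith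
    qed
    have Ue: "tr.U e s = bump (\<tau> s)" if s: "s \<in> {0..1}" for s
      using pe[OF s] pe[of 1] L by (simp add: tr.U_def \<tau>_def bump_outside)
    define F where "F r t = r\<^sup>2 * (bump' t)\<^sup>2 / 2 + \<kappa>\<^sup>2 * r\<^sup>2 * (bump t)\<^sup>2 / 2 + exp (2 * t) * (r\<^sup>2 * (bump t)\<^sup>2) / 2 - exp (2 * t) * R (r * bump t)" for r t
    have Fcont: "continuous_on A (F r)" for r A
      unfolding F_def[abs_def]
      by (intro continuous_intros bump_cont continuous_on_compose2[OF tr.R_cont[of UNIV]]) auto
    have Jpath: "tr.J (r *\<^sub>R (e, 0)) = 2 * L * integral {-1..1} (F r)" for r
    proof -
      have Ur: "tr.U (r *\<^sub>R e) s = r * bump (\<tau> s)" if "s \<in> {0..1}" for s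
      proof -
        have "fn 0 = (\<lambda>_. 0)" by auto
        then have "tr.U 0 s = 0" by (simp add: tr.U_def prim_def)
        then show ?thesis using tr.U_lin[OF that, of 0 "- r" e] Ue[OF that] by simp
      qed
      have "(norm (r *\<^sub>R (e, 0 :: cfun)))\<^sup>2 = r\<^sup>2 * (norm e)\<^sup>2" by (simp add: norm_prod_def power_mult_distrib)
      also have "(norm e)\<^sup>2 = integral {0..1} (\<lambda>s. (2 * L * bump' (\<tau> s))\<^sup>2)"
        unfolding norm_cfun_sq e_def by (rule integral_cong) (simp add: ce)
      finally have n: "(norm (r *\<^sub>R (e, 0 :: cfun)))\<^sup>2 / 2 = integral {0..1} (\<lambda>s. r\<^sup>2 / 2 * (2 * L * bump' (\<tau> s))\<^sup>2)" by simp
      have "tr.J (r *\<^sub>R (e, 0)) = integral {0..1} (\<lambda>s. r\<^sup>2 / 2 * (2 * L * bump' (\<tau> s))\<^sup>2) + integral {0..1} (\<lambda>s. tr.\<Theta> s (r * bump (\<tau> s)) \<kappa>)"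
      proof -
        have "integral {0..1} (\<lambda>s. tr.\<Theta> s (tr.U (fst (r *\<^sub>R (e, 0))) s) (tr.Aw (snd (r *\<^sub>R (e, 0))) s))
          = integral {0..1} (\<lambda>s. tr.\<Theta> s (r * bump (\<tau> s)) \<kappa>)"
          by (rule integral_cong) (simp add: tr.Aw_zero Ur)
        then show ?thesis unfolding tr.J_def n by simp
      qed
      also have "\<dots> = integral {0..1} (\<lambda>s. r\<^sup>2 / 2 * (2 * L * bump' (\<tau> s))\<^sup>2 + tr.\<Theta> s (r * bump (\<tau> s)) \<kappa>)"
        by (rule integral_add[symmetric]; intro int_fn tr.cont_\<Theta> continuous_intros cb)
      also have "\<dots> = integral {0..1} (\<lambda>s. (2 * L)\<^sup>2 * F r (\<tau> s))"
        by (rule integral_cong) (unfold tr.\<Theta>_def, unfold F_def q_def m_def, simp add: power_mult_distrib field_simps)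
      also have "\<dots> = (2 * L) * (integral {0..1} (\<lambda>s. F r (\<tau> s)) * (2 * L))" by (simp add: power2_eq_square)
      also have "integral {0..1} (\<lambda>s. F r (\<tau> s)) * (2 * L) = integral {-L..L} (F r)" by (rule subst[OF Fcont])
      also have "integral {-L..L} (F r) = integral {-1..1} (F r)"
      proof (rule integral_unique, rule has_integral_on_superset)
        show "(F r has_integral integral {-1..1} (F r)) {-1..1}"
          by (intro integrable_integral integrable_continuous_real Fcont)
        show "F r x = 0" if "x \<notin> {-1..1}" for x
        proof -
          have "1 \<le> \<bar>x\<bar>" using that by auto
          then show ?thesis by (simp add: F_def bump_outside R0)
        qed
      qed (use L in auto)
      finally show ?thesis .
    qed
    have F_le: "F r t \<le> r\<^sup>2 * C - exp (2 * t) * R (r * bump t)" if t: "t \<in> {-1..1}" for r t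
    proof -
      have "(bump' t)\<^sup>2 \<le> 16" using abs_le_square_iff[of "bump' t" 4] bump_bounds(3)[of t] by simp
      then have 1: "r\<^sup>2 * (bump' t)\<^sup>2 \<le> r\<^sup>2 * 16" by (intro mult_left_mono) auto
      have b: "(bump t)\<^sup>2 \<le> 1" using bump_bounds[of t] by (simp add: power_le_one)
      have 2: "\<kappa>\<^sup>2 * r\<^sup>2 * (bump t)\<^sup>2 \<le> \<kappa>\<^sup>2 * r\<^sup>2 * 1" using b by (intro mult_left_mono) auto
      have 3: "exp (2 * t) * (r\<^sup>2 * (bump t)\<^sup>2) \<le> exp 2 * (r\<^sup>2 * 1)" using t b by (intro mult_mono mult_left_mono) auto
      show ?thesis using 1 2 3 unfolding F_def C_def by (simp add: algebra_simps)
    qed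
    have path: "tr.J (r *\<^sub>R (e, 0)) \<le> 2 * L * (2 * T\<^sup>2 * C)" if r: "0 \<le> r" "r \<le> T" for r
    proof -
      have "integral {-1..1} (F r) \<le> integral {-1..1} (\<lambda>t::real. T\<^sup>2 * C)"
      proof (intro integral_le integrable_continuous_real Fcont continuous_intros)
        fix t :: real assume t: "t \<in> {-1..1}"
        have "r\<^sup>2 * C \<le> T\<^sup>2 * C" using r C0 by (intro mult_right_mono power_mono) auto
        moreover have "0 \<le> exp (2 * t) * R (r * bump t)" using R_ge by simp
        ultimately show "F r t \<le> T\<^sup>2 * C" using F_le[OF t, of r] by linarith
      qed
      then show ?thesis unfolding Jpath using L by (intro mult_left_mono) auto
    qed
    have endp: "tr.J (T *\<^sub>R (e, 0)) < 0"
    proof -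
      \<comment> \<open>For |t| \<le> 1/2 the weight is at least e^(-1) and the bump at least 1/2,
        so the argument of \<open>R\<close> is at least T / 2 \<ge> 1 and the power lower bound
        applies.\<close>
      let ?K = "exp (- 1) * R 1 * (T / 2) powr p"
      have i1: "integral {-1..1} (F T) \<le> integral {-1..1} (\<lambda>t. T\<^sup>2 * C - exp (2 * t) * R (T * bump t))"
        using F_le by (intro integral_le integrable_continuous_real Fcont continuous_intros bump_cont continuous_on_compose2[OF tr.R_cont[of UNIV]]) auto
      have i2: "integral {-1..1} (\<lambda>t. T\<^sup>2 * C - exp (2 * t) * R (T * bump t)) = 2 * T\<^sup>2 * C - integral {-1..1} (\<lambda>t. exp (2 * t) * R (T * bump t))"
        by (subst integral_diff) (auto intro!: integrable_continuous_real continuous_intros bump_cont continuous_on_compose2[OF tr.R_cont[of UNIV]])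
      have "integral {-1/2..1/2} (\<lambda>t::real. ?K) \<le> integral {-1/2..1/2} (\<lambda>t. exp (2 * t) * R (T * bump t))"
      proof (intro integral_le integrable_continuous_real continuous_intros bump_cont continuous_on_compose2[OF tr.R_cont[of UNIV]])
        fix t :: real assume t: "t \<in> {-1/2..1/2}"
        have b: "T / 2 \<le> T * bump t" using bump_half[of t] t T mult_left_mono[of "1/2" "bump t" T] by auto
        have "R 1 * (T / 2) powr p \<le> R 1 * (T * bump t) powr p" using b T p R_ge by (intro mult_left_mono powr_mono2) auto
        also have "\<dots> \<le> R (T * bump t)" by (rule R_lower) (use b T in linarith)
        finally have "exp (- 1) * (R 1 * (T / 2) powr p) \<le> exp (2 * t) * R (T * bump t)"
          using t R_ge by (intro mult_mono) auto
        then show "?K \<le> exp (2 * t) * R (T * bump t)" by (simp add: mult.assoc)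
      qed auto
      also have "\<dots> \<le> integral {-1..1} (\<lambda>t. exp (2 * t) * R (T * bump t))"
        using R_ge by (intro integral_subset_le integrable_continuous_real continuous_intros bump_cont continuous_on_compose2[OF tr.R_cont[of UNIV]]) auto
      finally have "?K \<le> integral {-1..1} (\<lambda>t. exp (2 * t) * R (T * bump t))" by simp
      then have "integral {-1..1} (F T) < 0" using i1 i2 TC by linarith
      then show ?thesis unfolding Jpath using L by (simp add: mult_pos_neg)
    qed
    obtain x where gx: "tr.g x = 0" and nz: "\<exists>s\<in>{0..1}. tr.U (fst x) s \<noteq> 0" and en:
      "(1/2 - 1/p) * ((norm (fst x))\<^sup>2 + integral {0..1} (\<lambda>s. q * (tr.Aw (snd x) s)\<^sup>2 * (tr.U (fst x) s)\<^sup>2 + m s * (tr.U (fst x) s)\<^sup>2))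
     + (norm (snd x))\<^sup>2 / 2 \<le> 2 * L * (2 * T\<^sup>2 * C)"
      by (rule tr.critical_point[OF _ path endp]) (use T in auto)
    obtain B where d5: "B 1 = 0" and B: "\<forall>s. 0 \<le> s \<and> s \<le> 1 \<longrightarrow> (tr.U (fst x) has_real_derivative fn (fst x) s) (at s within {0..1}) \<and>
      (fn (fst x) has_real_derivative tr.\<Theta>u s (tr.U (fst x) s) (tr.Aw (snd x) s)) (at s within {0..1}) \<and>
      (tr.Aw (snd x) has_real_derivative (\<eta> s)\<^sup>2 * B s) (at s within {0..1}) \<and>
      (B has_real_derivative tr.\<Theta>a s (tr.U (fst x) s) (tr.Aw (snd x) s)) (at s within {0..1}) \<and>
      fn (snd x) s = \<eta> s * B s"
      using tr.critical_ode[OF gx] by (elim exE conjE) (rule that)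
    have d1: "(tr.U (fst x) has_real_derivative fn (fst x) s) (at s within {0..1})" and
      d2: "(fn (fst x) has_real_derivative tr.\<Theta>u s (tr.U (fst x) s) (tr.Aw (snd x) s)) (at s within {0..1})" and
      d3: "(tr.Aw (snd x) has_real_derivative (\<eta> s)\<^sup>2 * B s) (at s within {0..1})" and
      d4: "(B has_real_derivative tr.\<Theta>a s (tr.U (fst x) s) (tr.Aw (snd x) s)) (at s within {0..1})" and
      d6: "fn (snd x) s = \<eta> s * B s" if "0 \<le> s" "s \<le> 1" for s
      using B[rule_format, of s] that by simp_all
    define \<sigma> where "\<sigma> t = (t + L) / (2 * L)" for t
    have \<sigma>01: "\<sigma> t \<in> {0..1}" and \<tau>\<sigma>: "\<tau> (\<sigma> t) = t" if "t \<in> {-L..L}" for t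
      using that L by (auto simp: \<sigma>_def \<tau>_def field_simps)
    have \<sigma>\<tau>: "\<sigma> (\<tau> s) = s" for s using L by (simp add: \<sigma>_def \<tau>_def)
    have \<sigma>_deriv: "(\<sigma> has_real_derivative 1 / (2 * L)) (at t within A)" for t A
      unfolding \<sigma>_def[abs_def] using L by (auto intro!: derivative_eq_intros)
    have chain: "((\<lambda>t. f (\<sigma> t)) has_real_derivative f' (\<sigma> t) / (2 * L)) (at t within {-L..L})"
      if "\<And>s. 0 \<le> s \<Longrightarrow> s \<le> 1 \<Longrightarrow> (f has_real_derivative f' s) (at s within {0..1})" "t \<in> {-L..L}" for f f' t
    proof -
      have "(f has_real_derivative f' (\<sigma> t)) (at (\<sigma> t) within \<sigma> ` {-L..L})"
        using that(1)[of "\<sigma> t"] \<sigma>01 that(2) by (intro DERIV_subset[where s = "{0..1}" and t = "\<sigma> ` {-L..L}"]) auto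
      from DERIV_image_chain[OF this \<sigma>_deriv] show ?thesis by (simp add: comp_def)
    qed
    define u du a b where "u t = tr.U (fst x) (\<sigma> t)" and "du t = fn (fst x) (\<sigma> t) / (2 * L)"
      and "a t = tr.Aw (snd x) (\<sigma> t)" and "b t = B (\<sigma> t) / (2 * L)" for t
    have ode: "ode_on R' {-L..L} u du a b"
      unfolding ode_on_def
    proof (intro ballI conjI)
      fix t assume t: "t \<in> {-L..L}"
      show "(u has_real_derivative du t) (at t within {-L..L})"
        unfolding u_def du_def by (rule chain[OF d1 t])
      have "(du has_real_derivative tr.\<Theta>u (\<sigma> t) (u t) (a t) / (2 * L) / (2 * L)) (at t within {-L..L})"
        unfolding du_def u_def a_def by (intro DERIV_cdivide chain[OF d2 t])
      moreover have "tr.\<Theta>u (\<sigma> t) (u t) (a t) / (2 * L) / (2 * L) = (a t)\<^sup>2 * u t + exp (2 * t) * (u t - R' (u t))"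
        unfolding tr.\<Theta>u_def unfolding q_def m_def \<tau>\<sigma>[OF t] using L by (simp add: field_simps power2_eq_square)
      ultimately show "(du has_real_derivative (a t)\<^sup>2 * u t + exp (2 * t) * (u t - R' (u t))) (at t within {-L..L})" by simp
      have "(a has_real_derivative (\<eta> (\<sigma> t))\<^sup>2 * B (\<sigma> t) / (2 * L)) (at t within {-L..L})"
        unfolding a_def by (rule chain[OF d3 t])
      then show "(a has_real_derivative exp (2 * t) * b t) (at t within {-L..L})"
        by (simp add: \<eta>_def \<tau>\<sigma>[OF t] b_def exp_double)
      have "(b has_real_derivative tr.\<Theta>a (\<sigma> t) (u t) (a t) / (2 * L) / (2 * L)) (at t within {-L..L})"
        unfolding b_def u_def a_def by (intro DERIV_cdivide chain[OF d4 t])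
      moreover have "tr.\<Theta>a (\<sigma> t) (u t) (a t) / (2 * L) / (2 * L) = a t * (u t)\<^sup>2"
        unfolding tr.\<Theta>a_def unfolding q_def using L by (simp add: field_simps power2_eq_square)
      ultimately show "(b has_real_derivative a t * (u t)\<^sup>2) (at t within {-L..L})" by simp
    qed
    note cont = ode_on_cont[OF ode]
    have bc: "u (- L) = 0" "u L = 0" "a (- L) = \<kappa>" "b L = 0"
      using L d5 by (auto simp: u_def a_def b_def \<sigma>_def)
    obtain s where "s \<in> {0..1}" "tr.U (fst x) s \<noteq> 0" using nz by blast
    then have nzt: "\<exists>t\<in>{-L..L}. u t \<noteq> 0"
      by (intro bexI[of _ "\<tau> s"] \<tau>_range) (simp_all add: u_def \<sigma>\<tau>)
    define \<theta> where "\<theta> = 1/2 - 1/p"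
    have \<theta>: "0 \<le> \<theta>" "\<theta> \<le> 1/2" using tr.theta_pos p by (auto simp: \<theta>_def)
    let ?E = "\<lambda>t. (du t)\<^sup>2 + ((a t)\<^sup>2 * (u t)\<^sup>2 + exp (2 * t) * (u t)\<^sup>2)" and ?G = "\<lambda>t. exp (2 * t) * (b t)\<^sup>2"
    have cE: "continuous_on {-L..L} ?E" "continuous_on {-L..L} ?G" by (intro continuous_intros cont)+
    have e1: "(norm (fst x))\<^sup>2 + integral {0..1} (\<lambda>s. q * (tr.Aw (snd x) s)\<^sup>2 * (tr.U (fst x) s)\<^sup>2 + m s * (tr.U (fst x) s)\<^sup>2) = 2 * L * integral {-L..L} ?E"
    proof -
      have "(norm (fst x))\<^sup>2 + integral {0..1} (\<lambda>s. q * (tr.Aw (snd x) s)\<^sup>2 * (tr.U (fst x) s)\<^sup>2 + m s * (tr.U (fst x) s)\<^sup>2)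
        = integral {0..1} (\<lambda>s. (fn (fst x) s)\<^sup>2 + (q * (tr.Aw (snd x) s)\<^sup>2 * (tr.U (fst x) s)\<^sup>2 + m s * (tr.U (fst x) s)\<^sup>2))"
        unfolding norm_cfun_sq
        by (rule integral_add[symmetric]) (intro int_fn continuous_intros tr.cm)+
      also have "\<dots> = integral {0..1} (\<lambda>s. (2 * L)\<^sup>2 * ?E (\<tau> s))"
        using L by (intro integral_cong) (simp add: u_def du_def a_def \<sigma>\<tau> q_def m_def power_divide algebra_simps)
      also have "\<dots> = 2 * L * (integral {0..1} (\<lambda>s. ?E (\<tau> s)) * (2 * L))" by (simp add: power2_eq_square)
      finally show ?thesis unfolding subst[OF cE(1)] .
    qed
    have e2: "(norm (snd x))\<^sup>2 = 2 * L * integral {-L..L} ?G"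
    proof -
      have "(norm (snd x))\<^sup>2 = integral {0..1} (\<lambda>s. (2 * L)\<^sup>2 * ?G (\<tau> s))"
        unfolding norm_cfun_sq using L
        by (intro integral_cong) (simp add: d6 b_def \<sigma>\<tau> \<eta>_def power_divide exp_double power_mult_distrib)
      also have "\<dots> = 2 * L * (integral {0..1} (\<lambda>s. ?G (\<tau> s)) * (2 * L))" by (simp add: power2_eq_square)
      finally show ?thesis unfolding subst[OF cE(2)] .
    qed
    have G0: "0 \<le> integral {-L..L} ?G"
      by (intro integral_nonneg integrable_continuous_real cE) auto
    have "2 * L * (\<theta> * integral {-L..L} ?E + integral {-L..L} ?G / 2) \<le> 2 * L * (2 * T\<^sup>2 * C)"
      using en unfolding e1 e2 \<theta>_def[symmetric] by (simp add: algebra_simps)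
    then have "\<theta> * integral {-L..L} ?E + integral {-L..L} ?G / 2 \<le> 2 * T\<^sup>2 * C"
      using L by (subst (asm) mult_le_cancel_left_pos) auto
    moreover have "\<theta> * integral {-L..L} ?G \<le> 1/2 * integral {-L..L} ?G" using \<theta> G0 by (intro mult_right_mono)
    moreover have "integral {-L..L} (energy_density u du a b) = integral {-L..L} ?E + integral {-L..L} ?G"
      unfolding energy_density_def[abs_def]
      by (subst integral_add[symmetric]) (auto intro!: integrable_continuous_real cE simp: add.assoc)
    ultimately have "\<theta> * integral {-L..L} (energy_density u du a b) \<le> 2 * T\<^sup>2 * C" by (simp add: distrib_left)
    then show "\<exists>u du a b. ode_on R' {-L..L} u du a b \<and> u (- L) = 0 \<and> u L = 0 \<and> a (- L) = \<kappa> \<and> b L = 0 \<and>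
     (\<exists>t\<in>{-L..L}. u t \<noteq> 0) \<and> (1/2 - 1/p) * integral {-L..L} (energy_density u du a b) \<le> 2 * T\<^sup>2 * C"
      using ode bc nzt unfolding \<theta>_def by blast
  qed
qed

end

section \<open>Comparison of increments and second-order conditions at extrema\<close>

lemma deriv_bound_increment:
  fixes f g :: "real \<Rightarrow> real"
  assumes xy: "x \<le> y"
    and f: "\<And>t. x \<le> t \<Longrightarrow> t \<le> y \<Longrightarrow> (f has_real_derivative f' t) (at t within {x..y})"
    and g: "\<And>t. x \<le> t \<Longrightarrow> t \<le> y \<Longrightarrow> (g has_real_derivative g' t) (at t within {x..y})"
    and le: "\<And>t. x \<le> t \<Longrightarrow> t \<le> y \<Longrightarrow> \<bar>f' t\<bar> \<le> g' t"
  shows "\<bar>f y - f x\<bar> \<le> g y - g x"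
proof -
  have cf: "continuous_on {x..y} f" and cg: "continuous_on {x..y} g"
    by (auto simp: continuous_on_eq_continuous_within intro!: DERIV_continuous[OF f] DERIV_continuous[OF g])
  have at: "(f has_real_derivative f' t) (at t)" "(g has_real_derivative g' t) (at t)" if "x < t" "t < y" for t
    using f[of t] g[of t] that by (simp_all add: at_within_Icc_at)
  have "g x - f x \<le> g y - f y"
  proof (rule DERIV_nonneg_imp_increasing_open[OF xy, where f = "\<lambda>t. g t - f t"])
    fix t assume t: "x < t" "t < y"
    have "((\<lambda>t. g t - f t) has_real_derivative g' t - f' t) (at t)" using at[OF t] by (intro DERIV_diff)
    moreover have "0 \<le> g' t - f' t" using le[of t] t by auto
    ultimately show "\<exists>z. ((\<lambda>t. g t - f t) has_real_derivative z) (at t) \<and> 0 \<le> z" by blast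
  qed (intro continuous_intros cf cg)
  moreover have "g x + f x \<le> g y + f y"
  proof (rule DERIV_nonneg_imp_increasing_open[OF xy, where f = "\<lambda>t. g t + f t"])
    fix t assume t: "x < t" "t < y"
    have "((\<lambda>t. g t + f t) has_real_derivative g' t + f' t) (at t)" using at[OF t] by (intro DERIV_add)
    moreover have "0 \<le> g' t + f' t" using le[of t] t by auto
    ultimately show "\<exists>z. ((\<lambda>t. g t + f t) has_real_derivative z) (at t) \<and> 0 \<le> z" by blast
  qed (intro continuous_intros cf cg)
  ultimately show ?thesis by linarith
qed

lemma deriv_nonneg_increment:
  fixes f :: "real \<Rightarrow> real"
  assumes "x \<le> y" "\<And>t. x \<le> t \<Longrightarrow> t \<le> y \<Longrightarrow> (f has_real_derivative f' t) (at t within {x..y})"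
    and "\<And>t. x \<le> t \<Longrightarrow> t \<le> y \<Longrightarrow> 0 \<le> f' t"
  shows "f x \<le> f y"
  using deriv_bound_increment[of x y "\<lambda>_. 0" "\<lambda>_. 0" f f'] assms by simp

text \<open>The second derivative is required at the single point \<open>t\<close> only: were it
  negative, du would be negative just to the right of \<open>t\<close> and u would fall below its
  minimum.\<close>

lemma interior_minimum:
  fixes u :: "real \<Rightarrow> real"
  assumes t: "x < t" "t < y" and u: "\<And>s. x < s \<Longrightarrow> s < y \<Longrightarrow> (u has_real_derivative du s) (at s)"
    and du: "(du has_real_derivative D) (at t)" and min: "\<And>s. x < s \<Longrightarrow> s < y \<Longrightarrow> u t \<le> u s"
  shows "du t = 0" "0 \<le> D"
proof -
  define d where "d = min (t - x) (y - t)"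
  have d: "0 < d" "\<And>s. \<bar>t - s\<bar> < d \<Longrightarrow> x < s \<and> s < y" using t by (auto simp: d_def)
  show 0: "du t = 0" by (rule DERIV_local_min[OF u[OF t] d(1)]) (use d min in auto)
  show "0 \<le> D"
  proof (rule ccontr)
    assume "\<not> 0 \<le> D"
    then obtain e where e: "0 < e" "\<And>h. 0 < h \<Longrightarrow> h < e \<Longrightarrow> du (t + h) < du t"
      using DERIV_neg_dec_right[OF du] by auto
    define h where "h = min e d / 2"
    have h: "0 < h" "h < e" "h < d" using e d by (auto simp: h_def)
    have der: "(u has_real_derivative du s) (at s)" if "t \<le> s" "s \<le> t + h" for s
      using d(2)[of s] that h by (intro u) auto
    obtain z where z: "t < z" "z < t + h" "u (t + h) - u t = (t + h - t) * du z"
      using MVT2[of t "t + h" u du] der h by auto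
    have "du z < 0" using e(2)[of "z - t"] z h 0 by simp
    then have "(t + h - t) * du z < 0" using h by (intro mult_pos_neg) auto
    then have "u (t + h) < u t" using z by linarith
    moreover have "u t \<le> u (t + h)" using min[of "t + h"] d(2)[of "t + h"] h by auto
    ultimately show False by simp
  qed
qed

lemma interior_maximum:
  fixes u :: "real \<Rightarrow> real"
  assumes t: "x < t" "t < y" and u: "\<And>s. x < s \<Longrightarrow> s < y \<Longrightarrow> (u has_real_derivative du s) (at s)"
    and du: "(du has_real_derivative D) (at t)" and max: "\<And>s. x < s \<Longrightarrow> s < y \<Longrightarrow> u s \<le> u t"
  shows "du t = 0" "D \<le> 0"
  using interior_minimum[of x t y "\<lambda>s. - u s" "\<lambda>s. - du s" "- D"] t u du max by (auto intro!: derivative_intros)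

section \<open>Estimates independent of the interval\<close>

text \<open>Constants derived in this locale must not involve \<open>L\<close>, since it will tend
  to infinity; they are expressed through \<kappa>, \<open>E\<close>, \<open>c\<close> and
  \<open>p\<close>.\<close>

locale truncated_ode = nonlinearity +
  fixes \<kappa> E L :: real and u du a b :: "real \<Rightarrow> real"
  assumes \<kappa>: "0 < \<kappa>" and L: "1 \<le> L" and ode: "ode_on R' {-L..L} u du a b"
    and bc: "u (- L) = 0" "u L = 0" "a (- L) = \<kappa>" "b L = 0"
    and nontrivial: "\<exists>t\<in>{-L..L}. u t \<noteq> 0"
    and energy: "integral {-L..L} (energy_density u du a b) \<le> E"
begin

abbreviation "e \<equiv> energy_density u du a b"
definition "\<Phi> t = integral {-L..t} e"

lemmas cont = ode_on_cont[OF ode]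

lemma derivs:
  assumes "-L \<le> t" "t \<le> L"
  shows "(u has_real_derivative du t) (at t within {-L..L})"
    "(du has_real_derivative (a t)\<^sup>2 * u t + exp (2 * t) * (u t - R' (u t))) (at t within {-L..L})"
    "(a has_real_derivative exp (2 * t) * b t) (at t within {-L..L})"
    "(b has_real_derivative a t * (u t)\<^sup>2) (at t within {-L..L})"
  using ode assms unfolding ode_on_def by auto

lemma cont_e: "continuous_on {-L..L} e"
  unfolding energy_density_def[abs_def] by (intro continuous_intros cont)

lemma e_nonneg: "0 \<le> e t" by (simp add: energy_density_def)

lemma \<Phi>_deriv: "-L \<le> t \<Longrightarrow> t \<le> L \<Longrightarrow> (\<Phi> has_real_derivative e t) (at t within {-L..L})"
  unfolding \<Phi>_def[abs_def] by (rule integral_has_real_derivative[OF cont_e]) simp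

lemma \<Phi>_mono: "-L \<le> x \<Longrightarrow> x \<le> y \<Longrightarrow> y \<le> L \<Longrightarrow> \<Phi> x \<le> \<Phi> y"
  by (rule deriv_nonneg_increment[where f' = e]) (auto intro!: DERIV_subset[OF \<Phi>_deriv] e_nonneg)

lemma \<Phi>_range: "-L \<le> t \<Longrightarrow> t \<le> L \<Longrightarrow> 0 \<le> \<Phi> t \<and> \<Phi> t \<le> E"
  using \<Phi>_mono[of "-L" t] \<Phi>_mono[of t L] energy by (simp add: \<Phi>_def)

lemma E0: "0 \<le> E" using \<Phi>_range[of 0] L by auto

text \<open>Every estimate below compares a quantity with a multiple of the energy \<open>\<Phi>\<close>
  accumulated so far.\<close>

lemma increment_le_energy:
  assumes xy: "-L \<le> x" "x \<le> y" "y \<le> L"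
    and f: "\<And>t. x \<le> t \<Longrightarrow> t \<le> y \<Longrightarrow> (f has_real_derivative f' t) (at t within {-L..L})"
    and le: "\<And>t. x \<le> t \<Longrightarrow> t \<le> y \<Longrightarrow> \<bar>f' t\<bar> \<le> K * e t" and K: "0 \<le> K"
  shows "\<bar>f y - f x\<bar> \<le> K * E"
proof -
  have sub: "{x..y} \<subseteq> {-L..L}" using xy by auto
  have "\<bar>f y - f x\<bar> \<le> K * \<Phi> y - K * \<Phi> x"
  proof (rule deriv_bound_increment[OF xy(2), where g = "\<lambda>t. K * \<Phi> t" and f' = f' and g' = "\<lambda>t. K * e t"])
    fix t assume t: "x \<le> t" "t \<le> y"
    show "(f has_real_derivative f' t) (at t within {x..y})" by (rule DERIV_subset[OF f[OF t] sub])
    have "(\<Phi> has_real_derivative e t) (at t within {x..y})" by (rule DERIV_subset[OF \<Phi>_deriv sub]) (use t xy in auto)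
    then show "((\<lambda>t. K * \<Phi> t) has_real_derivative K * e t) (at t within {x..y})" by (rule DERIV_cmult)
  qed (use le in auto)
  also have "\<dots> = K * (\<Phi> y - \<Phi> x)" by (simp add: right_diff_distrib)
  also have "\<dots> \<le> K * E" using \<Phi>_range[of x] \<Phi>_range[of y] xy K by (intro mult_left_mono) auto
  finally show ?thesis .
qed

text \<open>(a b)' = e^(2t) b^2 + a^2 u^2 is nonnegative and b vanishes at the right end. As (a^2)'
  = 2 e^(2t) a b, this makes a^2 nonincreasing.\<close>

lemma ab_nonpos: assumes "-L \<le> t" "t \<le> L" shows "a t * b t \<le> 0"
proof -
  have "a t * b t \<le> a L * b L"
  proof (rule deriv_nonneg_increment[OF assms(2), where f' = "\<lambda>s. exp (2 * s) * (b s)\<^sup>2 + (a s)\<^sup>2 * (u s)\<^sup>2"])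
    fix s assume s: "t \<le> s" "s \<le> L"
    have "((\<lambda>s. a s * b s) has_real_derivative exp (2 * s) * b s * b s + a s * (u s)\<^sup>2 * a s) (at s within {-L..L})"
      using derivs(3,4)[of s] assms s by (intro DERIV_mult) auto
    then have "((\<lambda>s. a s * b s) has_real_derivative exp (2 * s) * (b s)\<^sup>2 + (a s)\<^sup>2 * (u s)\<^sup>2) (at s within {-L..L})"
      by (simp add: power2_eq_square mult_ac)
    then show "((\<lambda>s. a s * b s) has_real_derivative exp (2 * s) * (b s)\<^sup>2 + (a s)\<^sup>2 * (u s)\<^sup>2) (at s within {t..L})"
      by (rule DERIV_subset) (use assms in auto)
  qed simp
  then show ?thesis using bc by simp
qed

lemma a_sq_antimono: assumes "-L \<le> x" "x \<le> y" "y \<le> L" shows "(a y)\<^sup>2 \<le> (a x)\<^sup>2"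
proof -
  have "- (a x)\<^sup>2 \<le> - (a y)\<^sup>2"
  proof (rule deriv_nonneg_increment[OF assms(2), where f' = "\<lambda>s. - (2 * exp (2 * s) * (a s * b s))"])
    fix s assume s: "x \<le> s" "s \<le> y"
    have "((\<lambda>s. - (a s)\<^sup>2) has_real_derivative - (2 * exp (2 * s) * (a s * b s))) (at s within {-L..L})"
      using derivs(3)[of s] assms s by (auto intro!: derivative_eq_intros)
    then show "((\<lambda>s. - (a s)\<^sup>2) has_real_derivative - (2 * exp (2 * s) * (a s * b s))) (at s within {x..y})"
      by (rule DERIV_subset) (use assms in auto)
    show "0 \<le> - (2 * exp (2 * s) * (a s * b s))" using ab_nonpos[of s] s assms by (simp add: mult_nonneg_nonpos)
  qed
  then show ?thesis by simp
qed

lemma a_le: assumes "-L \<le> t" "t \<le> L" shows "\<bar>a t\<bar> \<le> \<kappa>"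
  using a_sq_antimono[of "-L" t] assms bc \<kappa> abs_le_square_iff[of "a t" \<kappa>] by simp

text \<open>Young's inequality with parameter e^t: e^(2s) |b| is at most half the sum of e^(-t)
  e^(2s) and e^t times the energy density. Integrated up to t, the first part gives at most e^t / 4
  and the second at most E e^t / 2.\<close>

lemma a_near: assumes t: "-L \<le> t" "t \<le> L" shows "\<bar>a t - \<kappa>\<bar> \<le> (1 / 4 + E / 2) * exp t"
proof -
  have sub: "{-L..t} \<subseteq> {-L..L}" using t by auto
  let ?g = "\<lambda>s. exp (- t) * exp (2 * s) / 4 + exp t * \<Phi> s / 2"
  have "\<bar>a t - a (- L)\<bar> \<le> ?g t - ?g (- L)"
  proof (rule deriv_bound_increment[OF t(1), where f' = "\<lambda>s. exp (2 * s) * b s" and g = ?g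
      and g' = "\<lambda>s. exp (- t) * exp (2 * s) / 2 + exp t * e s / 2"])
    fix s assume s: "- L \<le> s" "s \<le> t"
    show "(a has_real_derivative exp (2 * s) * b s) (at s within {-L..t})"
      by (rule DERIV_subset[OF derivs(3) sub]) (use s t in auto)
    have "(\<Phi> has_real_derivative e s) (at s within {-L..t})"
      by (rule DERIV_subset[OF \<Phi>_deriv sub]) (use s t in auto)
    then show "(?g has_real_derivative exp (- t) * exp (2 * s) / 2 + exp t * e s / 2) (at s within {-L..t})"
      by (auto intro!: derivative_eq_intros)
    have "exp (2 * s) * (b s)\<^sup>2 \<le> e s" by (simp add: energy_density_def)
    then have 1: "exp t * (exp (2 * s) * (b s)\<^sup>2) \<le> exp t * e s" by (intro mult_left_mono) auto
    have "0 \<le> exp (2 * s) * (exp (- t) * (1 - exp t * \<bar>b s\<bar>)\<^sup>2)" by simp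
    also have "\<dots> = exp (2 * s) * exp (- t) - 2 * (exp (2 * s) * \<bar>b s\<bar>) * (exp t * exp (- t)) + exp t * (exp (2 * s) * (b s)\<^sup>2) * (exp t * exp (- t))"
      by (simp add: power2_eq_square algebra_simps abs_mult_self_eq)
    also have "exp t * exp (- t) = 1" by (simp add: exp_minus)
    finally have "2 * (exp (2 * s) * \<bar>b s\<bar>) \<le> exp (- t) * exp (2 * s) + exp t * e s"
      using 1 unfolding mult_1_right mult.commute[of "exp (2 * s)" "exp (- t)"] by linarith
    then show "\<bar>exp (2 * s) * b s\<bar> \<le> exp (- t) * exp (2 * s) / 2 + exp t * e s / 2"
      by (simp add: abs_mult)
  qed
  also have "\<dots> \<le> ?g t"
  proof -
    have "0 \<le> ?g (- L)" using \<Phi>_range[of "-L"] L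
      by (intro add_nonneg_nonneg divide_nonneg_nonneg mult_nonneg_nonneg) auto
    then show ?thesis by simp
  qed
  also have "\<dots> \<le> exp t / 4 + exp t * E / 2"
  proof -
    have "exp (- t) * exp (2 * t) = exp t" by (simp add: exp_add[symmetric])
    moreover have "exp t * \<Phi> t \<le> exp t * E" using \<Phi>_range[OF t] by (intro mult_left_mono) auto
    ultimately show ?thesis by simp
  qed
  finally show ?thesis using bc by (simp add: algebra_simps)
qed

lemma u_sq_deriv: "-L \<le> t \<Longrightarrow> t \<le> L \<Longrightarrow> ((\<lambda>t. (u t)\<^sup>2) has_real_derivative 2 * u t * du t) (at t within {-L..L})"
  using derivs(1)[of t] by (auto intro!: derivative_eq_intros)

text \<open>(u^2)' = 2 u u', and the energy density dominates 2 e^s |u u'|; integrate from t to the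
  right end, where u = 0.\<close>

lemma u_decay: assumes t: "-L \<le> t" "t \<le> L" shows "(u t)\<^sup>2 \<le> exp (- t) * E"
proof -
  have "\<bar>(u L)\<^sup>2 - (u t)\<^sup>2\<bar> \<le> exp (- t) * E"
  proof (rule increment_le_energy[OF t order_refl, where f = "\<lambda>t. (u t)\<^sup>2" and f' = "\<lambda>s. 2 * u s * du s"])
    fix s assume s: "t \<le> s" "s \<le> L"
    show "((\<lambda>t. (u t)\<^sup>2) has_real_derivative 2 * u s * du s) (at s within {-L..L})" using s t by (intro u_sq_deriv) auto
    have "2 * (exp s * \<bar>u s\<bar>) * \<bar>du s\<bar> \<le> (exp s * \<bar>u s\<bar>)\<^sup>2 + \<bar>du s\<bar>\<^sup>2"
      using sum_squares_bound[of "exp s * \<bar>u s\<bar>" "\<bar>du s\<bar>"] by simp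
    also have "\<dots> \<le> e s" by (simp add: energy_density_def power_mult_distrib exp_double)
    finally have 1: "2 * (exp s * \<bar>u s\<bar>) * \<bar>du s\<bar> \<le> e s" .
    have "exp t * (2 * \<bar>u s\<bar> * \<bar>du s\<bar>) \<le> exp s * (2 * \<bar>u s\<bar> * \<bar>du s\<bar>)" using s by (intro mult_right_mono) auto
    then have "exp t * \<bar>2 * u s * du s\<bar> \<le> e s" using 1 by (simp add: abs_mult mult_ac)
    then have "exp (- t) * (exp t * \<bar>2 * u s * du s\<bar>) \<le> exp (- t) * e s" by (intro mult_left_mono) auto
    then show "\<bar>2 * u s * du s\<bar> \<le> exp (- t) * e s" by (simp add: mult.assoc[symmetric] exp_add[symmetric])
  qed simp
  then show ?thesis using bc by simp
qed

lemma b_decay: assumes t: "-L \<le> t" "t \<le> L" shows "\<bar>b t\<bar> \<le> \<kappa> * E * exp (- (2 * t))"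
proof -
  have "\<bar>b L - b t\<bar> \<le> \<kappa> * exp (- (2 * t)) * E"
  proof (rule increment_le_energy[OF t order_refl derivs(4)])
    fix s assume s: "t \<le> s" "s \<le> L"
    have "exp (2 * t) * (u s)\<^sup>2 \<le> exp (2 * s) * (u s)\<^sup>2" using s by (intro mult_right_mono) auto
    also have "\<dots> \<le> e s" by (simp add: energy_density_def)
    finally have "exp (- (2 * t)) * (exp (2 * t) * (u s)\<^sup>2) \<le> exp (- (2 * t)) * e s" by (intro mult_left_mono) auto
    then have "(u s)\<^sup>2 \<le> exp (- (2 * t)) * e s" by (simp add: mult.assoc[symmetric] exp_add[symmetric])
    then have "\<bar>a s\<bar> * (u s)\<^sup>2 \<le> \<kappa> * (exp (- (2 * t)) * e s)" using a_le[of s] s t \<kappa> by (intro mult_mono) auto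
    then show "\<bar>a s * (u s)\<^sup>2\<bar> \<le> \<kappa> * exp (- (2 * t)) * e s" by (simp add: abs_mult)
  qed (use t \<kappa> in auto)
  then show ?thesis using bc by (simp add: mult_ac)
qed

text \<open>To the left of the given position a is still at least \<kappa> / 2, so a^2 u^2 in the
  energy controls u^2 where the weight e^(2t) is too small; integrate from the left end, where u =
  0.\<close>

lemma u_bounded_left:
  assumes t: "-L \<le> t" "t \<le> L" and near: "(1 / 4 + E / 2) * exp t \<le> \<kappa> / 2"
  shows "(u t)\<^sup>2 \<le> (4 / \<kappa>\<^sup>2 + 1) * E"
proof -
  have "\<bar>(u t)\<^sup>2 - (u (- L))\<^sup>2\<bar> \<le> (4 / \<kappa>\<^sup>2 + 1) * E"
  proof (rule increment_le_energy[OF order_refl t, where f = "\<lambda>t. (u t)\<^sup>2" and f' = "\<lambda>s. 2 * u s * du s"])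
    fix s assume s: "-L \<le> s" "s \<le> t"
    show "((\<lambda>t. (u t)\<^sup>2) has_real_derivative 2 * u s * du s) (at s within {-L..L})" using s t by (intro u_sq_deriv) auto
    have "(1 / 4 + E / 2) * exp s \<le> (1 / 4 + E / 2) * exp t" using s E0 by (intro mult_left_mono) auto
    then have "\<kappa> / 2 \<le> a s" using a_near[of s] near s t by linarith
    then have "(\<kappa> / 2)\<^sup>2 \<le> (a s)\<^sup>2" using \<kappa> by (intro power_mono) auto
    then have "(\<kappa> / 2)\<^sup>2 * (u s)\<^sup>2 \<le> (a s)\<^sup>2 * (u s)\<^sup>2" by (intro mult_right_mono) auto
    also have "\<dots> \<le> e s" by (simp add: energy_density_def)
    finally have "(u s)\<^sup>2 \<le> 4 / \<kappa>\<^sup>2 * e s" using \<kappa> by (simp add: field_simps)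
    moreover have "(du s)\<^sup>2 \<le> e s" by (simp add: energy_density_def)
    moreover have "\<bar>2 * u s * du s\<bar> \<le> (u s)\<^sup>2 + (du s)\<^sup>2"
      using sum_squares_bound[of "\<bar>u s\<bar>" "\<bar>du s\<bar>"] by (simp add: abs_mult)
    ultimately show "\<bar>2 * u s * du s\<bar> \<le> (4 / \<kappa>\<^sup>2 + 1) * e s" by (simp add: distrib_right)
  qed simp
  then show ?thesis using bc by simp
qed

lemma at_interior:
  assumes "-L < t" "t < L"
  shows "(u has_real_derivative du t) (at t)"
    "(du has_real_derivative (a t)\<^sup>2 * u t + exp (2 * t) * (u t - R' (u t))) (at t)"
  using derivs[of t] assms by (simp_all add: at_within_Icc_at)

text \<open>At a negative minimum the term with \<open>R'\<close> vanishes and the equation makes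
  u'' negative.\<close>

lemma u_nonneg: assumes t: "-L \<le> t" "t \<le> L" shows "0 \<le> u t"
proof (rule ccontr)
  assume neg: "\<not> 0 \<le> u t"
  obtain x where x: "x \<in> {-L..L}" "\<And>s. s \<in> {-L..L} \<Longrightarrow> u x \<le> u s"
    using continuous_attains_inf[of "{-L..L}" u] cont(1) L by auto
  have ux: "u x < 0" using x(2)[of t] t neg by auto
  then have xi: "-L < x" "x < L" using x(1) bc by (auto simp: less_le)
  have "0 \<le> (a x)\<^sup>2 * u x + exp (2 * x) * (u x - R' (u x))"
    by (rule interior_minimum(2)[OF xi at_interior(1) at_interior(2)[OF xi]]) (use x(2) in auto)
  moreover have "(a x)\<^sup>2 * u x \<le> 0" "exp (2 * x) * u x < 0" using ux by (auto simp: mult_nonneg_nonpos mult_pos_neg)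
  ultimately show False using R'_neg[of "u x"] ux by simp
qed

text \<open>The quantity \<open>?H\<close> decreases from the maximum to the right end, where it is
  nonnegative. At the maximum it equals R(M) - M^2 / 2, so M^2 / 2 \<le> R(M) \<le> c M^p bounds M
  from below. The second conclusion is the equation at the maximum, kept for locating it.\<close>

lemma maximum:
  obtains x where "-L < x" "x < L" "(1 / (2 * c)) powr (1 / (p - 2)) \<le> u x" "(a x)\<^sup>2 * u x \<le> exp (2 * x) * R' (u x)"
proof -
  obtain x where x: "x \<in> {-L..L}" "\<And>s. s \<in> {-L..L} \<Longrightarrow> u s \<le> u x"
    using continuous_attains_sup[of "{-L..L}" u] cont(1) L by auto
  obtain z where z: "z \<in> {-L..L}" "u z \<noteq> 0" using nontrivial by blast
  define M where "M = u x"
  have M0: "0 < M" using x(2)[OF z(1)] u_nonneg[of z] z unfolding M_def by auto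
  then have xi: "-L < x" "x < L" using x(1) bc by (auto simp: less_le M_def)
  note max = interior_maximum[OF xi at_interior(1) at_interior(2)[OF xi]]
  have dux: "du x = 0" and D: "(a x)\<^sup>2 * u x + exp (2 * x) * (u x - R' (u x)) \<le> 0"
    by (rule max; use x(2) in auto)+
  have "0 < exp (2 * x) * u x" using M0 by (simp add: M_def)
  then have aR: "(a x)\<^sup>2 * u x \<le> exp (2 * x) * R' (u x)" using D unfolding right_diff_distrib by linarith
  \<comment> \<open>The mechanical energy of u multiplied by e^(-2s), plus M^2 e^(-2s) a^2 / 2. The
    addition replaces -u^2 by M^2 - u^2 in front of the terms with a; this is nonnegative by the
    choice of M, and a b \<le> 0 does the rest.\<close>
  let ?H = "\<lambda>s. exp (- (2 * s)) * ((du s)\<^sup>2 - (a s)\<^sup>2 * (u s)\<^sup>2) / 2 - (u s)\<^sup>2 / 2 + R (u s) + M\<^sup>2 * (exp (- (2 * s)) * (a s)\<^sup>2) / 2"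
  have "- ?H x \<le> - ?H L"
  proof (rule deriv_nonneg_increment[where f = "\<lambda>s. - ?H s" and f' = "\<lambda>s. exp (- (2 * s)) * (du s)\<^sup>2 + exp (- (2 * s)) * ((a s)\<^sup>2 - exp (2 * s) * (a s * b s)) * (M\<^sup>2 - (u s)\<^sup>2)"])
    fix s assume s: "x \<le> s" "s \<le> L"
    then have sL: "-L \<le> s" "s \<le> L" using xi by auto
    have ee: "exp (- (2 * s)) * exp (2 * s) = 1" by (simp add: exp_minus)
    let ?W = "at s within {-L..L}"
    let ?ddu = "(a s)\<^sup>2 * u s + exp (2 * s) * (u s - R' (u s))"
    have dR: "((\<lambda>s. R (u s)) has_real_derivative R' (u s) * du s) ?W"
      by (rule DERIV_chain'[OF derivs(1)[OF sL] R_deriv])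
    have dE: "((\<lambda>s. exp (- (2 * s))) has_real_derivative - 2 * exp (- (2 * s))) ?W" by (auto intro!: derivative_eq_intros)
    have d1: "((\<lambda>s. (du s)\<^sup>2 - (a s)\<^sup>2 * (u s)\<^sup>2) has_real_derivative
        2 * du s * ?ddu - (2 * a s * (exp (2 * s) * b s) * (u s)\<^sup>2 + (a s)\<^sup>2 * (2 * u s * du s))) ?W"
      by (rule derivative_eq_intros derivs[OF sL] refl)+ (simp add: algebra_simps)
    have d2: "((\<lambda>s. (a s)\<^sup>2) has_real_derivative 2 * a s * (exp (2 * s) * b s)) ?W"
      by (rule derivative_eq_intros derivs[OF sL] refl)+ simp
    have "((\<lambda>s. - ?H s) has_real_derivative
       - ((- 2 * exp (- (2 * s)) * ((du s)\<^sup>2 - (a s)\<^sup>2 * (u s)\<^sup>2)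
          + (2 * du s * ?ddu - (2 * a s * (exp (2 * s) * b s) * (u s)\<^sup>2 + (a s)\<^sup>2 * (2 * u s * du s))) * exp (- (2 * s))) / 2
         - 2 * u s * du s / 2 + R' (u s) * du s
         + M\<^sup>2 * (- 2 * exp (- (2 * s)) * (a s)\<^sup>2 + 2 * a s * (exp (2 * s) * b s) * exp (- (2 * s))) / 2)) ?W"
      by (intro DERIV_minus DERIV_add DERIV_diff DERIV_cdivide DERIV_cmult DERIV_mult d1 d2 dE dR u_sq_deriv sL)
    moreover have "- ((- 2 * exp (- (2 * s)) * ((du s)\<^sup>2 - (a s)\<^sup>2 * (u s)\<^sup>2)
          + (2 * du s * ?ddu - (2 * a s * (exp (2 * s) * b s) * (u s)\<^sup>2 + (a s)\<^sup>2 * (2 * u s * du s))) * exp (- (2 * s))) / 2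
         - 2 * u s * du s / 2 + R' (u s) * du s
         + M\<^sup>2 * (- 2 * exp (- (2 * s)) * (a s)\<^sup>2 + 2 * a s * (exp (2 * s) * b s) * exp (- (2 * s))) / 2)
       = exp (- (2 * s)) * (du s)\<^sup>2 + exp (- (2 * s)) * ((a s)\<^sup>2 - exp (2 * s) * (a s * b s)) * (M\<^sup>2 - (u s)\<^sup>2)
         + (1 - exp (- (2 * s)) * exp (2 * s)) * (du s * (u s - R' (u s)))"
      by (simp add: field_simps power2_eq_square)
    ultimately have "((\<lambda>s. - ?H s) has_real_derivative exp (- (2 * s)) * (du s)\<^sup>2 + exp (- (2 * s)) * ((a s)\<^sup>2 - exp (2 * s) * (a s * b s)) * (M\<^sup>2 - (u s)\<^sup>2)) ?W"
      using ee by simp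
    then show "((\<lambda>s. - ?H s) has_real_derivative exp (- (2 * s)) * (du s)\<^sup>2 + exp (- (2 * s)) * ((a s)\<^sup>2 - exp (2 * s) * (a s * b s)) * (M\<^sup>2 - (u s)\<^sup>2)) (at s within {x..L})"
      by (rule DERIV_subset) (use xi in auto)
    have "(u s)\<^sup>2 \<le> M\<^sup>2" using x(2)[of s] u_nonneg[OF sL] sL by (intro power_mono) (auto simp: M_def)
    moreover have "exp (2 * s) * (a s * b s) \<le> 0" using ab_nonpos[OF sL] by (simp add: mult_nonneg_nonpos)
    ultimately show "0 \<le> exp (- (2 * s)) * (du s)\<^sup>2 + exp (- (2 * s)) * ((a s)\<^sup>2 - exp (2 * s) * (a s * b s)) * (M\<^sup>2 - (u s)\<^sup>2)"
      by (intro add_nonneg_nonneg mult_nonneg_nonneg) (auto intro: order_trans[OF _ zero_le_power2])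
  qed (use xi in auto)
  moreover have "0 \<le> ?H L" using bc R0 by simp
  moreover have "?H x = R M - M\<^sup>2 / 2" using dux by (simp add: M_def field_simps)
  ultimately have "M\<^sup>2 / 2 \<le> R M" by linarith
  also have "\<dots> \<le> c * M powr p" using R_le[of M] M0 by simp
  finally have "M\<^sup>2 / 2 \<le> c * (M powr (p - 2) * M\<^sup>2)" using M0 powr_add[of M "p - 2" 2] by simp
  then have "M\<^sup>2 * 1 \<le> M\<^sup>2 * (2 * c * M powr (p - 2))" by (simp add: mult_ac)
  then have "1 \<le> 2 * c * M powr (p - 2)" using M0 by (subst (asm) mult_le_cancel_left_pos) auto
  then have "1 / (2 * c) \<le> M powr (p - 2)" using c by (simp add: field_simps)
  then have "(1 / (2 * c)) powr (1 / (p - 2)) \<le> (M powr (p - 2)) powr (1 / (p - 2))" using c p by (intro powr_mono2) auto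
  also have "\<dots> = M" using p M0 by (simp add: powr_powr)
  finally show thesis using that[OF xi _ aR] by (simp add: M_def)
qed

end

section \<open>The limit on the whole line\<close>

text \<open>The bounds on [-T, T] hold only for large n because the intervals of definition grow. A
  diagonal sequence converges on the rationals, and the local Lipschitz bounds extend the
  convergence to every point. Pointwise convergence suffices later, through dominated
  convergence.\<close>

lemma local_arzela_ascoli:
  fixes f :: "nat \<Rightarrow> real \<Rightarrow> real"
  assumes loc: "\<And>T. \<exists>K. \<forall>\<^sub>F n in sequentially. \<forall>x\<in>{-T..T}. \<bar>f n x\<bar> \<le> K \<and> (\<forall>y\<in>{-T..T}. \<bar>f n x - f n y\<bar> \<le> K * \<bar>x - y\<bar>)"
  obtains k g where "strict_mono (k :: nat \<Rightarrow> nat)" "\<And>t. (\<lambda>n. f (k n) t) \<longlonglongrightarrow> g t" "continuous_on UNIV g"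
proof -
  have "\<exists>B>0. \<forall>n. \<bar>f n x\<bar> \<le> B" for x
  proof -
    obtain K where "\<forall>\<^sub>F n in sequentially. \<forall>z\<in>{-\<bar>x\<bar>..\<bar>x\<bar>}. \<bar>f n z\<bar> \<le> K \<and> (\<forall>y\<in>{-\<bar>x\<bar>..\<bar>x\<bar>}. \<bar>f n z - f n y\<bar> \<le> K * \<bar>z - y\<bar>)"
      using loc[of "\<bar>x\<bar>"] by blast
    then have "\<forall>\<^sub>F n in sequentially. norm (f n x) \<le> K"
      by eventually_elim (drule bspec[of _ _ x], auto)
    then have "Bseq (\<lambda>n. f n x)" by (rule BfunI)
    then show ?thesis unfolding Bseq_def by auto
  qed
  then obtain B where B: "\<And>x. 0 < B x" "\<And>x n. \<bar>f n x\<bar> \<le> B x" by metis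
  \<comment> \<open>Dividing by \<open>B x\<close> normalises the pointwise bounds to the common
    bound 1.\<close>
  obtain k where k: "strict_mono (k :: nat \<Rightarrow> nat)" and conv: "\<And>x. x \<in> \<rat> \<Longrightarrow> \<exists>l. (\<lambda>n. f (k n) x / B x) \<longlonglongrightarrow> l"
    using function_convergent_subsequence[OF countable_rat, of "\<lambda>n x. f n x / B x" 1] B
    by (auto simp: divide_le_eq less_imp_le)
  have convQ: "convergent (\<lambda>n. f (k n) r)" if rQ: "r \<in> \<rat>" for r
  proof -
    obtain l where "(\<lambda>n. f (k n) r / B r) \<longlonglongrightarrow> l" using conv[OF rQ] by blast
    from tendsto_mult_right[OF this, of "B r"] show ?thesis
      using B(1)[of r] by (auto simp: convergent_def)
  qed
  have lip: "\<exists>K\<ge>0. \<forall>\<^sub>F n in sequentially. \<forall>x\<in>{-T..T}. \<forall>y\<in>{-T..T}. \<bar>f (k n) x - f (k n) y\<bar> \<le> K * \<bar>x - y\<bar>" for T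
  proof -
    obtain K where K: "\<forall>\<^sub>F n in sequentially. \<forall>x\<in>{-T..T}. \<bar>f n x\<bar> \<le> K \<and> (\<forall>y\<in>{-T..T}. \<bar>f n x - f n y\<bar> \<le> K * \<bar>x - y\<bar>)"
      using loc by blast
    have "\<forall>\<^sub>F n in sequentially. \<forall>x\<in>{-T..T}. \<forall>y\<in>{-T..T}. \<bar>f (k n) x - f (k n) y\<bar> \<le> \<bar>K\<bar> * \<bar>x - y\<bar>"
      using eventually_subseq[OF k K]
    proof eventually_elim
      case (elim n)
      have "K * \<bar>x - y\<bar> \<le> \<bar>K\<bar> * \<bar>x - y\<bar>" for x y :: real by (intro mult_right_mono) auto
      then show ?case using elim by (meson order_trans)
    qed
    then show ?thesis by (intro exI[of _ "\<bar>K\<bar>"]) auto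
  qed
  have "convergent (\<lambda>n. f (k n) t)" for t
  proof -
    obtain K where K: "0 \<le> K" "\<forall>\<^sub>F n in sequentially. \<forall>x\<in>{-(\<bar>t\<bar>+1)..\<bar>t\<bar>+1}. \<forall>y\<in>{-(\<bar>t\<bar>+1)..\<bar>t\<bar>+1}. \<bar>f (k n) x - f (k n) y\<bar> \<le> K * \<bar>x - y\<bar>"
      using lip[of "\<bar>t\<bar> + 1"] by blast
    have "Cauchy (\<lambda>n. f (k n) t)"
    proof (rule metric_CauchyI)
      fix e :: real assume e: "0 < e"
      define d where "d = min 1 (e / (3 * (K + 1)))"
      have d: "0 < d" using e K by (simp add: d_def)
      obtain r where r: "r \<in> \<rat>" "t < r" "r < t + d" using Rats_dense_in_real[of t "t + d"] d by auto
      have Kd: "K * \<bar>t - r\<bar> < e / 3"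
      proof -
        have "K * \<bar>t - r\<bar> \<le> K * (e / (3 * (K + 1)))" using r K by (intro mult_left_mono) (auto simp: d_def)
        also have "\<dots> < e / 3" using K e by (simp add: field_simps)
        finally show ?thesis .
      qed
      obtain N1 where N1: "\<And>n. n \<ge> N1 \<Longrightarrow> \<bar>f (k n) t - f (k n) r\<bar> \<le> K * \<bar>t - r\<bar>"
      proof -
        have "d \<le> 1" by (simp add: d_def)
        then have "t \<in> {-(\<bar>t\<bar>+1)..\<bar>t\<bar>+1}" "r \<in> {-(\<bar>t\<bar>+1)..\<bar>t\<bar>+1}" using r by auto
        then show thesis using K(2) that unfolding eventually_sequentially by blast
      qed
      obtain N2 where N2: "\<And>m n. m \<ge> N2 \<Longrightarrow> n \<ge> N2 \<Longrightarrow> dist (f (k m) r) (f (k n) r) < e / 3"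
        using metric_CauchyD[OF convergent_Cauchy[OF convQ[OF r(1)]], of "e / 3"] e by auto
      show "\<exists>M. \<forall>m\<ge>M. \<forall>n\<ge>M. dist (f (k m) t) (f (k n) t) < e"
      proof (intro exI[of _ "max N1 N2"] allI impI)
        fix m n assume "max N1 N2 \<le> m" "max N1 N2 \<le> n"
        then show "dist (f (k m) t) (f (k n) t) < e"
          using N1[of m] N1[of n] N2[of m n] Kd unfolding dist_real_def by (auto simp: abs_if split: if_splits)
      qed
    qed
    then show ?thesis by (rule Cauchy_convergent)
  qed
  then obtain g where g: "\<And>t. (\<lambda>n. f (k n) t) \<longlonglongrightarrow> g t" unfolding convergent_def by metis
  have "isCont g t" for t
  proof -
    let ?T = "\<bar>t\<bar> + 1"
    obtain K where K: "0 \<le> K" "\<forall>\<^sub>F n in sequentially. \<forall>x\<in>{-?T..?T}. \<forall>y\<in>{-?T..?T}. \<bar>f (k n) x - f (k n) y\<bar> \<le> K * \<bar>x - y\<bar>"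
      using lip[of ?T] by blast
    have gl: "\<bar>g x - g y\<bar> \<le> K * \<bar>x - y\<bar>" if "x \<in> {-?T..?T}" "y \<in> {-?T..?T}" for x y
    proof (rule tendsto_upperbound)
      show "(\<lambda>n. \<bar>f (k n) x - f (k n) y\<bar>) \<longlonglongrightarrow> \<bar>g x - g y\<bar>" by (intro tendsto_intros g)
      show "\<forall>\<^sub>F n in sequentially. \<bar>f (k n) x - f (k n) y\<bar> \<le> K * \<bar>x - y\<bar>"
        using K(2) by eventually_elim (use that in auto)
    qed simp
    have "((\<lambda>x. g x - g t) \<longlongrightarrow> 0) (at t)"
    proof (rule Lim_null_comparison)
      show "\<forall>\<^sub>F x in at t. norm (g x - g t) \<le> K * \<bar>x - t\<bar>"
        unfolding eventually_at
      proof (intro exI[of _ 1] conjI ballI impI)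
        fix x assume "x \<noteq> t \<and> dist x t < 1"
        then have "\<bar>x - t\<bar> < 1" by (simp add: dist_real_def)
        then have "x \<in> {-?T..?T}" "t \<in> {-?T..?T}" by auto
        then show "norm (g x - g t) \<le> K * \<bar>x - t\<bar>" using gl by simp
      qed simp
      show "((\<lambda>x. K * \<bar>x - t\<bar>) \<longlongrightarrow> 0) (at t)" by (auto intro!: tendsto_eq_intros)
    qed
    then show ?thesis unfolding isCont_def by (simp add: LIM_zero_iff)
  qed
  then have "continuous_on UNIV g" by (simp add: continuous_at_imp_continuous_on)
  then show thesis using that k g by blast
qed

lemma integral_tendsto_bounded:
  fixes G :: "nat \<Rightarrow> real \<Rightarrow> real"
  assumes G: "\<forall>\<^sub>F n in sequentially. continuous_on {x..y} (G n) \<and> (\<forall>t\<in>{x..y}. \<bar>G n t\<bar> \<le> K)"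
    and conv: "\<And>t. t \<in> {x..y} \<Longrightarrow> (\<lambda>n. G n t) \<longlonglongrightarrow> g t"
  shows "(\<lambda>n. integral {x..y} (G n)) \<longlonglongrightarrow> integral {x..y} g"
proof -
  obtain N where N: "\<And>n. n \<ge> N \<Longrightarrow> continuous_on {x..y} (G n)" "\<And>n t. n \<ge> N \<Longrightarrow> t \<in> {x..y} \<Longrightarrow> \<bar>G n t\<bar> \<le> K"
    using G unfolding eventually_sequentially by blast
  have "(\<lambda>n. integral {x..y} (G (n + N))) \<longlonglongrightarrow> integral {x..y} g"
  proof (rule dominated_convergence(2)[where h = "\<lambda>_. K"])
    show "G (n + N) integrable_on {x..y}" for n by (intro integrable_continuous_real N) simp
    show "(\<lambda>n. G (n + N) t) \<longlonglongrightarrow> g t" if "t \<in> {x..y}" for t by (rule LIMSEQ_ignore_initial_segment[OF conv[OF that]])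
  qed (use N in auto)
  then show ?thesis by (rule LIMSEQ_offset)
qed

text \<open>Passing to the limit in F(x) - F(-T) = integral of G needs only bounded pointwise
  convergence; continuity of the limit \<open>g\<close> then allows differentiation.\<close>

lemma deriv_limit:
  fixes F G :: "nat \<Rightarrow> real \<Rightarrow> real"
  assumes F: "\<forall>\<^sub>F n in sequentially. \<forall>t\<in>{-T..T}. (F n has_real_derivative G n t) (at t within {-T..T})"
    and G: "\<forall>\<^sub>F n in sequentially. continuous_on {-T..T} (G n) \<and> (\<forall>t\<in>{-T..T}. \<bar>G n t\<bar> \<le> K)"
    and cF: "\<And>t. t \<in> {-T..T} \<Longrightarrow> (\<lambda>n. F n t) \<longlonglongrightarrow> f t" and cG: "\<And>t. t \<in> {-T..T} \<Longrightarrow> (\<lambda>n. G n t) \<longlonglongrightarrow> g t"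
    and g: "continuous_on {-T..T} g" and t: "- T < t" "t < T"
  shows "(f has_real_derivative g t) (at t)"
proof -
  have fe: "f x = f (- T) + integral {-T..x} g" if x: "x \<in> {-T..T}" for x
  proof -
    have sub: "{-T..x} \<subseteq> {-T..T}" using x by auto
    have "(\<lambda>n. integral {-T..x} (G n)) \<longlonglongrightarrow> integral {-T..x} g"
    proof (rule integral_tendsto_bounded)
      show "\<forall>\<^sub>F n in sequentially. continuous_on {-T..x} (G n) \<and> (\<forall>t\<in>{-T..x}. \<bar>G n t\<bar> \<le> K)"
        using G by eventually_elim (use sub in \<open>auto intro: continuous_on_subset\<close>)
    qed (use cG sub in auto)
    moreover have "\<forall>\<^sub>F n in sequentially. integral {-T..x} (G n) = F n x - F n (- T)"
      using F
    proof eventually_elim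
      case (elim n)
      have "(F n has_real_derivative G n z) (at z within {-T..x})" if "z \<in> {-T..x}" for z
        using DERIV_subset[OF _ sub] bspec[OF elim, of z] that sub by blast
      then have "(G n has_integral (F n x - F n (- T))) {-T..x}"
        using x by (intro fundamental_theorem_of_calculus)
          (auto simp: has_real_derivative_iff_has_vector_derivative[symmetric])
      then show ?case by (rule integral_unique)
    qed
    ultimately have "(\<lambda>n. F n x - F n (- T)) \<longlonglongrightarrow> integral {-T..x} g"
      by (rule Lim_transform_eventually)
    moreover have "(\<lambda>n. F n x - F n (- T)) \<longlonglongrightarrow> f x - f (- T)" using x by (intro tendsto_diff cF) auto
    ultimately have "f x - f (- T) = integral {-T..x} g" by (rule LIMSEQ_unique[rotated])
    then show ?thesis by simp
  qed
  have "((\<lambda>x. integral {-T..x} g) has_real_derivative g t) (at t within {-T..T})"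
    using t by (intro integral_has_real_derivative g) auto
  then have "((\<lambda>x. f (- T) + integral {-T..x} g) has_real_derivative g t) (at t within {-T..T})"
    by (auto intro!: derivative_eq_intros)
  then have "(f has_real_derivative g t) (at t within {-T..T})"
  proof (rule has_field_derivative_transform_within[where d = 1])
    show "t \<in> {-T..T}" using t by simp
    show "f (- T) + integral {-T..x} g = f x" if "x \<in> {-T..T}" for x by (rule fe[OF that, symmetric])
  qed simp
  then show ?thesis using t by (simp add: at_within_Icc_at)
qed

context nonlinearity begin

section \<open>Bounds and passage to the limit as the interval grows\<close>

lemma R'_nonneg: "0 \<le> R' s"
proof (cases "0 < s")
  case True
  have "0 \<le> p * R s" using p R_ge by simp
  then have "0 \<le> s * R' s" using AR[of s] by linarith
  then show ?thesis using True by (simp add: zero_le_mult_iff)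
qed (simp add: R'_neg)

lemma R'_bound: obtains Q where "0 < Q" "\<And>s. 0 \<le> s \<Longrightarrow> s \<le> M \<Longrightarrow> R' s \<le> Q"
proof -
  have "bounded (R' ` {0..M})"
    by (intro compact_imp_bounded compact_continuous_image continuous_on_subset[OF R'_cont]) auto
  then obtain Q where Q: "\<forall>y\<in>R' ` {0..M}. norm y \<le> Q" unfolding bounded_iff by blast
  show thesis
  proof (rule that[of "max 1 Q"])
    fix s assume "0 \<le> s" "s \<le> M"
    then have "norm (R' s) \<le> Q" using Q by auto
    then show "R' s \<le> max 1 Q" by simp
  qed simp
qed

text \<open>The order of the quantifiers matters: all constants are fixed before \<open>L\<close>. A
  point where u is at least \<delta> within distance \<open>T\<close> of 0 prevents the solutions
  from escaping to either end or flattening out.\<close>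

lemma uniform_family:
  assumes \<kappa>: "0 < \<kappa>"
  shows "\<exists>E M Q T \<delta>. 0 < \<delta> \<and> 0 < Q \<and> (\<forall>L\<ge>1. \<exists>u du a b. truncated_ode c p R R' \<kappa> E L u du a b \<and>
    (\<forall>t\<in>{-L..L}. u t \<le> M \<and> R' (u t) \<le> Q) \<and> (\<exists>x\<in>{-L..L}. \<bar>x\<bar> \<le> T \<and> \<delta> \<le> u x))"
proof -
  obtain \<beta> where \<beta>: "\<And>L. 1 \<le> L \<Longrightarrow> \<exists>u du a b. ode_on R' {-L..L} u du a b \<and> u (- L) = 0 \<and> u L = 0 \<and> a (- L) = \<kappa> \<and> b L = 0 \<and>
     (\<exists>t\<in>{-L..L}. u t \<noteq> 0) \<and> (1/2 - 1/p) * integral {-L..L} (energy_density u du a b) \<le> \<beta>"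
    using truncated_solution[of \<kappa>] by blast
  have th: "0 < 1/2 - 1/p" using p by (simp add: field_simps)
  define E where "E = \<beta> / (1/2 - 1/p)"
  have ex: "\<exists>u du a b. truncated_ode c p R R' \<kappa> E L u du a b" if L: "1 \<le> L" for L
  proof -
    obtain u du a b where *: "ode_on R' {-L..L} u du a b" "u (- L) = 0" "u L = 0" "a (- L) = \<kappa>" "b L = 0"
     "\<exists>t\<in>{-L..L}. u t \<noteq> 0" "(1/2 - 1/p) * integral {-L..L} (energy_density u du a b) \<le> \<beta>" using \<beta>[OF L] by blast
    have "integral {-L..L} (energy_density u du a b) \<le> E"
      using *(7) th unfolding E_def by (subst pos_le_divide_eq) (auto simp: mult.commute)
    then have "truncated_ode c p R R' \<kappa> E L u du a b"
      using * \<kappa> L nonlinearity_axioms by (intro truncated_ode.intro truncated_ode_axioms.intro)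
    then show ?thesis by blast
  qed
  have E0: "0 \<le> E" using ex[of 1] truncated_ode.E0 by auto
  \<comment> \<open>The position at which the bound for |a - \<kappa>| equals \<kappa> / 2; to its
    left a is at least \<kappa> / 2.\<close>
  define t1 where "t1 = ln (\<kappa> / 2 / (1/4 + E/2))"
  have t1: "(1/4 + E/2) * exp t = \<kappa> / 2 * exp (t - t1)" for t
    using \<kappa> E0 by (simp add: t1_def exp_diff add_pos_nonneg)
  define M where "M = sqrt (exp (- t1) * E + (4 / \<kappa>\<^sup>2 + 1) * E)"
  define \<delta> where "\<delta> = (1 / (2 * c)) powr (1 / (p - 2))"
  have \<delta>: "0 < \<delta>" using c by (simp add: \<delta>_def)
  obtain Q where Q: "0 < Q" "\<And>s. 0 \<le> s \<Longrightarrow> s \<le> M \<Longrightarrow> R' s \<le> Q" by (rule R'_bound[of M], erule that)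
  \<comment> \<open>At the maximum x, decay of u gives x \<le> ln (E / \<delta>^2). If x lies left
    of \<open>t1\<close>, the equation gives (\<kappa>/2)^2 \<delta> \<le> e^(2x) Q and thereby a
    lower bound for x.\<close>
  define T where "T = \<bar>t1\<bar> + \<bar>ln (E / \<delta>\<^sup>2)\<bar> + \<bar>ln ((\<kappa> / 2)\<^sup>2 * \<delta> / Q)\<bar>"
  have main: "(\<forall>t\<in>{-L..L}. u t \<le> M \<and> R' (u t) \<le> Q) \<and> (\<exists>x\<in>{-L..L}. \<bar>x\<bar> \<le> T \<and> \<delta> \<le> u x)"
    if "truncated_ode c p R R' \<kappa> E L u du a b" for L u du a b
  proof -
    interpret tr: truncated_ode c p R R' \<kappa> E L u du a b by (rule that)
    have uM: "u t \<le> M" if t: "-L \<le> t" "t \<le> L" for t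
    proof (cases "t \<le> t1")
      case True
      then have "(1/4 + E/2) * exp t \<le> \<kappa> / 2 * 1" unfolding t1 using \<kappa> by (intro mult_left_mono) auto
      then have "(u t)\<^sup>2 \<le> (4 / \<kappa>\<^sup>2 + 1) * E" using tr.u_bounded_left[OF t] by simp
      moreover have "0 \<le> exp (- t1) * E" using E0 by simp
      ultimately show ?thesis unfolding M_def by (intro real_le_rsqrt) linarith
    next
      case False
      then have "exp (- t) * E \<le> exp (- t1) * E" using E0 by (intro mult_right_mono) auto
      moreover have "0 \<le> (4 / \<kappa>\<^sup>2 + 1) * E" using E0 by simp
      ultimately show ?thesis using tr.u_decay[OF t] unfolding M_def by (intro real_le_rsqrt) linarith
    qed
    have uQ: "R' (u t) \<le> Q" if t: "-L \<le> t" "t \<le> L" for t using Q(2)[OF tr.u_nonneg[OF t] uM[OF t]] .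
    obtain x where x: "-L < x" "x < L" "\<delta> \<le> u x" and ax: "(a x)\<^sup>2 * u x \<le> exp (2 * x) * R' (u x)"
      using tr.maximum unfolding \<delta>_def by blast
    then have xL: "-L \<le> x" "x \<le> L" by auto
    have "\<delta>\<^sup>2 \<le> (u x)\<^sup>2" using x \<delta> by (intro power_mono) auto
    then have "\<delta>\<^sup>2 \<le> exp (- x) * E" using tr.u_decay[OF xL] by linarith
    then have "exp x * \<delta>\<^sup>2 \<le> exp x * (exp (- x) * E)" by (intro mult_left_mono) auto
    then have eE: "exp x * \<delta>\<^sup>2 \<le> E" by (simp add: mult.assoc[symmetric] exp_add[symmetric])
    then have "exp x \<le> E / \<delta>\<^sup>2" using \<delta> by (simp add: pos_le_divide_eq)
    then have up: "x \<le> ln (E / \<delta>\<^sup>2)" by (metis exp_gt_zero less_le_trans ln_exp ln_mono)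
    have lo: "- T \<le> x"
    proof (cases "x \<le> t1")
      case True
      then have "(1/4 + E/2) * exp x \<le> \<kappa> / 2 * 1" unfolding t1 using \<kappa> by (intro mult_left_mono) auto
      then have "\<kappa> / 2 \<le> a x" using tr.a_near[OF xL] by linarith
      then have "(\<kappa> / 2)\<^sup>2 \<le> (a x)\<^sup>2" using \<kappa> by (intro power_mono) auto
      then have "(\<kappa> / 2)\<^sup>2 * \<delta> \<le> (a x)\<^sup>2 * u x" using x \<delta> by (intro mult_mono) auto
      also have "\<dots> \<le> exp (2 * x) * Q" using ax mult_left_mono[OF uQ[OF xL] exp_ge_zero[of "2 * x"]] by linarith
      finally have "(\<kappa> / 2)\<^sup>2 * \<delta> / Q \<le> exp (2 * x)" using Q(1) by (simp add: pos_divide_le_eq)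
      moreover have "0 < (\<kappa> / 2)\<^sup>2 * \<delta> / Q" using \<kappa> \<delta> Q by simp
      ultimately have l: "ln ((\<kappa> / 2)\<^sup>2 * \<delta> / Q) \<le> 2 * x" by (metis ln_exp ln_mono)
      show ?thesis
      proof (cases "x \<le> 0")
        case True
        then show ?thesis using l unfolding T_def by linarith
      qed (simp add: T_def)
    qed (simp add: T_def)
    have "\<bar>x\<bar> \<le> T" using up lo unfolding T_def by linarith
    then show ?thesis using uM uQ x xL by (auto intro!: bexI[of _ x])
  qed
  have "\<exists>u du a b. truncated_ode c p R R' \<kappa> E L u du a b \<and>
    (\<forall>t\<in>{-L..L}. u t \<le> M \<and> R' (u t) \<le> Q) \<and> (\<exists>x\<in>{-L..L}. \<bar>x\<bar> \<le> T \<and> \<delta> \<le> u x)" if L: "1 \<le> L" for L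
  proof -
    obtain u du a b where tr: "truncated_ode c p R R' \<kappa> E L u du a b" using ex[OF L] by blast
    show ?thesis by (rule exI[of _ u], rule exI[of _ du], rule exI[of _ a], rule exI[of _ b], rule conjI[OF tr main[OF tr]])
  qed
  then show ?thesis using \<delta> Q(1) by blast
qed

text \<open>Take L = n + 1. Local bounds on u, u', a, b and their derivatives make the four
  sequences locally equi-Lipschitz; the equations pass to the limit in integrated form, and the
  estimates pass pointwise.\<close>

lemma whole_line_solution:
  assumes \<kappa>: "0 < \<kappa>"
  obtains u du a b :: "real \<Rightarrow> real" and E M where "ode_on R' UNIV u du a b" "\<And>t. 0 \<le> u t" "\<And>t. u t \<le> M" "\<exists>t. 0 < u t"
    "\<And>t. \<bar>a t\<bar> \<le> \<kappa>" "\<And>t. \<bar>a t - \<kappa>\<bar> \<le> (1/4 + E/2) * exp t" "\<And>t. \<bar>b t\<bar> \<le> \<kappa> * E * exp (- (2 * t))"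
    "\<And>T. integral {-T..T} (energy_density u du a b) \<le> E"
proof -
  obtain E M Q T0 \<delta> where \<delta>: "0 < \<delta>" and Q: "0 < Q" and fam: "\<And>L. 1 \<le> L \<Longrightarrow> \<exists>u du a b. truncated_ode c p R R' \<kappa> E L u du a b \<and>
    (\<forall>t\<in>{-L..L}. u t \<le> M \<and> R' (u t) \<le> Q) \<and> (\<exists>x\<in>{-L..L}. \<bar>x\<bar> \<le> T0 \<and> \<delta> \<le> u x)"
    using uniform_family[OF \<kappa>] by blast
  have "\<forall>n. \<exists>u du a b x. truncated_ode c p R R' \<kappa> E (real n + 1) u du a b \<and>
    (\<forall>t\<in>{-(real n + 1)..real n + 1}. u t \<le> M \<and> R' (u t) \<le> Q) \<and> x \<in> {-(real n + 1)..real n + 1} \<and> \<bar>x\<bar> \<le> T0 \<and> \<delta> \<le> u x"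
  proof
    fix n :: nat
    have "1 \<le> real n + 1" by simp
    from fam[OF this] show "\<exists>u du a b x. truncated_ode c p R R' \<kappa> E (real n + 1) u du a b \<and>
    (\<forall>t\<in>{-(real n + 1)..real n + 1}. u t \<le> M \<and> R' (u t) \<le> Q) \<and> x \<in> {-(real n + 1)..real n + 1} \<and> \<bar>x\<bar> \<le> T0 \<and> \<delta> \<le> u x"
      by blast
  qed
  then obtain u du a b x where tr: "\<And>n. truncated_ode c p R R' \<kappa> E (real n + 1) (u n) (du n) (a n) (b n)"
    and uM': "\<And>n. \<forall>t\<in>{-(real n + 1)..real n + 1}. u n t \<le> M \<and> R' (u n t) \<le> Q"
    and x: "\<And>n. x n \<in> {-(real n + 1)..real n + 1}" "\<And>n. \<bar>x n\<bar> \<le> T0" "\<And>n. \<delta> \<le> u n (x n)"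
    unfolding choice_iff by blast
  have uM: "u n t \<le> M" "R' (u n t) \<le> Q" if "\<bar>t\<bar> \<le> real n + 1" for n t
    using bspec[OF uM'[of n], of t] that by (auto simp: abs_le_iff)
  have u0: "0 \<le> u n t" if "\<bar>t\<bar> \<le> real n + 1" for n t
    by (rule truncated_ode.u_nonneg[OF tr]) (use that in \<open>auto simp: abs_le_iff\<close>)
  have a\<kappa>: "\<bar>a n t\<bar> \<le> \<kappa>" "\<bar>a n t - \<kappa>\<bar> \<le> (1/4 + E/2) * exp t" "\<bar>b n t\<bar> \<le> \<kappa> * E * exp (- (2 * t))" if "\<bar>t\<bar> \<le> real n + 1" for n t
    by (rule truncated_ode.a_le[OF tr] truncated_ode.a_near[OF tr] truncated_ode.b_decay[OF tr]; use that in \<open>auto simp: abs_le_iff\<close>)+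
  have E0: "0 \<le> E" using truncated_ode.E0[OF tr[of 0]] .
  have M0: "0 \<le> M" using u0[of 0 0] uM(1)[of 0 0] by simp
  define ddu where "ddu n t = (a n t)\<^sup>2 * u n t + exp (2 * t) * (u n t - R' (u n t))" for n t
  have der: "(u n has_real_derivative du n t) (at t within {-T..T})"
    "(du n has_real_derivative ddu n t) (at t within {-T..T})"
    "(a n has_real_derivative exp (2 * t) * b n t) (at t within {-T..T})"
    "(b n has_real_derivative a n t * (u n t)\<^sup>2) (at t within {-T..T})"
    if "t \<in> {-T..T}" "T \<le> real n + 1" for n t T
  proof -
    have sub: "{-T..T} \<subseteq> {-(real n + 1)..real n + 1}" using that by auto
    have "-(real n + 1) \<le> t" "t \<le> real n + 1" using that by auto
    note d = truncated_ode.derivs[OF tr[of n] this]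
    show "(u n has_real_derivative du n t) (at t within {-T..T})"
      "(du n has_real_derivative ddu n t) (at t within {-T..T})"
      "(a n has_real_derivative exp (2 * t) * b n t) (at t within {-T..T})"
      "(b n has_real_derivative a n t * (u n t)\<^sup>2) (at t within {-T..T})"
      unfolding ddu_def by (rule DERIV_subset[OF _ sub], rule d)+
  qed
  define K2 where "K2 T = \<kappa>\<^sup>2 * M + exp (2 * T) * (M + Q)" for T
  have ddu_le: "\<bar>ddu n t\<bar> \<le> K2 T" if t: "\<bar>t\<bar> \<le> T" "T \<le> real n + 1" for n t T
  proof -
    have tn: "\<bar>t\<bar> \<le> real n + 1" using t by linarith
    have "(a n t)\<^sup>2 \<le> \<kappa>\<^sup>2" using a\<kappa>(1)[OF tn] \<kappa> abs_le_square_iff[of "a n t" \<kappa>] by simp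
    then have "(a n t)\<^sup>2 * u n t \<le> \<kappa>\<^sup>2 * M" using uM(1)[OF tn] u0[OF tn] by (intro mult_mono) auto
    moreover have "0 \<le> (a n t)\<^sup>2 * u n t" using u0[OF tn] by simp
    moreover have "\<bar>exp (2 * t) * (u n t - R' (u n t))\<bar> \<le> exp (2 * T) * (M + Q)"
      unfolding abs_mult using t uM[OF tn] u0[OF tn] R'_nonneg[of "u n t"] Q M0 by (intro mult_mono) auto
    ultimately show ?thesis unfolding ddu_def K2_def by linarith
  qed
  \<comment> \<open>Since 0 \<le> u \<le> M, the mean value theorem on [t, t + 1] yields a point
    where |u'| \<le> M, and the bound on u'' carries it over to t. The window may reach T + 1, hence
    \<open>K2 (T + 1)\<close>.\<close>
  have du_le: "\<bar>du n t\<bar> \<le> M + K2 (T + 1)" if t: "\<bar>t\<bar> \<le> T" "T + 1 \<le> real n + 1" for n t T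
  proof -
    have tn: "\<bar>s\<bar> \<le> T + 1" if "t \<le> s" "s \<le> t + 1" for s using t that by (auto simp: abs_le_iff)
    have K2: "0 \<le> K2 (T + 1)" using M0 Q by (simp add: K2_def)
    have at: "(u n has_real_derivative du n s) (at s within {t..t+1})" "(du n has_real_derivative ddu n s) (at s within {t..t+1})"
      if "t \<le> s" "s \<le> t + 1" for s
      using der(1,2)[of s "T + 1" n] t tn[OF that] by (auto intro!: DERIV_subset[where t = "{t..t+1}" and s = "{-(T+1)..T+1}"] simp: abs_le_iff)
    obtain z where z: "t < z" "z < t + 1" "u n (t + 1) - u n t = (t + 1 - t) * du n z"
    proof -
      have hd: "(u n has_derivative (\<lambda>h. du n s * h)) (at s within {t..t+1})" if "t \<le> s" "s \<le> t + 1" for s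
        using at(1)[OF that] unfolding has_field_derivative_def .
      have "\<exists>z\<in>{t<..<t+1}. u n (t + 1) - u n t = du n z * (t + 1 - t)"
        by (rule mvt_simple[OF _ hd]) auto
      then show thesis using that by (auto simp: mult.commute)
    qed
    have "\<bar>u n (t + 1) - u n t\<bar> \<le> M"
      using uM(1)[of t n] u0[of t n] uM(1)[of "t+1" n] u0[of "t+1" n] tn[of t] tn[of "t + 1"] t by auto
    then have duz: "\<bar>du n z\<bar> \<le> M" using z by simp
    have "\<bar>du n z - du n t\<bar> \<le> K2 (T + 1) * z - K2 (T + 1) * t"
    proof (rule deriv_bound_increment[where f' = "ddu n" and g' = "\<lambda>_. K2 (T + 1)"])
      fix s assume s: "t \<le> s" "s \<le> z"
      show "(du n has_real_derivative ddu n s) (at s within {t..z})"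
        by (rule DERIV_subset[OF at(2)]) (use s z in auto)
      show "\<bar>ddu n s\<bar> \<le> K2 (T + 1)" by (rule ddu_le[OF tn t(2)]) (use s z in auto)
    qed (use z in \<open>auto intro!: derivative_eq_intros\<close>)
    also have "\<dots> = K2 (T + 1) * (z - t)" by (simp add: right_diff_distrib)
    also have "\<dots> \<le> K2 (T + 1) * 1" using K2 z by (intro mult_left_mono) auto
    finally show ?thesis using duz by linarith
  qed
  have ev: "\<forall>\<^sub>F n in sequentially. T \<le> real n" for T :: real
    by (simp add: eventually_sequentially) (meson of_nat_le_iff order_trans real_arch_simple)
  \<comment> \<open>A single constant that dominates all functions and all their derivatives on
    [-T, T].\<close>
  define D K where "D T = M + K2 (T + 1)" and "K T = M + \<kappa> + D T + K2 T + \<kappa> * E * exp (2 * T) + \<kappa> * E + \<kappa> * M\<^sup>2" for T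
  have nonneg: "0 \<le> K2 T" "0 \<le> D T" "0 \<le> \<kappa> * E" "0 \<le> \<kappa> * E * exp (2 * T)" "0 \<le> \<kappa> * M\<^sup>2" for T
    using M0 E0 \<kappa> Q by (simp_all add: K2_def D_def)
  have bounds: "\<bar>u n t\<bar> \<le> K T" "\<bar>du n t\<bar> \<le> K T" "\<bar>a n t\<bar> \<le> K T" "\<bar>b n t\<bar> \<le> K T" "\<bar>ddu n t\<bar> \<le> K T"
    "\<bar>exp (2 * t) * b n t\<bar> \<le> K T" "\<bar>a n t * (u n t)\<^sup>2\<bar> \<le> K T"
    if t: "\<bar>t\<bar> \<le> T" and n: "T \<le> real n" for n t T
  proof -
    have tn: "\<bar>t\<bar> \<le> real n + 1" using t n by linarith
    note nn = nonneg(1,2,4)[of T] nonneg(3,5) M0 \<kappa>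
    show "\<bar>u n t\<bar> \<le> K T" using uM(1)[OF tn] u0[OF tn] nn unfolding K_def by linarith
    show "\<bar>du n t\<bar> \<le> K T" using du_le[OF t, of n] n nn unfolding K_def D_def by linarith
    show "\<bar>a n t\<bar> \<le> K T" using a\<kappa>(1)[OF tn] nn unfolding K_def by linarith
    have "\<kappa> * E * exp (- (2 * t)) \<le> \<kappa> * E * exp (2 * T)" using t nn by (intro mult_left_mono) (auto simp: abs_le_iff)
    then show "\<bar>b n t\<bar> \<le> K T" using a\<kappa>(3)[OF tn] nn unfolding K_def by linarith
    show "\<bar>ddu n t\<bar> \<le> K T" using ddu_le[OF t, of n] n nn unfolding K_def by linarith
    have "exp (2 * t) * \<bar>b n t\<bar> \<le> exp (2 * t) * (\<kappa> * E * exp (- (2 * t)))" by (intro mult_left_mono a\<kappa>(3)[OF tn]) simp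
    also have "\<dots> = \<kappa> * E * (exp (2 * t) * exp (- (2 * t)))" by simp
    also have "\<dots> = \<kappa> * E" by (simp add: exp_add[symmetric] del: mult_eq_0_iff)
    finally have "\<bar>exp (2 * t) * b n t\<bar> \<le> \<kappa> * E" by (simp add: abs_mult)
    then show "\<bar>exp (2 * t) * b n t\<bar> \<le> K T" using nn unfolding K_def by linarith
    have "\<bar>a n t\<bar> * (u n t)\<^sup>2 \<le> \<kappa> * M\<^sup>2" using a\<kappa>(1)[OF tn] uM(1)[OF tn] u0[OF tn] \<kappa> by (intro mult_mono power_mono) auto
    then have "\<bar>a n t * (u n t)\<^sup>2\<bar> \<le> \<kappa> * M\<^sup>2" by (simp add: abs_mult)
    then show "\<bar>a n t * (u n t)\<^sup>2\<bar> \<le> K T" using nn unfolding K_def by linarith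
  qed
  have lip: "\<forall>\<^sub>F n in sequentially. \<forall>x\<in>{-T..T}. \<bar>f n x\<bar> \<le> K T \<and> (\<forall>y\<in>{-T..T}. \<bar>f n x - f n y\<bar> \<le> K T * \<bar>x - y\<bar>)"
    if fd: "\<And>n t. t \<in> {-T..T} \<Longrightarrow> T \<le> real n \<Longrightarrow> (f n has_real_derivative f' n t) (at t within {-T..T})"
      and fb: "\<And>n t. t \<in> {-T..T} \<Longrightarrow> T \<le> real n \<Longrightarrow> \<bar>f n t\<bar> \<le> K T \<and> \<bar>f' n t\<bar> \<le> K T" for f f' :: "nat \<Rightarrow> real \<Rightarrow> real" and T
    using ev[of T]
  proof eventually_elim
    case (elim n)
    have *: "\<bar>f n y - f n x\<bar> \<le> K T * (y - x)" if "x \<in> {-T..T}" "y \<in> {-T..T}" "x \<le> y" for x y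
    proof -
      have "\<bar>f n y - f n x\<bar> \<le> K T * y - K T * x"
      proof (rule deriv_bound_increment[OF that(3), where f' = "f' n" and g' = "\<lambda>_. K T"])
        fix s assume "x \<le> s" "s \<le> y"
        then have s: "s \<in> {-T..T}" using that by auto
        show "(f n has_real_derivative f' n s) (at s within {x..y})"
          by (rule DERIV_subset[OF fd[OF s elim]]) (use that in auto)
        show "\<bar>f' n s\<bar> \<le> K T" using fb[OF s elim] by simp
      qed (auto intro!: derivative_eq_intros)
      then show ?thesis by (simp add: right_diff_distrib)
    qed
    have "\<bar>f n x - f n y\<bar> \<le> K T * \<bar>x - y\<bar>" if "x \<in> {-T..T}" "y \<in> {-T..T}" for x y
      using *[of x y] *[of y x] that by (cases "x \<le> y") (auto simp: abs_minus_commute)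
    then show ?case using fb[OF _ elim] by blast
  qed
  have lips: "\<forall>\<^sub>F n in sequentially. \<forall>x\<in>{-T..T}. \<bar>u n x\<bar> \<le> K T \<and> (\<forall>y\<in>{-T..T}. \<bar>u n x - u n y\<bar> \<le> K T * \<bar>x - y\<bar>)"
    "\<forall>\<^sub>F n in sequentially. \<forall>x\<in>{-T..T}. \<bar>du n x\<bar> \<le> K T \<and> (\<forall>y\<in>{-T..T}. \<bar>du n x - du n y\<bar> \<le> K T * \<bar>x - y\<bar>)"
    "\<forall>\<^sub>F n in sequentially. \<forall>x\<in>{-T..T}. \<bar>a n x\<bar> \<le> K T \<and> (\<forall>y\<in>{-T..T}. \<bar>a n x - a n y\<bar> \<le> K T * \<bar>x - y\<bar>)"
    "\<forall>\<^sub>F n in sequentially. \<forall>x\<in>{-T..T}. \<bar>b n x\<bar> \<le> K T \<and> (\<forall>y\<in>{-T..T}. \<bar>b n x - b n y\<bar> \<le> K T * \<bar>x - y\<bar>)" for T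
    by (rule lip[OF der(1)] lip[OF der(2)] lip[OF der(3)] lip[OF der(4)]; use bounds in \<open>auto simp: abs_le_iff\<close>)+
  have sub: "\<exists>K. \<forall>\<^sub>F n in sequentially. \<forall>x\<in>{-T..T}. \<bar>f (k n) x\<bar> \<le> K \<and> (\<forall>y\<in>{-T..T}. \<bar>f (k n) x - f (k n) y\<bar> \<le> K * \<bar>x - y\<bar>)"
    if "\<And>T. \<forall>\<^sub>F n in sequentially. \<forall>x\<in>{-T..T}. \<bar>f n x\<bar> \<le> K T \<and> (\<forall>y\<in>{-T..T}. \<bar>f n x - f n y\<bar> \<le> K T * \<bar>x - y\<bar>)" "strict_mono k"
    for f :: "nat \<Rightarrow> real \<Rightarrow> real" and k :: "nat \<Rightarrow> nat" and T
    using eventually_subseq[OF that(2) that(1)[of T]] by (intro exI[of _ "K T"])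
  have id: "strict_mono (\<lambda>n::nat. n)" by (simp add: strict_mono_def)
  obtain k1 u0' where k1: "strict_mono (k1 :: nat \<Rightarrow> nat)" "\<And>t. (\<lambda>n. u (k1 n) t) \<longlonglongrightarrow> u0' t" "continuous_on UNIV u0'"
    using local_arzela_ascoli[of "\<lambda>n. u n", OF sub[OF lips(1) id]] by blast
  obtain k2 du0 where k2: "strict_mono (k2 :: nat \<Rightarrow> nat)" "\<And>t. (\<lambda>n. du (k1 (k2 n)) t) \<longlonglongrightarrow> du0 t" "continuous_on UNIV du0"
    using local_arzela_ascoli[of "\<lambda>n. du (k1 n)", OF sub[OF lips(2) k1(1)]] by blast
  have k12: "strict_mono (\<lambda>n. k1 (k2 n))" using strict_mono_o[OF k1(1) k2(1)] by (simp add: comp_def)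
  obtain k3 a0 where k3: "strict_mono (k3 :: nat \<Rightarrow> nat)" "\<And>t. (\<lambda>n. a (k1 (k2 (k3 n))) t) \<longlonglongrightarrow> a0 t" "continuous_on UNIV a0"
    using local_arzela_ascoli[of "\<lambda>n. a (k1 (k2 n))", OF sub[OF lips(3) k12]] by blast
  have k123: "strict_mono (\<lambda>n. k1 (k2 (k3 n)))" using strict_mono_o[OF k12 k3(1)] by (simp add: comp_def)
  obtain k4 b0 where k4: "strict_mono (k4 :: nat \<Rightarrow> nat)" "\<And>t. (\<lambda>n. b (k1 (k2 (k3 (k4 n)))) t) \<longlonglongrightarrow> b0 t" "continuous_on UNIV b0"
    using local_arzela_ascoli[of "\<lambda>n. b (k1 (k2 (k3 n)))", OF sub[OF lips(4) k123]] by blast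
  have k1234: "strict_mono (\<lambda>n. k1 (k2 (k3 (k4 n))))" using strict_mono_o[OF k123 k4(1)] by (simp add: comp_def)
  \<comment> \<open>The points where u is at least \<delta> stay bounded, so a further subsequence
    of them converges; the limit will witness nontriviality.\<close>
  have "bounded (range (\<lambda>n. x (k1 (k2 (k3 (k4 n))))))" unfolding bounded_iff using x(2) by auto
  then obtain x0 k5 where k5: "strict_mono (k5 :: nat \<Rightarrow> nat)" "((\<lambda>n. x (k1 (k2 (k3 (k4 n))))) \<circ> k5) \<longlonglongrightarrow> x0"
    using bounded_imp_convergent_subsequence by blast
  define k where "k n = k1 (k2 (k3 (k4 (k5 n))))" for n
  have k: "strict_mono k" using strict_mono_o[OF k1234 k5(1)] by (simp add: comp_def k_def[abs_def])
  have xl: "(\<lambda>n. x (k n)) \<longlonglongrightarrow> x0" using k5(2) by (simp add: comp_def k_def)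
  have sm: "strict_mono (\<lambda>n. k2 (k3 (k4 (k5 n))))" "strict_mono (\<lambda>n. k3 (k4 (k5 n)))" "strict_mono (\<lambda>n. k4 (k5 n))"
    using k2(1) k3(1) k4(1) k5(1) by (auto simp: strict_mono_def)
  have lu: "(\<lambda>n. u (k n) t) \<longlonglongrightarrow> u0' t" and ldu: "(\<lambda>n. du (k n) t) \<longlonglongrightarrow> du0 t"
    and la: "(\<lambda>n. a (k n) t) \<longlonglongrightarrow> a0 t" and lb: "(\<lambda>n. b (k n) t) \<longlonglongrightarrow> b0 t" for t
    using LIMSEQ_subseq_LIMSEQ[OF k1(2)[of t] sm(1)] LIMSEQ_subseq_LIMSEQ[OF k2(2)[of t] sm(2)]
      LIMSEQ_subseq_LIMSEQ[OF k3(2)[of t] sm(3)] LIMSEQ_subseq_LIMSEQ[OF k4(2)[of t] k5(1)]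
    by (simp_all add: comp_def k_def)
  define ddu0 where "ddu0 t = (a0 t)\<^sup>2 * u0' t + exp (2 * t) * (u0' t - R' (u0' t))" for t
  have lddu: "(\<lambda>n. ddu (k n) t) \<longlonglongrightarrow> ddu0 t" for t
  proof -
    have "isCont R' (u0' t)" using R'_cont by (simp add: continuous_on_eq_continuous_at)
    then show ?thesis unfolding ddu_def ddu0_def by (intro tendsto_intros la lu isCont_tendsto_compose[of _ R'])
  qed
  have evk: "\<forall>\<^sub>F n in sequentially. T \<le> real (k n)" for T :: real
    by (rule eventually_subseq[OF k ev])
  have cn: "continuous_on {-T..T} (u n)" "continuous_on {-T..T} (du n)" "continuous_on {-T..T} (a n)" "continuous_on {-T..T} (b n)"
    if "T \<le> real n" for n T
    by (rule DERIV_continuous_on, rule der, assumption, use that in linarith)+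
  have cn2: "continuous_on {-T..T} (ddu n)" if "T \<le> real n" for n T
    unfolding ddu_def[abs_def] by (intro continuous_intros cn that continuous_on_compose2[OF R'_cont]) auto
  have R'u: "continuous_on UNIV (\<lambda>t. R' (u0' t))" by (rule continuous_on_compose2[OF R'_cont k1(3)]) simp
  have c0: "continuous_on A u0'" "continuous_on A du0" "continuous_on A a0" "continuous_on A b0" "continuous_on A (\<lambda>t. R' (u0' t))" for A
    by (rule continuous_on_subset[OF _ subset_UNIV], rule k1(3) k2(3) k3(3) k4(3) R'u)+
  have ode: "ode_on R' UNIV u0' du0 a0 b0"
    unfolding ode_on_def
  proof (intro ballI conjI)
    fix t :: real
    define T where "T = \<bar>t\<bar> + 1"
    have t: "- T < t" "t < T" by (auto simp: T_def)
    have dk: "\<forall>\<^sub>F n in sequentially. \<forall>t\<in>{-T..T}. (u (k n) has_real_derivative du (k n) t) (at t within {-T..T})"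
      "\<forall>\<^sub>F n in sequentially. \<forall>t\<in>{-T..T}. (du (k n) has_real_derivative ddu (k n) t) (at t within {-T..T})"
      "\<forall>\<^sub>F n in sequentially. \<forall>t\<in>{-T..T}. (a (k n) has_real_derivative exp (2 * t) * b (k n) t) (at t within {-T..T})"
      "\<forall>\<^sub>F n in sequentially. \<forall>t\<in>{-T..T}. (b (k n) has_real_derivative a (k n) t * (u (k n) t)\<^sup>2) (at t within {-T..T})"
      by (rule eventually_mono[OF evk[of T]], intro ballI der, assumption, linarith)+
    have bk: "\<forall>\<^sub>F n in sequentially. continuous_on {-T..T} (du (k n)) \<and> (\<forall>t\<in>{-T..T}. \<bar>du (k n) t\<bar> \<le> K T)"
      "\<forall>\<^sub>F n in sequentially. continuous_on {-T..T} (ddu (k n)) \<and> (\<forall>t\<in>{-T..T}. \<bar>ddu (k n) t\<bar> \<le> K T)"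
      "\<forall>\<^sub>F n in sequentially. continuous_on {-T..T} (\<lambda>t. exp (2 * t) * b (k n) t) \<and> (\<forall>t\<in>{-T..T}. \<bar>exp (2 * t) * b (k n) t\<bar> \<le> K T)"
      "\<forall>\<^sub>F n in sequentially. continuous_on {-T..T} (\<lambda>t. a (k n) t * (u (k n) t)\<^sup>2) \<and> (\<forall>t\<in>{-T..T}. \<bar>a (k n) t * (u (k n) t)\<^sup>2\<bar> \<le> K T)"
      by (rule eventually_mono[OF evk[of T]], intro conjI ballI bounds cn cn2 continuous_intros; simp add: abs_le_iff)+
    show "(u0' has_real_derivative du0 t) (at t)"
      by (rule deriv_limit[OF dk(1) bk(1) lu ldu c0(2) t])
    have "(du0 has_real_derivative ddu0 t) (at t)"
      by (rule deriv_limit[OF dk(2) bk(2) ldu lddu _ t]) (unfold ddu0_def, intro continuous_intros c0)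
    then show "(du0 has_real_derivative (a0 t)\<^sup>2 * u0' t + exp (2 * t) * (u0' t - R' (u0' t))) (at t)" by (simp add: ddu0_def)
    show "(a0 has_real_derivative exp (2 * t) * b0 t) (at t)"
      by (rule deriv_limit[OF dk(3) bk(3) la _ _ t, where g = "\<lambda>t. exp (2 * t) * b0 t"]) (intro tendsto_intros lb continuous_intros c0)+
    show "(b0 has_real_derivative a0 t * (u0' t)\<^sup>2) (at t)"
      by (rule deriv_limit[OF dk(4) bk(4) lb _ _ t, where g = "\<lambda>t. a0 t * (u0' t)\<^sup>2"]) (intro tendsto_intros la lu continuous_intros c0)+
  qed
  have evt: "\<forall>\<^sub>F n in sequentially. \<bar>t\<bar> \<le> real (k n) + 1" for t
    using evk[of "\<bar>t\<bar>"] by eventually_elim simp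
  have 1: "0 \<le> u0' t" for t
    by (rule tendsto_lowerbound[OF lu]) (use evt[of t] in \<open>auto elim!: eventually_mono intro: u0\<close>)
  have 2: "u0' t \<le> M" for t
    by (rule tendsto_upperbound[OF lu]) (use evt[of t] in \<open>auto elim!: eventually_mono intro: uM\<close>)
  have 3: "\<bar>a0 t\<bar> \<le> \<kappa>" for t
    by (rule tendsto_upperbound[OF tendsto_rabs[OF la]]) (use evt[of t] in \<open>auto elim!: eventually_mono intro: a\<kappa>\<close>)
  have 4: "\<bar>a0 t - \<kappa>\<bar> \<le> (1/4 + E/2) * exp t" for t
    by (rule tendsto_upperbound[OF tendsto_rabs[OF tendsto_diff[OF la tendsto_const]]]) (use evt[of t] in \<open>auto elim!: eventually_mono intro: a\<kappa>\<close>)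
  have 5: "\<bar>b0 t\<bar> \<le> \<kappa> * E * exp (- (2 * t))" for t
    by (rule tendsto_upperbound[OF tendsto_rabs[OF lb]]) (use evt[of t] in \<open>auto elim!: eventually_mono intro: a\<kappa>\<close>)
  \<comment> \<open>The equi-Lipschitz bound allows the moving points to be replaced by their
    limit.\<close>
  have 6: "\<delta> \<le> u0' x0"
  proof -
    define T where "T = \<bar>T0\<bar> + \<bar>x0\<bar>"
    have "(\<lambda>n. K T * \<bar>x (k n) - x0\<bar>) \<longlonglongrightarrow> K T * \<bar>x0 - x0\<bar>" by (intro tendsto_intros xl)
    then have "(\<lambda>n. u (k n) x0 + K T * \<bar>x (k n) - x0\<bar>) \<longlonglongrightarrow> u0' x0" using tendsto_add[OF lu[of x0]] by fastforce
    moreover have "\<forall>\<^sub>F n in sequentially. \<delta> \<le> u (k n) x0 + K T * \<bar>x (k n) - x0\<bar>"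
      using eventually_subseq[OF k lips(1)[of T]]
    proof eventually_elim
      case (elim n)
      have "x (k n) \<in> {-T..T}" "x0 \<in> {-T..T}" using x(2)[of "k n"] by (auto simp: T_def)
      then have "\<bar>u (k n) (x (k n)) - u (k n) x0\<bar> \<le> K T * \<bar>x (k n) - x0\<bar>" using elim by blast
      then show ?case using x(3)[of "k n"] by linarith
    qed
    ultimately show ?thesis by (rule tendsto_lowerbound) simp
  qed
  have 7: "integral {-T..T} (energy_density u0' du0 a0 b0) \<le> E" for T
  proof (cases "0 \<le> T")
    case True
    let ?e = "\<lambda>n. energy_density (u n) (du n) (a n) (b n)"
    have lim: "(\<lambda>n. integral {-T..T} (?e (k n))) \<longlonglongrightarrow> integral {-T..T} (energy_density u0' du0 a0 b0)"
    proof (rule integral_tendsto_bounded[where K = "(K T)\<^sup>2 + (K T)\<^sup>2 * (K T)\<^sup>2 + exp (2 * T) * (K T)\<^sup>2 + exp (2 * T) * (K T)\<^sup>2"])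
      show "\<forall>\<^sub>F n in sequentially. continuous_on {-T..T} (?e (k n)) \<and> (\<forall>t\<in>{-T..T}. \<bar>?e (k n) t\<bar> \<le> (K T)\<^sup>2 + (K T)\<^sup>2 * (K T)\<^sup>2 + exp (2 * T) * (K T)\<^sup>2 + exp (2 * T) * (K T)\<^sup>2)"
        using evk[of T]
      proof eventually_elim
        case (elim n)
        have "\<bar>?e (k n) t\<bar> \<le> (K T)\<^sup>2 + (K T)\<^sup>2 * (K T)\<^sup>2 + exp (2 * T) * (K T)\<^sup>2 + exp (2 * T) * (K T)\<^sup>2" if t: "t \<in> {-T..T}" for t
        proof -
          have tT: "\<bar>t\<bar> \<le> T" using t by auto
          have sq: "(u (k n) t)\<^sup>2 \<le> (K T)\<^sup>2" "(du (k n) t)\<^sup>2 \<le> (K T)\<^sup>2" "(a (k n) t)\<^sup>2 \<le> (K T)\<^sup>2" "(b (k n) t)\<^sup>2 \<le> (K T)\<^sup>2"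
            using bounds(1-4)[OF tT elim] by (auto simp: abs_le_square_iff[symmetric])
          have e: "exp (2 * t) \<le> exp (2 * T)" using t by simp
          have "0 \<le> ?e (k n) t" by (simp add: energy_density_def)
          then have "\<bar>?e (k n) t\<bar> = ?e (k n) t" by simp
          also have "\<dots> \<le> (K T)\<^sup>2 + (K T)\<^sup>2 * (K T)\<^sup>2 + exp (2 * T) * (K T)\<^sup>2 + exp (2 * T) * (K T)\<^sup>2"
            unfolding energy_density_def by (intro add_mono mult_mono sq e) auto
          finally show ?thesis .
        qed
        moreover have "continuous_on {-T..T} (?e (k n))"
          unfolding energy_density_def[abs_def] by (intro continuous_intros cn elim)
        ultimately show ?case by blast
      qed
      show "(\<lambda>n. ?e (k n) t) \<longlonglongrightarrow> energy_density u0' du0 a0 b0 t" for t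
        unfolding energy_density_def by (intro tendsto_intros lu ldu la lb)
    qed
    show ?thesis
    proof (rule tendsto_upperbound[OF lim])
      show "\<forall>\<^sub>F n in sequentially. integral {-T..T} (?e (k n)) \<le> E"
        using evk[of T]
      proof eventually_elim
        case (elim n)
        let ?L = "real (k n) + 1"
        have ce: "continuous_on {-?L..?L} (?e (k n))" by (rule truncated_ode.cont_e[OF tr])
        have "integral {-T..T} (?e (k n)) \<le> integral {-?L..?L} (?e (k n))"
        proof (rule integral_subset_le)
          show sub: "{-T..T} \<subseteq> {-?L..?L}" using elim by auto
          show "?e (k n) integrable_on {-T..T}" "?e (k n) integrable_on {-?L..?L}"
            using ce continuous_on_subset[OF ce sub] by (auto intro: integrable_continuous_real)
        qed (simp add: energy_density_def)
        also have "\<dots> \<le> E" by (rule truncated_ode.energy[OF tr])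
        finally show ?case .
      qed
    qed simp
  qed (use E0 in simp)
  have "\<exists>t. 0 < u0' t" using 6 \<delta> by (intro exI[of _ x0]) linarith
  with ode 1 2 3 4 5 7 show thesis using that by blast
qed

end

text \<open>Monotone convergence along [-n, n]; the bridge from the energy bound on bounded
  intervals to Lebesgue integrability on the line.\<close>

lemma integrable_lborel_of_bounded_integrals:
  fixes f :: "real \<Rightarrow> real"
  assumes f: "continuous_on UNIV f" and nn: "\<And>t. 0 \<le> f t" and E: "\<And>T. integral {-T..T} f \<le> E"
  shows "integrable lborel f"
proof (rule integrableI_nonneg)
  show "f \<in> borel_measurable lborel" using borel_measurable_continuous_onI[OF f] by simp
  have "(\<integral>\<^sup>+x. ennreal (f x) \<partial>lborel) = (\<integral>\<^sup>+x. (SUP n. ennreal (indicator {-real n..real n} x * f x)) \<partial>lborel)"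
  proof (intro nn_integral_cong)
    fix x :: real
    obtain n where n: "\<bar>x\<bar> \<le> real n" using real_arch_simple by blast
    have "(SUP n. ennreal (indicator {-real n..real n} x * f x)) = ennreal (f x)"
    proof (rule antisym)
      show "(SUP n. ennreal (indicator {-real n..real n} x * f x)) \<le> ennreal (f x)"
        using nn by (intro SUP_least) (auto simp: indicator_def)
      show "ennreal (f x) \<le> (SUP n. ennreal (indicator {-real n..real n} x * f x))"
        by (rule SUP_upper2[of n]) (use n in \<open>auto simp: indicator_def abs_le_iff\<close>)
    qed
    then show "ennreal (f x) = (SUP n. ennreal (indicator {-real n..real n} x * f x))" by simp
  qed
  also have "\<dots> = (SUP n. \<integral>\<^sup>+x. ennreal (indicator {-real n..real n} x * f x) \<partial>lborel)"
  proof (rule nn_integral_monotone_convergence_SUP)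
    show "incseq (\<lambda>n x. ennreal (indicator {-real n..real n} x * f x))"
      by (rule incseq_SucI) (auto simp: le_fun_def indicator_def nn)
    show "(\<lambda>x. ennreal (indicator {-real n..real n} x * f x)) \<in> borel_measurable lborel" for n
      using borel_measurable_continuous_onI[OF f] by simp
  qed
  also have "\<dots> \<le> ennreal E"
  proof (rule SUP_least)
    fix n :: nat
    have "(f has_integral integral {-real n..real n} f) {-real n..real n}"
      by (intro integrable_integral integrable_continuous_real continuous_on_subset[OF f]) simp
    then have "(\<integral>\<^sup>+x. ennreal (indicator {-real n..real n} x * f x) \<partial>lborel) = ennreal (integral {-real n..real n} f)"
      using nn_integral_has_integral_lebesgue[of "{-real n..real n}" f "integral {-real n..real n} f"] nn by simp
    also have "\<dots> \<le> ennreal E" by (intro ennreal_leI E)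
    finally show "(\<integral>\<^sup>+x. ennreal (indicator {-real n..real n} x * f x) \<partial>lborel) \<le> ennreal E" .
  qed
  finally show "(\<integral>\<^sup>+x. ennreal (f x) \<partial>lborel) < \<infinity>" by (simp add: le_less_trans)
qed (use nn in simp)

section \<open>Positivity of the limit profile\<close>

locale profile = nonlinearity +
  fixes \<kappa> E M :: real and u du a b :: "real \<Rightarrow> real"
  assumes \<kappa>: "0 < \<kappa>" and ode: "ode_on R' UNIV u du a b" and u_nonneg: "\<And>t. 0 \<le> u t" and u_le: "\<And>t. u t \<le> M"
    and nontrivial: "\<exists>t. 0 < u t"
    and a_le: "\<And>t. \<bar>a t\<bar> \<le> \<kappa>" and a_near: "\<And>t. \<bar>a t - \<kappa>\<bar> \<le> (1/4 + E/2) * exp t"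
    and b_decay: "\<And>t. \<bar>b t\<bar> \<le> \<kappa> * E * exp (- (2 * t))"
    and energy: "\<And>T. integral {-T..T} (energy_density u du a b) \<le> E"
begin

abbreviation "e \<equiv> energy_density u du a b"
definition "ddu t = (a t)\<^sup>2 * u t + exp (2 * t) * (u t - R' (u t))"

lemma derivs:
  "(u has_real_derivative du t) (at t)" "(du has_real_derivative ddu t) (at t)"
  "(a has_real_derivative exp (2 * t) * b t) (at t)" "(b has_real_derivative a t * (u t)\<^sup>2) (at t)"
  using ode unfolding ode_on_def ddu_def by auto

lemma cont: "continuous_on A u" "continuous_on A du" "continuous_on A a" "continuous_on A b"
  by (rule continuous_on_subset[OF _ subset_UNIV], rule ode_on_cont[OF ode])+

lemma cont_ddu: "continuous_on A ddu"
  unfolding ddu_def[abs_def] by (intro continuous_intros cont continuous_on_compose2[OF R'_cont]) auto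

lemma cont_e: "continuous_on A e"
  unfolding energy_density_def[abs_def] by (intro continuous_intros cont)

lemma e_nonneg: "0 \<le> e t" by (simp add: energy_density_def)

lemma M0: "0 \<le> M" using u_nonneg[of 0] u_le[of 0] by linarith

lemma a_sq: "(a t)\<^sup>2 \<le> \<kappa>\<^sup>2" using a_le[of t] \<kappa> abs_le_square_iff[of "a t" \<kappa>] by simp

text \<open>
  \<open>R'\<close> is only continuous, so uniqueness for the initial value problem is not available;
  Gronwall's inequality for the function \<open>G\<close> in the proof takes its place.
\<close>

lemma u_pos: "0 < u t"
proof (rule ccontr)
  assume "\<not> 0 < u t"
  then have ut: "u t = 0" using u_nonneg[of t] by linarith
  have dut: "du t = 0"
    by (rule DERIV_local_min[OF derivs(1), of 1]) (use ut u_nonneg in auto)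
  obtain s where s: "0 < u s" using nontrivial by blast
  \<comment> \<open>With e^(2t) R(u) in the energy, the terms u' R'(u) cancel in the derivative, so
    no regularity of \<open>R'\<close> enters; u^2 is added to absorb the term |u u'|.\<close>
  define G where "G t = (du t)\<^sup>2 / 2 + exp (2 * t) * R (u t) + (u t)\<^sup>2" for t
  define G' where "G' t = du t * ((a t)\<^sup>2 + exp (2 * t) + 2) * u t + 2 * exp (2 * t) * R (u t)" for t
  have G_deriv: "(G has_real_derivative G' t) (at t)" for t
  proof -
    have dR: "((\<lambda>s. R (u s)) has_real_derivative R' (u t) * du t) (at t)" by (rule DERIV_chain'[OF derivs(1) R_deriv])
    have d1: "((\<lambda>t. (du t)\<^sup>2 / 2) has_real_derivative du t * ddu t) (at t)"
      using derivs(2)[of t] by (auto intro!: derivative_eq_intros)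
    have d3: "((\<lambda>t. (u t)\<^sup>2) has_real_derivative 2 * u t * du t) (at t)"
      using derivs(1)[of t] by (auto intro!: derivative_eq_intros)
    have "((\<lambda>t. exp (2 * t)) has_real_derivative 2 * exp (2 * t)) (at t)" by (auto intro!: derivative_eq_intros)
    from DERIV_add[OF DERIV_add[OF d1 DERIV_mult[OF this dR]] d3]
    have "(G has_real_derivative du t * ddu t + (2 * exp (2 * t) * R (u t) + R' (u t) * du t * exp (2 * t)) + 2 * u t * du t) (at t)"
      unfolding G_def[abs_def] .
    moreover have "du t * ddu t + (2 * exp (2 * t) * R (u t) + R' (u t) * du t * exp (2 * t)) + 2 * u t * du t = G' t"
      unfolding G'_def ddu_def by (simp add: algebra_simps power2_eq_square)
    ultimately show ?thesis by simp
  qed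
  have G0: "0 \<le> G t" for t using R_ge[of "u t"] by (simp add: G_def)
  have Gt: "G t = 0" by (simp add: G_def ut dut R0)
  have Gu: "(u t)\<^sup>2 \<le> G t" for t using R_ge[of "u t"] by (simp add: G_def)
  \<comment> \<open>C - 2 covers a^2 + e^(2x) + 2, the remaining 2 covers 2 e^(2x) R(u). The bound
    holds up to |t| + |s|, hence between \<open>t\<close> and \<open>s\<close> in either
    order.\<close>
  define C where "C = \<kappa>\<^sup>2 + exp (2 * (\<bar>t\<bar> + \<bar>s\<bar>)) + 4"
  have G'_le: "\<bar>G' x\<bar> \<le> C * G x" if x: "x \<le> \<bar>t\<bar> + \<bar>s\<bar>" for x
  proof -
    have e: "exp (2 * x) \<le> exp (2 * (\<bar>t\<bar> + \<bar>s\<bar>))" using x by simp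
    have 1: "\<bar>du x\<bar> * \<bar>u x\<bar> \<le> (du x)\<^sup>2 / 2 + (u x)\<^sup>2"
      using sum_squares_bound[of "\<bar>du x\<bar>" "\<bar>u x\<bar>"] zero_le_power2[of "u x"] unfolding power2_abs by linarith
    have "0 \<le> exp (2 * x) * R (u x)" using R_ge by simp
    then have 1: "\<bar>du x\<bar> * \<bar>u x\<bar> \<le> G x" using 1 unfolding G_def by linarith
    have 2: "exp (2 * x) * R (u x) \<le> G x" by (simp add: G_def)
    have "\<bar>du x * ((a x)\<^sup>2 + exp (2 * x) + 2) * u x\<bar> = ((a x)\<^sup>2 + exp (2 * x) + 2) * (\<bar>du x\<bar> * \<bar>u x\<bar>)"
      by (simp add: abs_mult add_nonneg_nonneg)
    also have "\<dots> \<le> (C - 2) * G x"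
    proof (rule mult_mono)
      show "(a x)\<^sup>2 + exp (2 * x) + 2 \<le> C - 2" using a_sq[of x] e unfolding C_def by linarith
    qed (use 1 in \<open>auto simp: C_def add_nonneg_nonneg\<close>)
    finally have "\<bar>du x * ((a x)\<^sup>2 + exp (2 * x) + 2) * u x\<bar> \<le> (C - 2) * G x" .
    moreover have "0 \<le> exp (2 * x) * R (u x)" using R_ge by simp
    ultimately show ?thesis unfolding G'_def left_diff_distrib using 2 by linarith
  qed
  have "G s = 0"
  proof (cases "t \<le> s")
    case True
    have "- (G t * exp (- C * t)) \<le> - (G s * exp (- C * s))"
    proof (rule deriv_nonneg_increment[OF True, where f = "\<lambda>x. - (G x * exp (- C * x))" and f' = "\<lambda>x. (C * G x - G' x) * exp (- C * x)"])
      fix x assume x: "t \<le> x" "x \<le> s"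
      have "((\<lambda>x. - (G x * exp (- C * x))) has_real_derivative - (G' x * exp (- C * x) + G x * (exp (- C * x) * (- C)))) (at x within {t..s})"
        by (rule derivative_eq_intros DERIV_subset[OF G_deriv subset_UNIV] refl)+ simp
      then show "((\<lambda>x. - (G x * exp (- C * x))) has_real_derivative (C * G x - G' x) * exp (- C * x)) (at x within {t..s})"
        by (simp add: algebra_simps)
      have "x \<le> \<bar>t\<bar> + \<bar>s\<bar>" using x by linarith
      from G'_le[OF this] have "0 \<le> C * G x - G' x" by linarith
      then show "0 \<le> (C * G x - G' x) * exp (- C * x)" by (intro mult_nonneg_nonneg) auto
    qed
    then have "G s * exp (- C * s) \<le> 0" using Gt by simp
    then have "G s \<le> 0" by (simp add: mult_le_0_iff)
    then show ?thesis using G0[of s] by simp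
  next
    case False
    then have st: "s \<le> t" by simp
    have "G s * exp (C * s) \<le> G t * exp (C * t)"
    proof (rule deriv_nonneg_increment[OF st, where f = "\<lambda>x. G x * exp (C * x)" and f' = "\<lambda>x. (C * G x + G' x) * exp (C * x)"])
      fix x assume x: "s \<le> x" "x \<le> t"
      have "((\<lambda>x. G x * exp (C * x)) has_real_derivative (G' x * exp (C * x) + G x * (exp (C * x) * C))) (at x within {s..t})"
        by (rule derivative_eq_intros DERIV_subset[OF G_deriv subset_UNIV] refl)+ simp
      then show "((\<lambda>x. G x * exp (C * x)) has_real_derivative (C * G x + G' x) * exp (C * x)) (at x within {s..t})"
        by (simp add: algebra_simps)
      have "x \<le> \<bar>t\<bar> + \<bar>s\<bar>" using x by linarith
      from G'_le[OF this] have "0 \<le> C * G x + G' x" by linarith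
      then show "0 \<le> (C * G x + G' x) * exp (C * x)" by (intro mult_nonneg_nonneg) auto
    qed
    then have "G s * exp (C * s) \<le> 0" using Gt by simp
    then have "G s \<le> 0" by (simp add: mult_le_0_iff)
    then show ?thesis using G0[of s] by simp
  qed
  then have "(u s)\<^sup>2 \<le> 0" using Gu[of s] by simp
  then show False using s by simp
qed

lemma integral_e_le: assumes "x \<le> y" shows "integral {x..y} e \<le> E"
proof -
  define T where "T = max \<bar>x\<bar> \<bar>y\<bar>"
  have "integral {x..y} e \<le> integral {-T..T} e"
    by (rule integral_subset_le) (auto intro!: integrable_continuous_real cont_e simp: e_nonneg T_def)
  then show ?thesis using energy[of T] by linarith
qed

lemma E0: "0 \<le> E" using integral_e_le[of 0 0] by simp

lemma increment_le:
  assumes xy: "x \<le> y" and f: "\<And>t. (f has_real_derivative f' t) (at t)"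
    and g: "\<And>t. (g has_real_derivative g' t) (at t)"
    and le: "\<And>t. x \<le> t \<Longrightarrow> t \<le> y \<Longrightarrow> \<bar>f' t\<bar> \<le> K * e t + g' t"
  shows "\<bar>f y - f x\<bar> \<le> K * integral {x..y} e + (g y - g x)"
proof -
  have "\<bar>f y - f x\<bar> \<le> (K * integral {x..y} e + g y) - (K * integral {x..x} e + g x)"
  proof (rule deriv_bound_increment[OF xy, where f' = f' and g' = "\<lambda>t. K * e t + g' t"])
    fix t assume t: "x \<le> t" "t \<le> y"
    show "(f has_real_derivative f' t) (at t within {x..y})" by (rule DERIV_subset[OF f subset_UNIV])
    have "((\<lambda>t. integral {x..t} e) has_real_derivative e t) (at t within {x..y})"
      by (rule integral_has_real_derivative[OF cont_e]) (use t in simp)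
    from DERIV_add[OF DERIV_cmult[OF this] DERIV_subset[OF g subset_UNIV]]
    show "((\<lambda>t. K * integral {x..t} e + g t) has_real_derivative K * e t + g' t) (at t within {x..y})" .
  qed (use le in auto)
  then show ?thesis by simp
qed

section \<open>Behaviour of the profile at -infinity, that is near the origin\<close>

definition "t1 = ln (\<kappa> / 2 / (1/4 + E/2))"

lemma a_lower: assumes "t \<le> t1" shows "\<kappa> / 2 \<le> a t"
proof -
  have "(1/4 + E/2) * exp t \<le> (1/4 + E/2) * exp t1" using assms E0 by (intro mult_left_mono) auto
  also have "\<dots> = \<kappa> / 2"
  proof -
    have w: "0 < 1/4 + E/2" using E0 by linarith
    have "exp t1 = \<kappa> / 2 / (1/4 + E/2)" unfolding t1_def using w \<kappa> by (intro exp_ln divide_pos_pos) auto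
    then show ?thesis using w by (metis less_irrefl nonzero_mult_div_cancel_left times_divide_eq_right)
  qed
  finally show ?thesis using a_near[of t] by linarith
qed

lemma u_sq_le_e: assumes "t \<le> t1" shows "(u t)\<^sup>2 \<le> 4 / \<kappa>\<^sup>2 * e t"
proof -
  have "(\<kappa> / 2)\<^sup>2 \<le> (a t)\<^sup>2" using a_lower[OF assms] \<kappa> by (intro power_mono) auto
  then have "(\<kappa> / 2)\<^sup>2 * (u t)\<^sup>2 \<le> (a t)\<^sup>2 * (u t)\<^sup>2" by (intro mult_right_mono) auto
  also have "\<dots> \<le> e t" by (simp add: energy_density_def)
  finally show ?thesis using \<kappa> by (simp add: field_simps)
qed

text \<open>The decay estimate blows up at -infinity. Left of \<open>t1\<close>, however, b' = a u^2
  is dominated by the energy density, whose integral is finite.\<close>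

lemma b_bounded: "\<exists>B. \<forall>t. \<bar>b t\<bar> \<le> B"
proof (intro exI allI)
  fix t
  have K: "0 \<le> \<kappa> * (4 / \<kappa>\<^sup>2) * E" using \<kappa> E0 by simp
  have K2: "0 \<le> \<kappa> * E * exp (- (2 * t1))" using \<kappa> E0 by simp
  show "\<bar>b t\<bar> \<le> \<kappa> * E * exp (- (2 * t1)) + \<kappa> * (4 / \<kappa>\<^sup>2) * E"
  proof (cases "t1 \<le> t")
    case True
    then have "\<kappa> * E * exp (- (2 * t)) \<le> \<kappa> * E * exp (- (2 * t1))" using \<kappa> E0 by (intro mult_left_mono) auto
    then show ?thesis using b_decay[of t] K by linarith
  next
    case False
    have "\<bar>b t1 - b t\<bar> \<le> \<kappa> * (4 / \<kappa>\<^sup>2) * integral {t..t1} e + (0 - 0)"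
    proof (rule increment_le[where g = "\<lambda>_. 0" and g' = "\<lambda>_. 0", OF _ derivs(4)])
      fix s assume "t \<le> s" "s \<le> t1"
      then have "\<bar>a s\<bar> * (u s)\<^sup>2 \<le> \<kappa> * (4 / \<kappa>\<^sup>2 * e s)" using a_le[of s] u_sq_le_e[of s] \<kappa> by (intro mult_mono) auto
      then show "\<bar>a s * (u s)\<^sup>2\<bar> \<le> \<kappa> * (4 / \<kappa>\<^sup>2) * e s + 0" by (simp add: abs_mult)
    qed (use False in auto)
    also have "\<dots> \<le> \<kappa> * (4 / \<kappa>\<^sup>2) * E" 
      using mult_left_mono[OF integral_e_le[of t t1], of "\<kappa> * (4 / \<kappa>\<^sup>2)"] False \<kappa> by auto
    finally show ?thesis using b_decay[of t1] by linarith
  qed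
qed

definition "B = (SOME B. \<forall>t. \<bar>b t\<bar> \<le> B)"

lemma b_le: "\<bar>b t\<bar> \<le> B" using someI_ex[OF b_bounded] unfolding B_def by blast

text \<open>With b bounded, integrating a' = e^(2t) b from t - n to t and letting n grow improves
  the rate from e^t to e^(2t). In the plane this is |A0| = O(r) instead of O(1).\<close>

lemma h_le: "\<bar>a t - \<kappa>\<bar> \<le> B / 2 * exp (2 * t)"
proof -
  have B0: "0 \<le> B" using b_le[of 0] by linarith
  have "\<bar>a t - \<kappa>\<bar> \<le> B / 2 * exp (2 * t) + (1/4 + E/2) * exp (t - real n)" for n
  proof -
    let ?x = "t - real n"
    have "\<bar>a t - a ?x\<bar> \<le> B / 2 * exp (2 * t) - B / 2 * exp (2 * ?x)"
    proof (rule deriv_bound_increment[where f' = "\<lambda>s. exp (2 * s) * b s" and g' = "\<lambda>s. B * exp (2 * s)" and g = "\<lambda>s. B / 2 * exp (2 * s)"])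
      show "(a has_real_derivative exp (2 * s) * b s) (at s within {?x..t})" for s by (rule DERIV_subset[OF derivs(3) subset_UNIV])
      show "((\<lambda>s. B / 2 * exp (2 * s)) has_real_derivative B * exp (2 * s)) (at s within {?x..t})" for s
        by (auto intro!: derivative_eq_intros)
      show "\<bar>exp (2 * s) * b s\<bar> \<le> B * exp (2 * s)" for s using b_le[of s] by (simp add: abs_mult)
    qed simp
    moreover have "0 \<le> B / 2 * exp (2 * ?x)" using B0 by simp
    ultimately show ?thesis using a_near[of ?x] by linarith
  qed
  moreover have "(\<lambda>n. B / 2 * exp (2 * t) + (1/4 + E/2) * exp (t - real n)) \<longlonglongrightarrow> B / 2 * exp (2 * t) + (1/4 + E/2) * 0"
    by (intro tendsto_intros) real_asymp
  ultimately show ?thesis using LIMSEQ_le_const by fastforce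
qed

text \<open>The integrals over [x, 0] are bounded and monotone in x, so their increments over unit
  windows tend to 0.\<close>

lemma e_tail: assumes "0 < \<epsilon>" shows "\<exists>T. \<forall>t\<le>T. integral {t - 1..t} e < \<epsilon>"
proof -
  define P where "P x = integral {x..0} e" for x
  have Pmono: "P y \<le> P x" if "x \<le> y" for x y
    unfolding P_def by (rule integral_subset_le) (use that in \<open>auto intro!: integrable_continuous_real cont_e simp: e_nonneg\<close>)
  have bdd: "bdd_above (range P)"
  proof (rule bdd_aboveI2)
    show "P x \<le> E" for x
    proof (cases "x \<le> 0")
      case False
      then show ?thesis using E0 by (simp add: P_def)
    qed (simp add: P_def integral_e_le)
  qed
  obtain x where x: "(SUP x. P x) - \<epsilon> < P x"
    using less_cSUP_iff[OF _ bdd, of "(SUP x. P x) - \<epsilon>"] assms by auto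
  show ?thesis
  proof (intro exI[of _ "min x 0"] allI impI)
    fix t assume t: "t \<le> min x 0"
    have "P (t - 1) \<le> (SUP x. P x)" by (rule cSUP_upper[OF _ bdd]) simp
    moreover have "P x \<le> P t" using t by (intro Pmono) simp
    moreover have "integral {t - 1..t} e + P t = P (t - 1)"
      unfolding P_def using t by (intro Henstock_Kurzweil_Integration.integral_combine integrable_continuous_real cont_e) auto
    ultimately show "integral {t - 1..t} e < \<epsilon>" using x by linarith
  qed
qed

definition "Q = (SOME Q. 0 < Q \<and> (\<forall>s. 0 \<le> s \<and> s \<le> M \<longrightarrow> R' s \<le> Q))"

lemma Q: "0 < Q" "R' (u t) \<le> Q"
proof -
  have "\<exists>Q. 0 < Q \<and> (\<forall>s. 0 \<le> s \<and> s \<le> M \<longrightarrow> R' s \<le> Q)" using R'_bound[of M] by metis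
  then have "0 < Q \<and> (\<forall>s. 0 \<le> s \<and> s \<le> M \<longrightarrow> R' s \<le> Q)" unfolding Q_def by (rule someI_ex)
  then show "0 < Q" "R' (u t) \<le> Q" using u_nonneg u_le by auto
qed

text \<open>The weight s - (t - 1) is 0 at the left end of the window and 1 at the right, so its
  product with u'^2 turns integral control over the window into a bound at t. The equation bounds
  u''^2 by the energy density and e^(4s); the constants are generous.\<close>

lemma du_sq_le:
  assumes "t \<le> t1"
  shows "(du t)\<^sup>2 \<le> (2 + 8 * \<kappa>\<^sup>2) * integral {t - 1..t} e + (M + Q)\<^sup>2 / 2 * exp (4 * t)"
proof -
  have "\<bar>(t - (t - 1)) * (du t)\<^sup>2 - (t - 1 - (t - 1)) * (du (t - 1))\<^sup>2\<bar> \<le> (2 + 8 * \<kappa>\<^sup>2) * integral {t - 1..t} e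
     + ((M + Q)\<^sup>2 / 2 * exp (4 * t) - (M + Q)\<^sup>2 / 2 * exp (4 * (t - 1)))"
  proof (rule increment_le[where f = "\<lambda>s. (s - (t - 1)) * (du s)\<^sup>2" and f' = "\<lambda>s. (du s)\<^sup>2 + (s - (t - 1)) * (2 * du s * ddu s)"
      and g = "\<lambda>s. (M + Q)\<^sup>2 / 2 * exp (4 * s)" and g' = "\<lambda>s. 2 * (M + Q)\<^sup>2 * exp (4 * s)"])
    show "((\<lambda>s. (s - (t - 1)) * (du s)\<^sup>2) has_real_derivative (du s)\<^sup>2 + (s - (t - 1)) * (2 * du s * ddu s)) (at s)" for s
      by (rule derivative_eq_intros derivs refl)+ simp
    show "((\<lambda>s. (M + Q)\<^sup>2 / 2 * exp (4 * s)) has_real_derivative 2 * (M + Q)\<^sup>2 * exp (4 * s)) (at s)" for s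
      by (auto intro!: derivative_eq_intros)
    fix s assume s: "t - 1 \<le> s" "s \<le> t"
    define y where "y = exp (2 * s) * (u s - R' (u s))"
    have "\<bar>y\<bar> \<le> exp (2 * s) * (M + Q)"
      unfolding y_def abs_mult using u_nonneg[of s] u_le[of s] Q(1) Q(2)[of s] R'_nonneg[of "u s"] by (intro mult_mono) auto
    then have "y\<^sup>2 \<le> (exp (2 * s) * (M + Q))\<^sup>2" by (metis abs_ge_zero power2_abs power_mono)
    also have "\<dots> = (M + Q)\<^sup>2 * exp (4 * s)" by (simp add: power_mult_distrib exp_double[symmetric])
    finally have y: "y\<^sup>2 \<le> (M + Q)\<^sup>2 * exp (4 * s)" .
    have "((a s)\<^sup>2 * u s)\<^sup>2 = (a s)\<^sup>2 * ((a s)\<^sup>2 * (u s)\<^sup>2)" by (simp add: power2_eq_square)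
    also have "\<dots> \<le> \<kappa>\<^sup>2 * e s" using a_sq[of s] by (intro mult_mono) (auto simp: energy_density_def)
    finally have z: "((a s)\<^sup>2 * u s)\<^sup>2 \<le> \<kappa>\<^sup>2 * e s" .
    have "(ddu s)\<^sup>2 \<le> 2 * ((a s)\<^sup>2 * u s)\<^sup>2 + 2 * y\<^sup>2"
      using sum_squares_bound[of "(a s)\<^sup>2 * u s" y] by (simp add: ddu_def y_def[symmetric] power2_sum)
    then have dd: "(ddu s)\<^sup>2 \<le> 2 * (\<kappa>\<^sup>2 * e s) + 2 * ((M + Q)\<^sup>2 * exp (4 * s))" using y z by linarith
    have d: "(du s)\<^sup>2 \<le> e s" by (simp add: energy_density_def)
    have "\<bar>2 * du s * ddu s\<bar> \<le> (du s)\<^sup>2 + (ddu s)\<^sup>2"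
      using sum_squares_bound[of "\<bar>du s\<bar>" "\<bar>ddu s\<bar>"] by (simp add: abs_mult)
    moreover have "\<bar>(s - (t - 1)) * (2 * du s * ddu s)\<bar> \<le> 1 * \<bar>2 * du s * ddu s\<bar>"
      unfolding abs_mult[of "s - (t - 1)"] using s by (intro mult_right_mono) auto
    ultimately have "\<bar>(du s)\<^sup>2 + (s - (t - 1)) * (2 * du s * ddu s)\<bar> \<le> 2 * e s + (2 * (\<kappa>\<^sup>2 * e s) + 2 * ((M + Q)\<^sup>2 * exp (4 * s)))"
      using d dd by (intro order_trans[OF abs_triangle_ineq]) simp
    also have "\<dots> \<le> (2 + 8 * \<kappa>\<^sup>2) * e s + 2 * (M + Q)\<^sup>2 * exp (4 * s)" using e_nonneg[of s] by (simp add: algebra_simps)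
    finally show "\<bar>(du s)\<^sup>2 + (s - (t - 1)) * (2 * du s * ddu s)\<bar> \<le> (2 + 8 * \<kappa>\<^sup>2) * e s + 2 * (M + Q)\<^sup>2 * exp (4 * s)" .
  qed simp
  moreover have "0 \<le> (M + Q)\<^sup>2 / 2 * exp (4 * (t - 1))" by simp
  moreover have "(t - (t - 1)) * (du t)\<^sup>2 - (t - 1 - (t - 1)) * (du (t - 1))\<^sup>2 = (du t)\<^sup>2" by simp
  ultimately show ?thesis by linarith
qed

text \<open>Both terms of the preceding bound tend to 0. In the plane, |grad u0| = |u'| / r is
  therefore o(1/r) at the origin.\<close>

lemma du_tendsto_0: assumes "0 < \<epsilon>" shows "\<exists>T. \<forall>t\<le>T. \<bar>du t\<bar> < \<epsilon>"
proof -
  define K where "K = 2 + 8 * \<kappa>\<^sup>2"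
  have K: "0 < K" by (simp add: K_def add_pos_nonneg)
  obtain T where T: "\<And>t. t \<le> T \<Longrightarrow> integral {t - 1..t} e < \<epsilon>\<^sup>2 / (2 * K)" using e_tail[of "\<epsilon>\<^sup>2 / (2 * K)"] assms K by auto
  have "((\<lambda>t. (M + Q)\<^sup>2 / 2 * exp (4 * t)) \<longlongrightarrow> (M + Q)\<^sup>2 / 2 * 0) at_bot"
    by (intro tendsto_intros) real_asymp
  then have "\<forall>\<^sub>F t in at_bot. (M + Q)\<^sup>2 / 2 * exp (4 * t) < \<epsilon>\<^sup>2 / 2" using assms by (intro order_tendstoD(2)) auto
  then obtain T2 where T2: "\<And>t. t \<le> T2 \<Longrightarrow> (M + Q)\<^sup>2 / 2 * exp (4 * t) < \<epsilon>\<^sup>2 / 2" unfolding eventually_at_bot_linorder by blast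
  have "\<bar>du t\<bar> < \<epsilon>" if t: "t \<le> min t1 (min T T2)" for t
  proof -
    have "K * integral {t - 1..t} e < K * (\<epsilon>\<^sup>2 / (2 * K))" using T[of t] t K by (intro mult_strict_left_mono) auto
    also have "\<dots> = \<epsilon>\<^sup>2 / 2" using K by simp
    finally have "(du t)\<^sup>2 < \<epsilon>\<^sup>2" using du_sq_le[of t] T2[of t] t unfolding K_def by auto
    then show ?thesis using assms by (metis abs_le_square_iff abs_of_pos not_le)
  qed
  then show ?thesis by blast
qed

lemma du_bounded: "\<exists>C\<ge>0. \<forall>t\<le>T. \<bar>du t\<bar> \<le> C"
proof -
  obtain T0 where T0: "\<And>t. t \<le> T0 \<Longrightarrow> \<bar>du t\<bar> < 1" using du_tendsto_0[of 1] by auto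
  have "bounded (du ` {T0..T})" by (intro compact_imp_bounded compact_continuous_image cont) auto
  then obtain C where "\<forall>y\<in>du ` {T0..T}. norm y \<le> C" unfolding bounded_iff by blast
  then have C: "\<bar>du t\<bar> \<le> C" if "T0 \<le> t" "t \<le> T" for t using that by auto
  show ?thesis
  proof (intro exI[of _ "max 1 C"] conjI allI impI)
    fix t assume "t \<le> T"
    then show "\<bar>du t\<bar> \<le> max 1 C" using T0[of t] C[of t] by (cases "t \<le> T0") auto
  qed simp
qed

end

section \<open>Logarithmic polar coordinates and fluxes through the origin\<close>

text \<open>Apart from the origin, a null set whose membership depends on the convention for ln 0,
  this is the open ball of radius e^(-s).\<close>

lemma emeasure_punctured_log_ball:
  "emeasure lborel {x :: real^2. s < - ln (norm x)} = ennreal (pi * exp (- 2 * s))"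
proof -
  let ?S = "{x :: real^2. s < - ln (norm x)}"
  have "?S - {0} = ball 0 (exp (- s)) - {0}"
  proof (intro set_eqI iffI)
    fix x :: "real^2" assume "x \<in> ?S - {0}"
    then have "0 < norm x" "ln (norm x) < - s" by auto
    then have "norm x < exp (- s)" by (metis exp_less_mono exp_ln)
    then show "x \<in> ball 0 (exp (- s)) - {0}" using \<open>x \<in> ?S - {0}\<close> by simp
  next
    fix x :: "real^2" assume "x \<in> ball 0 (exp (- s)) - {0}"
    then have "0 < norm x" "norm x < exp (- s)" by auto
    then have "ln (norm x) < - s" by (metis ln_exp ln_less_cancel_iff exp_gt_zero)
    then show "x \<in> ?S - {0}" using \<open>0 < norm x\<close> by auto
  qed
  moreover have z: "{0 :: real^2} \<in> null_sets lborel" by (simp add: null_sets_def)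
  have "emeasure lborel (?S - {0}) = emeasure lborel ?S"
    by (rule emeasure_Diff_null_set[OF z]) measurable
  moreover have "emeasure lborel (ball 0 (exp (- s)) - {0 :: real^2}) = emeasure lborel (ball (0 :: real^2) (exp (- s)))"
    by (rule emeasure_Diff_null_set[OF z]) simp
  ultimately have "emeasure lborel ?S = emeasure lborel (ball (0 :: real^2) (exp (- s)))" by simp
  also have "\<dots> = ennreal (pi * exp (- 2 * s))"
  proof -
    have "emeasure lborel (ball (0 :: real^2) (exp (- s))) = ennreal (measure lborel (ball (0 :: real^2) (exp (- s))))"
      using emeasure_lborel_ball_finite[of "0 :: real^2" "exp (- s)"] by (intro emeasure_eq_ennreal_measure) auto
    also have "measure lborel (ball (0 :: real^2) (exp (- s))) = pi * (exp (- s))\<^sup>2"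
      using content_ball[of "exp (- s)" "0 :: real^2"] by (simp add: unit_ball_vol_2)
    also have "(exp (- s))\<^sup>2 = exp (- 2 * s)" by (simp add: exp_double[symmetric])
    finally show ?thesis .
  qed
  finally show ?thesis .
qed

text \<open>The minus sign turns the half-lines {s<..} that determine a measure into balls around
  the origin, which have finite area; its derivative in s supplies the density.\<close>

lemma distr_log_norm:
  "distr (lborel :: (real^2) measure) borel (\<lambda>x. - ln (norm x)) = density lborel (\<lambda>s. ennreal (2 * pi * exp (- 2 * s)))"
proof (rule measure_eqI_lessThan)
  fix s :: real
  have 1: "emeasure (distr (lborel :: (real^2) measure) borel (\<lambda>x. - ln (norm x))) {s<..} = ennreal (pi * exp (- 2 * s))"
    by (subst emeasure_distr) (auto simp: vimage_def emeasure_punctured_log_ball)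
  then show "emeasure (distr (lborel :: (real^2) measure) borel (\<lambda>x. - ln (norm x))) {s<..} < \<infinity>" by simp
  have "emeasure (density lborel (\<lambda>s. ennreal (2 * pi * exp (- 2 * s)))) {s<..} = (\<integral>\<^sup>+x. ennreal (2 * pi * exp (- 2 * x)) * indicator {s<..} x \<partial>lborel)"
    by (rule emeasure_density) auto
  also have "\<dots> = (\<integral>\<^sup>+x. ennreal (2 * pi * exp (- 2 * x)) * indicator {s..} x \<partial>lborel)"
  proof (rule nn_integral_cong_AE)
    have "AE x in lborel. x \<noteq> s" by (rule AE_lborel_singleton)
    then show "AE x in lborel. ennreal (2 * pi * exp (- 2 * x)) * indicator {s<..} x = ennreal (2 * pi * exp (- 2 * x)) * indicator {s..} x"
      by eventually_elim (auto simp: indicator_def)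
  qed
  also have "\<dots> = 0 - (- (pi * exp (- 2 * s)))"
  proof (rule nn_integral_FTC_atLeast[where F = "\<lambda>x. - (pi * exp (- 2 * x))"])
    show "((\<lambda>x. - (pi * exp (- 2 * x))) \<longlongrightarrow> 0) at_top" by real_asymp
    show "((\<lambda>x. - (pi * exp (- 2 * x))) has_real_derivative 2 * pi * exp (- 2 * x)) (at x)" for x
      by (auto intro!: derivative_eq_intros)
  qed auto
  finally show "emeasure (distr (lborel :: (real^2) measure) borel (\<lambda>x. - ln (norm x))) {s<..}
     = emeasure (density lborel (\<lambda>s. ennreal (2 * pi * exp (- 2 * s)))) {s<..}" using 1 by simp
qed auto

text \<open>Polar integration of radial functions, with r dr = e^(2t) dt, obtained as a change of
  measure without an angular variable.\<close>

lemma nn_integral_log_radial: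
  fixes f :: "real \<Rightarrow> ennreal"
  assumes f: "f \<in> borel_measurable borel"
  shows "(\<integral>\<^sup>+x. f (ln (norm (x :: real^2))) \<partial>lborel) = (\<integral>\<^sup>+t. ennreal (2 * pi * exp (2 * t)) * f t \<partial>lborel)"
proof -
  have fm: "(\<lambda>s. f (- s)) \<in> borel_measurable borel" using f by measurable
  have "(\<integral>\<^sup>+x. f (ln (norm (x :: real^2))) \<partial>lborel) = (\<integral>\<^sup>+s. f (- s) \<partial>distr (lborel :: (real^2) measure) borel (\<lambda>x. - ln (norm x)))"
    using fm by (subst nn_integral_distr) auto
  also have "\<dots> = (\<integral>\<^sup>+s. ennreal (2 * pi * exp (- 2 * s)) * f (- s) \<partial>lborel)"
    unfolding distr_log_norm using fm by (subst nn_integral_density) auto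
  also have "\<dots> = (\<integral>\<^sup>+s. ennreal (2 * pi * exp (2 * s)) * f s \<partial>distr lborel borel (uminus :: real \<Rightarrow> real))"
    using f by (subst nn_integral_distr) auto
  finally show ?thesis by (simp add: lborel_distr_uminus)
qed

lemma integrable_log_radial:
  fixes f :: "real \<Rightarrow> real"
  assumes f: "f \<in> borel_measurable borel" and int: "integrable lborel (\<lambda>t. exp (2 * t) * f t)"
  shows "integrable lborel (\<lambda>x :: real^2. f (ln (norm x)))"
proof (rule integrableI_bounded)
  show "(\<lambda>x :: real^2. f (ln (norm x))) \<in> borel_measurable lborel" using f by measurable
  have "(\<integral>\<^sup>+x. ennreal (norm (f (ln (norm (x :: real^2))))) \<partial>lborel) = (\<integral>\<^sup>+t. ennreal (2 * pi * exp (2 * t)) * ennreal (norm (f t)) \<partial>lborel)"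
    by (rule nn_integral_log_radial) (use f in measurable)
  also have "\<dots> = (\<integral>\<^sup>+t. ennreal (2 * pi) * ennreal (norm (exp (2 * t) * f t)) \<partial>lborel)"
    by (intro nn_integral_cong) (simp add: ennreal_mult[symmetric] abs_mult mult_ac)
  also have "\<dots> = ennreal (2 * pi) * (\<integral>\<^sup>+t. ennreal (norm (exp (2 * t) * f t)) \<partial>lborel)"
    using f by (intro nn_integral_cmult) measurable
  also have "\<dots> < \<infinity>"
    using int unfolding integrable_iff_bounded by (simp add: ennreal_mult_less_top)
  finally show "(\<integral>\<^sup>+x. ennreal (norm (f (ln (norm (x :: real^2))))) \<partial>lborel) < \<infinity>" .
qed

text \<open>The reflection t -> -t moves the half-line to +infinity, where a nonnegative derivative
  integrates to the difference of the limits of its primitive.\<close>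

lemma integrable_Iic_FTC:
  fixes F g :: "real \<Rightarrow> real"
  assumes g: "g \<in> borel_measurable borel" and F: "\<And>t. t \<le> T \<Longrightarrow> (F has_real_derivative g t) (at t)"
    and nn: "\<And>t. t \<le> T \<Longrightarrow> 0 \<le> g t" and lim: "(F \<longlongrightarrow> 0) at_bot"
  shows "integrable lborel (\<lambda>t. indicator {..T} t * g t)"
proof (rule integrableI_nonneg)
  have "(\<integral>\<^sup>+x. ennreal (indicator {..T} x * g x) \<partial>lborel) = (\<integral>\<^sup>+x. ennreal (indicator {..T} x * g x) \<partial>distr lborel borel (uminus :: real \<Rightarrow> real))"
    by (simp add: lborel_distr_uminus)
  also have "\<dots> = (\<integral>\<^sup>+x. ennreal (g (- x)) * indicator {-T..} x \<partial>lborel)"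
    using g by (subst nn_integral_distr) (auto intro!: nn_integral_cong simp: indicator_def)
  also have "\<dots> = 0 - (- F (- (- T)))"
  proof (rule nn_integral_FTC_atLeast[where F = "\<lambda>x. - F (- x)"])
    show "((\<lambda>x. - F (- x)) \<longlongrightarrow> 0) at_top"
      using tendsto_minus[OF lim] by (simp add: filterlim_at_bot_mirror)
    show "((\<lambda>x. - F (- x)) has_real_derivative g (- x)) (at x)" if "- T \<le> x" for x
    proof -
      have "((\<lambda>x. F (- x)) has_real_derivative g (- x) * (- 1)) (at x)"
        by (rule DERIV_chain'[where f = uminus]) (use F[of "- x"] that in \<open>auto intro!: derivative_eq_intros\<close>)
      then show ?thesis using DERIV_minus by fastforce
    qed
    show "(\<lambda>x. g (- x)) \<in> borel_measurable borel" using g by measurable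
  qed (use nn in auto)
  also have "\<dots> < \<infinity>" by simp
  finally show "(\<integral>\<^sup>+x. ennreal (indicator {..T} x * g x) \<partial>lborel) < \<infinity>" .
qed (use g nn in \<open>auto simp: indicator_def\<close>)

lemma integrable_exp_Iic:
  assumes c: "0 < c" shows "integrable lborel (\<lambda>t::real. indicator {..T} t * exp (c * t))"
proof (rule integrable_Iic_FTC[where F = "\<lambda>t. exp (c * t) / c"])
  show "((\<lambda>t. exp (c * t) / c) \<longlongrightarrow> 0) at_bot" using c by real_asymp
qed (use c in \<open>auto intro!: derivative_eq_intros\<close>)

lemma integrable_exp_Ici: "integrable lborel (\<lambda>t::real. indicator {0..} t * exp (- 2 * t))"
proof -
  have "integrable lborel (\<lambda>x::real. indicator {..0} (0 + (- 1) * x) * exp (2 * (0 + (- 1) * x)))"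
    using integrable_exp_Iic[of 2 0] by (subst lborel_integrable_real_affine_iff) auto
  moreover have "(\<lambda>x::real. indicator {..0} (0 + (- 1) * x) * exp (2 * (0 + (- 1) * x))) = (\<lambda>t::real. indicator {0..} t * exp (- 2 * t) :: real)"
    by (auto simp: fun_eq_iff indicator_def)
  ultimately show ?thesis by (simp only:)
qed

text \<open>Almost everywhere bounds exclude the origin, where \<open>ln (norm x)\<close> has the junk value \<open>0\<close>.\<close>

lemma integrable_radial_bound:
  fixes G :: "real^2 \<Rightarrow> real"
  assumes G: "G \<in> borel_measurable borel" and f: "f \<in> borel_measurable borel"
    and int: "integrable lborel (\<lambda>t. exp (2 * t) * f t)" and le: "\<And>x. x \<noteq> 0 \<Longrightarrow> \<bar>G x\<bar> \<le> f (ln (norm x))"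
  shows "integrable lborel G"
proof (rule Bochner_Integration.integrable_bound[OF integrable_log_radial[OF f int]])
  show "AE x in lborel. norm (G x) \<le> norm (f (ln (norm x)))"
  proof (rule AE_mp[OF AE_lborel_singleton[of 0]], rule AE_I2, rule impI)
    fix x :: "real^2" assume "x \<noteq> 0"
    from le[OF this] show "norm (G x) \<le> norm (f (ln (norm x)))" by simp
  qed
qed (use G in simp)

section \<open>Local integrability of functions continuous off the origin\<close>

lemma borel_measurable_punctured:
  fixes f :: "real^2 \<Rightarrow> real"
  shows "continuous_on (- {0}) f \<Longrightarrow> f \<in> borel_measurable borel"
  by (rule borel_measurable_continuous_countable_exceptions[of "{0}"]) auto

text \<open>A compact set lies in a ball, so a radial majorant on ln r \<le> T suffices; in the
  variable t the only question is integrability at -infinity.\<close>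

lemma locally_integrableI:
  fixes G :: "real^2 \<Rightarrow> real"
  assumes G: "continuous_on (- {0}) G"
    and dom: "\<And>T. \<exists>f. f \<in> borel_measurable borel \<and> integrable lborel (\<lambda>t. exp (2 * t) * (indicator {..T} t * f t)) \<and>
      (\<forall>x. x \<noteq> 0 \<longrightarrow> ln (norm x) \<le> T \<longrightarrow> \<bar>G x\<bar> \<le> f (ln (norm x)))"
  shows "locally_integrable G"
  unfolding locally_integrable_def set_integrable_def
proof (intro allI impI)
  fix K :: "(real^2) set" assume K: "compact K"
  then obtain \<rho> where \<rho>: "0 < \<rho>" "\<And>x. x \<in> K \<Longrightarrow> norm x \<le> \<rho>" using compact_imp_bounded bounded_pos by metis
  obtain f where f: "f \<in> borel_measurable borel" "integrable lborel (\<lambda>t. exp (2 * t) * (indicator {..ln \<rho>} t * f t))"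
      "\<And>x. x \<noteq> 0 \<Longrightarrow> ln (norm x) \<le> ln \<rho> \<Longrightarrow> \<bar>G x\<bar> \<le> f (ln (norm x))" using dom[of "ln \<rho>"] by blast
  have Gm: "G \<in> borel_measurable borel" by (rule borel_measurable_punctured[OF G])
  have Km: "K \<in> sets borel" by (intro borel_closed compact_imp_closed K)
  have "integrable lborel (\<lambda>x. indicator K x * G x)"
  proof (rule integrable_radial_bound[OF _ _ ])
    show "(\<lambda>x. indicator K x * G x) \<in> borel_measurable borel" using Gm Km by measurable
    show "(\<lambda>t. \<bar>indicator {..ln \<rho>} t * f t\<bar>) \<in> borel_measurable borel" using f(1) by measurable
    show "integrable lborel (\<lambda>t. exp (2 * t) * \<bar>indicator {..ln \<rho>} t * f t\<bar>)"
      using integrable_abs[OF f(2)] by (simp add: abs_mult)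
    fix x :: "real^2" assume x: "x \<noteq> 0"
    show "\<bar>indicator K x * G x\<bar> \<le> \<bar>indicator {..ln \<rho>} (ln (norm x)) * f (ln (norm x))\<bar>"
    proof (cases "x \<in> K")
      case True
      have "ln (norm x) \<le> ln \<rho>" using \<rho> True x by simp
      then show ?thesis using f(3)[OF x] True by simp
    qed simp
  qed
  then show "integrable lborel (\<lambda>x. indicat_real K x *\<^sub>R G x)" by simp
qed

lemma locally_integrable_mult:
  fixes G w :: "real^2 \<Rightarrow> real"
  assumes G: "locally_integrable G" and w: "continuous_on UNIV w" and supp: "\<And>x. \<rho> \<le> norm x \<Longrightarrow> w x = 0"
  shows "integrable lborel (\<lambda>x. G x * w x)"
proof -
  let ?K = "cball (0 :: real^2) \<rho>"
  have "bounded (w ` ?K)" by (intro compact_imp_bounded compact_continuous_image continuous_on_subset[OF w]) auto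
  then obtain C where C: "\<forall>y\<in>w ` ?K. norm y \<le> C" unfolding bounded_iff by blast
  have wC: "\<bar>w x\<bar> \<le> \<bar>C\<bar>" for x
  proof (cases "x \<in> ?K")
    case True
    then have "norm (w x) \<le> C" using C by blast
    then show ?thesis by simp
  qed (use supp[of x] in simp)
  have GK: "integrable lborel (\<lambda>x. indicator ?K x *\<^sub>R G x)"
    using G unfolding locally_integrable_def set_integrable_def by simp
  have "integrable lborel (\<lambda>x. (indicator ?K x *\<^sub>R G x) * w x)"
  proof (rule Bochner_Integration.integrable_bound[OF integrable_mult_right[OF GK, of "\<bar>C\<bar>"]])
    show "(\<lambda>x. (indicator ?K x *\<^sub>R G x) * w x) \<in> borel_measurable lborel"
      using GK borel_measurable_continuous_onI[OF w] by (intro borel_measurable_times) auto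
    show "AE x in lborel. norm ((indicator ?K x *\<^sub>R G x) * w x) \<le> norm (\<bar>C\<bar> * (indicator ?K x *\<^sub>R G x))"
    proof (rule AE_I2)
      fix x :: "real^2"
      show "norm ((indicator ?K x *\<^sub>R G x) * w x) \<le> norm (\<bar>C\<bar> * (indicator ?K x *\<^sub>R G x))"
        using mult_right_mono[OF wC[of x], of "\<bar>indicator ?K x * G x\<bar>"] by (simp add: abs_mult mult_ac)
    qed
  qed
  moreover have "(\<lambda>x. (indicator ?K x *\<^sub>R G x) * w x) = (\<lambda>x. G x * w x)"
    using supp by (auto simp: fun_eq_iff indicator_def)
  ultimately show ?thesis by (simp only:)
qed

text \<open>A C^1 cutoff, 0 up to 1 and equal to 1 from 2 on. Gluing at 2 is smooth enough because
  the bump has derivative 0 at its top.\<close>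

definition step :: "real \<Rightarrow> real" where "step z = bump (max 0 (2 - z))"
definition step' :: "real \<Rightarrow> real" where "step' z = - bump' (max 0 (2 - z))"

lemma step_low: "z \<le> 1 \<Longrightarrow> step z = 0" "z \<le> 1 \<Longrightarrow> step' z = 0"
  by (auto simp: step_def step'_def bump_outside)

lemma step_high: "2 \<le> z \<Longrightarrow> step z = 1" "2 \<le> z \<Longrightarrow> step' z = 0"
  by (auto simp: step_def step'_def bump_def bump'_def)

lemma step_bounds: "0 \<le> step z" "step z \<le> 1" "\<bar>step' z\<bar> \<le> 4"
  using bump_bounds by (auto simp: step_def step'_def)

lemma step_cont: "continuous_on A step" "continuous_on A step'"
  unfolding step_def[abs_def] step'_def[abs_def]
  by (intro continuous_intros continuous_on_compose2[OF bump_cont(1)[of UNIV]] continuous_on_compose2[OF bump_cont(2)[of UNIV]]; simp)+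

lemma step_deriv: "(step has_real_derivative step' z) (at z)"
proof -
  consider "z < 2" | "2 < z" | "z = 2" by linarith
  then show ?thesis
  proof cases
    case 1
    have "((\<lambda>z. bump (2 - z)) has_real_derivative bump' (2 - z) * (- 1)) (at z)"
      by (rule DERIV_chain'[OF _ bump_deriv]) (auto intro!: derivative_eq_intros)
    then have "(step has_real_derivative bump' (2 - z) * (- 1)) (at z)"
      by (rule has_field_derivative_transform_within_open[where S = "{..<2}"]) (use 1 in \<open>auto simp: step_def\<close>)
    then show ?thesis using 1 by (simp add: step'_def)
  next
    case 2
    have "((\<lambda>z. 1) has_real_derivative 0) (at z)" by simp
    then have "(step has_real_derivative 0) (at z)"
      by (rule has_field_derivative_transform_within_open[where S = "{2<..}"]) (use 2 in \<open>auto simp: step_high\<close>)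
    then show ?thesis using 2 by (simp add: step_high)
  next
    case 3
    have b: "(bump has_real_derivative 0) (at 0)" using bump_deriv[of 0 UNIV] by (simp add: bump'_def)
    have "((\<lambda>h. (step (2 + h) - 1) / h) \<longlongrightarrow> 0) (at 0)"
    proof (rule Lim_null_comparison)
      have "((\<lambda>h. (bump h - 1) / h) \<longlongrightarrow> 0) (at 0)" using b by (simp add: DERIV_def bump_def)
      then have "((\<lambda>h. \<bar>(bump h - 1) / h\<bar>) \<longlongrightarrow> \<bar>0\<bar>) (at 0)" by (rule tendsto_rabs)
      then show "((\<lambda>h. \<bar>(bump h - 1) / h\<bar>) \<longlongrightarrow> 0) (at 0)" by simp
      have "norm ((step (2 + h) - 1) / h) \<le> \<bar>(bump h - 1) / h\<bar>" for h
      proof (cases "0 \<le> h")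
        case True
        then show ?thesis by (simp add: step_high)
      next
        case False
        have "bump (- h) = bump h" by (simp add: bump_def)
        then show ?thesis using False by (simp add: step_def max_def)
      qed
      then show "\<forall>\<^sub>F h in at 0. norm ((step (2 + h) - 1) / h) \<le> \<bar>(bump h - 1) / h\<bar>" by (intro always_eventually) simp
    qed
    then show ?thesis using 3 by (simp add: DERIV_def step_high)
  qed
qed

text \<open>Translation invariance of Lebesgue measure: each difference quotient of \<open>F\<close>
  has integral 0, and dominated convergence passes this on to the derivative. Shifts of length at
  most 1 keep the supports in the ball of radius |\<rho>| + 1.\<close>

lemma integral_directional_derivative_zero:
  fixes F D :: "real^2 \<Rightarrow> real"
  assumes F: "continuous_on UNIV F" and D: "continuous_on UNIV D"
    and supp: "\<And>x. \<rho> \<le> norm x \<Longrightarrow> F x = 0" "\<And>x. \<rho> \<le> norm x \<Longrightarrow> D x = 0"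
    and der: "\<And>x. ((\<lambda>s. F (x + s *\<^sub>R axis i 1)) has_real_derivative D x) (at 0)"
  shows "integrable lborel D" "(LINT x|lborel. D x) = 0"
proof -
  let ?e = "axis i 1 :: real^2"
  let ?K = "cball (0 :: real^2) (\<bar>\<rho>\<bar> + 1)"
  have ne: "norm ?e = 1" by (simp add: norm_axis_1)
  have intc: "integrable lborel G" if G: "continuous_on UNIV G" "\<And>x. \<rho> \<le> norm x \<Longrightarrow> G x = 0" for G :: "real^2 \<Rightarrow> real"
  proof -
    have "integrable lborel (\<lambda>x. indicator ?K x *\<^sub>R G x)"
      by (intro borel_integrable_compact continuous_on_subset[OF G(1)]) auto
    moreover have "(\<lambda>x. indicator ?K x *\<^sub>R G x) = G" using G(2) by (auto simp: fun_eq_iff indicator_def)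
    ultimately show ?thesis by (simp only:)
  qed
  show intD: "integrable lborel D" by (rule intc[OF D supp(2)])
  have intF: "integrable lborel F" by (rule intc[OF F supp(1)])
  have "bounded (D ` ?K)" by (intro compact_imp_bounded compact_continuous_image continuous_on_subset[OF D]) auto
  then obtain C where "\<forall>y\<in>D ` ?K. norm y \<le> C" unfolding bounded_iff by blast
  then have C: "\<bar>D x\<bar> \<le> max 0 C" for x using supp(2)[of x] by (cases "x \<in> ?K") (auto simp: le_max_iff_disj)
  have line: "((\<lambda>s. F (x + s *\<^sub>R ?e)) has_real_derivative D (x + s *\<^sub>R ?e)) (at s)" for x s
  proof -
    have "((\<lambda>r. F ((x + s *\<^sub>R ?e) + (r - s) *\<^sub>R ?e)) has_real_derivative D (x + s *\<^sub>R ?e) * 1) (at s)"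
      by (rule DERIV_chain'[where f = "\<lambda>r. r - s"]) (auto intro!: derivative_eq_intros der)
    then show ?thesis by (simp add: algebra_simps)
  qed
  define q where "q n x = (F (x + inverse (real (Suc n)) *\<^sub>R ?e) - F x) * real (Suc n)" for n x
  have "(\<lambda>n. LINT x|lborel. q n x) \<longlonglongrightarrow> (LINT x|lborel. D x)"
  proof (rule integral_dominated_convergence[where w = "\<lambda>x. indicator ?K x * max 0 C"])
    show "integrable lborel (\<lambda>x. indicator ?K x * max 0 C)"
      using emeasure_lborel_cball_finite[of "0 :: real^2" "\<bar>\<rho>\<bar> + 1"]
      by (intro integrable_mult_left integrable_real_indicator) auto
    show "D \<in> borel_measurable lborel" using borel_measurable_continuous_onI[OF D] by simp
    show "q n \<in> borel_measurable lborel" for n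
    proof -
      have "F \<in> borel_measurable borel" by (rule borel_measurable_continuous_onI[OF F])
      then show ?thesis unfolding q_def by measurable
    qed
    show "AE x in lborel. (\<lambda>n. q n x) \<longlonglongrightarrow> D x"
    proof (rule AE_I2)
      fix x
      have "((\<lambda>h. (F (x + h *\<^sub>R ?e) - F x) / h) \<longlongrightarrow> D x) (at 0)" using der[of x] by (simp add: DERIV_def)
      then have "(\<lambda>n. (F (x + inverse (real (Suc n)) *\<^sub>R ?e) - F x) / inverse (real (Suc n))) \<longlonglongrightarrow> D x"
        by (rule filterlim_compose) (intro filterlim_atI LIMSEQ_inverse_real_of_nat always_eventually, simp)
      then show "(\<lambda>n. q n x) \<longlonglongrightarrow> D x" unfolding q_def by (simp add: divide_inverse)
    qed
    show "AE x in lborel. norm (q n x) \<le> indicator ?K x * max 0 C" for n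
    proof (rule AE_I2)
      fix x :: "real^2"
      let ?h = "inverse (real (Suc n))"
      have h: "0 < ?h" "?h \<le> 1" by (auto simp: inverse_le_1_iff)
      obtain z where "F (x + ?h *\<^sub>R ?e) - F (x + 0 *\<^sub>R ?e) = (?h - 0) * D (x + z *\<^sub>R ?e)"
        using MVT2[of 0 ?h "\<lambda>s. F (x + s *\<^sub>R ?e)" "\<lambda>s. D (x + s *\<^sub>R ?e)"] h line by blast
      then have "q n x = D (x + z *\<^sub>R ?e)" unfolding q_def by simp
      then have le: "\<bar>q n x\<bar> \<le> max 0 C" using C by simp
      show "norm (q n x) \<le> indicator ?K x * max 0 C"
      proof (cases "x \<in> ?K")
        case False
        then have nx: "\<bar>\<rho>\<bar> + 1 < norm x" by simp
        have "norm x \<le> norm (x + ?h *\<^sub>R ?e) + norm (?h *\<^sub>R ?e)"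
            using norm_triangle_ineq4[of "x + ?h *\<^sub>R ?e" "?h *\<^sub>R ?e"] by simp
        then have "norm x - 1 \<le> norm (x + ?h *\<^sub>R ?e)" using h ne by simp
        then have "F (x + ?h *\<^sub>R ?e) = 0" "F x = 0" using nx by (auto intro!: supp(1))
        then show ?thesis by (simp add: q_def)
      qed (use le in simp)
    qed
  qed
  moreover have "(LINT x|lborel. q n x) = 0" for n
  proof -
    let ?h = "inverse (real (Suc n)) *\<^sub>R ?e"
    have Fm: "F \<in> borel_measurable borel" by (rule borel_measurable_continuous_onI[OF F])
    have "integrable lborel (\<lambda>x. F (?h + x))"
      using integrable_distr_eq[of "(+) ?h" lborel borel F] Fm intF by (simp add: lborel_distr_plus)
    moreover have "(LINT x|lborel. F (?h + x)) = (LINT x|lborel. F x)"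
      using integral_distr[of "(+) ?h" lborel borel F] Fm by (simp add: lborel_distr_plus)
    ultimately
    show ?thesis unfolding q_def using intF by (simp add: add.commute)
  qed
  ultimately show "(LINT x|lborel. D x) = 0" using LIMSEQ_unique[OF tendsto_const] by fastforce
qed

lemma continuous_on_extend_zero:
  fixes G :: "real^2 \<Rightarrow> real"
  assumes "continuous_on (- {0}) G" "0 < r" "\<And>x. norm x < r \<Longrightarrow> G x = 0"
  shows "continuous_on UNIV G"
proof -
  have "continuous_on (ball 0 r) G"
    by (rule continuous_on_eq[OF continuous_on_const[of _ 0]]) (use assms(3) in auto)
  then have "continuous_on (- {0} \<union> ball 0 r) G"
    by (intro continuous_on_open_Un assms(1)) auto
  moreover have "- {0} \<union> ball 0 r = (UNIV :: (real^2) set)" using assms(2) by auto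
  ultimately show ?thesis by simp
qed

lemma norm_sq_line_deriv: "((\<lambda>s. (norm (x + s *\<^sub>R axis i 1 :: real^2))\<^sup>2) has_real_derivative 2 * x $ i) (at 0)"
proof -
  have "(norm (x + s *\<^sub>R axis i 1 :: real^2))\<^sup>2 = (norm x)\<^sup>2 + 2 * s * x $ i + s\<^sup>2" for s
    unfolding power2_norm_eq_inner
    by (simp add: inner_add_left inner_add_right inner_axis inner_axis' power2_eq_square algebra_simps)
  then have "(\<lambda>s. (norm (x + s *\<^sub>R axis i 1 :: real^2))\<^sup>2) = (\<lambda>s. (norm x)\<^sup>2 + 2 * s * x $ i + s\<^sup>2)" by (rule ext)
  then show ?thesis by (simp, auto intro!: derivative_eq_intros)
qed

text \<open>The flux through small circles vanishes because \<open>Y = o(1/r)\<close>; the cutoff \<open>step\<close> realises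
  this without a boundary integral.\<close>

lemma integral_divergence_zero:
  fixes Y D :: "2 \<Rightarrow> real^2 \<Rightarrow> real"
  assumes Yc: "\<And>i. continuous_on (- {0}) (Y i)" and Dc: "\<And>i. continuous_on (- {0}) (D i)"
    and der: "\<And>i x. x \<noteq> 0 \<Longrightarrow> ((\<lambda>s. Y i (x + s *\<^sub>R axis i 1)) has_real_derivative D i x) (at 0)"
    and supp: "\<And>i x. \<rho> \<le> norm x \<Longrightarrow> Y i x = 0" "\<And>i x. \<rho> \<le> norm x \<Longrightarrow> D i x = 0"
    and small: "\<And>\<epsilon>. 0 < \<epsilon> \<Longrightarrow> \<exists>\<delta>>0. \<forall>i x. 0 < norm x \<longrightarrow> norm x < \<delta> \<longrightarrow> \<bar>Y i x\<bar> * norm x \<le> \<epsilon>"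
    and int: "integrable lborel (\<lambda>x. D 1 x + D 2 x)"
  shows "(LINT x|lborel. D 1 x + D 2 x) = 0"
proof -
  define N where "N n = real (Suc n)" for n
  have N: "1 \<le> N n" for n by (simp add: N_def)
  \<comment> \<open>The squared norm is used because it is differentiable at the origin too. The
    cutoff vanishes for |x| \<le> 1/N and is 1 once N |x| \<ge> 2.\<close>
  define z where "z n x = (N n)\<^sup>2 * (norm x)\<^sup>2" for n and x :: "real^2"
  define \<eta> where "\<eta> n x = step (z n x)" for n and x :: "real^2"
  define \<eta>' where "\<eta>' n i x = step' (z n x) * ((N n)\<^sup>2 * (2 * x $ i))" for n i and x :: "real^2"
  have z_small: "z n x \<le> 1" if "norm x < 1 / N n" for n x
  proof -
    have "N n * norm x \<le> 1" using that N[of n] by (simp add: field_simps)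
    then have "(N n * norm x)\<^sup>2 \<le> 1\<^sup>2" using N[of n] by (intro power_mono) auto
    then show ?thesis by (simp add: z_def power_mult_distrib)
  qed
  have \<eta>c: "continuous_on A (\<eta> n)" "continuous_on A (\<eta>' n i)" for A n i
    unfolding \<eta>_def[abs_def] \<eta>'_def[abs_def] z_def
    by (intro continuous_intros continuous_on_compose2[OF step_cont(1)[of UNIV]] continuous_on_compose2[OF step_cont(2)[of UNIV]]; simp)+
  have \<eta>_der: "((\<lambda>s. \<eta> n (x + s *\<^sub>R axis i 1)) has_real_derivative \<eta>' n i x) (at 0)" for n i x
  proof -
    have "((\<lambda>s. z n (x + s *\<^sub>R axis i 1)) has_real_derivative (N n)\<^sup>2 * (2 * x $ i)) (at 0)"
      unfolding z_def by (rule DERIV_cmult[OF norm_sq_line_deriv])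
    moreover have "(step has_real_derivative step' (z n x)) (at (z n (x + 0 *\<^sub>R axis i 1)))" using step_deriv by simp
    ultimately show ?thesis unfolding \<eta>_def \<eta>'_def by (rule DERIV_chain')
  qed
  \<comment> \<open>The product of cutoff and field has continuous directional derivatives on the
    whole plane, so these integrate to 0; only the terms with \<open>\<eta>'\<close> remain to be
    estimated.\<close>
  define DF where "DF n i x = \<eta> n x * D i x + \<eta>' n i x * Y i x" for n i x
  have zero: "integrable lborel (DF n i)" "(LINT x|lborel. DF n i x) = 0" for n i
  proof -
    have r: "0 < 1 / N n" using N[of n] by simp
    have F: "continuous_on UNIV (\<lambda>x. \<eta> n x * Y i x)"
    proof (rule continuous_on_extend_zero[OF _ r])
      show "continuous_on (- {0}) (\<lambda>x. \<eta> n x * Y i x)" by (intro continuous_intros \<eta>c Yc)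
      show "\<eta> n x * Y i x = 0" if "norm x < 1 / N n" for x using z_small[OF that] by (simp add: \<eta>_def step_low)
    qed
    have Dd: "continuous_on UNIV (DF n i)" unfolding DF_def[abs_def]
    proof (rule continuous_on_extend_zero[OF _ r])
      show "continuous_on (- {0}) (\<lambda>x. \<eta> n x * D i x + \<eta>' n i x * Y i x)" by (intro continuous_intros \<eta>c Yc Dc)
      show "\<eta> n x * D i x + \<eta>' n i x * Y i x = 0" if "norm x < 1 / N n" for x
        using z_small[OF that] by (simp add: \<eta>_def \<eta>'_def step_low)
    qed
    have d: "((\<lambda>s. \<eta> n (x + s *\<^sub>R axis i 1) * Y i (x + s *\<^sub>R axis i 1)) has_real_derivative DF n i x) (at 0)" for x
    proof (cases "x = 0")
      case True
      have "((\<lambda>s. 0) has_real_derivative DF n i x) (at 0)"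
        using True by (simp add: DF_def \<eta>_def \<eta>'_def z_def step_low)
      then show ?thesis
        by (rule has_field_derivative_transform_within[OF _ r]) (use True in \<open>auto simp: \<eta>_def step_low z_small norm_axis_1\<close>)
    next
      case False
      show ?thesis using DERIV_mult[OF \<eta>_der[of n x i] der[OF False, of i]] by (simp add: DF_def algebra_simps)
    qed
    show "integrable lborel (DF n i)" "(LINT x|lborel. DF n i x) = 0"
      by (rule integral_directional_derivative_zero[OF F Dd _ _ d, of \<rho>]; simp add: supp DF_def)+
  qed
  have Dm: "(\<lambda>x. D 1 x + D 2 x) \<in> borel_measurable lborel" using int by simp
  have \<eta>m: "\<eta> n \<in> borel_measurable borel" for n by (rule borel_measurable_continuous_onI[OF \<eta>c(1)])
  have \<eta>D: "integrable lborel (\<lambda>x. \<eta> n x * (D 1 x + D 2 x))" for n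
  proof (rule Bochner_Integration.integrable_bound[OF int])
    show "(\<lambda>x. \<eta> n x * (D 1 x + D 2 x)) \<in> borel_measurable lborel" using \<eta>m[of n] Dm by simp
    show "AE x in lborel. norm (\<eta> n x * (D 1 x + D 2 x)) \<le> norm (D 1 x + D 2 x)"
      using step_bounds by (intro AE_I2) (simp add: \<eta>_def abs_mult mult_left_le_one_le)
  qed
  have lim: "(\<lambda>n. LINT x|lborel. \<eta> n x * (D 1 x + D 2 x)) \<longlonglongrightarrow> (LINT x|lborel. D 1 x + D 2 x)"
  proof (rule integral_dominated_convergence[where w = "\<lambda>x. norm (D 1 x + D 2 x)"])
    show "(\<lambda>x. \<eta> n x * (D 1 x + D 2 x)) \<in> borel_measurable lborel" for n using \<eta>D[of n] by simp
    show "AE x in lborel. norm (\<eta> n x * (D 1 x + D 2 x)) \<le> norm (D 1 x + D 2 x)" for n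
      using step_bounds by (intro AE_I2) (simp add: \<eta>_def abs_mult mult_left_le_one_le)
    show "AE x in lborel. (\<lambda>n. \<eta> n x * (D 1 x + D 2 x)) \<longlonglongrightarrow> D 1 x + D 2 x"
    proof (rule AE_mp[OF AE_lborel_singleton[of 0]], rule AE_I2, rule impI)
      fix x :: "real^2" assume x: "x \<noteq> 0"
      have "\<forall>\<^sub>F n in sequentially. \<eta> n x * (D 1 x + D 2 x) = D 1 x + D 2 x"
      proof -
        obtain m :: nat where m: "2 / norm x \<le> real m" using real_arch_simple by blast
        show ?thesis
        proof (rule eventually_sequentiallyI[of m])
          fix n assume "m \<le> n"
          then have "2 / norm x \<le> N n" using m by (simp add: N_def)
          then have "2 \<le> N n * norm x" using x by (simp add: field_simps)
          then have "2\<^sup>2 \<le> (N n * norm x)\<^sup>2" by (intro power_mono) auto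
          then have "2 \<le> z n x" by (simp add: z_def power_mult_distrib)
          then show "\<eta> n x * (D 1 x + D 2 x) = D 1 x + D 2 x" by (simp add: \<eta>_def step_high)
        qed
      qed
      then show "(\<lambda>n. \<eta> n x * (D 1 x + D 2 x)) \<longlonglongrightarrow> D 1 x + D 2 x" by (rule tendsto_eventually)
    qed
  qed (use Dm int in auto)
  have eq: "(LINT x|lborel. \<eta> n x * (D 1 x + D 2 x)) = - (LINT x|lborel. \<eta>' n 1 x * Y 1 x + \<eta>' n 2 x * Y 2 x)"
    and \<eta>Yint: "integrable lborel (\<lambda>x. \<eta>' n 1 x * Y 1 x + \<eta>' n 2 x * Y 2 x)" for n
  proof -
    have s: "(\<lambda>x. DF n 1 x + DF n 2 x - \<eta> n x * (D 1 x + D 2 x)) = (\<lambda>x. \<eta>' n 1 x * Y 1 x + \<eta>' n 2 x * Y 2 x)"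
      by (simp add: DF_def algebra_simps)
    have "integrable lborel (\<lambda>x. DF n 1 x + DF n 2 x - \<eta> n x * (D 1 x + D 2 x))" using zero(1) \<eta>D by simp
    then show "integrable lborel (\<lambda>x. \<eta>' n 1 x * Y 1 x + \<eta>' n 2 x * Y 2 x)" unfolding s .
    have "(LINT x|lborel. DF n 1 x + DF n 2 x - \<eta> n x * (D 1 x + D 2 x)) = - (LINT x|lborel. \<eta> n x * (D 1 x + D 2 x))"
      using zero \<eta>D[of n] by simp
    then show "(LINT x|lborel. \<eta> n x * (D 1 x + D 2 x)) = - (LINT x|lborel. \<eta>' n 1 x * Y 1 x + \<eta>' n 2 x * Y 2 x)"
      unfolding s by simp
  qed
  have "(\<lambda>n. LINT x|lborel. \<eta> n x * (D 1 x + D 2 x)) \<longlonglongrightarrow> 0"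
  proof (rule LIMSEQ_I)
    fix r :: real assume r: "0 < r"
    \<comment> \<open>The two terms with \<open>\<eta>'\<close> are together at most 16 N^2
      \<epsilon> and live in a disc of area 4 pi / N^2. The product 64 pi \<epsilon> is r /
      2.\<close>
    define \<epsilon> where "\<epsilon> = r / (128 * pi)"
    have \<epsilon>: "0 < \<epsilon>" using r by (simp add: \<epsilon>_def)
    obtain \<delta> where \<delta>: "0 < \<delta>" and sm: "\<And>i x. 0 < norm x \<Longrightarrow> norm x < \<delta> \<Longrightarrow> \<bar>Y i x\<bar> * norm x \<le> \<epsilon>" using small[OF \<epsilon>] by blast
    obtain m :: nat where m: "2 / \<delta> < real m" using reals_Archimedean2 by blast
    show "\<exists>no. \<forall>n\<ge>no. norm ((LINT x|lborel. \<eta> n x * (D 1 x + D 2 x)) - 0) < r"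
    proof (intro exI[of _ m] allI impI)
      fix n assume n: "m \<le> n"
      have "2 / \<delta> < N n" using m n by (simp add: N_def)
      then have Nd: "2 / N n < \<delta>" using \<delta> N[of n] by (simp add: field_simps)
      have pt: "\<bar>\<eta>' n i x * Y i x\<bar> \<le> 8 * (N n)\<^sup>2 * \<epsilon> * indicator (cball 0 (2 / N n)) x" for i x
      proof (cases "1 < z n x \<and> z n x < 2")
        case True
        then have x0: "x \<noteq> 0" by (auto simp: z_def)
        have "(N n * norm x)\<^sup>2 \<le> 2\<^sup>2" using True by (simp add: z_def power_mult_distrib)
        then have "N n * norm x \<le> 2" by (rule power2_le_imp_le) simp
        then have xn: "norm x \<le> 2 / N n" using N[of n] by (simp add: field_simps)
        then have "norm x < \<delta>" using Nd by simp
        then have y: "\<bar>Y i x\<bar> * norm x \<le> \<epsilon>" using sm[of x i] x0 by simp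
        have "\<bar>\<eta>' n i x * Y i x\<bar> = \<bar>step' (z n x)\<bar> * ((N n)\<^sup>2 * 2 * (\<bar>x $ i\<bar> * \<bar>Y i x\<bar>))" by (simp add: \<eta>'_def abs_mult)
        also have "\<dots> \<le> 4 * ((N n)\<^sup>2 * 2 * \<epsilon>)"
        proof (intro mult_mono mult_left_mono step_bounds)
          have "\<bar>x $ i\<bar> * \<bar>Y i x\<bar> \<le> norm x * \<bar>Y i x\<bar>" by (intro mult_right_mono component_le_norm_cart) simp
          then show "\<bar>x $ i\<bar> * \<bar>Y i x\<bar> \<le> \<epsilon>" using y by (simp add: mult.commute)
        qed auto
        finally show ?thesis using xn by (simp add: indicator_def)
      next
        case False
        then have "\<eta>' n i x = 0" unfolding \<eta>'_def by (cases "z n x \<le> 1") (auto simp: step_low step_high)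
        then show ?thesis using \<epsilon> by simp
      qed
      have fin: "emeasure lborel (cball (0 :: real^2) (2 / N n)) < \<infinity>" by (rule emeasure_lborel_cball_finite)
      have ind: "integrable lborel (\<lambda>x. 16 * (N n)\<^sup>2 * \<epsilon> * indicator (cball (0 :: real^2) (2 / N n)) x)"
        using fin by (intro integrable_mult_right integrable_real_indicator) auto
      have "norm (LINT x|lborel. \<eta>' n 1 x * Y 1 x + \<eta>' n 2 x * Y 2 x) \<le> (LINT x|lborel. 16 * (N n)\<^sup>2 * \<epsilon> * indicator (cball (0 :: real^2) (2 / N n)) x)"
      proof (rule order_trans[OF integral_norm_bound], rule integral_mono[OF integrable_norm[OF \<eta>Yint] ind])
        fix x :: "real^2"
        show "norm (\<eta>' n 1 x * Y 1 x + \<eta>' n 2 x * Y 2 x) \<le> 16 * (N n)\<^sup>2 * \<epsilon> * indicator (cball 0 (2 / N n)) x"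
          using pt[of 1 x] pt[of 2 x] abs_triangle_ineq[of "\<eta>' n 1 x * Y 1 x" "\<eta>' n 2 x * Y 2 x"] by simp
      qed
      also have "\<dots> = 16 * (N n)\<^sup>2 * \<epsilon> * measure lborel (cball (0 :: real^2) (2 / N n))" using fin by simp
      also have "measure lborel (cball (0 :: real^2) (2 / N n)) = pi * (2 / N n)\<^sup>2"
        using content_cball[of "2 / N n" "0 :: real^2"] N[of n] by (simp add: unit_ball_vol_2)
      also have "16 * (N n)\<^sup>2 * \<epsilon> * (pi * (2 / N n)\<^sup>2) = r / 2"
        using N[of n] by (simp add: \<epsilon>_def power_divide field_simps)
      finally show "norm ((LINT x|lborel. \<eta> n x * (D 1 x + D 2 x)) - 0) < r" using r unfolding eq by simp
    qed
  qed
  then show ?thesis using lim LIMSEQ_unique by blast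
qed

section \<open>Test functions and the passage from classical to weak derivatives\<close>

lemma test_function_cont:
  assumes "test_function v"
  shows "continuous_on A v" "continuous_on A (partial i v)"
proof -
  have "C_k 0 v" "C_k (Suc 0) v" using assms unfolding test_function_def by blast+
  then have "continuous_on UNIV v" "continuous_on UNIV (partial i v)" by auto
  then show "continuous_on A v" "continuous_on A (partial i v)" using continuous_on_subset by blast+
qed

lemma test_function_deriv:
  assumes "test_function v"
  shows "((\<lambda>s. v (x + s *\<^sub>R axis i 1)) has_real_derivative partial i v x) (at 0)"
proof -
  have "C_k (Suc 0) v" using assms unfolding test_function_def by blast
  then have "v differentiable (at x)" by simp
  then have v: "(v has_derivative frechet_derivative v (at x)) (at x)" by (simp add: frechet_derivative_works)
  have "((\<lambda>s. x + s *\<^sub>R axis i 1) has_derivative (\<lambda>s. s *\<^sub>R axis i 1)) (at (0::real))"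
    by (auto intro!: derivative_eq_intros)
  moreover have "(v has_derivative frechet_derivative v (at x)) (at (x + (0::real) *\<^sub>R axis i 1))" using v by simp
  ultimately have "((\<lambda>s. v (x + s *\<^sub>R axis i 1)) has_derivative (\<lambda>s. frechet_derivative v (at x) (s *\<^sub>R axis i 1))) (at 0)"
    by (rule has_derivative_compose)
  moreover have "(\<lambda>s. frechet_derivative v (at x) (s *\<^sub>R axis i 1)) = (*) (partial i v x)"
    using linear_cmul[OF has_derivative_linear[OF v]] by (auto simp: fun_eq_iff partial_def mult.commute)
  ultimately show ?thesis by (simp add: has_field_derivative_def)
qed

lemma test_function_support:
  assumes "test_function v"
  obtains \<rho> where "\<And>x. \<rho> \<le> norm x \<Longrightarrow> v x = 0" "\<And>i x. \<rho> \<le> norm x \<Longrightarrow> partial i v x = 0"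
proof -
  have "bounded {x. v x \<noteq> 0}"
    using assms compact_imp_bounded bounded_subset closure_subset unfolding test_function_def by metis
  then obtain r where r: "\<And>x. v x \<noteq> 0 \<Longrightarrow> norm x \<le> r" unfolding bounded_iff by auto
  show thesis
  proof (rule that[of "r + 1"])
    show "v x = 0" if "r + 1 \<le> norm x" for x using r[of x] that by force
    show "partial i v x = 0" if x: "r + 1 \<le> norm x" for i x
    proof -
      have z: "v (x + s *\<^sub>R axis i 1) = 0" if "\<bar>s\<bar> < 1" for s
      proof (rule ccontr)
        assume "v (x + s *\<^sub>R axis i 1) \<noteq> 0"
        then have "norm (x + s *\<^sub>R axis i 1) \<le> r" by (rule r)
        moreover have "norm x \<le> norm (x + s *\<^sub>R axis i 1) + norm (s *\<^sub>R (axis i 1 :: real^2))"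
          using norm_triangle_ineq4[of "x + s *\<^sub>R axis i 1" "s *\<^sub>R axis i 1"] by simp
        ultimately show False using x that by (simp add: norm_axis_1)
      qed
      have "((\<lambda>s::real. 0::real) has_real_derivative 0) (at 0)" by simp
      then have "((\<lambda>s. v (x + s *\<^sub>R axis i 1)) has_real_derivative 0) (at 0)"
        by (rule has_field_derivative_transform_within[where d = 1]) (simp_all add: z dist_real_def)
      then show ?thesis using test_function_deriv[OF assms, of x i] DERIV_unique by blast
    qed
  qed
qed

text \<open>The gradient of ln r is x / r^2, computed through half the logarithm of the squared
  norm.\<close>

lemma log_radial_deriv:
  assumes x: "x \<noteq> (0 :: real^2)" and f: "(f has_real_derivative f') (at (ln (norm x)))"
  shows "((\<lambda>s. f (ln (norm (x + s *\<^sub>R axis i 1)))) has_real_derivative f' * exp (- 2 * ln (norm x)) * x $ i) (at 0)"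
proof -
  have l: "ln (norm y) = ln ((norm y)\<^sup>2) / 2" for y :: "real^2"
    by (cases "y = 0") (simp_all add: ln_realpow)
  have e: "exp (- 2 * ln (norm x)) = 1 / (norm x)\<^sup>2"
    using x exp_double[of "ln (norm x)"] by (simp add: exp_minus inverse_eq_divide)
  have "((\<lambda>s. ln ((norm (x + s *\<^sub>R axis i 1))\<^sup>2) / 2) has_real_derivative (1 / (norm x)\<^sup>2 * (2 * x $ i)) / 2) (at 0)"
  proof (rule DERIV_cdivide, rule DERIV_chain'[OF norm_sq_line_deriv])
    show "(ln has_real_derivative 1 / (norm x)\<^sup>2) (at ((norm (x + 0 *\<^sub>R axis i 1))\<^sup>2))"
      using x DERIV_ln_divide[of "(norm x)\<^sup>2"] by simp
  qed
  then have d: "((\<lambda>s. ln (norm (x + s *\<^sub>R axis i 1))) has_real_derivative x $ i / (norm x)\<^sup>2) (at 0)"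
    unfolding l[symmetric] by simp
  have "((\<lambda>s. f (ln (norm (x + s *\<^sub>R axis i 1)))) has_real_derivative f' * (x $ i / (norm x)\<^sup>2)) (at 0)"
    by (rule DERIV_chain'[OF d]) (use f in simp)
  then show ?thesis unfolding e by simp
qed

lemma coord_deriv: "((\<lambda>s. (x + s *\<^sub>R axis i 1) $ j) has_real_derivative (if j = i then 1 else 0)) (at (0 :: real))"
  for x :: "real^2"
  by (auto simp: axis_def intro!: derivative_eq_intros)

lemma cont_log_radial: "continuous_on UNIV f \<Longrightarrow> continuous_on (- {0}) (\<lambda>x :: real^2. f (ln (norm x)))"
  for f :: "real \<Rightarrow> real"
  by (rule continuous_on_compose2[of UNIV f]) (auto intro!: continuous_intros)

text \<open>The condition f = o(1/r) at the origin: exactly what makes the flux through small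
  circles vanish, whose length is proportional to r.\<close>

definition small_flux :: "(real^2 \<Rightarrow> real) \<Rightarrow> bool" where
  "small_flux f \<longleftrightarrow> (\<forall>\<epsilon>>0. \<exists>\<delta>>0. \<forall>x. 0 < norm x \<longrightarrow> norm x < \<delta> \<longrightarrow> \<bar>f x\<bar> * norm x \<le> \<epsilon>)"

lemma small_flux_bounded:
  assumes "\<And>x. 0 < norm x \<Longrightarrow> norm x < 1 \<Longrightarrow> \<bar>f x\<bar> \<le> C"
  shows "small_flux f"
  unfolding small_flux_def
proof (intro allI impI)
  fix \<epsilon> :: real assume e: "0 < \<epsilon>"
  show "\<exists>\<delta>>0. \<forall>x. 0 < norm x \<longrightarrow> norm x < \<delta> \<longrightarrow> \<bar>f x\<bar> * norm x \<le> \<epsilon>"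
  proof (intro exI[of _ "min 1 (\<epsilon> / (\<bar>C\<bar> + 1))"] conjI allI impI)
    fix x :: "real^2" assume x: "0 < norm x" "norm x < min 1 (\<epsilon> / (\<bar>C\<bar> + 1))"
    have "\<bar>f x\<bar> * norm x \<le> (\<bar>C\<bar> + 1) * (\<epsilon> / (\<bar>C\<bar> + 1))"
      using assms[of x] x by (intro mult_mono) auto
    also have "\<dots> = \<epsilon>" by (simp add: add_nonneg_eq_0_iff)
    finally show "\<bar>f x\<bar> * norm x \<le> \<epsilon>" .
  qed (use e in simp)
qed

lemma small_flux_mult:
  assumes f: "small_flux f" and w: "test_function w"
  shows "small_flux (\<lambda>x. f x * w x)"
  unfolding small_flux_def
proof (intro allI impI)
  fix \<epsilon> :: real assume e: "0 < \<epsilon>"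
  have "bounded (w ` cball 0 1)" by (intro compact_imp_bounded compact_continuous_image test_function_cont[OF w]) auto
  then obtain C where C: "\<forall>y\<in>w ` cball 0 1. norm y \<le> C" unfolding bounded_iff by blast
  have "0 < \<epsilon> / (\<bar>C\<bar> + 1)" using e by simp
  then obtain d where d: "0 < d" "\<And>x. 0 < norm x \<Longrightarrow> norm x < d \<Longrightarrow> \<bar>f x\<bar> * norm x \<le> \<epsilon> / (\<bar>C\<bar> + 1)"
    using f unfolding small_flux_def by blast
  show "\<exists>\<delta>>0. \<forall>x. 0 < norm x \<longrightarrow> norm x < \<delta> \<longrightarrow> \<bar>f x * w x\<bar> * norm x \<le> \<epsilon>"
  proof (intro exI[of _ "min d 1"] conjI allI impI)
    fix x :: "real^2" assume x: "0 < norm x" "norm x < min d 1"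
    then have "norm (w x) \<le> C" using C by auto
    then have "\<bar>w x\<bar> * (\<bar>f x\<bar> * norm x) \<le> (\<bar>C\<bar> + 1) * (\<epsilon> / (\<bar>C\<bar> + 1))"
      using d(2)[of x] x by (intro mult_mono) auto
    also have "\<dots> = \<epsilon>" by (simp add: add_nonneg_eq_0_iff)
    finally show "\<bar>f x * w x\<bar> * norm x \<le> \<epsilon>" by (simp add: abs_mult mult_ac)
  qed (use d in simp)
qed

text \<open>The divergence of the field with components y_i w_i. Each component has its own test
  function, so that the scalar equation, with equal ones, and the curl equation, with the components
  of \<open>V\<close> interchanged, are both instances.\<close>

lemma divergence_test:
  fixes y d w :: "2 \<Rightarrow> real^2 \<Rightarrow> real"
  assumes yc: "\<And>i. continuous_on (- {0}) (y i)" and dc: "\<And>i. continuous_on (- {0}) (d i)"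
    and der: "\<And>i x. x \<noteq> 0 \<Longrightarrow> ((\<lambda>s. y i (x + s *\<^sub>R axis i 1)) has_real_derivative d i x) (at 0)"
    and small: "\<And>i. small_flux (y i)" and w: "\<And>i. test_function (w i)"
    and G: "integrable lborel G"
    and eq: "\<And>x. x \<noteq> 0 \<Longrightarrow> G x = (d 1 x * w 1 x + y 1 x * partial 1 (w 1) x) + (d 2 x * w 2 x + y 2 x * partial 2 (w 2) x)"
  shows "has_bochner_integral lborel G 0"
proof -
  define Y where "Y i x = y i x * w i x" for i x
  define D where "D i x = d i x * w i x + y i x * partial i (w i) x" for i x
  have Yc: "continuous_on (- {0}) (Y i)" and Dc: "continuous_on (- {0}) (D i)" for i
    unfolding Y_def[abs_def] D_def[abs_def] by (intro continuous_intros yc dc test_function_cont[OF w])+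
  have dY: "((\<lambda>s. Y i (x + s *\<^sub>R axis i 1)) has_real_derivative D i x) (at 0)" if "x \<noteq> 0" for i x
    unfolding Y_def D_def using DERIV_mult[OF der[OF that, of i] test_function_deriv[OF w[of i], of x i]]
    by (simp add: mult_ac)
  obtain \<rho>1 where \<rho>1: "\<And>x. \<rho>1 \<le> norm x \<Longrightarrow> w 1 x = 0" "\<And>i x. \<rho>1 \<le> norm x \<Longrightarrow> partial i (w 1) x = 0"
    using test_function_support[OF w[of 1]] by blast
  obtain \<rho>2 where \<rho>2: "\<And>x. \<rho>2 \<le> norm x \<Longrightarrow> w 2 x = 0" "\<And>i x. \<rho>2 \<le> norm x \<Longrightarrow> partial i (w 2) x = 0"
    using test_function_support[OF w[of 2]] by blast
  have supp: "w i x = 0" "partial j (w i) x = 0" if "max \<rho>1 \<rho>2 \<le> norm x" for i j x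
    using \<rho>1 \<rho>2 that exhaust_2[of i] by auto
  have ae: "AE x in lborel. G x = D 1 x + D 2 x"
    by (rule AE_mp[OF AE_lborel_singleton[of 0]], rule AE_I2) (use eq in \<open>auto simp: D_def\<close>)
  have Gm: "G \<in> borel_measurable lborel" using G by simp
  have Dm: "(\<lambda>x. D 1 x + D 2 x) \<in> borel_measurable lborel"
    using borel_measurable_punctured[OF Dc[of 1]] borel_measurable_punctured[OF Dc[of 2]] by simp
  have int: "integrable lborel (\<lambda>x. D 1 x + D 2 x)" using G integrable_cong_AE[OF Gm Dm ae] by simp
  have sm: "\<exists>\<delta>>0. \<forall>i x. 0 < norm x \<longrightarrow> norm x < \<delta> \<longrightarrow> \<bar>Y i x\<bar> * norm x \<le> \<epsilon>" if e: "0 < \<epsilon>" for \<epsilon>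
  proof -
    have sf: "small_flux (Y i)" for i unfolding Y_def by (rule small_flux_mult[OF small w])
    obtain \<delta>1 where \<delta>1: "0 < \<delta>1" "\<And>x. 0 < norm x \<Longrightarrow> norm x < \<delta>1 \<Longrightarrow> \<bar>Y 1 x\<bar> * norm x \<le> \<epsilon>"
      using sf[of 1] e unfolding small_flux_def by blast
    obtain \<delta>2 where \<delta>2: "0 < \<delta>2" "\<And>x. 0 < norm x \<Longrightarrow> norm x < \<delta>2 \<Longrightarrow> \<bar>Y 2 x\<bar> * norm x \<le> \<epsilon>"
      using sf[of 2] e unfolding small_flux_def by blast
    show ?thesis
      by (intro exI[of _ "min \<delta>1 \<delta>2"]) (use \<delta>1 \<delta>2 in \<open>auto simp: forall_2\<close>)
  qed
  have "(LINT x|lborel. D 1 x + D 2 x) = 0"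
    by (rule integral_divergence_zero[OF Yc Dc dY _ _ sm int, of "max \<rho>1 \<rho>2"]) (simp_all add: Y_def D_def supp)
  then have "(LINT x|lborel. G x) = 0" using integral_cong_AE[OF Gm Dm ae] by simp
  then show ?thesis using G by (simp add: has_bochner_integral_iff)
qed

text \<open>Off the origin the derivative is classical, and f = o(1/r) excludes a contribution
  concentrated at the origin. The field tested has \<open>f\<close> as component \<open>i\<close>
  and 0 as the other.\<close>

lemma weak_partialI:
  assumes f: "continuous_on (- {0}) f" and g: "continuous_on (- {0}) g"
    and der: "\<And>x. x \<noteq> 0 \<Longrightarrow> ((\<lambda>s. f (x + s *\<^sub>R axis i 1)) has_real_derivative g x) (at 0)"
    and small: "small_flux f" and lf: "locally_integrable f" and lg: "locally_integrable g"
  shows "weak_partial i f g"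
  unfolding weak_partial_def
proof (intro conjI allI impI lf lg)
  fix v assume v: "test_function v"
  obtain \<rho> where \<rho>: "\<And>x. \<rho> \<le> norm x \<Longrightarrow> v x = 0" "\<And>i x. \<rho> \<le> norm x \<Longrightarrow> partial i v x = 0"
    using test_function_support[OF v] by blast
  have i1: "integrable lborel (\<lambda>x. f x * partial i v x)" by (rule locally_integrable_mult[OF lf test_function_cont(2)[OF v] \<rho>(2)])
  have i2: "integrable lborel (\<lambda>x. g x * v x)" by (rule locally_integrable_mult[OF lg test_function_cont(1)[OF v] \<rho>(1)])
  have "has_bochner_integral lborel (\<lambda>x. f x * partial i v x + g x * v x) 0"
  proof (rule divergence_test[where y = "\<lambda>j x. if j = i then f x else 0" and d = "\<lambda>j x. if j = i then g x else 0" and w = "\<lambda>j. v"])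
    show "small_flux (\<lambda>x. if j = i then f x else 0)" for j
      using small small_flux_bounded[of "\<lambda>x. 0" 0] by (cases "j = i") auto
    show "integrable lborel (\<lambda>x. f x * partial i v x + g x * v x)" using i1 i2 by simp
    show "f x * partial i v x + g x * v x = ((if 1 = i then g x else 0) * v x + (if 1 = i then f x else 0) * partial 1 v x) +
         ((if 2 = i then g x else 0) * v x + (if 2 = i then f x else 0) * partial 2 v x)" for x
      using exhaust_2[of i] by auto
    show "continuous_on (- {0}) (\<lambda>x. if j = i then f x else 0)" "continuous_on (- {0}) (\<lambda>x. if j = i then g x else 0)" for j
      using f g by (cases "j = i"; simp)+
    show "((\<lambda>s. if j = i then f (x + s *\<^sub>R axis j 1) else 0) has_real_derivative (if j = i then g x else 0)) (at 0)" if "x \<noteq> 0" for j x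
      using der[OF that] by (cases "j = i") simp_all
  qed (rule v)
  then have "(LINT x|lborel. f x * partial i v x + g x * v x) = 0" by (simp add: has_bochner_integral_iff)
  then show "(LINT x|lborel. f x * partial i v x) = - (LINT x|lborel. g x * v x)" using i1 i2 by simp
qed

text \<open>\<open>G\<close> is the integrand as written in the notion of solution, with
  conventional values at the origin; \<open>H\<close> is the expression whose integrability is known
  term by term.\<close>

lemma divergence_test_AE:
  fixes y d w :: "2 \<Rightarrow> real^2 \<Rightarrow> real"
  assumes yc: "\<And>i. continuous_on (- {0}) (y i)" and dc: "\<And>i. continuous_on (- {0}) (d i)"
    and der: "\<And>i x. x \<noteq> 0 \<Longrightarrow> ((\<lambda>s. y i (x + s *\<^sub>R axis i 1)) has_real_derivative d i x) (at 0)"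
    and small: "\<And>i. small_flux (y i)" and w: "\<And>i. test_function (w i)"
    and H: "integrable lborel H"
    and eq: "\<And>x. x \<noteq> 0 \<Longrightarrow> H x = (d 1 x * w 1 x + y 1 x * partial 1 (w 1) x) + (d 2 x * w 2 x + y 2 x * partial 2 (w 2) x)"
    and GH: "\<And>x. x \<noteq> 0 \<Longrightarrow> G x = H x"
  shows "has_bochner_integral lborel G 0"
proof -
  have "continuous_on (- {0}) (\<lambda>x. (d 1 x * w 1 x + y 1 x * partial 1 (w 1) x) + (d 2 x * w 2 x + y 2 x * partial 2 (w 2) x))"
    by (intro continuous_intros yc dc test_function_cont[OF w])
  then have "continuous_on (- {0}) G"
    by (rule continuous_on_eq) (use eq GH in auto)
  then have Gm: "G \<in> borel_measurable lborel" using borel_measurable_punctured by simp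
  have Hm: "H \<in> borel_measurable lborel" using H by simp
  have ae: "AE x in lborel. G x = H x"
    by (rule AE_mp[OF AE_lborel_singleton[of 0]], rule AE_I2) (use GH in auto)
  have "has_bochner_integral lborel H 0" by (rule divergence_test[OF yc dc der small w H eq])
  then show ?thesis using has_bochner_integral_cong_AE[OF Gm Hm ae] by simp
qed

lemma exp_cancel: "exp (2 * t) * exp (- 2 * t) = 1" for t :: real
  by (simp add: exp_add[symmetric])

section \<open>The solution in the plane\<close>

context profile begin

lemma integrable_le_energy:
  assumes f: "continuous_on UNIV f" and nn: "\<And>t. 0 \<le> f t" and le: "\<And>t. f t \<le> K * e t"
  shows "integrable lborel f"
proof (rule integrable_lborel_of_bounded_integrals[OF f nn])
  fix T
  have "integral {-T..T} f \<le> integral {-T..T} (\<lambda>t. K * e t)"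
    by (intro integral_le integrable_continuous_real continuous_intros cont_e continuous_on_subset[OF f] le) simp
  also have "\<dots> = K * integral {-T..T} e" by simp
  also have "\<dots> \<le> \<bar>K\<bar> * E" 
  proof -
    have "0 \<le> integral {-T..T} e" by (intro integral_nonneg integrable_continuous_real cont_e) (rule e_nonneg)
    then have "K * integral {-T..T} e \<le> \<bar>K\<bar> * integral {-T..T} e" by (intro mult_right_mono) auto
    also have "\<dots> \<le> \<bar>K\<bar> * E" by (intro mult_left_mono energy) simp
    finally show ?thesis .
  qed
  finally show "integral {-T..T} f \<le> \<bar>K\<bar> * E" .
qed

lemma int_du: "integrable lborel (\<lambda>t. (du t)\<^sup>2)"
  by (rule integrable_le_energy[where K = 1]) (auto intro!: continuous_intros cont simp: energy_density_def)

lemma int_exp_u: "integrable lborel (\<lambda>t. exp (2 * t) * (u t)\<^sup>2)"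
  by (rule integrable_le_energy[where K = 1]) (auto intro!: continuous_intros cont simp: energy_density_def)

text \<open>Left of \<open>t1\<close> the term a^2 u^2 of the energy controls u^2, right of it the
  term e^(2t) u^2 does. In the plane this is the integrability of u^2 / r^2.\<close>

lemma int_u_sq: "integrable lborel (\<lambda>t. (u t)\<^sup>2)"
proof (rule integrable_le_energy[where K = "4 / \<kappa>\<^sup>2 + exp (- (2 * t1))"])
  fix t
  have p: "0 \<le> 4 / \<kappa>\<^sup>2 * e t" "0 \<le> exp (- (2 * t1)) * e t" using e_nonneg by simp_all
  show "(u t)\<^sup>2 \<le> (4 / \<kappa>\<^sup>2 + exp (- (2 * t1))) * e t"
  proof (cases "t \<le> t1")
    case True
    then show ?thesis using u_sq_le_e[of t] p unfolding distrib_right by linarith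
  next
    case False
    have "exp (2 * t1) * (u t)\<^sup>2 \<le> exp (2 * t) * (u t)\<^sup>2" using False by (intro mult_right_mono) auto
    also have "\<dots> \<le> e t" by (simp add: energy_density_def)
    finally have "exp (- (2 * t1)) * (exp (2 * t1) * (u t)\<^sup>2) \<le> exp (- (2 * t1)) * e t" by (intro mult_left_mono) auto
    then have "(u t)\<^sup>2 \<le> exp (- (2 * t1)) * e t" by (simp add: mult.assoc[symmetric] exp_add[symmetric])
    then show ?thesis using p unfolding distrib_right by linarith
  qed
qed (auto intro!: continuous_intros cont)

text \<open>Integrating the equation for \<open>u\<close> gives integrability of \<open>u\<close> at \<open>-\<infinity>\<close>, because \<open>u'\<close> tends to \<open>0\<close> there.\<close>

lemma int_u_Iic: "integrable lborel (\<lambda>t. indicator {..T} t * u t)"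
proof -
  \<comment> \<open>Adding Q e^(2t) compensates the term with \<open>R'\<close>, so that the sum is
    nonnegative up to \<open>t1\<close> and dominates (\<kappa>/2)^2 u. Its primitive u' + Q e^(2t)
    / 2 tends to 0.\<close>
  let ?g = "\<lambda>t. ddu t + Q * exp (2 * t)"
  have g_ge: "(\<kappa> / 2)\<^sup>2 * u t \<le> ?g t" if t: "t \<le> t1" for t
  proof -
    have "(\<kappa> / 2)\<^sup>2 \<le> (a t)\<^sup>2" using a_lower[of t] t \<kappa> by (intro power_mono) auto
    then have "(\<kappa> / 2)\<^sup>2 * u t \<le> (a t)\<^sup>2 * u t" using u_nonneg by (intro mult_right_mono)
    moreover have "exp (2 * t) * R' (u t) \<le> exp (2 * t) * Q" using Q by (intro mult_left_mono) auto
    moreover have "0 \<le> exp (2 * t) * u t" using u_nonneg by simp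
    ultimately show ?thesis unfolding ddu_def right_diff_distrib mult.commute[of Q] by linarith
  qed
  have "(du \<longlongrightarrow> 0) at_bot"
  proof (rule tendstoI)
    fix \<epsilon> :: real assume "0 < \<epsilon>"
    then obtain T where "\<forall>t\<le>T. \<bar>du t\<bar> < \<epsilon>" using du_tendsto_0 by blast
    then show "\<forall>\<^sub>F t in at_bot. dist (du t) 0 < \<epsilon>" unfolding eventually_at_bot_linorder by auto
  qed
  moreover have "((\<lambda>t. Q / 2 * exp (2 * t)) \<longlongrightarrow> Q / 2 * 0) at_bot" by (intro tendsto_intros) real_asymp
  ultimately have lim: "((\<lambda>t. du t + Q / 2 * exp (2 * t)) \<longlongrightarrow> 0) at_bot" using tendsto_add[of du 0 at_bot] by fastforce
  have um: "u \<in> borel_measurable borel" by (rule borel_measurable_continuous_onI[OF cont(1)])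
  have gc: "continuous_on UNIV ?g" by (intro continuous_intros cont_ddu)
  have "integrable lborel (\<lambda>t. indicator {..t1} t * ?g t)"
  proof (rule integrable_Iic_FTC[OF _ _ _ lim])
    show "?g \<in> borel_measurable borel" by (rule borel_measurable_continuous_onI[OF gc])
    show "((\<lambda>t. du t + Q / 2 * exp (2 * t)) has_real_derivative ?g t) (at t)" for t
    proof -
      have "((\<lambda>t. Q / 2 * exp (2 * t)) has_real_derivative Q * exp (2 * t)) (at t)" by (auto intro!: derivative_eq_intros)
      then show ?thesis by (rule DERIV_add[OF derivs(2)])
    qed
    show "0 \<le> ?g t" if "t \<le> t1" for t
      using g_ge[OF that] u_nonneg[of t] by (meson mult_nonneg_nonneg order_trans zero_le_power2)
  qed
  then have "integrable lborel (\<lambda>t. 1 / (\<kappa> / 2)\<^sup>2 * (indicator {..t1} t * ?g t) + M * exp (- (2 * t1)) * (indicator {..T} t * exp (2 * t)))"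
    by (intro Bochner_Integration.integrable_add integrable_mult_right integrable_exp_Iic) auto
  then show ?thesis
  proof (rule Bochner_Integration.integrable_bound)
    show "AE t in lborel. norm (indicator {..T} t * u t) \<le> norm (1 / (\<kappa> / 2)\<^sup>2 * (indicator {..t1} t * ?g t) + M * exp (- (2 * t1)) * (indicator {..T} t * exp (2 * t)))"
    proof (rule AE_I2)
      fix t
      let ?A = "1 / (\<kappa> / 2)\<^sup>2 * (indicator {..t1} t * ?g t)" and ?B = "M * exp (- (2 * t1)) * (indicator {..T} t * exp (2 * t))"
      have B0: "0 \<le> ?B" using M0 by simp
      have A0: "0 \<le> ?A"
      proof (cases "t \<le> t1")
        case True
        have "0 \<le> (\<kappa> / 2)\<^sup>2 * u t" using u_nonneg by simp
        then have "0 \<le> ?g t" using g_ge[OF True] by linarith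
        then show ?thesis by simp
      qed simp
      have "indicator {..T} t * u t \<le> ?A + ?B"
      proof (cases "t \<le> t1")
        case True
        have "u t \<le> ?A" using g_ge[OF True] \<kappa> True by (simp add: field_simps)
        moreover have "indicator {..T} t * u t \<le> u t" using u_nonneg[of t] by (simp add: indicator_def)
        ultimately show ?thesis using B0 by linarith
      next
        case False
        have "M * 1 \<le> M * (exp (- (2 * t1)) * exp (2 * t))"
          using M0 False by (intro mult_left_mono) (auto simp: exp_add[symmetric])
        then have "u t \<le> M * exp (- (2 * t1)) * exp (2 * t)" using u_le[of t] by (simp add: mult.assoc)
        then have "indicator {..T} t * u t \<le> ?B" by (simp add: indicator_def)
        then show ?thesis using A0 by linarith
      qed
      then show "norm (indicator {..T} t * u t) \<le> norm (?A + ?B)" using A0 B0 u_nonneg[of t] by simp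
    qed
  qed (use um in simp)
qed

end

section \<open>The planar fields and their weak derivatives\<close>

locale planar_profile = profile +
  fixes \<sigma> :: real
  assumes \<sigma>: "\<sigma> = 1 \<or> \<sigma> = - 1"
begin

abbreviation "lr x \<equiv> ln (norm (x :: real^2))"

text \<open>\<open>hh\<close> is the radial factor \<sigma> (\<kappa> - a) / r^2 of A0. The factors
  \<open>\<psi>\<close> and \<open>w\<close> are such that the gradients of \<open>hh\<close> and u,
  as functions of x, are \<psi> x and w x; \<open>DA0\<close> is the classical Jacobian off the
  origin.\<close>

definition "hh t = \<sigma> * (\<kappa> - a t) * exp (- 2 * t)"
definition "\<psi> t = (- \<sigma> * b t - 2 * hh t) * exp (- 2 * t)"
definition "w t = du t * exp (- 2 * t)"
definition "u0 x = u (lr x)"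
definition "Du0 x = w (lr x) *\<^sub>R x"
definition A0 :: "real^2 \<Rightarrow> real^3" where "A0 x = hh (lr x) *\<^sub>R vector [- (x $ 2), x $ 1, 0]"
definition DA0 :: "real^2 \<Rightarrow> real^2^3" where
  "DA0 x = (\<chi> j i. if j = 1 then - (\<psi> (lr x) * x $ i * x $ 2 + (if i = 2 then hh (lr x) else 0))
     else if j = 2 then \<psi> (lr x) * x $ i * x $ 1 + (if i = 1 then hh (lr x) else 0) else 0)"

lemma exp_lr: "x \<noteq> 0 \<Longrightarrow> exp (lr x) = norm x" "x \<noteq> 0 \<Longrightarrow> exp (- 2 * lr x) * (norm x)\<^sup>2 = 1"
  "x \<noteq> 0 \<Longrightarrow> exp (- 2 * lr x) = 1 / (norm x)\<^sup>2" "x \<noteq> 0 \<Longrightarrow> exp (- lr x) * norm x = 1"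
proof -
  assume x: "x \<noteq> 0"
  show 1: "exp (lr x) = norm x" using x by simp
  have "exp (- 2 * lr x) = inverse ((exp (lr x))\<^sup>2)" by (simp add: exp_minus exp_double[symmetric])
  then show 3: "exp (- 2 * lr x) = 1 / (norm x)\<^sup>2" unfolding 1 by (simp add: inverse_eq_divide)
  then show "exp (- 2 * lr x) * (norm x)\<^sup>2 = 1" using x by simp
  show "exp (- lr x) * norm x = 1" using x by (simp add: exp_minus)
qed

lemma norm_sq2: "(norm (x :: real^2))\<^sup>2 = (x $ 1)\<^sup>2 + (x $ 2)\<^sup>2"
  unfolding power2_norm_eq_inner by (simp add: inner_vec_def sum_2 power2_eq_square)

text \<open>The first bound serves near the origin and rests on the improved rate e^(2t) for a -
  \<kappa>; the second serves at infinity.\<close>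

lemma hh_le: "\<bar>hh t\<bar> \<le> B / 2" "\<bar>hh t\<bar> \<le> 2 * \<kappa> * exp (- 2 * t)"
proof -
  have 1: "\<bar>hh t\<bar> = \<bar>a t - \<kappa>\<bar> * exp (- 2 * t)" using \<sigma> by (auto simp: hh_def abs_mult abs_minus_commute)
  have "\<bar>a t - \<kappa>\<bar> * exp (- 2 * t) \<le> B / 2 * exp (2 * t) * exp (- 2 * t)" by (intro mult_right_mono h_le) simp
  also have "\<dots> = B / 2 * (exp (2 * t) * exp (- 2 * t))" by (simp only: mult.assoc)
  also have "exp (2 * t) * exp (- 2 * t) = 1" by (simp add: exp_add[symmetric])
  finally show "\<bar>hh t\<bar> \<le> B / 2" unfolding 1 by simp
  show "\<bar>hh t\<bar> \<le> 2 * \<kappa> * exp (- 2 * t)"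
    unfolding 1 using a_le[of t] \<kappa> by (intro mult_right_mono) auto
qed

lemma B0: "0 \<le> B" using b_le[of 0] by linarith

lemma hh_deriv: "(hh has_real_derivative \<psi> t * exp (2 * t)) (at t)"
proof -
  have e: "exp (2 * t) * exp (- 2 * t) = 1" by (simp add: exp_add[symmetric])
  have "(hh has_real_derivative \<sigma> * (0 - exp (2 * t) * b t) * exp (- 2 * t) + exp (- 2 * t) * (- 2) * (\<sigma> * (\<kappa> - a t))) (at t)"
    unfolding hh_def[abs_def]
    by (intro DERIV_mult DERIV_cmult DERIV_diff DERIV_const derivs) (auto intro!: derivative_eq_intros)
  moreover have "\<sigma> * (0 - exp (2 * t) * b t) * exp (- 2 * t) + exp (- 2 * t) * (- 2) * (\<sigma> * (\<kappa> - a t)) = - \<sigma> * b t * (exp (2 * t) * exp (- 2 * t)) - 2 * hh t"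
    by (simp add: hh_def algebra_simps)
  moreover have "\<psi> t * exp (2 * t) = (- \<sigma> * b t - 2 * hh t) * (exp (2 * t) * exp (- 2 * t))"
    by (simp add: \<psi>_def mult_ac)
  ultimately show ?thesis unfolding e by simp
qed

lemma w_deriv: "(w has_real_derivative (ddu t - 2 * du t) * exp (- 2 * t)) (at t)"
proof -
  have "(w has_real_derivative ddu t * exp (- 2 * t) + exp (- 2 * t) * (- 2) * du t) (at t)"
    unfolding w_def[abs_def] by (intro DERIV_mult derivs) (auto intro!: derivative_eq_intros)
  then show ?thesis by (simp add: algebra_simps)
qed

lemma cont_t: "continuous_on A hh" "continuous_on A \<psi>" "continuous_on A w"
  unfolding hh_def[abs_def] \<psi>_def[abs_def] w_def[abs_def] hh_def by (intro continuous_intros cont)+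

lemma cont_x: "continuous_on (- {0}) (\<lambda>x. u (lr x))" "continuous_on (- {0}) (\<lambda>x. du (lr x))"
  "continuous_on (- {0}) (\<lambda>x. a (lr x))" "continuous_on (- {0}) (\<lambda>x. b (lr x))" "continuous_on (- {0}) (\<lambda>x. ddu (lr x))"
  "continuous_on (- {0}) (\<lambda>x. hh (lr x))" "continuous_on (- {0}) (\<lambda>x. \<psi> (lr x))" "continuous_on (- {0}) (\<lambda>x. w (lr x))"
  "continuous_on (- {0}) (\<lambda>x. R' (u (lr x)))" "continuous_on (- {0}) (\<lambda>x. exp (- 2 * lr x))"
  by (rule cont_log_radial, rule cont cont_ddu cont_t)+
    (rule cont_log_radial, intro continuous_intros continuous_on_compose2[OF R'_cont cont(1)]; simp)+

text \<open>Writing the derivative as f' e^(2t) absorbs the factor 1 / r^2 of the chain rule and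
  leaves f' x_i.\<close>

lemma radial_x:
  assumes x: "x \<noteq> 0" and f: "\<And>t. (f has_real_derivative f' t * exp (2 * t)) (at t)"
  shows "((\<lambda>s. f (lr (x + s *\<^sub>R axis i 1))) has_real_derivative f' (lr x) * x $ i) (at 0)"
proof -
  have "f' (lr x) * exp (2 * lr x) * exp (- 2 * lr x) = f' (lr x) * (exp (2 * lr x) * exp (- 2 * lr x))" by (simp only: mult.assoc)
  also have "exp (2 * lr x) * exp (- 2 * lr x) = 1" by (simp add: exp_add[symmetric])
  finally have "f' (lr x) * exp (2 * lr x) * exp (- 2 * lr x) = f' (lr x)" by (simp only: mult_1_right)
  then show ?thesis using log_radial_deriv[OF x f, of i] by (simp only:)
qed

lemma bounded_locally_integrable:
  assumes "continuous_on (- {0}) G" "\<And>T. \<exists>C. \<forall>x. x \<noteq> 0 \<longrightarrow> lr x \<le> T \<longrightarrow> \<bar>G x\<bar> \<le> C"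
  shows "locally_integrable G"
proof (rule locally_integrableI[OF assms(1)])
  fix T
  obtain C where C: "\<And>x. x \<noteq> 0 \<Longrightarrow> lr x \<le> T \<Longrightarrow> \<bar>G x\<bar> \<le> C" using assms(2) by blast
  have "integrable lborel (\<lambda>t. C * (indicator {..T} t * exp (2 * t)))" by (intro integrable_mult_right integrable_exp_Iic) simp
  then have "integrable lborel (\<lambda>t. exp (2 * t) * (indicator {..T} t * C))" by (simp add: mult_ac)
  then show "\<exists>f. f \<in> borel_measurable borel \<and> integrable lborel (\<lambda>t. exp (2 * t) * (indicator {..T} t * f t)) \<and>
      (\<forall>x. x \<noteq> 0 \<longrightarrow> ln (norm x) \<le> T \<longrightarrow> \<bar>G x\<bar> \<le> f (ln (norm x)))"
    using C by (intro exI[of _ "\<lambda>_. C"]) auto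
qed

lemma norm_le_exp: "x \<noteq> 0 \<Longrightarrow> lr x \<le> T \<Longrightarrow> norm x \<le> exp T"
  by (metis exp_le_cancel_iff exp_ln zero_less_norm_iff)

text \<open>Multiplied by r, the gradient is at most |u'|, which tends to 0 at -infinity.\<close>

lemma small_flux_w: "small_flux (\<lambda>x. w (lr x) * x $ i)"
  unfolding small_flux_def
proof (intro allI impI)
  fix \<epsilon> :: real assume "0 < \<epsilon>"
  then obtain T where T: "\<And>t. t \<le> T \<Longrightarrow> \<bar>du t\<bar> < \<epsilon>" using du_tendsto_0 by blast
  show "\<exists>\<delta>>0. \<forall>x. 0 < norm x \<longrightarrow> norm x < \<delta> \<longrightarrow> \<bar>w (lr x) * x $ i\<bar> * norm x \<le> \<epsilon>"
  proof (intro exI[of _ "exp T"] conjI allI impI)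
    fix x :: "real^2" assume x: "0 < norm x" "norm x < exp T"
    then have "lr x \<le> T" by (metis less_imp_le ln_exp ln_less_cancel_iff exp_gt_zero)
    then have d: "\<bar>du (lr x)\<bar> \<le> \<epsilon>" using T by (simp add: less_imp_le)
    have "\<bar>w (lr x) * x $ i\<bar> * norm x \<le> \<bar>w (lr x)\<bar> * norm x * norm x"
      unfolding abs_mult by (intro mult_right_mono mult_left_mono component_le_norm_cart) auto
    also have "\<dots> = \<bar>du (lr x)\<bar> * (exp (- 2 * lr x) * (norm x)\<^sup>2)" by (simp add: w_def abs_mult power2_eq_square)
    also have "\<dots> = \<bar>du (lr x)\<bar>" using exp_lr(2)[of x] x by simp
    finally show "\<bar>w (lr x) * x $ i\<bar> * norm x \<le> \<epsilon>" using d by simp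
  qed simp
qed

lemma loc_u: "locally_integrable (\<lambda>x. u (lr x))"
  by (rule bounded_locally_integrable[OF cont_x(1)]) (use u_nonneg u_le in \<open>auto intro!: exI[of _ M]\<close>)

lemma Du_le: "x \<noteq> 0 \<Longrightarrow> \<bar>w (lr x) * x $ i\<bar> \<le> \<bar>du (lr x)\<bar> * exp (- lr x)"
proof -
  assume x: "x \<noteq> 0"
  have "\<bar>w (lr x) * x $ i\<bar> \<le> \<bar>w (lr x)\<bar> * norm x" unfolding abs_mult by (intro mult_left_mono component_le_norm_cart) auto
  also have "\<dots> = \<bar>du (lr x)\<bar> * (exp (- 2 * lr x) * exp (lr x))" using exp_lr(1)[OF x] by (simp add: w_def abs_mult)
  also have "exp (- 2 * lr x) * exp (lr x) = exp (- lr x)" by (simp add: exp_add[symmetric])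
  finally show ?thesis .
qed

text \<open>The gradient is at most |u'| / r with u' bounded on left half-lines, and 1/r is locally
  integrable in the plane.\<close>

lemma loc_Du: "locally_integrable (\<lambda>x. w (lr x) * x $ i)"
proof (rule locally_integrableI)
  show "continuous_on (- {0}) (\<lambda>x. w (lr x) * x $ i)" by (intro continuous_intros cont_x)
  fix T
  obtain C where C: "0 \<le> C" "\<And>t. t \<le> T \<Longrightarrow> \<bar>du t\<bar> \<le> C" using du_bounded[of T] by blast
  have "integrable lborel (\<lambda>t. C * (indicator {..T} t * exp (1 * t)))" by (intro integrable_mult_right integrable_exp_Iic) simp
  moreover have "(\<lambda>t. exp (2 * t) * (indicator {..T} t * (C * exp (- t)))) = (\<lambda>t. C * (indicator {..T} t * exp (1 * t)))"
  proof
    fix t :: real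
    have "exp (2 * t) * (indicator {..T} t * (C * exp (- t))) = C * (indicator {..T} t * (exp (2 * t) * exp (- t)))"
      by (simp only: mult_ac)
    also have "exp (2 * t) * exp (- t) = exp (1 * t)" by (simp add: exp_add[symmetric])
    finally show "exp (2 * t) * (indicator {..T} t * (C * exp (- t))) = C * (indicator {..T} t * exp (1 * t))" .
  qed
  ultimately have "integrable lborel (\<lambda>t. exp (2 * t) * (indicator {..T} t * (C * exp (- t))))" by (simp only:)
  moreover have "\<bar>w (lr x) * x $ i\<bar> \<le> C * exp (- lr x)" if "x \<noteq> 0" "lr x \<le> T" for x
    using Du_le[OF that(1), of i] mult_right_mono[OF C(2)[OF that(2)] exp_ge_zero[of "- lr x"]] by (rule order_trans)
  ultimately show "\<exists>f. f \<in> borel_measurable borel \<and> integrable lborel (\<lambda>t. exp (2 * t) * (indicator {..T} t * f t)) \<and>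
      (\<forall>x. x \<noteq> 0 \<longrightarrow> ln (norm x) \<le> T \<longrightarrow> \<bar>w (lr x) * x $ i\<bar> \<le> f (ln (norm x)))"
    by (intro exI[of _ "\<lambda>t. C * exp (- t)"]) auto
qed

lemma weak_gradient_u0: "weak_gradient u0 Du0"
  unfolding weak_gradient_def
proof
  fix i
  have "weak_partial i (\<lambda>x. u (lr x)) (\<lambda>x. w (lr x) * x $ i)"
  proof (rule weak_partialI[OF cont_x(1) _ _ _ loc_u loc_Du])
    show "continuous_on (- {0}) (\<lambda>x. w (lr x) * x $ i)" by (intro continuous_intros cont_x)
    show "((\<lambda>s. u (lr (x + s *\<^sub>R axis i 1))) has_real_derivative w (lr x) * x $ i) (at 0)" if "x \<noteq> 0" for x
    proof (rule radial_x[OF that])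
      fix t :: real
      have "exp (- 2 * t) * exp (2 * t) = 1" by (simp add: exp_add[symmetric])
      then have "w t * exp (2 * t) = du t" unfolding w_def mult.assoc by (simp only: mult_1_right)
      then show "(u has_real_derivative w t * exp (2 * t)) (at t)" using derivs(1) by simp
    qed
    show "small_flux (\<lambda>x. u (lr x))" by (rule small_flux_bounded[of _ M]) (use u_nonneg u_le in auto)
  qed
  then show "weak_partial i u0 (\<lambda>x. Du0 x $ i)" by (simp add: u0_def[abs_def] Du0_def)
qed

lemma \<psi>_le: "x \<noteq> 0 \<Longrightarrow> \<bar>\<psi> (lr x) * x $ i * x $ j\<bar> \<le> \<bar>b (lr x)\<bar> + 2 * \<bar>hh (lr x)\<bar>"
proof -
  assume x: "x \<noteq> 0"
  have "\<bar>\<psi> (lr x) * x $ i * x $ j\<bar> \<le> \<bar>\<psi> (lr x)\<bar> * norm x * norm x"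
    unfolding abs_mult by (intro mult_mono component_le_norm_cart) auto
  also have "\<dots> = \<bar>- \<sigma> * b (lr x) - 2 * hh (lr x)\<bar> * (exp (- 2 * lr x) * (norm x)\<^sup>2)"
    by (simp add: \<psi>_def abs_mult power2_eq_square)
  also have "\<dots> = \<bar>- \<sigma> * b (lr x) - 2 * hh (lr x)\<bar>" using exp_lr(2)[OF x] by simp
  also have "\<dots> \<le> \<bar>b (lr x)\<bar> + 2 * \<bar>hh (lr x)\<bar>" using \<sigma> by auto
  finally show ?thesis .
qed

lemma DA0_le: "x \<noteq> 0 \<Longrightarrow> \<bar>DA0 x $ j $ i\<bar> \<le> \<bar>b (lr x)\<bar> + 3 * \<bar>hh (lr x)\<bar>"
proof -
  assume x: "x \<noteq> 0"
  have aux: "\<bar>X + (if q then h else 0)\<bar> \<le> A + 3 * \<bar>h\<bar>" if "\<bar>X\<bar> \<le> A + 2 * \<bar>h\<bar>" for X A h :: real and q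
    using that by (cases q) auto
  have "\<bar>- (\<psi> (lr x) * x $ i * x $ 2 + (if i = 2 then hh (lr x) else 0))\<bar> \<le> \<bar>b (lr x)\<bar> + 3 * \<bar>hh (lr x)\<bar>"
    "\<bar>\<psi> (lr x) * x $ i * x $ 1 + (if i = 1 then hh (lr x) else 0)\<bar> \<le> \<bar>b (lr x)\<bar> + 3 * \<bar>hh (lr x)\<bar>"
    using aux[OF \<psi>_le[OF x, of i 2], of "i = 2"] aux[OF \<psi>_le[OF x, of i 1], of "i = 1"] by (simp_all only: abs_minus_cancel)
  then show ?thesis by (simp add: DA0_def)
qed

lemma cont_DA0: "continuous_on (- {0}) (\<lambda>x. DA0 x $ j $ i)"
proof -
  have "continuous_on (- {0}) (\<lambda>x. if i = l then hh (lr x) else 0)" for l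
    by (cases "i = l") (simp_all add: cont_x)
  then show ?thesis
    unfolding DA0_def by (cases "j = 1"; cases "j = 2") (auto intro!: continuous_intros cont_x)
qed

lemma cont_A0: "continuous_on (- {0}) (\<lambda>x. A0 x $ j)"
proof -
  consider "j = 1" | "j = 2" | "j = 3" using exhaust_3 by blast
  then show ?thesis
    by cases (auto simp: A0_def vector_3 intro!: continuous_intros cont_x)
qed

lemma A0_le: "\<bar>A0 x $ j\<bar> \<le> B / 2 * norm x"
proof -
  have 1: "\<bar>hh (lr x) * x $ i\<bar> \<le> B / 2 * norm x" for i
    unfolding abs_mult using B0 by (intro mult_mono hh_le component_le_norm_cart) auto
  have 0: "0 \<le> B / 2 * norm x" using B0 by simp
  consider "j = 1" | "j = 2" | "j = 3" using exhaust_3 by blast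
  then show ?thesis using 1[of 1] 1[of 2] 0 by cases (simp_all add: A0_def vector_3)
qed

lemma loc_DA0: "locally_integrable (\<lambda>x. DA0 x $ j $ i)"
proof (rule bounded_locally_integrable[OF cont_DA0])
  fix T
  have "\<bar>DA0 x $ j $ i\<bar> \<le> B + 3 * (B / 2)" if "x \<noteq> 0" for x
    using DA0_le[OF that, of j i] b_le[of "lr x"] hh_le(1)[of "lr x"] by linarith
  then show "\<exists>C. \<forall>x. x \<noteq> 0 \<longrightarrow> lr x \<le> T \<longrightarrow> \<bar>DA0 x $ j $ i\<bar> \<le> C" by blast
qed

lemma loc_A0: "locally_integrable (\<lambda>x. A0 x $ j)"
proof (rule bounded_locally_integrable[OF cont_A0])
  fix T
  have "\<bar>A0 x $ j\<bar> \<le> B / 2 * exp T" if "x \<noteq> 0" "lr x \<le> T" for x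
    using A0_le[of x j] mult_left_mono[OF norm_le_exp[OF that], of "B / 2"] B0 by linarith
  then show "\<exists>C. \<forall>x. x \<noteq> 0 \<longrightarrow> lr x \<le> T \<longrightarrow> \<bar>A0 x $ j\<bar> \<le> C" by blast
qed

lemma weak_jacobian_A0: "weak_jacobian A0 DA0"
  unfolding weak_jacobian_def
proof (intro allI)
  fix j :: 3 and i :: 2
  have sf: "small_flux (\<lambda>x. A0 x $ j)"
  proof (rule small_flux_bounded[of _ "B / 2"])
    fix x :: "real^2" assume "norm x < 1"
    then have "B / 2 * norm x \<le> B / 2 * 1" using B0 by (intro mult_left_mono) auto
    then show "\<bar>A0 x $ j\<bar> \<le> B / 2" using A0_le[of x j] by simp
  qed
  have d: "((\<lambda>s. A0 (x + s *\<^sub>R axis i 1) $ j) has_real_derivative DA0 x $ j $ i) (at 0)" if x: "x \<noteq> 0" for x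
  proof -
    have m: "((\<lambda>s. hh (lr (x + s *\<^sub>R axis i 1)) * (x + s *\<^sub>R axis i 1) $ l) has_real_derivative
       \<psi> (lr x) * x $ i * x $ l + (if i = l then hh (lr x) else 0)) (at 0)" for l
      using DERIV_mult[OF radial_x[OF x hh_deriv, of i] coord_deriv[of x i l]] by (cases "i = l") simp_all
    consider "j = 1" | "j = 2" | "j = 3" using exhaust_3 by blast
    then show ?thesis
    proof cases
      case 1
      have "A0 y $ j = - (hh (lr y) * y $ 2)" "DA0 x $ j $ i = - (\<psi> (lr x) * x $ i * x $ 2 + (if i = 2 then hh (lr x) else 0))" for y
        using 1 by (simp_all add: A0_def DA0_def vector_3)
      then show ?thesis using DERIV_minus[OF m[of 2]] by (simp only:)
    next
      case 2
      have "A0 y $ j = hh (lr y) * y $ 1" "DA0 x $ j $ i = \<psi> (lr x) * x $ i * x $ 1 + (if i = 1 then hh (lr x) else 0)" for y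
        using 2 by (simp_all add: A0_def DA0_def vector_3)
      then show ?thesis using m[of 1] by (simp only:)
    qed (simp add: A0_def DA0_def vector_3)
  qed
  show "weak_partial i (\<lambda>x. A0 x $ j) (\<lambda>x. DA0 x $ j $ i)"
    by (rule weak_partialI[OF cont_A0 cont_DA0 d sf loc_A0 loc_DA0])
qed

text \<open>The terms with \<kappa> cancel and \<sigma> a grad \<theta> is left. Both sides are 0 at
  the origin, so the identity holds everywhere.\<close>

lemma gauge_field:
  assumes k: "real_of_int k = \<sigma> * \<kappa>"
  shows "of_int k *\<^sub>R grad_theta x - A0 x = (\<sigma> * a (lr x) * exp (- 2 * lr x)) *\<^sub>R vector [- (x $ 2), x $ 1, 0]"
proof (cases "x = 0")
  case True
  then show ?thesis by (simp add: vec_eq_iff forall_3 vector_3 grad_theta_def A0_def)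
next
  case False
  have c: "y / (norm x)\<^sup>2 = exp (- 2 * lr x) * y" for y using exp_lr(3)[OF False] by simp
  show ?thesis
    unfolding vec_eq_iff forall_3 grad_theta_def A0_def c
    by (simp add: vector_3 k hh_def algebra_simps)
qed

lemma gauge_field_norm:
  assumes k: "real_of_int k = \<sigma> * \<kappa>" and x: "x \<noteq> 0"
  shows "(norm (of_int k *\<^sub>R grad_theta x - A0 x))\<^sup>2 = (a (lr x))\<^sup>2 * exp (- 2 * lr x)"
proof -
  have n: "(norm (vector [- (x $ 2), x $ 1, 0] :: real^3))\<^sup>2 = (norm x)\<^sup>2"
    unfolding norm_sq2 power2_norm_eq_inner by (simp add: inner_vec_def sum_3 vector_3 power2_eq_square)
  have "(norm (of_int k *\<^sub>R grad_theta x - A0 x))\<^sup>2 = (\<sigma> * a (lr x) * exp (- 2 * lr x))\<^sup>2 * (norm x)\<^sup>2"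
    unfolding gauge_field[OF k] norm_scaleR power_mult_distrib[of "\<bar>_\<bar>"] power2_abs n ..
  also have "\<dots> = \<sigma>\<^sup>2 * (a (lr x))\<^sup>2 * exp (- 2 * lr x) * (exp (- 2 * lr x) * (norm x)\<^sup>2)"
    by (simp add: power2_eq_square mult_ac)
  finally show ?thesis using exp_lr(2)[OF x] \<sigma> by auto
qed

text \<open>Boundedness of u leaves u / r^2 just short of integrable. The weight e^(2t) cancels 1 /
  r^2, and what is needed is the integrability of u itself at -infinity.\<close>

lemma loc_potential: "locally_integrable (\<lambda>x. (a (lr x))\<^sup>2 * exp (- 2 * lr x) * u (lr x))"
proof (rule locally_integrableI)
  show "continuous_on (- {0}) (\<lambda>x. (a (lr x))\<^sup>2 * exp (- 2 * lr x) * u (lr x))" by (intro continuous_intros cont_x)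
  fix T
  have um: "u \<in> borel_measurable borel" by (rule borel_measurable_continuous_onI[OF cont(1)])
  have "exp (2 * t) * (indicator {..T} t * (\<kappa>\<^sup>2 * exp (- 2 * t) * u t)) = \<kappa>\<^sup>2 * (indicator {..T} t * u t)" for t
    using exp_cancel[of t] by algebra
  moreover have "integrable lborel (\<lambda>t. \<kappa>\<^sup>2 * (indicator {..T} t * u t))" by (intro integrable_mult_right int_u_Iic)
  ultimately have "integrable lborel (\<lambda>t. exp (2 * t) * (indicator {..T} t * (\<kappa>\<^sup>2 * exp (- 2 * t) * u t)))"
    by (simp only:)
  moreover have "\<bar>(a t)\<^sup>2 * exp (- 2 * t) * u t\<bar> \<le> \<kappa>\<^sup>2 * exp (- 2 * t) * u t" for t
    using a_sq[of t] u_nonneg[of t] by (simp add: mult_right_mono)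
  ultimately show "\<exists>f. f \<in> borel_measurable borel \<and> integrable lborel (\<lambda>t. exp (2 * t) * (indicator {..T} t * f t)) \<and>
      (\<forall>x. x \<noteq> 0 \<longrightarrow> ln (norm x) \<le> T \<longrightarrow> \<bar>(a (lr x))\<^sup>2 * exp (- 2 * lr x) * u (lr x)\<bar> \<le> f (ln (norm x)))"
    using um by (intro exI[of _ "\<lambda>t. \<kappa>\<^sup>2 * exp (- 2 * t) * u t"]) auto
qed

lemma loc_W': "locally_integrable (\<lambda>x. u (lr x) - R' (u (lr x)))"
proof (rule bounded_locally_integrable)
  show "continuous_on (- {0}) (\<lambda>x. u (lr x) - R' (u (lr x)))" by (intro continuous_intros cont_x)
  fix T
  have "\<bar>u t - R' (u t)\<bar> \<le> M + Q" for t
    using u_nonneg[of t] u_le[of t] Q(1) Q(2)[of t] R'_nonneg[of "u t"] by linarith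
  then show "\<exists>C. \<forall>x. x \<noteq> 0 \<longrightarrow> lr x \<le> T \<longrightarrow> \<bar>u (lr x) - R' (u (lr x))\<bar> \<le> C" by blast
qed

text \<open>The divergence of w x is e^(-2t) u'', the Laplacian in logarithmic coordinates, and the
  equation for u'' turns it into the remaining terms. Knowing W' at positive arguments suffices
  because u is positive.\<close>

lemma equation_u:
  assumes k: "real_of_int k = \<sigma> * \<kappa>" and W': "\<And>s. 0 < s \<Longrightarrow> W' s = s - R' s" and v: "test_function v"
  shows "has_bochner_integral lborel (\<lambda>x. inner (Du0 x) (grad v x)
     + (norm (of_int k *\<^sub>R grad_theta x - A0 x))\<^sup>2 * u0 x * v x + W' (u0 x) * v x) 0"
proof -
  define \<chi>' where "\<chi>' t = (ddu t - 2 * du t) * exp (- 4 * t)" for t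
  define d where "d i x = \<chi>' (lr x) * x $ i * x $ i + w (lr x)" for i :: 2 and x :: "real^2"
  obtain \<rho> where \<rho>: "\<And>x. \<rho> \<le> norm x \<Longrightarrow> v x = 0" "\<And>i x. \<rho> \<le> norm x \<Longrightarrow> partial i v x = 0"
    using test_function_support[OF v] by blast
  note loc = locally_integrable_mult[OF _ test_function_cont(1)[OF v] \<rho>(1)] locally_integrable_mult[OF _ test_function_cont(2)[OF v] \<rho>(2)]
  have c\<chi>: "continuous_on (- {0}) (\<lambda>x. \<chi>' (lr x))"
    by (rule cont_log_radial) (unfold \<chi>'_def[abs_def], intro continuous_intros cont cont_ddu)
  let ?H = "\<lambda>x. (w (lr x) * x $ 1) * partial 1 v x + (w (lr x) * x $ 2) * partial 2 v x
     + (a (lr x))\<^sup>2 * exp (- 2 * lr x) * u (lr x) * v x + (u (lr x) - R' (u (lr x))) * v x"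
  show ?thesis
  proof (rule divergence_test_AE[where y = "\<lambda>i x. w (lr x) * x $ i" and d = d and w = "\<lambda>_. v" and H = ?H])
    show "continuous_on (- {0}) (\<lambda>x. w (lr x) * x $ i)" for i by (intro continuous_intros cont_x)
    show "continuous_on (- {0}) (d i)" for i unfolding d_def[abs_def] by (intro continuous_intros cont_x c\<chi>)
    show "((\<lambda>s. w (lr (x + s *\<^sub>R axis i 1)) * (x + s *\<^sub>R axis i 1) $ i) has_real_derivative d i x) (at 0)" if x: "x \<noteq> 0" for i x
    proof -
      have "(w has_real_derivative \<chi>' t * exp (2 * t)) (at t)" for t
      proof -
        have "exp (- 4 * t) * exp (2 * t) = exp (- 2 * t)" by (simp add: exp_add[symmetric])
        then have "\<chi>' t * exp (2 * t) = (ddu t - 2 * du t) * exp (- 2 * t)" unfolding \<chi>'_def by (simp add: mult.assoc)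
        then show ?thesis using w_deriv by (simp only:)
      qed
      from DERIV_mult[OF radial_x[OF x this, of i] coord_deriv[of x i i]] show ?thesis by (simp add: d_def)
    qed
    show "small_flux (\<lambda>x. w (lr x) * x $ i)" for i by (rule small_flux_w)
    show "integrable lborel ?H"
      by (intro Bochner_Integration.integrable_add loc loc_Du loc_potential loc_W')
    show "test_function v" by (rule v)
    fix x :: "real^2" assume x: "x \<noteq> 0"
    have r: "x $ 1 * x $ 1 + x $ 2 * x $ 2 = (norm x)\<^sup>2" unfolding norm_sq2 by (simp add: power2_eq_square)
    have "exp (- 4 * lr x) * (norm x)\<^sup>2 = exp (- 2 * lr x) * (exp (- 2 * lr x) * (norm x)\<^sup>2)"
      by (simp add: mult.assoc[symmetric] exp_add[symmetric])
    then have e4: "exp (- 4 * lr x) * (norm x)\<^sup>2 = exp (- 2 * lr x)" unfolding exp_lr(2)[OF x] by (simp only: mult_1_right)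
    have e2: "exp (2 * lr x) * exp (- 2 * lr x) = 1" by (simp add: exp_add[symmetric])
    have "d 1 x + d 2 x = \<chi>' (lr x) * (x $ 1 * x $ 1 + x $ 2 * x $ 2) + 2 * w (lr x)"
      by (simp add: d_def algebra_simps)
    also have "\<dots> = (ddu (lr x) - 2 * du (lr x)) * (exp (- 4 * lr x) * (norm x)\<^sup>2) + 2 * w (lr x)"
      unfolding r \<chi>'_def by (simp add: mult.assoc)
    also have "\<dots> = ddu (lr x) * exp (- 2 * lr x)" unfolding e4 by (simp add: w_def algebra_simps)
    also have "\<dots> = (a (lr x))\<^sup>2 * exp (- 2 * lr x) * u (lr x) + (u (lr x) - R' (u (lr x))) * (exp (2 * lr x) * exp (- 2 * lr x))"
      unfolding ddu_def by (simp add: algebra_simps)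
    finally have dd: "d 1 x + d 2 x = (a (lr x))\<^sup>2 * exp (- 2 * lr x) * u (lr x) + (u (lr x) - R' (u (lr x)))" unfolding e2 by simp
    have "?H x = (w (lr x) * x $ 1) * partial 1 v x + (w (lr x) * x $ 2) * partial 2 v x + (d 1 x + d 2 x) * v x"
      unfolding dd by (simp add: distrib_right)
    then show "?H x = d 1 x * v x + w (lr x) * x $ 1 * partial 1 v x + (d 2 x * v x + w (lr x) * x $ 2 * partial 2 v x)"
      by (simp add: distrib_right)
    have "inner (Du0 x) (grad v x) = (w (lr x) * x $ 1) * partial 1 v x + (w (lr x) * x $ 2) * partial 2 v x"
      by (simp add: inner_vec_def sum_2 Du0_def grad_def)
    then show "inner (Du0 x) (grad v x) + (norm (of_int k *\<^sub>R grad_theta x - A0 x))\<^sup>2 * u0 x * v x + W' (u0 x) * v x = ?H x"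
      using gauge_field_norm[OF k x] W'[OF u_pos[of "lr x"]] by (simp add: u0_def)
  qed
qed

lemma loc_b: "locally_integrable (\<lambda>x. b (lr x))"
  by (rule bounded_locally_integrable[OF cont_x(4)]) (use b_le in blast)

text \<open>On a ball |x_i| is at most e^T, which leaves u^2 / r^2.\<close>

lemma loc_current: "locally_integrable (\<lambda>x. a (lr x) * (u (lr x))\<^sup>2 * exp (- 2 * lr x) * x $ i)"
proof (rule locally_integrableI)
  show "continuous_on (- {0}) (\<lambda>x. a (lr x) * (u (lr x))\<^sup>2 * exp (- 2 * lr x) * x $ i)" by (intro continuous_intros cont_x)
  fix T
  have um: "u \<in> borel_measurable borel" by (rule borel_measurable_continuous_onI[OF cont(1)])
  let ?f = "\<lambda>t. \<kappa> * exp T * (exp (- 2 * t) * (u t)\<^sup>2)"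
  have "exp (2 * t) * (indicator {..T} t * ?f t) = \<kappa> * exp T * (indicator {..T} t *\<^sub>R (u t)\<^sup>2)" for t
  proof -
    show ?thesis using exp_cancel[of t] unfolding real_scaleR_def by algebra
  qed
  moreover have "integrable lborel (\<lambda>t. \<kappa> * exp T * (indicator {..T} t *\<^sub>R (u t)\<^sup>2))"
    by (intro integrable_mult_right integrable_mult_indicator int_u_sq) auto
  ultimately have "integrable lborel (\<lambda>t. exp (2 * t) * (indicator {..T} t * ?f t))" by (simp only:)
  moreover have "\<bar>a (lr x) * (u (lr x))\<^sup>2 * exp (- 2 * lr x) * x $ i\<bar> \<le> ?f (lr x)" if x: "x \<noteq> 0" "lr x \<le> T" for x
  proof -
    have "\<bar>x $ i\<bar> \<le> exp T" using component_le_norm_cart[of x i] norm_le_exp[OF x] by linarith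
    then have "\<bar>a (lr x)\<bar> * \<bar>x $ i\<bar> \<le> \<kappa> * exp T" using a_le[of "lr x"] \<kappa> by (intro mult_mono) auto
    then have "\<bar>a (lr x)\<bar> * \<bar>x $ i\<bar> * (exp (- 2 * lr x) * (u (lr x))\<^sup>2) \<le> ?f (lr x)" by (intro mult_right_mono) auto
    then show ?thesis by (simp add: abs_mult mult_ac)
  qed
  ultimately show "\<exists>f. f \<in> borel_measurable borel \<and> integrable lborel (\<lambda>t. exp (2 * t) * (indicator {..T} t * f t)) \<and>
      (\<forall>x. x \<noteq> 0 \<longrightarrow> ln (norm x) \<le> T \<longrightarrow> \<bar>a (lr x) * (u (lr x))\<^sup>2 * exp (- 2 * lr x) * x $ i\<bar> \<le> f (ln (norm x)))"
    using um by (intro exI[of _ ?f]) auto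
qed

lemma curl_DA0:
  assumes "x \<noteq> 0" shows "curl_of (DA0 x) = vector [0, 0, - \<sigma> * b (lr x)]"
proof -
  have "DA0 x $ 2 $ 1 - DA0 x $ 1 $ 2 = \<psi> (lr x) * (norm x)\<^sup>2 + 2 * hh (lr x)"
    unfolding norm_sq2 by (simp add: DA0_def power2_eq_square algebra_simps)
  also have "\<psi> (lr x) * (norm x)\<^sup>2 = (- \<sigma> * b (lr x) - 2 * hh (lr x)) * (exp (- 2 * lr x) * (norm x)\<^sup>2)"
    by (simp add: \<psi>_def mult.assoc)
  finally have "DA0 x $ 2 $ 1 - DA0 x $ 1 $ 2 = - \<sigma> * b (lr x)" using exp_lr(2)[OF assms] by simp
  then show ?thesis by (simp add: curl_of_def vec_eq_iff forall_3 vector_3 DA0_def[of x])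
qed

text \<open>The curl has only a third component, -\<sigma> b, and the current has none, so only the
  first two components of \<open>V\<close> enter. Pairing with the curl of \<open>V\<close> is then
  a divergence test, with V2 for the first direction and V1 for the second.\<close>

lemma equation_A:
  assumes k: "real_of_int k = \<sigma> * \<kappa>" and V: "test_field V"
  shows "has_bochner_integral lborel (\<lambda>x. inner (curl_of (DA0 x)) (curl_of (jacobian V x))
               - inner (of_int k *\<^sub>R grad_theta x - A0 x) (V x) * (u0 x)\<^sup>2) 0"
proof -
  define V1 V2 where "V1 x = V x $ 1" and "V2 x = V x $ 2" for x
  have t: "test_function V1" "test_function V2" using V unfolding test_field_def V1_def[abs_def] V2_def[abs_def] by auto
  obtain \<rho>1 where \<rho>1: "\<And>x. \<rho>1 \<le> norm x \<Longrightarrow> V1 x = 0" "\<And>i x. \<rho>1 \<le> norm x \<Longrightarrow> partial i V1 x = 0"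
    using test_function_support[OF t(1)] by blast
  obtain \<rho>2 where \<rho>2: "\<And>x. \<rho>2 \<le> norm x \<Longrightarrow> V2 x = 0" "\<And>i x. \<rho>2 \<le> norm x \<Longrightarrow> partial i V2 x = 0"
    using test_function_support[OF t(2)] by blast
  note loc1 = locally_integrable_mult[OF _ test_function_cont(1)[OF t(1)] \<rho>1(1)] locally_integrable_mult[OF _ test_function_cont(2)[OF t(1)] \<rho>1(2)]
  note loc2 = locally_integrable_mult[OF _ test_function_cont(1)[OF t(2)] \<rho>2(1)] locally_integrable_mult[OF _ test_function_cont(2)[OF t(2)] \<rho>2(2)]
  \<comment> \<open>The opposite signs of the two directions reproduce the antisymmetry of the
    curl.\<close>
  define \<sigma>' where "\<sigma>' i = (if i = 1 then - \<sigma> else \<sigma>)" for i :: 2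
  let ?j = "\<lambda>x i. a (lr x) * (u (lr x))\<^sup>2 * exp (- 2 * lr x) * x $ i"
  let ?H = "\<lambda>x. - \<sigma> * (b (lr x) * partial 1 V2 x) + \<sigma> * (b (lr x) * partial 2 V1 x) - \<sigma> * (?j x 1 * V2 x) + \<sigma> * (?j x 2 * V1 x)"
  show ?thesis
  proof (rule divergence_test_AE[where y = "\<lambda>i x. \<sigma>' i * b (lr x)" and d = "\<lambda>i x. \<sigma>' i * ?j x i" and w = "\<lambda>i. if i = 1 then V2 else V1" and H = ?H])
    show "continuous_on (- {0}) (\<lambda>x. \<sigma>' i * b (lr x))" "continuous_on (- {0}) (\<lambda>x. \<sigma>' i * ?j x i)" for i
      by (intro continuous_intros cont_x)+
    show "((\<lambda>s. \<sigma>' i * b (lr (x + s *\<^sub>R axis i 1))) has_real_derivative \<sigma>' i * ?j x i) (at 0)" if x: "x \<noteq> 0" for i x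
    proof (rule DERIV_cmult, rule radial_x[OF x, where f' = "\<lambda>t. a t * (u t)\<^sup>2 * exp (- 2 * t)"])
      fix t :: real
      have "exp (- 2 * t) * exp (2 * t) = 1" by (simp add: exp_add[symmetric])
      then have "a t * (u t)\<^sup>2 * exp (- 2 * t) * exp (2 * t) = a t * (u t)\<^sup>2" by (simp only: mult.assoc mult_1_right)
      then show "(b has_real_derivative a t * (u t)\<^sup>2 * exp (- 2 * t) * exp (2 * t)) (at t)" using derivs(4) by (simp only:)
    qed
    show "small_flux (\<lambda>x. \<sigma>' i * b (lr x))" for i
      by (rule small_flux_bounded[of _ B]) (use \<sigma> b_le in \<open>auto simp: \<sigma>'_def abs_mult\<close>)
    show "test_function (if i = 1 then V2 else V1)" for i :: 2 using t by simp
    show "integrable lborel ?H"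
      by (intro Bochner_Integration.integrable_add Bochner_Integration.integrable_diff integrable_mult_right loc1 loc2 loc_b loc_current)
    fix x :: "real^2" assume x: "x \<noteq> 0"
    show "?H x = \<sigma>' 1 * ?j x 1 * (if (1::2) = 1 then V2 else V1) x + \<sigma>' 1 * b (lr x) * partial 1 (if (1::2) = 1 then V2 else V1) x +
         (\<sigma>' 2 * ?j x 2 * (if (2::2) = 1 then V2 else V1) x + \<sigma>' 2 * b (lr x) * partial 2 (if (2::2) = 1 then V2 else V1) x)"
      by (simp add: \<sigma>'_def)
    have c: "curl_of (jacobian V x) $ 3 = partial 1 V2 x - partial 2 V1 x"
      by (simp add: curl_of_def vector_3 jacobian_def V1_def[abs_def] V2_def[abs_def])
    have "inner (curl_of (DA0 x)) (curl_of (jacobian V x)) = - \<sigma> * b (lr x) * (partial 1 V2 x - partial 2 V1 x)"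
      unfolding curl_DA0[OF x] by (simp add: inner_vec_def sum_3 vector_3 c)
    moreover have "inner (of_int k *\<^sub>R grad_theta x - A0 x) (V x) * (u0 x)\<^sup>2 = \<sigma> * (?j x 1 * V2 x) - \<sigma> * (?j x 2 * V1 x)"
      unfolding gauge_field[OF k] by (simp add: inner_vec_def sum_3 vector_3 u0_def V1_def V2_def algebra_simps)
    ultimately show "inner (curl_of (DA0 x)) (curl_of (jacobian V x)) - inner (of_int k *\<^sub>R grad_theta x - A0 x) (V x) * (u0 x)\<^sup>2 = ?H x"
      by (simp add: algebra_simps)
  qed
qed

section \<open>Finiteness of the energy in the plane\<close>

lemma integrable_Du0: "integrable lborel (\<lambda>x. (norm (Du0 x))\<^sup>2)"
proof (rule integrable_radial_bound[where f = "\<lambda>t. (du t)\<^sup>2 * exp (- 2 * t)"])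
  have "continuous_on (- {0}) (\<lambda>x. (norm (Du0 x))\<^sup>2)" unfolding Du0_def by (intro continuous_intros cont_x)
  then show "(\<lambda>x. (norm (Du0 x))\<^sup>2) \<in> borel_measurable borel" by (rule borel_measurable_punctured)
  have "du \<in> borel_measurable borel" by (rule borel_measurable_continuous_onI[OF cont(2)])
  then show "(\<lambda>t. (du t)\<^sup>2 * exp (- 2 * t)) \<in> borel_measurable borel" by measurable
  have "exp (2 * t) * ((du t)\<^sup>2 * exp (- 2 * t)) = (du t)\<^sup>2" for t
    using exp_cancel[of t] by algebra
  then show "integrable lborel (\<lambda>t. exp (2 * t) * ((du t)\<^sup>2 * exp (- 2 * t)))" using int_du by (simp only:)
  fix x :: "real^2" assume x: "x \<noteq> 0"
  have "(norm (Du0 x))\<^sup>2 = (du (lr x))\<^sup>2 * exp (- 2 * lr x) * (exp (- 2 * lr x) * (norm x)\<^sup>2)"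
    by (simp add: Du0_def w_def power_mult_distrib power2_eq_square mult_ac)
  then show "\<bar>(norm (Du0 x))\<^sup>2\<bar> \<le> (du (lr x))\<^sup>2 * exp (- 2 * lr x)" using exp_lr(2)[OF x] by simp
qed

lemma integrable_u0: "integrable lborel (\<lambda>x. (1 + 1 / (norm x)\<^sup>2) * (u0 x)\<^sup>2)"
proof (rule integrable_radial_bound[where f = "\<lambda>t. (1 + exp (- 2 * t)) * (u t)\<^sup>2"])
  have "continuous_on (- {0}) (\<lambda>x. (1 + 1 / (norm x)\<^sup>2) * (u0 x)\<^sup>2)" unfolding u0_def by (intro continuous_intros cont_x) auto
  then show "(\<lambda>x. (1 + 1 / (norm x)\<^sup>2) * (u0 x)\<^sup>2) \<in> borel_measurable borel" by (rule borel_measurable_punctured)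
  have "u \<in> borel_measurable borel" by (rule borel_measurable_continuous_onI[OF cont(1)])
  then show "(\<lambda>t. (1 + exp (- 2 * t)) * (u t)\<^sup>2) \<in> borel_measurable borel" by measurable
  have "exp (2 * t) * ((1 + exp (- 2 * t)) * (u t)\<^sup>2) = exp (2 * t) * (u t)\<^sup>2 + (u t)\<^sup>2" for t
    using exp_cancel[of t] by algebra
  moreover have "integrable lborel (\<lambda>t. exp (2 * t) * (u t)\<^sup>2 + (u t)\<^sup>2)"
    by (intro Bochner_Integration.integrable_add int_exp_u int_u_sq)
  ultimately show "integrable lborel (\<lambda>t. exp (2 * t) * ((1 + exp (- 2 * t)) * (u t)\<^sup>2))" by (simp only:)
  show "\<bar>(1 + 1 / (norm x)\<^sup>2) * (u0 x)\<^sup>2\<bar> \<le> (1 + exp (- 2 * lr x)) * (u (lr x))\<^sup>2" if "x \<noteq> 0" for x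
    unfolding exp_lr(3)[OF that] u0_def by simp
qed

text \<open>In the unit disc the entries are bounded; outside, b and \<open>hh\<close> are
  O(r^(-2)), so the squares are O(r^(-4)). The factor 6 counts the entries of the Jacobian.\<close>

lemma integrable_DA0: "integrable lborel (\<lambda>x. \<Sum>i\<in>UNIV. \<Sum>j\<in>UNIV. (DA0 x $ j $ i)\<^sup>2)"
proof -
  define K where "K = B + \<kappa> * E + 3 * B + 6 * \<kappa>"
  have KE: "0 \<le> \<kappa> * E" using \<kappa> E0 by simp
  let ?f = "\<lambda>t. 6 * K\<^sup>2 * (indicator {..0} t + indicator {0..} t * exp (- 4 * t))"
  have le: "(\<bar>b t\<bar> + 3 * \<bar>hh t\<bar>)\<^sup>2 \<le> K\<^sup>2 * (indicator {..0} t + indicator {0..} t * exp (- 4 * t))" for t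
  proof (cases "t \<le> 0")
    case True
    have "\<bar>b t\<bar> + 3 * \<bar>hh t\<bar> \<le> K" using b_le[of t] hh_le(1)[of t] B0 \<kappa> KE unfolding K_def by linarith
    then have "(\<bar>b t\<bar> + 3 * \<bar>hh t\<bar>)\<^sup>2 \<le> K\<^sup>2" by (intro power_mono) auto
    also have "\<dots> = K\<^sup>2 * 1" by simp
    also have "\<dots> \<le> K\<^sup>2 * (indicator {..0} t + indicator {0..} t * exp (- 4 * t))" using True by (intro mult_left_mono) auto
    finally show ?thesis .
  next
    case False
    have "\<bar>b t\<bar> \<le> \<kappa> * E * exp (- 2 * t)" using b_decay[of t] by simp
    then have "\<bar>b t\<bar> + 3 * \<bar>hh t\<bar> \<le> (\<kappa> * E + 6 * \<kappa>) * exp (- 2 * t)"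
      using hh_le(2)[of t] unfolding distrib_right by linarith
    also have "\<dots> \<le> K * exp (- 2 * t)" using B0 by (intro mult_right_mono) (auto simp: K_def)
    finally have "(\<bar>b t\<bar> + 3 * \<bar>hh t\<bar>)\<^sup>2 \<le> (K * exp (- 2 * t))\<^sup>2" by (intro power_mono) auto
    also have "\<dots> = K\<^sup>2 * exp (- 4 * t)" by (simp add: power_mult_distrib exp_double[symmetric])
    finally show ?thesis using False by simp
  qed
  show ?thesis
  proof (rule integrable_radial_bound[where f = ?f])
    have "continuous_on (- {0}) (\<lambda>x. \<Sum>i\<in>UNIV. \<Sum>j\<in>UNIV. (DA0 x $ j $ i)\<^sup>2)" by (intro continuous_intros cont_DA0)
    then show "(\<lambda>x. \<Sum>i\<in>UNIV. \<Sum>j\<in>UNIV. (DA0 x $ j $ i)\<^sup>2) \<in> borel_measurable borel" by (rule borel_measurable_punctured)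
    show "?f \<in> borel_measurable borel" by measurable
    have "exp (2 * t) * ?f t = 6 * K\<^sup>2 * (indicator {..0} t * exp (2 * t) + indicator {0..} t * exp (- 2 * t))" for t :: real
    proof -
      have "exp (2 * t) * exp (- 4 * t) = exp (- 2 * t)" by (simp add: exp_add[symmetric])
      moreover have "e * (6 * K\<^sup>2 * (p + q * f)) = 6 * K\<^sup>2 * (p * e + q * (e * f))" for e f p q :: real by algebra
      ultimately show ?thesis by metis
    qed
    moreover have "integrable lborel (\<lambda>t. 6 * K\<^sup>2 * (indicator {..0} t * exp (2 * t) + indicator {0..} t * exp (- 2 * t)))"
      by (intro integrable_mult_right Bochner_Integration.integrable_add integrable_exp_Iic integrable_exp_Ici) simp
    ultimately show "integrable lborel (\<lambda>t. exp (2 * t) * ?f t)" by (simp only:)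
    fix x :: "real^2" assume x: "x \<noteq> 0"
    have sq: "(DA0 x $ j $ i)\<^sup>2 \<le> (\<bar>b (lr x)\<bar> + 3 * \<bar>hh (lr x)\<bar>)\<^sup>2" for i j
      using power_mono[OF DA0_le[OF x, of j i], of 2] by simp
    have "(\<Sum>i\<in>UNIV. \<Sum>j\<in>UNIV. (DA0 x $ j $ i)\<^sup>2) \<le> (\<Sum>i\<in>(UNIV::2 set). \<Sum>j\<in>(UNIV::3 set). (\<bar>b (lr x)\<bar> + 3 * \<bar>hh (lr x)\<bar>)\<^sup>2)"
      by (intro sum_mono sq)
    also have "\<dots> = 6 * (\<bar>b (lr x)\<bar> + 3 * \<bar>hh (lr x)\<bar>)\<^sup>2" by simp
    also have "\<dots> \<le> ?f (lr x)" using le[of "lr x"] by simp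
    finally show "\<bar>\<Sum>i\<in>UNIV. \<Sum>j\<in>UNIV. (DA0 x $ j $ i)\<^sup>2\<bar> \<le> ?f (lr x)"
      by (simp add: sum_nonneg)
  qed
qed

lemma div_DA0: "div_of (DA0 x) = 0" by (simp add: div_of_def DA0_def)

lemma solution:
  assumes k: "real_of_int k = \<sigma> * \<kappa>" and W': "\<And>s. 0 < s \<Longrightarrow> W' s = s - R' s"
  shows "distributional_solution k W' u0 Du0 A0 DA0"
  unfolding distributional_solution_def
  using weak_gradient_u0 weak_jacobian_A0 equation_u[OF k W'] equation_A[OF k] by blast

end

section \<open>Extension of the nonlinearity and assembly of the solution\<close>

theorem theorem1p1:
  fixes k :: int and R R' W W' :: "real \<Rightarrow> real" and c p :: real
  assumes k: "k \<noteq> 0"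
    and R_deriv: "\<And>s. 0 \<le> s \<Longrightarrow> (R has_real_derivative R' s) (at s within {0..})"
    and R_C1: "continuous_on {0..} R'"
    and W_def: "\<And>s. 0 \<le> s \<Longrightarrow> W s = 1/2 * s\<^sup>2 - R s"
    and W_deriv: "\<And>s. 0 \<le> s \<Longrightarrow> (W has_real_derivative W' s) (at s within {0..})"
    and R_zero: "R 0 = 0" "R' 0 = 0"
    and c: "0 < c" and p: "2 < p"
    and R_growth: "\<And>s. 0 \<le> s \<Longrightarrow> \<bar>R s\<bar> \<le> c * s powr p"
    and R_superlinear: "\<And>s. 0 < s \<Longrightarrow> p * R s \<le> s * R' s \<and> 0 < p * R s"
  shows "\<exists>(u0 :: real^2 \<Rightarrow> real) Du0 (A0 :: real^2 \<Rightarrow> real^3) DA0.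
      distributional_solution k W' u0 Du0 A0 DA0 \<and>
      \<not> (AE x in lborel. u0 x = 0) \<and>
      (\<forall>x. 0 < u0 x) \<and>
      (\<forall>x y. norm x = norm y \<longrightarrow> u0 x = u0 y) \<and>
      integrable lborel (\<lambda>x. (norm (Du0 x))\<^sup>2) \<and>
      integrable lborel (\<lambda>x. (1 + 1 / (norm x)\<^sup>2) * (u0 x)\<^sup>2) \<and>
      (\<forall>x. A0 x $ 3 = 0) \<and>
      (AE x in lborel. div_of (DA0 x) = 0) \<and>
      integrable lborel (\<lambda>x. \<Sum>i\<in>UNIV. \<Sum>j\<in>UNIV. (DA0 x $ j $ i)\<^sup>2)"
proof -
  \<comment> \<open>The extension by 0 to negative arguments that the truncated problems work
    with.\<close>
  define Q Q' where "Q s = R (max 0 s)" and "Q' s = R' (max 0 s)" for s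
  have Rpos: "0 < R s" if "0 < s" for s
    using R_superlinear[OF that] p by (simp add: zero_less_mult_iff)
  have Qpos: "0 < Q s" if "0 < s" for s using Rpos[OF that] that by (simp add: Q_def)
  have Qneg: "Q s = 0" "Q' s = 0" if "s \<le> 0" for s using that R_zero by (simp_all add: Q_def Q'_def max_def)
  have Q_le: "Q s \<le> c * \<bar>s\<bar> powr p" for s
    using R_growth[of s] Qneg[of s] c by (cases "0 \<le> s") (auto simp: Q_def)
  have Q_deriv: "(Q has_real_derivative Q' s) (at s)" for s
  proof -
    consider "s < 0" | "s = 0" | "0 < s" by linarith
    then show ?thesis
    proof cases
      case 1
      have "((\<lambda>s. 0) has_real_derivative 0) (at s)" by simp
      then have "(Q has_real_derivative 0) (at s)"
        by (rule has_field_derivative_transform_within_open[where S = "{..<0}"]) (use 1 Qneg in auto)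
      then show ?thesis using 1 Qneg by simp
    next
      case 2
      \<comment> \<open>At 0 the two-sided derivative comes from the growth condition: |Q(h) / h| is
        at most c |h|^(p-1).\<close>
      have "((\<lambda>h. Q h / h) \<longlongrightarrow> 0) (at 0)"
      proof (rule Lim_null_comparison)
        have "(\<lambda>h. c * \<bar>h\<bar> powr (p - 1)) \<midarrow>0\<rightarrow> c * \<bar>0\<bar> powr (p - 1)"
          using p by (intro tendsto_intros tendsto_powr') auto
        then show "(\<lambda>h. c * \<bar>h\<bar> powr (p - 1)) \<midarrow>0\<rightarrow> 0" by simp
        have "norm (Q h / h) \<le> c * \<bar>h\<bar> powr (p - 1)" for h
        proof (cases "h = 0")
          case False
          have "0 \<le> Q h" using Qpos[of h] Qneg[of h] by (cases "0 < h") auto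
          then have "norm (Q h / h) = Q h / \<bar>h\<bar>" by simp
          also have "\<dots> \<le> c * \<bar>h\<bar> powr p / \<bar>h\<bar>" using Q_le by (intro divide_right_mono) auto
          also have "\<dots> = c * \<bar>h\<bar> powr (p - 1)" using False by (simp add: powr_diff)
          finally show ?thesis .
        qed simp
        then show "\<forall>\<^sub>F h in at 0. norm (Q h / h) \<le> c * \<bar>h\<bar> powr (p - 1)" by (intro always_eventually) simp
      qed
      then show ?thesis using 2 Qneg by (simp add: DERIV_def)
    next
      case 3
      have "(R has_real_derivative R' s) (at s)"
        using R_deriv[of s] 3 at_within_interior[of s "{0..}"] by simp
      then have "(Q has_real_derivative R' s) (at s)"
        by (rule has_field_derivative_transform_within_open[where S = "{0<..}"]) (use 3 in \<open>auto simp: Q_def\<close>)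
      then show ?thesis using 3 by (simp add: Q'_def)
    qed
  qed
  have nl: "nonlinearity c p Q Q'"
  proof
    show "continuous_on UNIV Q'" unfolding Q'_def[abs_def]
      by (rule continuous_on_compose2[OF R_C1]) (auto intro!: continuous_intros)
    show "0 \<le> Q s" for s using Qpos[of s] Qneg[of s] by (cases "0 < s") auto
    show "p * Q s \<le> s * Q' s" for s
      using R_superlinear[of s] Qneg[of s] by (cases "0 < s") (auto simp: Q_def Q'_def)
  qed (use Q_deriv Qneg Q_le Qpos c p in auto)
  \<comment> \<open>The profile depends on |k| alone; the sign of k only orients the field.\<close>
  define \<kappa> \<sigma> where "\<kappa> = real_of_int \<bar>k\<bar>" and "\<sigma> = real_of_int (sgn k)"
  have \<kappa>: "0 < \<kappa>" and \<sigma>: "\<sigma> = 1 \<or> \<sigma> = - 1" and k\<sigma>: "real_of_int k = \<sigma> * \<kappa>"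
    using k by (auto simp: \<kappa>_def \<sigma>_def sgn_if)
  obtain u du a b :: "real \<Rightarrow> real" and E M where prof: "ode_on Q' UNIV u du a b" "\<And>t. 0 \<le> u t" "\<And>t. u t \<le> M" "\<exists>t. 0 < u t"
    "\<And>t. \<bar>a t\<bar> \<le> \<kappa>" "\<And>t. \<bar>a t - \<kappa>\<bar> \<le> (1/4 + E/2) * exp t" "\<And>t. \<bar>b t\<bar> \<le> \<kappa> * E * exp (- (2 * t))"
    "\<And>T. integral {-T..T} (energy_density u du a b) \<le> E"
    using nonlinearity.whole_line_solution[OF nl \<kappa>] by metis
  have pl: "planar_profile c p Q Q' \<kappa> E M u du a b \<sigma>"
    by (intro planar_profile.intro profile.intro nl profile_axioms.intro planar_profile_axioms.intro \<kappa> \<sigma> prof)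
  interpret pl: planar_profile c p Q Q' \<kappa> E M u du a b \<sigma> by (rule pl)
  \<comment> \<open>Uniqueness of derivatives at interior points of the half-line identifies
    W'.\<close>
  have W': "W' s = s - Q' s" if s: "0 < s" for s
  proof -
    have "(R has_real_derivative R' s) (at s)" "(W has_real_derivative W' s) (at s)"
      using R_deriv[of s] W_deriv[of s] s at_within_interior[of s "{0..}"] by simp_all
    then have "((\<lambda>s. 1/2 * s\<^sup>2 - R s) has_real_derivative s - R' s) (at s)"
      by (auto intro!: derivative_eq_intros)
    then have "(W has_real_derivative s - R' s) (at s)"
      by (rule has_field_derivative_transform_within_open[where S = "{0<..}"]) (use s W_def in auto)
    then show ?thesis using \<open>(W has_real_derivative W' s) (at s)\<close> DERIV_unique s by (fastforce simp: Q'_def)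
  qed
  have pos: "0 < pl.u0 x" for x by (simp add: pl.u0_def pl.u_pos)
  have "\<not> (AE x in lborel. pl.u0 x = 0)"
  proof
    assume "AE x in lborel. pl.u0 x = 0"
    then have "AE x in (lborel :: (real^2) measure). False" by (rule AE_mp) (use pos in \<open>auto intro!: AE_I2 simp: less_le\<close>)
    then have "ae_filter (lborel :: (real^2) measure) = bot" unfolding trivial_limit_def by simp
    then have "emeasure (lborel :: (real^2) measure) UNIV = 0" by (simp add: ae_filter_eq_bot_iff)
    then show False by simp
  qed
  moreover have "\<forall>x y. norm x = norm y \<longrightarrow> pl.u0 x = pl.u0 y" by (simp add: pl.u0_def)
  moreover have "\<forall>x. pl.A0 x $ 3 = 0" by (simp add: pl.A0_def vector_3)
  ultimately show ?thesis
    using pl.solution[OF k\<sigma> W'] pos pl.integrable_Du0 pl.integrable_u0 pl.integrable_DA0 pl.div_DA0 by blast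
qed

end
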